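(* Let $\tau=\{\leq\}$ be the vocabulary of linear orderings. For every $\alpha<\omega_1$ and every $\Pi^{\mathtt{in}}_\alpha$ $\tau$-sentence $T$ that implies the axioms of linear orderings, $$vo(T)\leq \alpha+\omega .$$
   Context: All structures are countable. Formulas are in the infinitary logic $L_{\omega_1,\omega}$; $\Sigma^{\mathtt{in}}_0=\Pi^{\mathtt{in}}_0$ are the finitary quantifier-free formulas, a $\Sigma^{\mathtt{in}}_\alpha$ formula is a countable disjunction of formulas $\exists\bar x\,\varphi$ with $\varphi$ in $\Pi^{\mathtt{in}}_\beta$ for some $\beta<\alpha$, and $\Pi^{\mathtt{in}}_\alpha$ is defined dually. $\mathcal A\equiv_\beta\mathcal B$ means that $\mathcal A$ and $\mathcal B$ satisfy the same $\Pi^{\mathtt{in}}_\beta$ sentences ($\Pi^{\mathtt{in}}_\beta$-elementary equivalence). The Scott rank $\mathrm{SR}(\mathcal M)$ of a structure $\mathcal M$ is the least $\alpha<\omega_1$ for which there is a finite tuple $\bar m$ of parameters from $\mathcal M$ such that the automorphism orbit of every finite tuple of $\mathcal M$ is definable by a $\Sigma^{\mathtt{in}}_\alpha$ formula over $\bar m$. The Vaught ordinal $vo(T)$ of a sentence $T$ is the least ordinal $\beta$ such that either (i) there are only countably many models of $T$ (up to isomorphism) and they all have Scott rank less than $\beta$, or (ii) there are uncountably many models of $T$ that are pairwise not $\Pi^{\mathtt{in}}_\beta$-elementary equivalent. *)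

theory Defs
  imports Complex_Main "HOL-Library.Countable_Set"
begin

unbundle cardinal_syntax

section \<open>Ordinals\<close>

text \<open>
  The type of ordinals below \<open>\<omega>\<^sub>2\<close>. The countable ordinals alone would not do: the minimum that
  defines the Vaught ordinal could a priori be \<open>\<omega>\<^sub>1\<close>, and it is never larger than that.
  An ordinal \<open>\<alpha>\<close> is below \<open>\<omega>\<^sub>1\<close> iff \<open>{..<\<alpha>}\<close> is countable.
\<close>

abbreviation omega2_rel :: "nat set set rel" where
  "omega2_rel \<equiv> cardSuc (cardSuc natLeq)"

lemma Card_order_omega2: "Card_order omega2_rel"
  by (simp add: cardSuc_Card_order natLeq_Card_order)

lemma infinite_omega1: "infinite (Field (cardSuc natLeq))"
  using cardSuc_finite[OF natLeq_Card_order] by (simp add: Field_natLeq)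

lemma infinite_omega2: "infinite (Field omega2_rel)"
  using cardSuc_finite[OF cardSuc_Card_order[OF natLeq_Card_order]] infinite_omega1 by simp

typedef ordinal = "Field omega2_rel"
  using infinite_omega2 by (metis ex_in_conv finite.emptyI)

instantiation ordinal :: wellorder
begin

definition less_eq_ordinal :: "ordinal \<Rightarrow> ordinal \<Rightarrow> bool" where
  "\<alpha> \<le> \<beta> \<longleftrightarrow> (Rep_ordinal \<alpha>, Rep_ordinal \<beta>) \<in> omega2_rel"

definition less_ordinal :: "ordinal \<Rightarrow> ordinal \<Rightarrow> bool" where
  "(\<alpha>::ordinal) < \<beta> \<longleftrightarrow> \<alpha> \<le> \<beta> \<and> \<alpha> \<noteq> \<beta>"

instance
proof -
  have wo: "well_order_on (Field omega2_rel) omega2_rel"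
    using Card_order_omega2 by (auto simp: card_order_on_def)
  then have lin: "refl_on (Field omega2_rel) omega2_rel" "trans omega2_rel"
      "antisym omega2_rel" "total_on (Field omega2_rel) omega2_rel"
      and wf: "wf (omega2_rel - Id)"
    by (auto simp: order_on_defs)
  have refl: "x \<le> x" for x :: ordinal
    using lin(1) Rep_ordinal by (auto simp: less_eq_ordinal_def refl_on_def)
  have trans: "x \<le> y \<Longrightarrow> y \<le> z \<Longrightarrow> x \<le> z" for x y z :: ordinal
    using lin(2) unfolding less_eq_ordinal_def by (meson transD)
  have asym: "x \<le> y \<Longrightarrow> y \<le> x \<Longrightarrow> x = y" for x y :: ordinal
    using lin(3) unfolding less_eq_ordinal_def by (meson Rep_ordinal_inject antisymD)
  have tot: "x \<le> y \<or> y \<le> x" for x y :: ordinal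
    using lin(4) refl Rep_ordinal unfolding less_eq_ordinal_def total_on_def by metis
  have "{(x::ordinal, y). x < y} \<subseteq> inv_image (omega2_rel - Id) Rep_ordinal"
    by (auto simp: less_ordinal_def less_eq_ordinal_def Rep_ordinal_inject)
  then have wfl: "wf {(x::ordinal, y). x < y}"
    using wf wf_inv_image wf_subset by blast
  show "OFCLASS(ordinal, wellorder_class)"
  proof
    fix P :: "ordinal \<Rightarrow> bool" and a
    assume step: "\<And>x. (\<And>y. y < x \<Longrightarrow> P y) \<Longrightarrow> P x"
    show "P a" using wfl by (rule wf_induct_rule) (blast intro: step)
  qed (use refl trans asym tot in \<open>auto simp: less_ordinal_def\<close>)
qed

end

lemma card_initial_segment_ordinal: "|{..<\<alpha>}| \<le>o cardSuc natLeq" for \<alpha> :: ordinal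
proof -
  have below: "|underS omega2_rel (Rep_ordinal \<alpha>)| <o omega2_rel"
    by (rule card_of_underS[OF Card_order_omega2 Rep_ordinal])
  have "inj_on Rep_ordinal {..<\<alpha>}"
    by (simp add: inj_on_def Rep_ordinal_inject)
  moreover have "Rep_ordinal ` {..<\<alpha>} \<subseteq> underS omega2_rel (Rep_ordinal \<alpha>)"
    by (auto simp: underS_def less_ordinal_def less_eq_ordinal_def Rep_ordinal_inject)
  ultimately have "|{..<\<alpha>}| \<le>o |underS omega2_rel (Rep_ordinal \<alpha>)|"
    by (intro card_of_ordLeqI[of Rep_ordinal]) auto
  then have "|{..<\<alpha>}| <o omega2_rel"
    using below by (rule ordLeq_ordLess_trans)
  then show ?thesis
    using cardSuc_ordLeq_ordLess[OF cardSuc_Card_order[OF natLeq_Card_order] card_of_Card_order]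
    by blast
qed

lemma ordinal_strict_upper_bound:
  fixes A :: "ordinal set"
  assumes "|A| \<le>o cardSuc natLeq"
  shows "\<exists>\<gamma>. \<forall>\<alpha>\<in>A. \<alpha> < \<gamma>"
proof (rule ccontr)
  assume "\<not> ?thesis"
  then have unb: "\<exists>\<alpha>\<in>A. \<gamma> \<le> \<alpha>" for \<gamma> by (meson not_le)
  have Co1: "Card_order (cardSuc natLeq)" by (simp add: cardSuc_Card_order natLeq_Card_order)
  let ?K = "Rep_ordinal ` A"
  have K: "?K \<subseteq> Field omega2_rel" using Rep_ordinal by auto
  have "cofinal ?K omega2_rel"
    unfolding cofinal_def
  proof
    fix a assume "a \<in> Field omega2_rel"
    then obtain b where b: "b \<in> Field omega2_rel" "a \<noteq> b" "(a, b) \<in> omega2_rel"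
      using infinite_Card_order_limit[OF Card_order_omega2 infinite_omega2] by (metis FieldI2)
    obtain \<alpha> where \<alpha>: "\<alpha> \<in> A" "Abs_ordinal b \<le> \<alpha>" using unb by blast
    then have ba: "(b, Rep_ordinal \<alpha>) \<in> omega2_rel"
      using b(1) by (simp add: less_eq_ordinal_def Abs_ordinal_inverse)
    have wo: "well_order_on (Field omega2_rel) omega2_rel"
      using Card_order_omega2 by (auto simp: card_order_on_def)
    then have "trans omega2_rel" "antisym omega2_rel" by (auto simp: order_on_defs)
    have "(a, Rep_ordinal \<alpha>) \<in> omega2_rel"
      using transD[OF \<open>trans omega2_rel\<close> b(3) ba] .
    moreover have "a \<noteq> Rep_ordinal \<alpha>"
      using antisymD[OF \<open>antisym omega2_rel\<close> b(3)] ba b(2) by blast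
    ultimately show "\<exists>b\<in>?K. a \<noteq> b \<and> (a, b) \<in> omega2_rel" using \<alpha>(1) by blast
  qed
  then have "|?K| =o omega2_rel"
    using infinite_cardSuc_regularCard[OF infinite_omega1 Co1] K
    unfolding regularCard_def by blast
  moreover have "|?K| \<le>o cardSuc natLeq"
    by (rule ordLeq_transitive[OF card_of_image assms])
  ultimately have "omega2_rel \<le>o cardSuc natLeq"
    by (meson ordIso_ordLeq_trans ordIso_symmetric)
  then show False
    using not_ordLess_ordLeq[OF cardSuc_greater[OF Co1]] by contradiction
qed

lemma ex_uncountable_ordinal: "\<exists>\<alpha>::ordinal. uncountable {..<\<alpha>}"
proof (rule ccontr)
  assume "\<not> ?thesis"
  then have cnt: "countable {..<\<alpha>}" for \<alpha> :: ordinal by blast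
  have Co1: "Card_order (cardSuc natLeq)" by (simp add: cardSuc_Card_order natLeq_Card_order)
  have inj: "inj_on Abs_ordinal (Field omega2_rel)" by (simp add: Abs_ordinal_inject inj_on_def)
  have "cardSuc natLeq \<le>o |Field omega2_rel|"
    by (rule ordLeq_ordIso_trans[OF cardSuc_ordLeq[OF Co1]
          ordIso_symmetric[OF card_of_Field_ordIso[OF Card_order_omega2]]])
  then have "|Field (cardSuc natLeq)| \<le>o |Field omega2_rel|"
    by (rule ordIso_ordLeq_trans[OF card_of_Field_ordIso[OF Co1]])
  then obtain f where f: "inj_on f (Field (cardSuc natLeq))"
      "f ` Field (cardSuc natLeq) \<subseteq> Field omega2_rel"
    using card_of_ordLeq by (metis (no_types))
  let ?A = "Abs_ordinal ` f ` Field (cardSuc natLeq)"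
  have "|?A| \<le>o |Field (cardSuc natLeq)|"
    by (rule ordLeq_transitive[OF card_of_image card_of_image])
  then have "|?A| \<le>o cardSuc natLeq"
    by (rule ordLeq_ordIso_trans[OF _ card_of_Field_ordIso[OF Co1]])
  then obtain \<gamma> where \<gamma>: "\<forall>\<alpha>\<in>?A. \<alpha> < \<gamma>" using ordinal_strict_upper_bound by blast
  then have "?A \<subseteq> {..<\<gamma>}" by auto
  then have "countable ?A" using cnt[of \<gamma>] by (rule countable_subset)
  then have "countable ((Abs_ordinal \<circ> f) ` Field (cardSuc natLeq))"
    by (simp only: image_comp)
  moreover have "inj_on (Abs_ordinal \<circ> f) (Field (cardSuc natLeq))"
    by (rule comp_inj_on[OF f(1) inj_on_subset[OF inj f(2)]])
  ultimately have "countable (Field (cardSuc natLeq))"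
    by (rule countable_image_inj_on)
  then obtain g :: "nat set \<Rightarrow> nat" where "inj_on g (Field (cardSuc natLeq))"
    by (rule countableE)
  then have "|Field (cardSuc natLeq)| \<le>o |UNIV :: nat set|"
    by (intro card_of_ordLeqI[of g]) auto
  then have "|Field (cardSuc natLeq)| \<le>o natLeq"
    by (rule ordLeq_ordIso_trans[OF _ card_of_nat])
  then have "cardSuc natLeq \<le>o natLeq"
    by (rule ordIso_ordLeq_trans[OF ordIso_symmetric[OF card_of_Field_ordIso[OF Co1]]])
  then show False
    using not_ordLess_ordLeq[OF cardSuc_greater[OF natLeq_Card_order]] by contradiction
qed

text \<open>
  Addition is defined by \<open>\<alpha> + \<beta> = max \<alpha> (sup {(\<alpha> + \<delta>) + 1 | \<delta> < \<beta>})\<close>; the supremum of successors is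
  the least strict upper bound.
\<close>

instantiation ordinal :: "{zero, plus}"
begin

definition zero_ordinal :: ordinal where
  "zero_ordinal = (LEAST \<alpha>. True)"

function plus_ordinal :: "ordinal \<Rightarrow> ordinal \<Rightarrow> ordinal" where
  "plus_ordinal \<alpha> \<beta> = (LEAST \<gamma>. \<alpha> \<le> \<gamma> \<and> (\<forall>\<delta>\<in>{..<\<beta>}. plus_ordinal \<alpha> \<delta> < \<gamma>))"
  by pat_completeness auto
termination
  by (relation "inv_image {(x::ordinal, y). x < y} snd") (auto simp: wellorder_class.wf)

declare plus_ordinal.simps [simp del]

instance ..

end

lemma zero_le_ordinal: "0 \<le> \<alpha>" for \<alpha> :: ordinal
  unfolding zero_ordinal_def by (rule Least_le) simp

definition ordinal_omega :: ordinal where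
  "ordinal_omega = (LEAST \<alpha>. infinite {..<\<alpha>})"

lemma plus_ordinal_characterisation:
  fixes \<alpha> \<beta> :: ordinal
  shows "\<alpha> \<le> \<alpha> + \<beta>" and "\<delta> < \<beta> \<Longrightarrow> \<alpha> + \<delta> < \<alpha> + \<beta>"
    and "\<alpha> \<le> \<gamma> \<Longrightarrow> (\<And>\<delta>. \<delta> < \<beta> \<Longrightarrow> \<alpha> + \<delta> < \<gamma>) \<Longrightarrow> \<alpha> + \<beta> \<le> \<gamma>"
proof -
  let ?P = "\<lambda>\<gamma>. \<alpha> \<le> \<gamma> \<and> (\<forall>\<delta>\<in>{..<\<beta>}. \<alpha> + \<delta> < \<gamma>)"
  have eq: "\<alpha> + \<beta> = (LEAST \<gamma>. ?P \<gamma>)" by (rule plus_ordinal.simps)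
  have "|(\<lambda>\<delta>. \<alpha> + \<delta>) ` {..<\<beta>}| \<le>o cardSuc natLeq"
    by (rule ordLeq_transitive[OF card_of_image card_initial_segment_ordinal])
  then obtain \<gamma>0 where "\<forall>x\<in>(\<lambda>\<delta>. \<alpha> + \<delta>) ` {..<\<beta>}. x < \<gamma>0"
    using ordinal_strict_upper_bound by blast
  then have "?P (max \<alpha> \<gamma>0)" by (auto simp: less_max_iff_disj)
  then have "?P (\<alpha> + \<beta>)" unfolding eq by (rule LeastI)
  then show "\<alpha> \<le> \<alpha> + \<beta>" and "\<delta> < \<beta> \<Longrightarrow> \<alpha> + \<delta> < \<alpha> + \<beta>" by auto
  show "\<alpha> + \<beta> \<le> \<gamma>" if "\<alpha> \<le> \<gamma>" "\<And>\<delta>. \<delta> < \<beta> \<Longrightarrow> \<alpha> + \<delta> < \<gamma>"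
    unfolding eq by (rule Least_le) (use that in auto)
qed

lemma infinite_lessThan_ordinal_omega: "infinite {..<ordinal_omega}"
  unfolding ordinal_omega_def
  using ex_uncountable_ordinal by (metis (mono_tags, lifting) LeastI uncountable_infinite)

unbundle no cardinal_syntax


section \<open>Infinitary formulas over one binary relation symbol\<close>

text \<open>
  Variables are natural numbers. Countable conjunctions and disjunctions are indexed by all of
  \<open>nat\<close>; a finite nonempty one is obtained by repetition, an empty one is a constant family
  of \<open>Falsum\<close> or \<open>Neg Falsum\<close>.
  The constructors do not enforce that a formula has only finitely many free variables, but
  this passes from a formula to its subformulas, and it is imposed wherever formulas
  are used below.
\<close>

datatype fm =
    Falsum
  | Eq nat nat
  | Le nat nat
  | Neg fm
  | And fm fm
  | Or fm fm
  | CConj "nat \<Rightarrow> fm"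
  | CDisj "nat \<Rightarrow> fm"
  | Ex nat fm
  | All nat fm

primrec fv :: "fm \<Rightarrow> nat set" where
  "fv Falsum = {}"
| "fv (Eq x y) = {x, y}"
| "fv (Le x y) = {x, y}"
| "fv (Neg \<phi>) = fv \<phi>"
| "fv (And \<phi> \<psi>) = fv \<phi> \<union> fv \<psi>"
| "fv (Or \<phi> \<psi>) = fv \<phi> \<union> fv \<psi>"
| "fv (CConj \<Phi>) = (\<Union>i. fv (\<Phi> i))"
| "fv (CDisj \<Phi>) = (\<Union>i. fv (\<Phi> i))"
| "fv (Ex x \<phi>) = fv \<phi> - {x}"
| "fv (All x \<phi>) = fv \<phi> - {x}"

definition sentence :: "fm \<Rightarrow> bool" where
  "sentence \<phi> \<longleftrightarrow> fv \<phi> = {}"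

primrec finitary_qf :: "fm \<Rightarrow> bool" where
  "finitary_qf Falsum \<longleftrightarrow> True"
| "finitary_qf (Eq x y) \<longleftrightarrow> True"
| "finitary_qf (Le x y) \<longleftrightarrow> True"
| "finitary_qf (Neg \<phi>) \<longleftrightarrow> finitary_qf \<phi>"
| "finitary_qf (And \<phi> \<psi>) \<longleftrightarrow> finitary_qf \<phi> \<and> finitary_qf \<psi>"
| "finitary_qf (Or \<phi> \<psi>) \<longleftrightarrow> finitary_qf \<phi> \<and> finitary_qf \<psi>"
| "finitary_qf (CConj \<Phi>) \<longleftrightarrow> False"
| "finitary_qf (CDisj \<Phi>) \<longleftrightarrow> False"
| "finitary_qf (Ex x \<phi>) \<longleftrightarrow> False"
| "finitary_qf (All x \<phi>) \<longleftrightarrow> False"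

text \<open>\<open>foldr Ex xs \<phi>\<close> is \<open>\<exists>xs. \<phi>\<close> for a finite tuple \<open>xs\<close> of variables.\<close>

inductive Sigma_in :: "ordinal \<Rightarrow> fm \<Rightarrow> bool" and Pi_in :: "ordinal \<Rightarrow> fm \<Rightarrow> bool" where
  Sigma_zero: "finitary_qf \<phi> \<Longrightarrow> Sigma_in 0 \<phi>"
| Pi_zero: "finitary_qf \<phi> \<Longrightarrow> Pi_in 0 \<phi>"
| Sigma_CDisj: "(\<And>i. \<exists>xs \<psi> \<beta>. \<beta> < \<alpha> \<and> Pi_in \<beta> \<psi> \<and> \<Phi> i = foldr Ex xs \<psi>) \<Longrightarrow> Sigma_in \<alpha> (CDisj \<Phi>)"
| Pi_CConj: "(\<And>i. \<exists>xs \<psi> \<beta>. \<beta> < \<alpha> \<and> Sigma_in \<beta> \<psi> \<and> \<Phi> i = foldr All xs \<psi>) \<Longrightarrow> Pi_in \<alpha> (CConj \<Phi>)"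


section \<open>Countable structures\<close>

text \<open>
  A structure is a pair of a nonempty universe \<open>A \<subseteq> \<nat>\<close> and a binary relation on \<open>A\<close>. Up to isomorphism
  these are all the countable structures, finite ones included.
\<close>

type_synonym struct = "nat set \<times> nat rel"

definition structures :: "struct set" where
  "structures = {(A, R). A \<noteq> {} \<and> R \<subseteq> A \<times> A}"

primrec sat :: "struct \<Rightarrow> (nat \<Rightarrow> nat) \<Rightarrow> fm \<Rightarrow> bool" where
  "sat M e Falsum \<longleftrightarrow> False"
| "sat M e (Eq x y) \<longleftrightarrow> e x = e y"
| "sat M e (Le x y) \<longleftrightarrow> (e x, e y) \<in> snd M"
| "sat M e (Neg \<phi>) \<longleftrightarrow> \<not> sat M e \<phi>"
| "sat M e (And \<phi> \<psi>) \<longleftrightarrow> sat M e \<phi> \<and> sat M e \<psi>"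
| "sat M e (Or \<phi> \<psi>) \<longleftrightarrow> sat M e \<phi> \<or> sat M e \<psi>"
| "sat M e (CConj \<Phi>) \<longleftrightarrow> (\<forall>i. sat M e (\<Phi> i))"
| "sat M e (CDisj \<Phi>) \<longleftrightarrow> (\<exists>i. sat M e (\<Phi> i))"
| "sat M e (Ex x \<phi>) \<longleftrightarrow> (\<exists>a\<in>fst M. sat M (e(x := a)) \<phi>)"
| "sat M e (All x \<phi>) \<longleftrightarrow> (\<forall>a\<in>fst M. sat M (e(x := a)) \<phi>)"

lemma sat_cong_fv: "(\<And>x. x \<in> fv \<phi> \<Longrightarrow> e x = e' x) \<Longrightarrow> sat M e \<phi> = sat M e' \<phi>"
proof (induction \<phi> arbitrary: e e')
  case (CConj \<Phi>)
  have "sat M e (\<Phi> i) = sat M e' (\<Phi> i)" for i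
    by (rule CConj.IH) (use CConj.prems in auto)
  then show ?case by simp
next
  case (CDisj \<Phi>)
  have "sat M e (\<Phi> i) = sat M e' (\<Phi> i)" for i
    by (rule CDisj.IH) (use CDisj.prems in auto)
  then show ?case by simp
next
  case (Ex x \<phi>)
  have "sat M (e(x := a)) \<phi> = sat M (e'(x := a)) \<phi>" for a
    by (rule Ex.IH) (use Ex.prems in auto)
  then show ?case by simp
next
  case (All x \<phi>)
  have "sat M (e(x := a)) \<phi> = sat M (e'(x := a)) \<phi>" for a
    by (rule All.IH) (use All.prems in auto)
  then show ?case by simp
next
  case (And \<phi> \<psi>)
  have "sat M e \<phi> = sat M e' \<phi>" by (rule And.IH) (use And.prems in auto)
  moreover have "sat M e \<psi> = sat M e' \<psi>" by (rule And.IH) (use And.prems in auto)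
  ultimately show ?case by simp
next
  case (Or \<phi> \<psi>)
  have "sat M e \<phi> = sat M e' \<phi>" by (rule Or.IH) (use Or.prems in auto)
  moreover have "sat M e \<psi> = sat M e' \<psi>" by (rule Or.IH) (use Or.prems in auto)
  ultimately show ?case by simp
next
  case (Neg \<phi>)
  have "sat M e \<phi> = sat M e' \<phi>" by (rule Neg.IH) (use Neg.prems in auto)
  then show ?case by simp
qed auto

definition models :: "struct \<Rightarrow> fm \<Rightarrow> bool" where
  "models M \<phi> \<longleftrightarrow> (\<forall>e. range e \<subseteq> fst M \<longrightarrow> sat M e \<phi>)"

definition Mod :: "fm \<Rightarrow> struct set" where
  "Mod T = {M \<in> structures. models M T}"

definition implies_linear_order :: "fm \<Rightarrow> bool" where
  "implies_linear_order T \<longleftrightarrow> (\<forall>M\<in>Mod T. linear_order_on (fst M) (snd M))"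

definition is_iso :: "struct \<Rightarrow> struct \<Rightarrow> (nat \<Rightarrow> nat) \<Rightarrow> bool" where
  "is_iso M N f \<longleftrightarrow> bij_betw f (fst M) (fst N) \<and>
     (\<forall>x\<in>fst M. \<forall>y\<in>fst M. (x, y) \<in> snd M \<longleftrightarrow> (f x, f y) \<in> snd N)"

definition iso_rel :: "struct set \<Rightarrow> struct rel" where
  "iso_rel K = {(M, N). M \<in> K \<and> N \<in> K \<and> (\<exists>f. is_iso M N f)}"

definition Pi_equiv :: "ordinal \<Rightarrow> struct \<Rightarrow> struct \<Rightarrow> bool" where
  "Pi_equiv \<beta> M N \<longleftrightarrow> (\<forall>\<phi>. Pi_in \<beta> \<phi> \<and> sentence \<phi> \<longrightarrow> (models M \<phi> \<longleftrightarrow> models N \<phi>))"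


section \<open>Scott rank and Vaught ordinal\<close>

definition same_orbit :: "struct \<Rightarrow> nat list \<Rightarrow> nat list \<Rightarrow> bool" where
  "same_orbit M as bs \<longleftrightarrow> (\<exists>f. is_iso M M f \<and> map f as = bs)"

text \<open>
  In \<open>\<phi>\<close> the first \<open>length ps\<close> variables stand for the parameters \<open>ps\<close> and the next \<open>length as\<close> variables
  for the tuple being defined. Since \<open>\<phi>\<close> has no other free variables, the values of
  \<open>(!) (ps @ bs)\<close> out of range are immaterial.
\<close>

definition orbits_definable :: "ordinal \<Rightarrow> struct \<Rightarrow> nat list \<Rightarrow> bool" where
  "orbits_definable \<alpha> M ps \<longleftrightarrow>
     (\<forall>as. set as \<subseteq> fst M \<longrightarrow>
       (\<exists>\<phi>. Sigma_in \<alpha> \<phi> \<and> fv \<phi> \<subseteq> {..<length ps + length as} \<and>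
         (\<forall>bs. set bs \<subseteq> fst M \<and> length bs = length as \<longrightarrow>
           (sat M ((!) (ps @ bs)) \<phi> \<longleftrightarrow> same_orbit M as bs))))"

definition Scott_rank :: "struct \<Rightarrow> ordinal" where
  "Scott_rank M = (LEAST \<alpha>. countable {..<\<alpha>} \<and> (\<exists>ps. set ps \<subseteq> fst M \<and> orbits_definable \<alpha> M ps))"

definition Vaught_ordinal :: "fm \<Rightarrow> ordinal" where
  "Vaught_ordinal T = (LEAST \<beta>.
     (countable (Mod T // iso_rel (Mod T)) \<and> (\<forall>M\<in>Mod T. Scott_rank M < \<beta>)) \<or>
     (\<exists>S \<subseteq> Mod T. uncountable S \<and> pairwise (\<lambda>M N. \<not> Pi_equiv \<beta> M N) S))"

end

theory Submission
  imports Defs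
begin

text \<open>
  A countable linear order is represented by a countable set of reals, and \<open>E\<^sub>n\<close> is the back-and-forth
  relation of level \<open>\<alpha> + 1 + n\<close>. It suffices to show: if the orders that are \<open>E\<^sub>0\<close>-equivalent to \<open>M\<close> fall
  into countably many classes for the intersection \<open>E\<^sub>\<omega>\<close> of the \<open>E\<^sub>n\<close>, then \<open>M\<close> is \<^emph>\<open>low\<close>, that is,
  homogeneous for some \<open>E\<^sub>n\<close>, hence of Scott rank below \<open>\<alpha> + \<omega>\<close>. The level of homogeneity grows by at
  most a constant under sums of intervals. With few classes every order is \<open>E\<^sub>n\<close>-equivalent to a low one
  (a generic model), and no order contains an increasing sequence of intervals with decreasing
  sequences of arbitrarily complicated subintervals, because replacing intervals by low copies would code
  arbitrary sets of natural numbers. From an order that is not low one builds, by isolating a model among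
  those with unbounded levels of initial segments and taking limits of its initial segments, precisely
  the mirror image of such a sequence.
\<close>

section \<open>Successor ordinals\<close>

text \<open>The base level is \<alpha> + 1 because level \<alpha> preserves the truth of
  \<open>T\<close>, while one further move guarantees nonemptiness even for \<alpha> = 0, as level 0
  relates every order to the empty one. Equivalence respects ordered sums, so any interval may be
  exchanged for an equivalent order without leaving the class; every contradiction exploits this
  freedom. The failure of the second alternative yields only a countable list of representatives, so
  each contradiction is a diagonal construction against that list. The obstacle is that coding reads
  the levels of initial segments, and these may take any value in between as the end point climbs.
  Decreasing sequences of complicated intervals remove this: an initial segment that reaches into
  one contains complicated intervals already, so its level jumps. The constants record losses:
  turning an equivalence with a homogeneous order into an isomorphism costs three levels, passing to
  a limit or across a cut costs four, and codes are spaced widely enough to absorb such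
  losses.\<close>

definition osuc :: "ordinal \<Rightarrow> ordinal" where
  "osuc \<beta> = (LEAST \<gamma>. \<beta> < \<gamma>)"

text \<open>A larger ordinal must be exhibited before \<open>LEAST\<close> is meaningful;
  \<open>\<beta> + ordinal_omega\<close> serves, since \<omega> has at least one
  predecessor.\<close>

lemma less_osuc: "\<beta> < osuc \<beta>"
proof -
  have "{..<ordinal_omega} \<noteq> {}"
    using infinite_lessThan_ordinal_omega by (metis finite.emptyI)
  then obtain \<delta> where "\<delta> < ordinal_omega" by auto
  then have "\<beta> < \<beta> + ordinal_omega"
    using plus_ordinal_characterisation(1,2) by (metis order.strict_trans1)
  then show ?thesis unfolding osuc_def by (rule LeastI)
qed

lemma osuc_le_iff: "osuc \<beta> \<le> \<gamma> \<longleftrightarrow> \<beta> < \<gamma>"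
proof
  show "\<beta> < \<gamma>" if "osuc \<beta> \<le> \<gamma>" using that less_osuc[of \<beta>] by simp
  show "osuc \<beta> \<le> \<gamma>" if "\<beta> < \<gamma>" unfolding osuc_def by (rule Least_le) (rule that)
qed

lemma less_osuc_iff: "\<gamma> < osuc \<beta> \<longleftrightarrow> \<gamma> \<le> \<beta>"
  using osuc_le_iff[of \<beta> \<gamma>] by (metis not_le)

lemma countable_osuc: "countable {..<\<beta>} \<Longrightarrow> countable {..<osuc \<beta>}"
proof -
  have "{..<osuc \<beta>} = insert \<beta> {..<\<beta>}" by (auto simp: less_osuc_iff)
  then show "countable {..<\<beta>} \<Longrightarrow> countable {..<osuc \<beta>}" by simp
qed

lemma osuc_pow_mono: "m \<le> n \<Longrightarrow> (osuc ^^ m) \<beta> \<le> (osuc ^^ n) \<beta>"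
proof (induction n)
  case (Suc n)
  then show ?case
    using less_osuc[of "(osuc ^^ n) \<beta>"] by (cases "m = Suc n") auto
qed simp

lemma countable_osuc_pow: "countable {..<\<beta>} \<Longrightarrow> countable {..<(osuc ^^ n) \<beta>}"
  by (induction n) (auto intro: countable_osuc)

lemma osuc_pow_less_omega: "(osuc ^^ n) 0 < ordinal_omega"
proof -
  have "finite {..<(osuc ^^ n) 0}"
  proof (induction n)
    case 0
    have "{..<0 :: ordinal} = {}" using zero_le_ordinal by (auto simp: not_less[symmetric])
    then show ?case by simp
  next
    case (Suc n)
    have "{..<osuc ((osuc ^^ n) 0)} = insert ((osuc ^^ n) 0) {..<(osuc ^^ n) 0}"
      by (auto simp: less_osuc_iff)
    then show ?case using Suc by simp
  qed
  then have "\<not> ordinal_omega \<le> (osuc ^^ n) 0"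
    using infinite_lessThan_ordinal_omega
    by (meson finite_subset lessThan_subset_iff)
  then show ?thesis by simp
qed

text \<open>All formulas and equivalences built below sit finitely many successors above \<alpha>;
  this places them strictly below the bound of the theorem.\<close>

lemma osuc_pow_less_plus_omega: "(osuc ^^ n) \<alpha> < \<alpha> + ordinal_omega"
proof -
  have "(osuc ^^ n) \<alpha> \<le> \<alpha> + (osuc ^^ n) 0"
  proof (induction n)
    case 0 show ?case by (simp add: plus_ordinal_characterisation)
  next
    case (Suc n)
    have "\<alpha> + (osuc ^^ n) 0 < \<alpha> + osuc ((osuc ^^ n) 0)"
      by (rule plus_ordinal_characterisation(2)[OF less_osuc])
    then show ?case using Suc by (simp add: osuc_le_iff)
  qed
  then show ?thesis
    using plus_ordinal_characterisation(2)[OF osuc_pow_less_omega[of n], of \<alpha>] by simp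
qed

section \<open>Back-and-forth relations between linear orders\<close>

text \<open>Since all pairs are compared in both orders, the equivalence for \<open><\<close> forces
  those for equality and for \<open>\<le>\<close>: \<open>p\<close> is the graph of a partial
  isomorphism.\<close>

definition piso :: "(real \<times> real) set \<Rightarrow> bool" where
  "piso p \<longleftrightarrow> (\<forall>(x, y)\<in>p. \<forall>(x', y')\<in>p. x < x' \<longleftrightarrow> y < y')"

lemma pisoD: "piso p \<Longrightarrow> (x, y) \<in> p \<Longrightarrow> (x', y') \<in> p \<Longrightarrow> x < x' \<longleftrightarrow> y < y'"
  unfolding piso_def by blast

lemma pisoD_le: "piso p \<Longrightarrow> (x, y) \<in> p \<Longrightarrow> (x', y') \<in> p \<Longrightarrow> x \<le> x' \<longleftrightarrow> y \<le> y'"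
  using pisoD[of p x' y' x y] by (simp add: not_less[symmetric])

lemma pisoD_eq: "piso p \<Longrightarrow> (x, y) \<in> p \<Longrightarrow> (x', y') \<in> p \<Longrightarrow> x = x' \<longleftrightarrow> y = y'"
  using pisoD[of p x y x' y'] pisoD[of p x' y' x y] by (metis linorder_cases less_irrefl)

lemma piso_subset: "piso p \<Longrightarrow> q \<subseteq> p \<Longrightarrow> piso q"
  unfolding piso_def by blast

text \<open>These are the symmetric back-and-forth relations with finite sets as moves: a whole
  block of quantifiers costs one level in the formula hierarchy, so a whole finite set must be
  answered in one move. A position is a relation rather than a pair of tuples, which makes
  restriction, converse and composition available.\<close>

function bf :: "ordinal \<Rightarrow> real set \<Rightarrow> real set \<Rightarrow> (real \<times> real) set \<Rightarrow> bool" where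
  "bf \<beta> A B p \<longleftrightarrow> finite p \<and> p \<subseteq> A \<times> B \<and> piso p \<and>
     (\<forall>\<gamma>\<in>{..<\<beta>}.
        (\<forall>C. finite C \<and> C \<subseteq> A \<longrightarrow> (\<exists>p'. p \<subseteq> p' \<and> C \<subseteq> Domain p' \<and> bf \<gamma> A B p')) \<and>
        (\<forall>D. finite D \<and> D \<subseteq> B \<longrightarrow> (\<exists>p'. p \<subseteq> p' \<and> D \<subseteq> Range p' \<and> bf \<gamma> A B p')))"
  by pat_completeness auto
termination
  by (relation "inv_image {(x::ordinal, y). x < y} fst") (auto simp: wellorder_class.wf)

declare bf.simps [simp del]

lemma bfI:
  assumes "finite p" "p \<subseteq> A \<times> B" "piso p"
    and "\<And>\<gamma> C. \<gamma> < \<beta> \<Longrightarrow> finite C \<Longrightarrow> C \<subseteq> A \<Longrightarrow> \<exists>p'. p \<subseteq> p' \<and> C \<subseteq> Domain p' \<and> bf \<gamma> A B p'"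
    and "\<And>\<gamma> D. \<gamma> < \<beta> \<Longrightarrow> finite D \<Longrightarrow> D \<subseteq> B \<Longrightarrow> \<exists>p'. p \<subseteq> p' \<and> D \<subseteq> Range p' \<and> bf \<gamma> A B p'"
  shows "bf \<beta> A B p"
  unfolding bf.simps[of \<beta>] using assms by auto

lemma bf_base: "bf \<beta> A B p \<Longrightarrow> finite p" "bf \<beta> A B p \<Longrightarrow> p \<subseteq> A \<times> B" "bf \<beta> A B p \<Longrightarrow> piso p"
  unfolding bf.simps[of \<beta>] by auto

lemma bf_forth:
  assumes "bf \<beta> A B p" "\<gamma> < \<beta>" "finite C" "C \<subseteq> A"
  obtains p' where "p \<subseteq> p'" "C \<subseteq> Domain p'" "bf \<gamma> A B p'"
  using assms(1)[unfolded bf.simps[of \<beta>]] assms(2-4) by (meson lessThan_iff)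

lemma bf_back:
  assumes "bf \<beta> A B p" "\<gamma> < \<beta>" "finite D" "D \<subseteq> B"
  obtains p' where "p \<subseteq> p'" "D \<subseteq> Range p'" "bf \<gamma> A B p'"
  using assms(1)[unfolded bf.simps[of \<beta>]] assms(2-4) by (meson lessThan_iff)

lemma bf_mono: "\<gamma> \<le> \<beta> \<Longrightarrow> bf \<beta> A B p \<Longrightarrow> bf \<gamma> A B p"
  unfolding bf.simps[of \<beta>] bf.simps[of \<gamma>] by auto

lemma bf_subset: "bf \<beta> A B p \<Longrightarrow> q \<subseteq> p \<Longrightarrow> bf \<beta> A B q"
proof -
  assume p: "bf \<beta> A B p" and q: "q \<subseteq> p"
  show ?thesis
  proof (rule bfI)
    show "finite q" using q bf_base(1)[OF p] by (rule finite_subset)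
    show "q \<subseteq> A \<times> B" using q bf_base(2)[OF p] by blast
    show "piso q" using piso_subset[OF bf_base(3)[OF p] q] .
    show "\<exists>p'. q \<subseteq> p' \<and> C \<subseteq> Domain p' \<and> bf \<gamma> A B p'" if "\<gamma> < \<beta>" "finite C" "C \<subseteq> A" for \<gamma> C
      using bf_forth[OF p that] q by (metis subset_trans)
    show "\<exists>p'. q \<subseteq> p' \<and> D \<subseteq> Range p' \<and> bf \<gamma> A B p'" if "\<gamma> < \<beta>" "finite D" "D \<subseteq> B" for \<gamma> D
      using bf_back[OF p that] q by (metis subset_trans)
  qed
qed

lemma bf_empty: "bf \<beta> A B p \<Longrightarrow> bf \<beta> A B {}"
  by (erule bf_subset) simp

lemma bf_converse: "bf \<beta> A B p \<Longrightarrow> bf \<beta> B A (p\<inverse>)"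
proof (induction \<beta> arbitrary: p rule: less_induct)
  case (less \<beta>)
  note p = less.prems
  show ?case
  proof (rule bfI)
    show "finite (p\<inverse>)" using bf_base(1)[OF p] by simp
    show "p\<inverse> \<subseteq> B \<times> A" using bf_base(2)[OF p] by blast
    show "piso (p\<inverse>)" using bf_base(3)[OF p] unfolding piso_def by auto
    fix \<gamma> assume g: "\<gamma> < \<beta>"
    show "\<exists>p'. p\<inverse> \<subseteq> p' \<and> C \<subseteq> Domain p' \<and> bf \<gamma> B A p'" if C: "finite C" "C \<subseteq> B" for C
    proof -
      obtain q where "p \<subseteq> q" "C \<subseteq> Range q" "bf \<gamma> A B q" using bf_back[OF p g C] .
      then show ?thesis using less.IH[OF g, of q] by (intro exI[of _ "q\<inverse>"]) auto
    qed
    show "\<exists>p'. p\<inverse> \<subseteq> p' \<and> D \<subseteq> Range p' \<and> bf \<gamma> B A p'" if D: "finite D" "D \<subseteq> A" for D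
    proof -
      obtain q where "p \<subseteq> q" "D \<subseteq> Domain q" "bf \<gamma> A B q" using bf_forth[OF p g D] .
      then show ?thesis using less.IH[OF g, of q] by (intro exI[of _ "q\<inverse>"]) auto
    qed
  qed
qed

lemma bf_trans: "bf \<beta> A B p \<Longrightarrow> bf \<beta> B C q \<Longrightarrow> bf \<beta> A C (p O q)"
proof (induction \<beta> arbitrary: p q rule: less_induct)
  case (less \<beta>)
  note p = less.prems(1) and q = less.prems(2)
  show ?case
  proof (rule bfI)
    have "p O q \<subseteq> Domain p \<times> Range q" by blast
    moreover have "finite (Domain p \<times> Range q)"
      using bf_base(1)[OF p] bf_base(1)[OF q] by (simp add: finite_Domain finite_Range)
    ultimately show "finite (p O q)" by (rule finite_subset)
    show "p O q \<subseteq> A \<times> C" using bf_base(2)[OF p] bf_base(2)[OF q] by blast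
    show "piso (p O q)" using bf_base(3)[OF p] bf_base(3)[OF q] unfolding piso_def by fast
    fix \<gamma> assume g: "\<gamma> < \<beta>"
    show "\<exists>p'. p O q \<subseteq> p' \<and> D \<subseteq> Domain p' \<and> bf \<gamma> A C p'" if D: "finite D" "D \<subseteq> A" for D
    proof -
      obtain p' where p': "p \<subseteq> p'" "D \<subseteq> Domain p'" "bf \<gamma> A B p'" using bf_forth[OF p g D] .
      have "finite (Range p')" "Range p' \<subseteq> B"
        using bf_base(1,2)[OF p'(3)] by (auto simp: finite_Range)
      then obtain q' where q': "q \<subseteq> q'" "Range p' \<subseteq> Domain q'" "bf \<gamma> B C q'" by (rule bf_forth[OF q g])
      show ?thesis
        using less.IH[OF g p'(3) q'(3)] p' q' by (intro exI[of _ "p' O q'"]) blast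
    qed
    show "\<exists>p'. p O q \<subseteq> p' \<and> D \<subseteq> Range p' \<and> bf \<gamma> A C p'" if D: "finite D" "D \<subseteq> C" for D
    proof -
      obtain q' where q': "q \<subseteq> q'" "D \<subseteq> Range q'" "bf \<gamma> B C q'" using bf_back[OF q g D] .
      have "finite (Domain q')" "Domain q' \<subseteq> B"
        using bf_base(1,2)[OF q'(3)] by (auto simp: finite_Domain)
      then obtain p' where p': "p \<subseteq> p'" "Domain q' \<subseteq> Range p'" "bf \<gamma> A B p'" by (rule bf_back[OF p g])
      show ?thesis
        using less.IH[OF g p'(3) q'(3)] p' q' by (intro exI[of _ "p' O q'"]) blast
    qed
  qed
qed

lemma bf_trans0: "bf \<beta> A B {} \<Longrightarrow> bf \<beta> B C {} \<Longrightarrow> bf \<beta> A C {}"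
  using bf_trans[of \<beta> A B "{}" C "{}"] by simp

lemma bf_sym0: "bf \<beta> A B {} \<Longrightarrow> bf \<beta> B A {}"
  using bf_converse[of \<beta> A B "{}"] by simp

subsection \<open>Isomorphisms\<close>

definition oiso :: "(real \<Rightarrow> real) \<Rightarrow> real set \<Rightarrow> real set \<Rightarrow> bool" where
  "oiso f A B \<longleftrightarrow> strict_mono_on A f \<and> f ` A = B"

definition isom :: "real set \<Rightarrow> real set \<Rightarrow> bool" where
  "isom A B \<longleftrightarrow> (\<exists>f. oiso f A B)"

definition gr :: "(real \<Rightarrow> real) \<Rightarrow> real set \<Rightarrow> (real \<times> real) set" where
  "gr f A = (\<lambda>x. (x, f x)) ` A"

lemma in_gr: "(x, y) \<in> gr f A \<longleftrightarrow> x \<in> A \<and> y = f x" by (auto simp: gr_def)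

lemma strict_mono_on_subset: "strict_mono_on A f \<Longrightarrow> B \<subseteq> A \<Longrightarrow> strict_mono_on B f" for f :: "real \<Rightarrow> real"
  by (auto simp: strict_mono_on_def)

lemma strict_mono_on_less_iff:
  "strict_mono_on A f \<Longrightarrow> x \<in> A \<Longrightarrow> y \<in> A \<Longrightarrow> f x < f y \<longleftrightarrow> x < (y::real)" for f :: "real \<Rightarrow> real"
  by (metis linorder_less_linear order_less_asym strict_mono_onD)

lemma strict_mono_on_le_iff:
  "strict_mono_on A f \<Longrightarrow> x \<in> A \<Longrightarrow> y \<in> A \<Longrightarrow> f x \<le> f y \<longleftrightarrow> x \<le> (y::real)" for f :: "real \<Rightarrow> real"
  using strict_mono_on_less_iff[of A f y x] by (simp add: not_less[symmetric])

lemma strict_mono_on_eq_iff: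
  "strict_mono_on A f \<Longrightarrow> x \<in> A \<Longrightarrow> y \<in> A \<Longrightarrow> f x = f y \<longleftrightarrow> x = (y::real)" for f :: "real \<Rightarrow> real"
  using strict_mono_on_le_iff[of A f y x] strict_mono_on_le_iff[of A f x y] by (simp add: order_eq_iff)

lemma oiso_refl: "oiso (\<lambda>x. x) A A" by (simp add: oiso_def strict_mono_on_def)

lemma oiso_image: "strict_mono_on A f \<Longrightarrow> oiso f A (f ` A)" by (simp add: oiso_def)

lemma oiso_below: "oiso f A B \<Longrightarrow> x \<in> A \<Longrightarrow> oiso f (A \<inter> {..<x}) (B \<inter> {..<f x})"
  using strict_mono_on_less_iff[of A f _ x] unfolding oiso_def by (auto intro: strict_mono_on_subset)

lemma oiso_above: "oiso f A B \<Longrightarrow> x \<in> A \<Longrightarrow> oiso f (A \<inter> {x<..}) (B \<inter> {f x<..})"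
  using strict_mono_on_less_iff[of A f x] unfolding oiso_def by (auto intro: strict_mono_on_subset)

lemma oiso_atMost: "oiso f A B \<Longrightarrow> x \<in> A \<Longrightarrow> oiso f (A \<inter> {..x}) (B \<inter> {..f x})"
  using strict_mono_on_le_iff[of A f _ x] unfolding oiso_def by (auto intro: strict_mono_on_subset)

lemma oiso_between:
  "oiso f A B \<Longrightarrow> x \<in> A \<Longrightarrow> y \<in> A \<Longrightarrow> oiso f (A \<inter> {x<..<y}) (B \<inter> {f x<..<f y})"
  using strict_mono_on_less_iff[of A f x] strict_mono_on_less_iff[of A f _ y]
  unfolding oiso_def by (auto intro: strict_mono_on_subset)

lemma oiso_between': 
  "oiso f A B \<Longrightarrow> x \<in> A \<Longrightarrow> y \<in> A \<Longrightarrow> oiso f (A \<inter> {x<..y}) (B \<inter> {f x<..f y})"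
  using strict_mono_on_less_iff[of A f x] strict_mono_on_le_iff[of A f _ y]
  unfolding oiso_def by (auto intro: strict_mono_on_subset)

lemma oiso_inv: "oiso f A B \<Longrightarrow> oiso (inv_into A f) B A"
proof -
  assume f: "oiso f A B"
  then have m: "strict_mono_on A f" and B: "B = f ` A" by (auto simp: oiso_def)
  have inj: "inj_on f A" using m by (rule strict_mono_on_imp_inj_on)
  show ?thesis unfolding oiso_def strict_mono_on_def
    using inj B m by (auto simp: strict_mono_on_less_iff)
qed

lemma oiso_comp: "oiso f A B \<Longrightarrow> oiso g B C \<Longrightarrow> oiso (g \<circ> f) A C"
  unfolding oiso_def strict_mono_on_def by (auto simp: image_comp)

lemma isom_refl: "isom A A" using oiso_refl isom_def by blast
lemma isom_sym: "isom A B \<Longrightarrow> isom B A" using oiso_inv isom_def by blast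
lemma isom_trans: "isom A B \<Longrightarrow> isom B C \<Longrightarrow> isom A C" unfolding isom_def using oiso_comp by blast
lemma oiso_isom: "oiso f A B \<Longrightarrow> isom A B" using isom_def by blast

lemma isom_countable: "isom A B \<Longrightarrow> countable A \<Longrightarrow> countable B"
  by (auto simp: isom_def oiso_def)

lemma isom_glue:
  fixes f g :: "real \<Rightarrow> 'i::linorder"
  assumes f: "mono_on A f" and g: "mono_on B g"
    and iso: "\<And>i. isom {x\<in>A. f x = i} {y\<in>B. g y = i}"
  shows "isom A B"
proof -
  obtain h where h: "\<And>i. oiso (h i) {x\<in>A. f x = i} {y\<in>B. g y = i}"
    using iso unfolding isom_def by metis
  define k where "k x = h (f x) x" for x
  have k: "k x \<in> B \<and> g (k x) = f x" if "x \<in> A" for x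
    using h[of "f x"] that unfolding oiso_def k_def by blast
  have "strict_mono_on A k"
  proof (rule strict_mono_onI)
    fix r s assume rs: "r \<in> A" "s \<in> A" "r < s"
    then have "f r \<le> f s" using f by (simp add: mono_on_def)
    then consider "f r < f s" | "f r = f s" by fastforce
    then show "k r < k s"
    proof cases
      case 1
      have "\<not> k s \<le> k r"
      proof
        assume "k s \<le> k r"
        then have "g (k s) \<le> g (k r)" using k[OF rs(1)] k[OF rs(2)] mono_onD[OF g] by blast
        then show False using k[OF rs(1)] k[OF rs(2)] 1 by auto
      qed
      then show ?thesis by simp
    next
      case 2
      then show ?thesis using h[of "f r"] rs unfolding oiso_def k_def strict_mono_on_def by auto
    qed
  qed
  moreover have "k ` A = B"
  proof
    show "k ` A \<subseteq> B" using k by auto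
    show "B \<subseteq> k ` A"
    proof
      fix y assume "y \<in> B"
      then have "y \<in> h (g y) ` {x\<in>A. f x = g y}" using h[of "g y"] by (auto simp: oiso_def)
      then obtain x where "x \<in> A" "f x = g y" "y = h (g y) x" by auto
      then show "y \<in> k ` A" by (metis k_def image_eqI)
    qed
  qed
  ultimately show ?thesis by (auto simp: isom_def oiso_def)
qed

lemma oiso_glue2:
  assumes f: "oiso f A1 B1" and g: "oiso g A2 B2"
    and lt: "\<And>x y. x \<in> A1 \<Longrightarrow> y \<in> A2 \<Longrightarrow> x < y" "\<And>x y. x \<in> B1 \<Longrightarrow> y \<in> B2 \<Longrightarrow> x < y"
  shows "oiso (\<lambda>x. if x \<in> A1 then f x else g x) (A1 \<union> A2) (B1 \<union> B2)"
proof -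
  have d: "x \<notin> A1" if "x \<in> A2" for x using lt(1) that by blast
  let ?h = "\<lambda>x. if x \<in> A1 then f x else g x"
  have fB: "f x \<in> B1" if "x \<in> A1" for x using f that by (auto simp: oiso_def)
  have gB: "g x \<in> B2" if "x \<in> A2" for x using g that by (auto simp: oiso_def)
  have "strict_mono_on (A1 \<union> A2) ?h"
  proof (rule strict_mono_onI)
    fix r s assume rs: "r \<in> A1 \<union> A2" "s \<in> A1 \<union> A2" "r < s"
    consider "r \<in> A1" "s \<in> A1" | "r \<in> A1" "s \<in> A2" | "r \<in> A2" "s \<in> A2"
      using rs lt(1)[of s r] by force
    then show "?h r < ?h s"
    proof cases
      case 1 then show ?thesis using f rs(3) by (simp add: oiso_def strict_mono_on_def)
    next
      case 2 then show ?thesis using d lt(2) fB gB by simp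
    next
      case 3 then show ?thesis using g rs(3) d by (simp add: oiso_def strict_mono_on_def)
    qed
  qed
  moreover have "?h ` A1 = B1" using f by (simp add: oiso_def)
  moreover have "?h ` A2 = B2"
  proof -
    have "?h ` A2 = g ` A2" using d by (intro image_cong) auto
    then show ?thesis using g by (simp add: oiso_def)
  qed
  ultimately show ?thesis unfolding oiso_def image_Un by blast
qed

lemma bf_oiso: "oiso f A B \<Longrightarrow> finite p \<Longrightarrow> p \<subseteq> gr f A \<Longrightarrow> bf \<beta> A B p"
proof (induction \<beta> arbitrary: p rule: less_induct)
  case (less \<beta>)
  have m: "strict_mono_on A f" and B: "B = f ` A" using less.prems(1) by (auto simp: oiso_def)
  show ?case
  proof (rule bfI)
    show "finite p" by fact
    show "p \<subseteq> A \<times> B" using less.prems(3) B by (auto simp: gr_def)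
    show "piso p" unfolding piso_def
    proof clarify
      fix x y x' y' assume "(x, y) \<in> p" "(x', y') \<in> p"
      then have "(x, y) \<in> gr f A" "(x', y') \<in> gr f A" using less.prems(3) by auto
      then show "x < x' \<longleftrightarrow> y < y'" by (auto simp: in_gr strict_mono_on_less_iff[OF m])
    qed
    fix \<gamma> assume g: "\<gamma> < \<beta>"
    show "\<exists>p'. p \<subseteq> p' \<and> C \<subseteq> Domain p' \<and> bf \<gamma> A B p'" if "finite C" "C \<subseteq> A" for C
      using less.IH[OF g less.prems(1), of "p \<union> gr f C"] that less.prems
      by (intro exI[of _ "p \<union> gr f C"]) (auto simp: gr_def)
    show "\<exists>p'. p \<subseteq> p' \<and> D \<subseteq> Range p' \<and> bf \<gamma> A B p'" if D: "finite D" "D \<subseteq> B" for D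
    proof -
      obtain C where "C \<subseteq> A" "finite C" "D = f ` C"
        using finite_subset_image[OF D(1)] D(2) B by metis
      then show ?thesis using less.IH[OF g less.prems(1), of "p \<union> gr f C"] less.prems
        by (intro exI[of _ "p \<union> gr f C"]) (auto simp: gr_def)
    qed
  qed
qed

lemma bf_isom: "isom A B \<Longrightarrow> bf \<beta> A B {}"
  unfolding isom_def using bf_oiso by blast

lemma bf_Id_on: "finite C \<Longrightarrow> C \<subseteq> A \<Longrightarrow> bf \<beta> A A (Id_on C)"
  by (rule bf_oiso[OF oiso_refl]) (auto simp: gr_def Id_on_def)

lemma bf_refl0: "bf \<beta> A A {}" by (rule bf_isom[OF isom_refl])

subsection \<open>Sums and intervals\<close>

text \<open>Both sides are sums over one index order, and the game is played on each summand
  separately. This is what permits the replacement of intervals by equivalent orders.\<close>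

lemma bf_sum:
  fixes f g :: "real \<Rightarrow> 'i::linorder"
  assumes f: "mono_on A f" and g: "mono_on B g"
  shows "finite p \<Longrightarrow> p \<subseteq> A \<times> B \<Longrightarrow> (\<And>x y. (x, y) \<in> p \<Longrightarrow> f x = g y) \<Longrightarrow>
    (\<And>i. bf \<beta> {x\<in>A. f x = i} {y\<in>B. g y = i} {(x, y)\<in>p. f x = i}) \<Longrightarrow> bf \<beta> A B p"
proof (induction \<beta> arbitrary: p rule: less_induct)
  case (less \<beta>)
  let ?A = "\<lambda>i. {x\<in>A. f x = i}" and ?B = "\<lambda>i. {y\<in>B. g y = i}"
  let ?p = "\<lambda>i. {(x, y)\<in>p. f x = i}"
  have fp: "f ` Domain p = f ` fst ` p" by (auto simp: Domain_fst)
  have ext: "bf \<gamma> A B (\<Union>i. q i)" 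
    if g: "\<gamma> < \<beta>" and q: "\<And>i. bf \<gamma> (?A i) (?B i) (q i)" and fin: "finite I" "\<And>i. i \<notin> I \<Longrightarrow> q i = {}" for q \<gamma> I
  proof (rule less.IH[OF g])
    have "(\<Union>i. q i) = (\<Union>i\<in>I. q i)" using fin(2) by blast
    then show "finite (\<Union>i. q i)" using fin(1) bf_base(1)[OF q] by simp
    have sub: "q i \<subseteq> ?A i \<times> ?B i" for i using bf_base(2)[OF q] .
    show "(\<Union>i. q i) \<subseteq> A \<times> B" using sub by blast
    show "f x = g y" if "(x, y) \<in> (\<Union>i. q i)" for x y using that sub by fastforce
    show "bf \<gamma> (?A i) (?B i) {(x, y) \<in> \<Union>i. q i. f x = i}" for i
    proof -
      have "{(x, y) \<in> \<Union>i. q i. f x = i} = q i" using sub by fastforce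
      then show ?thesis using q by simp
    qed
  qed
  have pi: "p = (\<Union>i. ?p i)" by auto
  show ?case
  proof (rule bfI)
    show "finite p" "p \<subseteq> A \<times> B" by fact+
    show "piso p" unfolding piso_def
    proof clarify
      fix x y x' y' assume a: "(x, y) \<in> p" "(x', y') \<in> p"
      have i: "f x = g y" "f x' = g y'" using less.prems(3) a by auto
      have AB: "x \<in> A" "x' \<in> A" "y \<in> B" "y' \<in> B" using less.prems(2) a by auto
      show "x < x' \<longleftrightarrow> y < y'"
      proof (cases "f x = f x'")
        case True
        then have "(x, y) \<in> ?p (f x)" "(x', y') \<in> ?p (f x)" using a by auto
        then show ?thesis using pisoD[OF bf_base(3)[OF less.prems(4)[of "f x"]]] by blast
      next
        case False
        have "x < x' \<longleftrightarrow> f x < f x'"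
          using f AB False unfolding mono_on_def
          by (metis linorder_not_less order.order_iff_strict order_less_imp_le)
        moreover have "y < y' \<longleftrightarrow> g y < g y'"
          using g AB False i unfolding mono_on_def
          by (metis linorder_not_less order.order_iff_strict order_less_imp_le)
        ultimately show ?thesis using i by simp
      qed
    qed
    fix \<gamma> assume gb: "\<gamma> < \<beta>"
    show "\<exists>p'. p \<subseteq> p' \<and> C \<subseteq> Domain p' \<and> bf \<gamma> A B p'" if C: "finite C" "C \<subseteq> A" for C
    proof -
      \<comment> \<open>A finite move meets finitely many summands. On those met by neither the move
        nor the position the empty relation is chosen, so that the union of all choices stays
        finite.\<close>
      have "\<exists>q. ?p i \<subseteq> q \<and> C \<inter> ?A i \<subseteq> Domain q \<and> bf \<gamma> (?A i) (?B i) q \<and> (i \<notin> f ` C \<union> f ` Domain p \<longrightarrow> q = {})" for i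
      proof (cases "i \<in> f ` C \<union> f ` Domain p")
        case True
        have "finite (C \<inter> ?A i)" "C \<inter> ?A i \<subseteq> ?A i" using C by auto
        then obtain q where "?p i \<subseteq> q" "C \<inter> ?A i \<subseteq> Domain q" "bf \<gamma> (?A i) (?B i) q"
          by (rule bf_forth[OF less.prems(4)[of i] gb])
        then show ?thesis using True by (intro exI[of _ q]) simp
      next
        case False
        then have "?p i = {}" "C \<inter> ?A i = {}" by auto
        then show ?thesis using bf_empty[OF bf_mono[OF order_less_imp_le[OF gb] less.prems(4)[of i]]] by auto
      qed
      then have "\<exists>q. \<forall>i. ?p i \<subseteq> q i \<and> C \<inter> ?A i \<subseteq> Domain (q i) \<and> bf \<gamma> (?A i) (?B i) (q i) \<and>
          (i \<notin> f ` C \<union> f ` Domain p \<longrightarrow> q i = {})" by (intro choice allI)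
      then obtain q where "\<forall>i. ?p i \<subseteq> q i \<and> C \<inter> ?A i \<subseteq> Domain (q i) \<and> bf \<gamma> (?A i) (?B i) (q i) \<and>
          (i \<notin> f ` C \<union> f ` Domain p \<longrightarrow> q i = {})" ..
      then have q: "\<And>i. ?p i \<subseteq> q i" "\<And>i. C \<inter> ?A i \<subseteq> Domain (q i)" "\<And>i. bf \<gamma> (?A i) (?B i) (q i)"
        "\<And>i. i \<notin> f ` C \<union> f ` Domain p \<Longrightarrow> q i = {}" by simp_all
      have "bf \<gamma> A B (\<Union>i. q i)"
        by (rule ext[OF gb q(3), of "f ` C \<union> f ` Domain p"]) (use q(4) C less.prems(1) in \<open>auto simp: finite_Domain\<close>)
      moreover have "p \<subseteq> (\<Union>i. q i)"
      proof clarify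
        fix x y assume "(x, y) \<in> p"
        then have "(x, y) \<in> q (f x)" using q(1)[of "f x"] by auto
        then show "(x, y) \<in> (\<Union>i. q i)" by (rule UN_I[OF UNIV_I])
      qed
      moreover have "C \<subseteq> Domain (\<Union>i. q i)"
      proof
        fix c assume "c \<in> C" then have "c \<in> C \<inter> ?A (f c)" using C by auto
        then show "c \<in> Domain (\<Union>i. q i)" using q(2)[of "f c"] by blast
      qed
      ultimately show ?thesis by blast
    qed
    show "\<exists>p'. p \<subseteq> p' \<and> D \<subseteq> Range p' \<and> bf \<gamma> A B p'" if D: "finite D" "D \<subseteq> B" for D
    proof -
      have "\<exists>q. ?p i \<subseteq> q \<and> D \<inter> ?B i \<subseteq> Range q \<and> bf \<gamma> (?A i) (?B i) q \<and> (i \<notin> g ` D \<union> f ` Domain p \<longrightarrow> q = {})" for i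
      proof (cases "i \<in> g ` D \<union> f ` Domain p")
        case True
        have "finite (D \<inter> ?B i)" "D \<inter> ?B i \<subseteq> ?B i" using D by auto
        then obtain q where "?p i \<subseteq> q" "D \<inter> ?B i \<subseteq> Range q" "bf \<gamma> (?A i) (?B i) q"
          by (rule bf_back[OF less.prems(4)[of i] gb])
        then show ?thesis using True by (intro exI[of _ q]) simp
      next
        case False
        then have "?p i = {}" "D \<inter> ?B i = {}" by auto
        then show ?thesis using bf_empty[OF bf_mono[OF order_less_imp_le[OF gb] less.prems(4)[of i]]] by auto
      qed
      then have "\<exists>q. \<forall>i. ?p i \<subseteq> q i \<and> D \<inter> ?B i \<subseteq> Range (q i) \<and> bf \<gamma> (?A i) (?B i) (q i) \<and>
          (i \<notin> g ` D \<union> f ` Domain p \<longrightarrow> q i = {})" by (intro choice allI)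
      then obtain q where "\<forall>i. ?p i \<subseteq> q i \<and> D \<inter> ?B i \<subseteq> Range (q i) \<and> bf \<gamma> (?A i) (?B i) (q i) \<and>
          (i \<notin> g ` D \<union> f ` Domain p \<longrightarrow> q i = {})" ..
      then have q: "\<And>i. ?p i \<subseteq> q i" "\<And>i. D \<inter> ?B i \<subseteq> Range (q i)" "\<And>i. bf \<gamma> (?A i) (?B i) (q i)"
        "\<And>i. i \<notin> g ` D \<union> f ` Domain p \<Longrightarrow> q i = {}" by simp_all
      have "bf \<gamma> A B (\<Union>i. q i)"
        by (rule ext[OF gb q(3), of "g ` D \<union> f ` Domain p"]) (use q(4) D less.prems(1) in \<open>auto simp: finite_Domain\<close>)
      moreover have "p \<subseteq> (\<Union>i. q i)"
      proof clarify
        fix x y assume "(x, y) \<in> p"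
        then have "(x, y) \<in> q (f x)" using q(1)[of "f x"] by auto
        then show "(x, y) \<in> (\<Union>i. q i)" by (rule UN_I[OF UNIV_I])
      qed
      moreover have "D \<subseteq> Range (\<Union>i. q i)"
      proof
        fix c assume "c \<in> D" then have "c \<in> D \<inter> ?B (g c)" using D by auto
        then show "c \<in> Range (\<Union>i. q i)" using q(2)[of "g c"] by blast
      qed
      ultimately show ?thesis by blast
    qed
  qed
qed

lemma bf_sum2:
  assumes 1: "bf \<beta> A1 B1 p1" and 2: "bf \<beta> A2 B2 p2"
    and lt: "\<And>x y. x \<in> A1 \<Longrightarrow> y \<in> A2 \<Longrightarrow> x < y" "\<And>x y. x \<in> B1 \<Longrightarrow> y \<in> B2 \<Longrightarrow> x < y"
  shows "bf \<beta> (A1 \<union> A2) (B1 \<union> B2) (p1 \<union> p2)"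
proof -
  define f where "f x = (if x \<in> A1 then 0 else 1 :: nat)" for x
  define g where "g x = (if x \<in> B1 then 0 else 1 :: nat)" for x
  have dA: "x \<notin> A1" if "x \<in> A2" for x using lt(1) that by blast
  have dB: "x \<notin> B1" if "x \<in> B2" for x using lt(2) that by blast
  have s1: "p1 \<subseteq> A1 \<times> B1" and s2: "p2 \<subseteq> A2 \<times> B2" using bf_base(2)[OF 1] bf_base(2)[OF 2] by auto
  show ?thesis
  proof (rule bf_sum[of _ f _ g])
    show "mono_on (A1 \<union> A2) f"
      unfolding mono_on_def f_def using lt(1) by (force simp: not_less)
    show "mono_on (B1 \<union> B2) g"
      unfolding mono_on_def g_def using lt(2) by (force simp: not_less)
    show "finite (p1 \<union> p2)" using bf_base(1)[OF 1] bf_base(1)[OF 2] by simp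
    show "p1 \<union> p2 \<subseteq> (A1 \<union> A2) \<times> (B1 \<union> B2)" using s1 s2 by blast
    show "f x = g y" if "(x, y) \<in> p1 \<union> p2" for x y
      using that s1 s2 dA dB by (auto simp: f_def g_def)
    show "bf \<beta> {x \<in> A1 \<union> A2. f x = i} {y \<in> B1 \<union> B2. g y = i} {(x, y) \<in> p1 \<union> p2. f x = i}" for i
    proof -
      consider "i = 0" | "i = 1" | "i > 1" by force
      then show ?thesis
      proof cases
        case 1
        have "{x \<in> A1 \<union> A2. f x = i} = A1" "{y \<in> B1 \<union> B2. g y = i} = B1" "{(x, y) \<in> p1 \<union> p2. f x = i} = p1"
          using 1 s1 s2 dA by (auto simp: f_def g_def)
        then show ?thesis using \<open>bf \<beta> A1 B1 p1\<close> by simp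
      next
        case 2
        have "{x \<in> A1 \<union> A2. f x = i} = A2" "{y \<in> B1 \<union> B2. g y = i} = B2" "{(x, y) \<in> p1 \<union> p2. f x = i} = p2"
          using 2 s1 s2 dA dB by (auto simp: f_def g_def)
        then show ?thesis using \<open>bf \<beta> A2 B2 p2\<close> by simp
      next
        case 3
        then have "{x \<in> A1 \<union> A2. f x = i} = {}" "{y \<in> B1 \<union> B2. g y = i} = {}" "{(x, y) \<in> p1 \<union> p2. f x = i} = {}"
          by (auto simp: f_def g_def)
        then show ?thesis using bf_refl0[of \<beta> "{}"] by (simp only:)
      qed
    qed
  qed
qed

text \<open>The hypothesis says that \<open>U\<close> and \<open>V\<close> are cut out by the same
  order conditions relative to \<open>p\<close>. It passes to larger positions, so every answer in
  the full game to a move inside \<open>U\<close> or \<open>V\<close> can be restricted to these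
  sets.\<close>

lemma bf_restrict:
  "bf \<beta> A B p \<Longrightarrow> (\<And>x y. x \<in> A \<Longrightarrow> y \<in> B \<Longrightarrow> piso (insert (x, y) p) \<Longrightarrow> x \<in> U \<longleftrightarrow> y \<in> V) \<Longrightarrow>
    bf \<beta> (A \<inter> U) (B \<inter> V) (p \<inter> U \<times> V)"
proof (induction \<beta> arbitrary: p rule: less_induct)
  case (less \<beta>)
  note p = less.prems(1)
  have UV: "x \<in> U \<longleftrightarrow> y \<in> V" if "bf \<gamma> A B q" "p \<subseteq> q" "(x, y) \<in> q" for \<gamma> q x y
    by (rule less.prems(2)) (use that bf_base(2)[OF that(1)] piso_subset[OF bf_base(3)[OF that(1)]] in auto)
  have IH: "bf \<gamma> (A \<inter> U) (B \<inter> V) (q \<inter> U \<times> V)" if g: "\<gamma> < \<beta>" and q: "bf \<gamma> A B q" "p \<subseteq> q" for \<gamma> q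
  proof (rule less.IH[OF g q(1)])
    show "x \<in> U \<longleftrightarrow> y \<in> V" if "x \<in> A" "y \<in> B" "piso (insert (x, y) q)" for x y
      by (rule less.prems(2)[OF that(1,2) piso_subset[OF that(3)]]) (use q in auto)
  qed
  show ?case
  proof (rule bfI)
    show "finite (p \<inter> U \<times> V)" using bf_base(1)[OF p] by simp
    show "p \<inter> U \<times> V \<subseteq> (A \<inter> U) \<times> (B \<inter> V)" using bf_base(2)[OF p] by blast
    show "piso (p \<inter> U \<times> V)" using piso_subset[OF bf_base(3)[OF p]] by blast
    fix \<gamma> assume g: "\<gamma> < \<beta>"
    show "\<exists>p'. p \<inter> U \<times> V \<subseteq> p' \<and> C \<subseteq> Domain p' \<and> bf \<gamma> (A \<inter> U) (B \<inter> V) p'" if C: "finite C" "C \<subseteq> A \<inter> U" for C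
    proof -
      have "C \<subseteq> A" using C(2) by blast
      then obtain q where q: "p \<subseteq> q" "C \<subseteq> Domain q" "bf \<gamma> A B q" by (rule bf_forth[OF p g C(1)])
      have cov: "C \<subseteq> Domain (q \<inter> U \<times> V)"
      proof
        fix c assume "c \<in> C"
        then obtain d where "(c, d) \<in> q" "c \<in> U" using q(2) C(2) by blast
        then show "c \<in> Domain (q \<inter> U \<times> V)" using UV[OF q(3,1)] by blast
      qed
      have "p \<inter> U \<times> V \<subseteq> q \<inter> U \<times> V" using q(1) by blast
      with cov IH[OF g q(3,1)] show ?thesis by (intro exI conjI)
    qed
    show "\<exists>p'. p \<inter> U \<times> V \<subseteq> p' \<and> D \<subseteq> Range p' \<and> bf \<gamma> (A \<inter> U) (B \<inter> V) p'" if D: "finite D" "D \<subseteq> B \<inter> V" for D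
    proof -
      have "D \<subseteq> B" using D(2) by blast
      then obtain q where q: "p \<subseteq> q" "D \<subseteq> Range q" "bf \<gamma> A B q" by (rule bf_back[OF p g D(1)])
      have cov: "D \<subseteq> Range (q \<inter> U \<times> V)"
      proof
        fix d assume "d \<in> D"
        then obtain c where "(c, d) \<in> q" "d \<in> V" using q(2) D(2) by blast
        then show "d \<in> Range (q \<inter> U \<times> V)" using UV[OF q(3,1)] by blast
      qed
      have "p \<inter> U \<times> V \<subseteq> q \<inter> U \<times> V" using q(1) by blast
      with cov IH[OF g q(3,1)] show ?thesis by (intro exI conjI)
    qed
  qed
qed

lemma bf_below:
  assumes "bf \<beta> A B p" "(x, y) \<in> p"
  shows "bf \<beta> (A \<inter> {..<x}) (B \<inter> {..<y}) (p \<inter> {..<x} \<times> {..<y})"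
proof (rule bf_restrict[OF assms(1)])
  show "x' \<in> {..<x} \<longleftrightarrow> y' \<in> {..<y}" if "piso (insert (x', y') p)" for x' y'
    using pisoD[OF that, of x' y' x y] assms(2) by simp
qed

lemma bf_above:
  assumes "bf \<beta> A B p" "(x, y) \<in> p"
  shows "bf \<beta> (A \<inter> {x<..}) (B \<inter> {y<..}) (p \<inter> {x<..} \<times> {y<..})"
proof (rule bf_restrict[OF assms(1)])
  show "x' \<in> {x<..} \<longleftrightarrow> y' \<in> {y<..}" if "piso (insert (x', y') p)" for x' y'
    using pisoD[OF that, of x y x' y'] assms(2) by simp
qed

lemma bf_below0: "bf \<beta> A B p \<Longrightarrow> (x, y) \<in> p \<Longrightarrow> bf \<beta> (A \<inter> {..<x}) (B \<inter> {..<y}) {}"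
  using bf_empty[OF bf_below] .

lemma bf_between0:
  assumes p: "bf \<beta> A B p" "(x, y) \<in> p" "(x', y') \<in> p"
  shows "bf \<beta> (A \<inter> {x<..<x'}) (B \<inter> {y<..<y'}) {}"
proof (rule bf_empty[OF bf_restrict[OF p(1)]])
  show "u \<in> {x<..<x'} \<longleftrightarrow> v \<in> {y<..<y'}" if "piso (insert (u, v) p)" for u v
    using pisoD[OF that, of x y u v] pisoD[OF that, of u v x' y'] p(2,3) by simp
qed

text \<open>Reversal of the order is realised by negation of reals; mirror images of later results
  are obtained through it.\<close>

lemma bf_uminus: 
  "bf \<beta> A B p \<Longrightarrow> bf \<beta> (uminus ` A) (uminus ` B) ((\<lambda>(x, y). (- x, - y)) ` p)"
proof (induction \<beta> arbitrary: p rule: less_induct)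
  case (less \<beta>)
  note p = less.prems
  let ?h = "\<lambda>(x, y). (- x, - y :: real)"
  show ?case
  proof (rule bfI)
    show "finite (?h ` p)" using bf_base(1)[OF p] by simp
    show "?h ` p \<subseteq> uminus ` A \<times> uminus ` B" using bf_base(2)[OF p] by auto
    show "piso (?h ` p)" using bf_base(3)[OF p] unfolding piso_def by fastforce
    fix \<gamma> assume g: "\<gamma> < \<beta>"
    show "\<exists>p'. ?h ` p \<subseteq> p' \<and> C \<subseteq> Domain p' \<and> bf \<gamma> (uminus ` A) (uminus ` B) p'" if C: "finite C" "C \<subseteq> uminus ` A" for C
    proof -
      have "finite (uminus ` C)" "uminus ` C \<subseteq> A" using C by auto
      then obtain q where q: "p \<subseteq> q" "uminus ` C \<subseteq> Domain q" "bf \<gamma> A B q" by (rule bf_forth[OF p g])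
      have "C \<subseteq> Domain (?h ` q)"
      proof
        fix c assume "c \<in> C" then obtain d where "(- c, d) \<in> q" using q(2) by blast
        then show "c \<in> Domain (?h ` q)" by (force intro!: DomainI)
      qed
      then show ?thesis using less.IH[OF g q(3)] q(1) by (intro exI[of _ "?h ` q"]) auto
    qed
    show "\<exists>p'. ?h ` p \<subseteq> p' \<and> D \<subseteq> Range p' \<and> bf \<gamma> (uminus ` A) (uminus ` B) p'" if D: "finite D" "D \<subseteq> uminus ` B" for D
    proof -
      have "finite (uminus ` D)" "uminus ` D \<subseteq> B" using D by auto
      then obtain q where q: "p \<subseteq> q" "uminus ` D \<subseteq> Range q" "bf \<gamma> A B q" by (rule bf_back[OF p g])
      have "D \<subseteq> Range (?h ` q)"
      proof
        fix c assume "c \<in> D" then obtain d where "(d, - c) \<in> q" using q(2) by blast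
        then show "c \<in> Range (?h ` q)" by (force intro!: RangeI)
      qed
      then show ?thesis using less.IH[OF g q(3)] q(1) by (intro exI[of _ "?h ` q"]) auto
    qed
  qed
qed

lemma bf_uminus0: "bf \<beta> A B {} \<Longrightarrow> bf \<beta> (uminus ` A) (uminus ` B) {}"
  using bf_uminus[of \<beta> A B "{}"] by simp

lemma oiso_uminus: "oiso f A B \<Longrightarrow> oiso (\<lambda>x. - f (- x)) (uminus ` A) (uminus ` B)"
  unfolding oiso_def strict_mono_on_def by (auto simp: image_comp image_iff)

lemma isom_uminus: "isom A B \<Longrightarrow> isom (uminus ` A) (uminus ` B)"
  unfolding isom_def using oiso_uminus by blast

section \<open>Absorption in sums of linear orders\<close>

text \<open>The map \<open>\<theta>\<close> pushes the initial segment \<open>V\<close> onto its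
  part above \<open>v\<close>, and the identity is used on the rest of \<open>X\<close>.\<close>

lemma isom_shift:
  assumes V: "V \<subseteq> X" "\<And>x y. x \<in> V \<Longrightarrow> y \<in> X \<Longrightarrow> y \<le> x \<Longrightarrow> y \<in> V" "v \<in> V"
    and th: "strict_mono_on V \<theta>" "\<theta> ` V = V \<inter> {v<..}"
  shows "isom X (X \<inter> {v<..})"
proof -
  have lt: "x < y" if "x \<in> V" "y \<in> X - V" for x y
    using V(2)[of x y] that by force
  have "oiso \<theta> V (V \<inter> {v<..})" using th by (simp add: oiso_def)
  from oiso_glue2[OF this oiso_refl[of "X - V"]] lt
  have "isom (V \<union> (X - V)) (V \<inter> {v<..} \<union> (X - V))" by (auto simp: isom_def)
  moreover have "V \<union> (X - V) = X" using V(1) by blast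
  moreover have "V \<inter> {v<..} \<union> (X - V) = X \<inter> {v<..}" using V(1) lt[OF V(3)] by auto
  ultimately show ?thesis by simp
qed

lemma oiso_max:
  assumes "oiso f (A \<inter> {..x}) (B \<inter> {..y})" "x \<in> A" "y \<in> B"
  shows "f x = y"
proof -
  have "f x \<le> y" using assms by (auto simp: oiso_def)
  have "y \<in> f ` (A \<inter> {..x})" using assms by (simp add: oiso_def)
  then obtain s where s: "s \<in> A \<inter> {..x}" "f s = y" by blast
  then have "y \<le> f x"
    using strict_mono_on_le_iff[of "A \<inter> {..x}" f s x] assms by (auto simp: oiso_def)
  with \<open>f x \<le> y\<close> show ?thesis by simp
qed

text \<open>
  Let \<open>D\<close> be the part of \<open>X\<close> up to \<open>v\<close> and \<open>T\<close> the rest, so that \<open>X = D + T\<close>. Put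
  \<open>W j = {z \<in> T. T \<inter> {..z} \<cong> D + \<dots> + D}\<close> (\<open>j\<close> summands). If some isomorphism from \<open>X \<inter> {..w}\<close> onto an initial
  segment of \<open>T\<close> does not move \<open>w\<close> up, its iterates shift \<open>X\<close> onto \<open>T\<close>; otherwise the levels \<open>W j\<close> follow
  each other, and either they are bounded and again one map shifts them, or \<open>T = D + D + \<dots>\<close>.
\<close>

lemma isom_absorb_tail:
  fixes X :: "real set"
  assumes v: "v \<in> X" and ne: "X \<inter> {v<..} \<noteq> {}"
    and hyp: "\<And>w. w \<in> X \<Longrightarrow> v < w \<Longrightarrow> \<exists>z\<in>X. v < z \<and> isom (X \<inter> {..w}) (X \<inter> {v<..z})"
  shows "isom X (X \<inter> {v<..})"
proof (rule ccontr)
  assume contr: "\<not> ?thesis"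
  define T where "T = X \<inter> {v<..}"
  have Tz: "T \<inter> {..z} = X \<inter> {v<..z}" for z by (auto simp: T_def)
  have hypT: "\<exists>z\<in>T. \<exists>\<theta>. oiso \<theta> (X \<inter> {..w}) (T \<inter> {..z})" if "w \<in> T" for w
    using hyp[of w] that by (auto simp: T_def Tz[unfolded T_def] isom_def)
  have no_absorb: False
    if th: "oiso \<theta> (X \<inter> {..w}) (T \<inter> {..z})" and w: "w \<in> X" "v \<le> w" and z: "z \<in> T" "z \<le> w" for \<theta> w z
  proof -
    have m: "strict_mono_on (X \<inter> {..w}) \<theta>" and im: "\<theta> ` (X \<inter> {..w}) = T \<inter> {..z}"
      using th by (auto simp: oiso_def)
    have it: "(\<theta> ^^ k) v \<in> X \<inter> {..w}" for k
    proof (induction k)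
      case (Suc k)
      then have "(\<theta> ^^ Suc k) v \<in> T \<inter> {..z}" using im by auto
      then show ?case using z by (auto simp: T_def)
    qed (use v w in simp)
    \<comment> \<open>The initial segment generated by the orbit of \<open>v\<close>. The orbit
      never leaves the domain of \<open>\<theta>\<close>, because images stay below
      \<open>z \<le> w\<close>.\<close>
    define V where "V = {x\<in>X. \<exists>k. x \<le> (\<theta> ^^ k) v}"
    have Ow: "V \<subseteq> X \<inter> {..w}"
    proof
      fix x assume "x \<in> V"
      then obtain k where "x \<in> X" "x \<le> (\<theta> ^^ k) v" by (auto simp: V_def)
      then show "x \<in> X \<inter> {..w}" using it[of k] by auto
    qed
    have "isom X (X \<inter> {v<..})"
    proof (rule isom_shift[of V])
      show "V \<subseteq> X" by (auto simp: V_def)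
      show "y \<in> V" if "x \<in> V" "y \<in> X" "y \<le> x" for x y using that by (auto simp: V_def intro: order_trans)
      show "v \<in> V" using v by (auto simp: V_def intro: exI[of _ 0])
      show "strict_mono_on V \<theta>" using m Ow by (rule strict_mono_on_subset)
      show "\<theta> ` V = V \<inter> {v<..}"
      proof
        show "\<theta> ` V \<subseteq> V \<inter> {v<..}"
        proof
          fix y assume "y \<in> \<theta> ` V"
          then obtain x k where x: "x \<in> V" "y = \<theta> x" "x \<le> (\<theta> ^^ k) v" by (auto simp: V_def)
          then have "\<theta> x \<in> T" using im Ow by auto
          moreover have "\<theta> x \<le> \<theta> ((\<theta> ^^ k) v)"
            using strict_mono_on_le_iff[OF m] it x Ow by (metis subsetD)
          ultimately show "y \<in> V \<inter> {v<..}" using x unfolding V_def T_def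
            by (auto intro!: exI[of _ "Suc k"])
        qed
        show "V \<inter> {v<..} \<subseteq> \<theta> ` V"
        proof
          fix t assume t: "t \<in> V \<inter> {v<..}"
          then obtain k where k: "t \<le> (\<theta> ^^ k) v" "t \<in> X" by (auto simp: V_def)
          then obtain k' where k': "k = Suc k'" using t by (cases k) auto
          have "\<theta> ((\<theta> ^^ k') v) \<le> z" using it[of k'] im by auto
          then have "t \<in> T \<inter> {..z}" using k k' t by (auto simp: T_def)
          then obtain s where s: "s \<in> X \<inter> {..w}" "t = \<theta> s" using im by auto
          have "s \<le> (\<theta> ^^ k') v"
            using strict_mono_on_le_iff[OF m s(1) it[of k']] k(1) k' s(2) by simp
          then show "t \<in> \<theta> ` V" using s by (auto simp: V_def)
        qed
      qed
    qed
    then show False using contr by simp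
  qed
  define W where "W = rec_nat {v} (\<lambda>_ S. {z\<in>T. \<exists>w\<in>S. isom (X \<inter> {..w}) (T \<inter> {..z})})"
  have W0: "W 0 = {v}" and WS: "W (Suc j) = {z\<in>T. \<exists>w\<in>W j. isom (X \<inter> {..w}) (T \<inter> {..z})}" for j
    by (simp_all add: W_def)
  have WX: "w \<in> X" "v \<le> w" if "w \<in> W j" for w j
    using that v by (cases j; auto simp: W0 WS T_def)+
  have glueX: "isom (X \<inter> {..a}) (X \<inter> {..b})" if ab: "isom (T \<inter> {..a}) (T \<inter> {..b})" "a \<in> T" "b \<in> T" for a b
  proof -
    obtain f where f: "oiso f (T \<inter> {..a}) (T \<inter> {..b})" using ab(1) unfolding isom_def by blast
    have "isom (X \<inter> {..v} \<union> T \<inter> {..a}) (X \<inter> {..v} \<union> T \<inter> {..b})"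
      by (rule oiso_isom, rule oiso_glue2[OF oiso_refl f]) (auto simp: T_def)
    moreover have "X \<inter> {..v} \<union> T \<inter> {..c} = X \<inter> {..c}" if "c \<in> T" for c using that by (auto simp: T_def)
    ultimately show ?thesis using ab by simp
  qed
  have Wiso: "isom (X \<inter> {..w}) (X \<inter> {..w'})" if "w \<in> W j" "w' \<in> W j" for w w' j
    using that
  proof (induction j arbitrary: w w')
    case (Suc j)
    then show ?case by (auto simp: WS intro!: glueX) (meson isom_sym isom_trans)
  qed (auto simp: W0 isom_refl)
  have WisoT: "isom (T \<inter> {..w}) (T \<inter> {..w'})" if "w \<in> W (Suc j)" "w' \<in> W (Suc j)" for w w' j
    using that Wiso[of _ j] unfolding WS by (auto) (meson isom_sym isom_trans)
  have Wclosed: "\<theta> w \<in> W (Suc j)"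
    if th: "oiso \<theta> (X \<inter> {..w0}) (T \<inter> {..z0})" and w: "w \<in> W j" "w \<le> w0" for \<theta> w w0 z0 j
  proof -
    have wX: "w \<in> X \<inter> {..w0}" using w WX by auto
    have tw: "\<theta> w \<in> T \<inter> {..z0}" using th wX by (auto simp: oiso_def)
    have "oiso \<theta> (X \<inter> {..w0} \<inter> {..w}) (T \<inter> {..z0} \<inter> {..\<theta> w})" by (rule oiso_atMost[OF th wX])
    moreover have "X \<inter> {..w0} \<inter> {..w} = X \<inter> {..w}" using w by auto
    moreover have "T \<inter> {..z0} \<inter> {..\<theta> w} = T \<inter> {..\<theta> w}" using tw by auto
    ultimately show ?thesis using w(1) tw by (auto simp: WS isom_def)
  qed
  have Wne: "W j \<noteq> {}" for j
  proof (induction j)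
    case (Suc j)
    then obtain w where w: "w \<in> W j" by auto
    obtain t where "t \<in> T" "w \<le> t"
    proof (cases "w \<in> T")
      case False
      then have "w = v" using WX[OF w] by (auto simp: T_def)
      then show thesis using that ne by (force simp: T_def)
    qed (use that in auto)
    then show ?case using hypT[of t] Wclosed[OF _ w] by blast
  qed (simp add: W0)
  have lt1: "w < z" if w: "w \<in> W i" and z: "z \<in> W (Suc i)" for w z i
  proof (rule ccontr)
    assume "\<not> w < z"
    then have "z \<le> w" by simp
    obtain u where u: "u \<in> W i" "isom (X \<inter> {..u}) (T \<inter> {..z})" and zT: "z \<in> T" using z by (auto simp: WS)
    then obtain \<theta> where "oiso \<theta> (X \<inter> {..w}) (T \<inter> {..z})"
      using isom_trans[OF Wiso[OF w u(1)] u(2)] by (auto simp: isom_def)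
    then show False using no_absorb WX[OF w] zT \<open>z \<le> w\<close> by blast
  qed
  have lt: "w < z" if "w \<in> W i" "z \<in> W j" "i < j" for w z i j
    using that
  proof (induction j arbitrary: z)
    case (Suc j)
    obtain u where u: "u \<in> W j" using Wne by blast
    show ?case
    proof (cases "i = j")
      case False
      then have "w < u" using Suc u by simp
      also have "u < z" using lt1[OF u Suc.prems(2)] .
      finally show ?thesis .
    qed (use lt1 Suc in auto)
  qed simp
  have cof: "\<exists>k. \<exists>w\<in>W k. t < w" if t: "t \<in> T" for t
  proof (rule ccontr)
    assume "\<not> ?thesis"
    then have bd: "w \<le> t" if "w \<in> W k" for w k using that by force
    obtain z \<theta> where th: "oiso \<theta> (X \<inter> {..t}) (T \<inter> {..z})" using hypT[OF t] by blast
    have m: "strict_mono_on (X \<inter> {..t}) \<theta>" and im: "\<theta> ` (X \<inter> {..t}) = T \<inter> {..z}"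
      using th by (auto simp: oiso_def)
    define V where "V = {x\<in>X. \<exists>k. \<exists>w\<in>W k. x \<le> w}"
    have Ot: "V \<subseteq> X \<inter> {..t}" using bd by (force simp: V_def)
    have "isom X (X \<inter> {v<..})"
    proof (rule isom_shift[of V])
      show "V \<subseteq> X" by (auto simp: V_def)
      show "y \<in> V" if "x \<in> V" "y \<in> X" "y \<le> x" for x y using that by (auto simp: V_def intro: order_trans)
      show "v \<in> V" using v by (auto simp: V_def W0 intro!: exI[of _ 0])
      show "strict_mono_on V \<theta>" using m Ot by (rule strict_mono_on_subset)
      show "\<theta> ` V = V \<inter> {v<..}"
      proof
        show "\<theta> ` V \<subseteq> V \<inter> {v<..}"
        proof
          fix y assume "y \<in> \<theta> ` V"
          then obtain x where x0: "x \<in> V" "y = \<theta> x" by blast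
          then obtain k w where x: "x \<in> V" "y = \<theta> x" "w \<in> W k" "x \<le> w" unfolding V_def by blast
          then have "\<theta> x \<in> T" using im Ot by auto
          moreover have "\<theta> x \<le> \<theta> w"
            using strict_mono_on_le_iff[OF m, of x w] x Ot bd[OF x(3)] WX[OF x(3)] by auto
          moreover have "\<theta> w \<in> W (Suc k)" using Wclosed[OF th x(3) bd[OF x(3)]] .
          ultimately show "y \<in> V \<inter> {v<..}" using x(2) unfolding V_def T_def by auto
        qed
        show "V \<inter> {v<..} \<subseteq> \<theta> ` V"
        proof
          fix y assume y: "y \<in> V \<inter> {v<..}"
          then obtain k w where k: "w \<in> W k" "y \<le> w" "y \<in> X" by (auto simp: V_def)
          have w': "\<theta> w \<in> W (Suc k)" using Wclosed[OF th k(1) bd[OF k(1)]] .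
          have wX: "w \<in> X \<inter> {..t}" using WX[OF k(1)] bd[OF k(1)] by auto
          have "y < \<theta> w" using lt1[OF k(1) w'] k(2) by simp
          moreover have "\<theta> w \<le> z" using im wX by auto
          ultimately have "y \<in> T \<inter> {..z}" using k y by (auto simp: T_def)
          then obtain s where s: "s \<in> X \<inter> {..t}" "y = \<theta> s" using im by auto
          have "s < w" using strict_mono_on_less_iff[OF m s(1) wX] \<open>y < \<theta> w\<close> s(2) by simp
          then have "s \<in> V" using s(1) k(1) unfolding V_def by (auto intro!: exI[of _ k] bexI[of _ w])
          then show "y \<in> \<theta> ` V" using s(2) by blast
        qed
      qed
    qed
    then show False using contr by simp
  qed
  define D where "D = X \<inter> {..v}"
  \<comment> \<open>A point of level \<open>Suc i\<close> ends a copy of \<open>D\<close> that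
    begins right after a point of level i: the map witnessing the level carries such a copy one
    level up.\<close>
  have Q: "\<exists>a\<in>W i. isom D (X \<inter> {a<..c})" if "c \<in> W (Suc i)" for c i
    using that
  proof (induction i arbitrary: c)
    case 0
    then show ?case by (auto simp: W0 WS D_def Tz)
  next
    case (Suc i)
    from Suc.prems obtain u where u: "u \<in> W (Suc i)" "isom (X \<inter> {..u}) (T \<inter> {..c})" and c: "c \<in> T"
      unfolding WS[of "Suc i"] by auto
    obtain \<theta> where th: "oiso \<theta> (X \<inter> {..u}) (T \<inter> {..c})" using u(2) by (auto simp: isom_def)
    obtain a where a: "a \<in> W i" "isom D (X \<inter> {a<..u})" using Suc.IH[OF u(1)] by blast
    have au: "a < u" using lt1[OF a(1) u(1)] .
    have tu: "\<theta> u = c" using oiso_max[OF th _ c] WX[OF u(1)] by simp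
    have ta: "\<theta> a \<in> W (Suc i)" using Wclosed[OF th a(1)] au by simp
    have "oiso \<theta> (X \<inter> {..u} \<inter> {a<..u}) (T \<inter> {..c} \<inter> {\<theta> a<..\<theta> u})"
      by (rule oiso_between'[OF th]) (use WX[OF a(1)] WX[OF u(1)] au in auto)
    moreover have "X \<inter> {..u} \<inter> {a<..u} = X \<inter> {a<..u}" by auto
    moreover have "T \<inter> {..c} \<inter> {\<theta> a<..\<theta> u} = X \<inter> {\<theta> a<..c}"
      using WX[OF ta] tu by (auto simp: T_def)
    ultimately show ?case using ta isom_trans[OF a(2) oiso_isom] by metis
  qed
  \<comment> \<open>Iterating an isomorphism from the segment up to \<open>c'\<close> onto the one
    up to \<open>c\<close> gives a decreasing sequence \<open>e\<close> of points of the same level,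
    all above \<open>a\<close>. Keeping the points below all \<open>e k\<close> fixed and shifting
    the others matches the two intervals.\<close>
  have adj: "isom (X \<inter> {a<..c'}) (X \<inter> {a<..c})"
    if a: "a \<in> W i" and c: "c \<in> W (Suc i)" "c' \<in> W (Suc i)" "c < c'" for a c c' i
  proof -
    have cT: "c \<in> T" "c' \<in> T" using c by (auto simp: WS)
    obtain \<psi> where ps: "oiso \<psi> (T \<inter> {..c'}) (T \<inter> {..c})" using WisoT[OF c(2,1)] by (auto simp: isom_def)
    have m: "strict_mono_on (T \<inter> {..c'}) \<psi>" and im: "\<psi> ` (T \<inter> {..c'}) = T \<inter> {..c}"
      using ps by (auto simp: oiso_def)
    define e where "e k = (\<psi> ^^ k) c'" for k
    have eS: "e (Suc k) = \<psi> (e k)" for k by (simp add: e_def)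
    have e1: "e (Suc 0) = c" using oiso_max[OF ps cT(2,1)] by (simp add: e_def)
    have e: "e k \<in> T \<inter> {..c'} \<and> e k \<in> W (Suc i)" for k
    proof (induction k)
      case (Suc k)
      have "e (Suc k) \<in> T \<inter> {..c}" using im Suc eS by auto
      moreover have "oiso \<psi> (T \<inter> {..c'} \<inter> {..e k}) (T \<inter> {..c} \<inter> {..e (Suc k)})"
        using oiso_atMost[OF ps] Suc eS by simp
      moreover have "T \<inter> {..c'} \<inter> {..e k} = T \<inter> {..e k}" using Suc by auto
      moreover have "T \<inter> {..c} \<inter> {..e (Suc k)} = T \<inter> {..e (Suc k)}" using calculation(1) by auto
      ultimately have "isom (T \<inter> {..e k}) (T \<inter> {..e (Suc k)})" "e (Suc k) \<in> T" "e (Suc k) \<le> c"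
        using oiso_isom by auto
      moreover obtain u where "u \<in> W i" "isom (X \<inter> {..u}) (T \<inter> {..e k})" using Suc by (auto simp: WS)
      ultimately show ?case using c(3) isom_trans by (auto simp: WS)
    qed (use cT c in \<open>auto simp: e_def\<close>)
    have edec: "e (Suc k) < e k" for k
    proof (induction k)
      case (Suc k)
      then show ?case using strict_mono_on_less_iff[OF m] e eS by metis
    qed (use e1 c in \<open>simp add: e_def\<close>)
    have ae: "a < e k" for k using lt1[OF a] e by blast
    define L where "L = {x\<in>X. a < x \<and> (\<forall>k. x \<le> e k)}"
    define V where "V = {x\<in>T \<inter> {..c'}. \<exists>k. e k < x}"
    have imO: "\<psi> ` V = V \<inter> {..c}"
    proof
      show "\<psi> ` V \<subseteq> V \<inter> {..c}"
      proof
        fix y assume "y \<in> \<psi> ` V"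
        then obtain x k where x: "x \<in> T \<inter> {..c'}" "e k < x" "y = \<psi> x" by (auto simp: V_def)
        have "y \<in> T \<inter> {..c}" using im x by auto
        moreover have "e (Suc k) < y" using strict_mono_on_less_iff[OF m] e x eS by metis
        ultimately show "y \<in> V \<inter> {..c}" using c(3) by (auto simp: V_def)
      qed
      show "V \<inter> {..c} \<subseteq> \<psi> ` V"
      proof
        fix y assume y: "y \<in> V \<inter> {..c}"
        then obtain k where k: "e k < y" "y \<in> T \<inter> {..c}" by (auto simp: V_def)
        then obtain s where s: "s \<in> T \<inter> {..c'}" "y = \<psi> s" using im by blast
        have "\<psi> (e k) < \<psi> s" using edec[of k] eS k s by simp
        then have "e k < s" using strict_mono_on_less_iff[OF m] e s by metis
        then show "y \<in> \<psi> ` V" using s by (auto simp: V_def)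
      qed
    qed
    have oi: "oiso \<psi> V (V \<inter> {..c})"
      using strict_mono_on_subset[OF m, of V] imO by (auto simp: oiso_def V_def)
    have iso0: "isom (L \<union> V) (L \<union> V \<inter> {..c})"
      by (rule oiso_isom, rule oiso_glue2[OF oiso_refl oi]) (auto simp: L_def V_def intro: order.strict_trans1)
    have LO: "x \<in> L \<union> V \<longleftrightarrow> x \<in> X \<inter> {a<..c'}" for x
    proof
      assume "x \<in> L \<union> V"
      then show "x \<in> X \<inter> {a<..c'}"
      proof
        assume "x \<in> L"
        then show ?thesis using e[of 0] by (auto simp: L_def e_def dest: spec[of _ 0])
      next
        assume "x \<in> V"
        then obtain k where "x \<in> T \<inter> {..c'}" "e k < x" by (auto simp: V_def)
        then show ?thesis using ae[of k] by (auto simp: T_def)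
      qed
    next
      assume x: "x \<in> X \<inter> {a<..c'}"
      show "x \<in> L \<union> V"
      proof (cases "\<exists>k. e k < x")
        case True
        then show ?thesis using x WX[OF a] by (auto simp: V_def T_def)
      next
        case False
        then show ?thesis using x by (auto simp: L_def not_less)
      qed
    qed
    have LO': "L \<union> V = X \<inter> {a<..c'}" by (rule set_eqI) (rule LO)
    moreover have "L \<union> V \<inter> {..c} = X \<inter> {a<..c}"
    proof -
      have Lc: "x \<le> c" if "x \<in> L" for x using that e1 by (metis (mono_tags, lifting) L_def mem_Collect_eq)
      have "L \<union> V \<inter> {..c} = (L \<union> V) \<inter> {..c}" by (rule set_eqI) (use Lc in blast)
      also have "\<dots> = X \<inter> {a<..c}" unfolding LO' using c(3) by auto
      finally show ?thesis .
    qed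
    ultimately show ?thesis using iso0 by simp
  qed
  have full: "\<exists>a\<in>W i. \<forall>c\<in>W (Suc i). isom D (X \<inter> {a<..c})" for i
  proof -
    obtain c0 where c0: "c0 \<in> W (Suc i)" using Wne by blast
    obtain a where a: "a \<in> W i" "isom D (X \<inter> {a<..c0})" using Q[OF c0] by blast
    have "isom D (X \<inter> {a<..c})" if c: "c \<in> W (Suc i)" for c
    proof -
      consider "c = c0" | "c < c0" | "c0 < c" by linarith
      then show ?thesis
        using a(2) adj[OF a(1) c c0] adj[OF a(1) c0 c] by cases (auto intro: isom_trans isom_sym)
    qed
    then show ?thesis using a(1) by blast
  qed
  then obtain a where a: "\<And>i. a i \<in> W i" "\<And>i c. c \<in> W (Suc i) \<Longrightarrow> isom D (X \<inter> {a i<..c})" by metis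
  have a0: "a 0 = v" using a(1)[of 0] by (simp add: W0)
  have amono: "a i < a j" if "i < j" for i j using lt[OF a(1) a(1) that] .
  have acof: "\<exists>i. x \<le> a i" if "x \<in> X" for x
  proof (cases "x \<in> T")
    case True
    then obtain k w where "w \<in> W k" "x < w" using cof by blast
    then show ?thesis using lt1[OF _ a(1)[of "Suc k"]] by (meson less_trans order_less_imp_le)
  next
    case False
    then show ?thesis using that a0 by (auto simp: T_def intro!: exI[of _ 0])
  qed
  have acofS: "\<exists>i. x \<le> a (Suc i)" if "x \<in> X" for x
    using acof[OF that] amono[of _ "Suc _"] by (meson less_imp_le lessI order_trans)
  \<comment> \<open>For \<open>f\<close> piece 0 is the part up to \<open>v\<close> and piece 1 is
    \<open>(a 0, a 1]\<close>, while for \<open>g\<close> piece 0 is already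
    \<open>(a 0, a 1]\<close>. All these pieces are copies of \<open>D\<close>, so equal numbers can
    be matched.\<close>
  define f where "f x = (LEAST i. x \<le> a i)" for x
  define g where "g x = (LEAST i. x \<le> a (Suc i))" for x
  have f_iff: "f x = Suc i \<longleftrightarrow> a i < x \<and> x \<le> a (Suc i)" if "x \<in> X" for x i
  proof
    assume fx: "f x = Suc i"
    have "x \<le> a (f x)" unfolding f_def by (rule LeastI_ex[OF acof[OF that]])
    moreover have "\<not> x \<le> a i" using not_less_Least[of i "\<lambda>i. x \<le> a i"] fx by (simp add: f_def)
    ultimately show "a i < x \<and> x \<le> a (Suc i)" using fx by simp
  next
    assume x: "a i < x \<and> x \<le> a (Suc i)"
    show "f x = Suc i" unfolding f_def
    proof (rule Least_equality)
      show "Suc i \<le> j" if "x \<le> a j" for j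
        using amono[of j i] x that by (metis Suc_leI le_less_linear less_le_trans less_trans not_less_iff_gr_or_eq)
    qed (use x in simp)
  qed
  have f0: "f x = 0 \<longleftrightarrow> x \<le> v" if "x \<in> X" for x
  proof -
    have "x \<le> a (f x)" unfolding f_def by (rule LeastI_ex[OF acof[OF that]])
    moreover have "f x \<le> 0" if "x \<le> a 0" unfolding f_def by (rule Least_le) (rule that)
    ultimately show ?thesis using a0 by auto
  qed
  have g_iff: "g x = i \<longleftrightarrow> a i < x \<and> x \<le> a (Suc i)" if "x \<in> T" for x i
  proof -
    have x: "x \<in> X" "\<not> x \<le> v" using that by (auto simp: T_def)
    obtain j where j: "f x = Suc j" using f0[OF x(1)] x(2) by (cases "f x") auto
    have "g x = j" unfolding g_def
    proof (rule Least_equality)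
      show "x \<le> a (Suc j)" using f_iff[OF x(1)] j by blast
      show "j \<le> k" if "x \<le> a (Suc k)" for k
        using Least_le[of "\<lambda>i. x \<le> a i" "Suc k", OF that] j by (simp add: f_def)
    qed
    then show ?thesis using f_iff[OF x(1)] j by auto
  qed
  have "isom X T"
  proof (rule isom_glue[of X f T g])
    show "mono_on X f"
    proof (rule mono_onI)
      fix r s assume "r \<in> X" "s \<in> X" "r \<le> s"
      then show "f r \<le> f s" unfolding f_def by (intro Least_le) (meson LeastI_ex acof order_trans)
    qed
    show "mono_on T g"
    proof (rule mono_onI)
      fix r s assume "r \<in> T" "s \<in> T" "r \<le> s"
      then show "g r \<le> g s" unfolding g_def T_def by (intro Least_le) (meson IntD1 LeastI_ex acofS order_trans)
    qed
    fix i
    have gi: "{y\<in>T. g y = i} = X \<inter> {a i<..a (Suc i)}" for i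
      using g_iff amono[of 0 i] a0 by (cases i) (auto simp: T_def)
    show "isom {x\<in>X. f x = i} {y\<in>T. g y = i}"
    proof (cases i)
      case 0
      have "{x\<in>X. f x = i} = D" using f0 0 by (auto simp: D_def)
      then show ?thesis using gi a(2)[OF a(1)] 0 by simp
    next
      case (Suc j)
      have "{x\<in>X. f x = i} = X \<inter> {a j<..a (Suc j)}" using f_iff Suc by auto
      then show ?thesis using gi a(2)[OF a(1), of j] a(2)[OF a(1), of i] Suc isom_trans isom_sym by metis
    qed
  qed
  then show False using contr by (simp add: T_def)
qed

text \<open>The tail above the lower of the two points absorbs the segment between them by
  \<open>isom_absorb_tail\<close>.\<close>

lemma isom_tails:
  fixes A :: "real set"
  assumes uv: "u \<in> A" "v \<in> A" and nomax: "\<And>x. x \<in> A \<Longrightarrow> \<exists>y\<in>A. x < y"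
    and 1: "\<And>w. w \<in> A \<Longrightarrow> u < w \<Longrightarrow> \<exists>z\<in>A. v < z \<and> isom (A \<inter> {u<..w}) (A \<inter> {v<..z})"
    and 2: "\<And>w. w \<in> A \<Longrightarrow> v < w \<Longrightarrow> \<exists>z\<in>A. u < z \<and> isom (A \<inter> {v<..w}) (A \<inter> {u<..z})"
  shows "isom (A \<inter> {u<..}) (A \<inter> {v<..})"
proof -
  have main: "isom (A \<inter> {u<..}) (A \<inter> {v<..})" if uv: "u < v" "v \<in> A"
    and 1: "\<And>w. w \<in> A \<Longrightarrow> u < w \<Longrightarrow> \<exists>z\<in>A. v < z \<and> isom (A \<inter> {u<..w}) (A \<inter> {v<..z})" for u v
  proof -
    let ?X = "A \<inter> {u<..}"
    have e: "?X \<inter> {v<..} = A \<inter> {v<..}" "?X \<inter> {..w} = A \<inter> {u<..w}" "?X \<inter> {v<..z} = A \<inter> {v<..z}" for w z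
      using uv by auto
    have "isom ?X (?X \<inter> {v<..})"
    proof (rule isom_absorb_tail)
      show "v \<in> ?X" using uv by simp
      show "?X \<inter> {v<..} \<noteq> {}" using nomax[OF uv(2)] by (auto simp: e)
      show "\<exists>z\<in>?X. v < z \<and> isom (?X \<inter> {..w}) (?X \<inter> {v<..z})" if "w \<in> ?X" "v < w" for w
        using 1[of w] that uv by (force simp: e)
    qed
    then show ?thesis by (simp add: e)
  qed
  consider "u = v" | "u < v" | "v < u" by linarith
  then show ?thesis
    using main[OF _ uv(2) 1] main[OF _ uv(1) 2] by cases (auto simp: isom_refl intro: isom_sym)
qed

text \<open>Cantor's argument: stage n brings the n-th elements of both orders into the position,
  starting from \<open>p0\<close>, so the isomorphism in the limit extends
  \<open>p0\<close>.\<close>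

lemma bf_back_forth_oiso:
  assumes cA: "countable A" and cB: "countable B" and p0: "p0 \<in> F"
    and base: "\<And>p. p \<in> F \<Longrightarrow> p \<subseteq> A \<times> B \<and> piso p"
    and forth: "\<And>p x. p \<in> F \<Longrightarrow> x \<in> A \<Longrightarrow> \<exists>q\<in>F. p \<subseteq> q \<and> x \<in> Domain q"
    and backw: "\<And>p y. p \<in> F \<Longrightarrow> y \<in> B \<Longrightarrow> \<exists>q\<in>F. p \<subseteq> q \<and> y \<in> Range q"
  shows "\<exists>f. oiso f A B \<and> p0 \<subseteq> gr f A"
proof -
  \<comment> \<open>The membership guards matter for an empty order, where
    \<open>from_nat_into\<close> returns an arbitrary value.\<close>
  have "\<exists>P. P 0 = p0 \<and> (\<forall>n::nat. P n \<in> F \<and> P n \<subseteq> P (Suc n) \<and>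
     (from_nat_into A n \<in> A \<longrightarrow> from_nat_into A n \<in> Domain (P (Suc n))) \<and>
     (from_nat_into B n \<in> B \<longrightarrow> from_nat_into B n \<in> Range (P (Suc n))))"
  proof -
    have "\<exists>P. \<forall>n::nat. (P n \<in> F \<and> (n = 0 \<longrightarrow> P n = p0)) \<and> (P n \<subseteq> P (Suc n) \<and>
     (from_nat_into A n \<in> A \<longrightarrow> from_nat_into A n \<in> Domain (P (Suc n))) \<and>
     (from_nat_into B n \<in> B \<longrightarrow> from_nat_into B n \<in> Range (P (Suc n))))"
    proof (rule dependent_nat_choice)
      show "\<exists>x. x \<in> F \<and> (0 = (0::nat) \<longrightarrow> x = p0)" using p0 by blast
      fix p and n :: nat assume p: "p \<in> F \<and> (n = 0 \<longrightarrow> p = p0)"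
      have pF: "p \<in> F" using p by simp
      obtain q where q: "q \<in> F" "p \<subseteq> q" "from_nat_into A n \<in> A \<longrightarrow> from_nat_into A n \<in> Domain q"
      proof (cases "from_nat_into A n \<in> A")
        case True
        then show thesis using forth[OF pF True] that by blast
      next
        case False
        then show thesis by (intro that[OF pF]) auto
      qed
      obtain r where r: "r \<in> F" "q \<subseteq> r" "from_nat_into B n \<in> B \<longrightarrow> from_nat_into B n \<in> Range r"
      proof (cases "from_nat_into B n \<in> B")
        case True
        then show thesis using backw[OF q(1) True] that by blast
      next
        case False
        then show thesis by (intro that[OF q(1)]) auto
      qed
      have "from_nat_into A n \<in> A \<longrightarrow> from_nat_into A n \<in> Domain r" using q(3) r(2) by blast
      then show "\<exists>y. (y \<in> F \<and> (Suc n = 0 \<longrightarrow> y = p0)) \<and> p \<subseteq> y \<and>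
         (from_nat_into A n \<in> A \<longrightarrow> from_nat_into A n \<in> Domain y) \<and>
         (from_nat_into B n \<in> B \<longrightarrow> from_nat_into B n \<in> Range y)"
        using q(2) r by (intro exI[of _ r]) auto
    qed
    then obtain P where P: "\<forall>n::nat. (P n \<in> F \<and> (n = 0 \<longrightarrow> P n = p0)) \<and> (P n \<subseteq> P (Suc n) \<and>
     (from_nat_into A n \<in> A \<longrightarrow> from_nat_into A n \<in> Domain (P (Suc n))) \<and>
     (from_nat_into B n \<in> B \<longrightarrow> from_nat_into B n \<in> Range (P (Suc n))))" ..
    show ?thesis
    proof (intro exI conjI allI)
      show "P 0 = p0" using P by simp
      show "P n \<in> F" "P n \<subseteq> P (Suc n)"
        "from_nat_into A n \<in> A \<longrightarrow> from_nat_into A n \<in> Domain (P (Suc n))"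
        "from_nat_into B n \<in> B \<longrightarrow> from_nat_into B n \<in> Range (P (Suc n))" for n
        using spec[OF P, of n] by simp_all
    qed
  qed
  then obtain P where P: "P 0 = p0" "\<And>n. P n \<in> F" "\<And>n. P n \<subseteq> P (Suc n)"
     "\<And>n. from_nat_into A n \<in> A \<Longrightarrow> from_nat_into A n \<in> Domain (P (Suc n))"
     "\<And>n. from_nat_into B n \<in> B \<Longrightarrow> from_nat_into B n \<in> Range (P (Suc n))" by blast
  have Pm: "P m \<subseteq> P n" if "m \<le> n" for m n using lift_Suc_mono_le[of P, OF P(3) that] .
  define r where "r = (\<Union>n. P n)"
  have rAB: "r \<subseteq> A \<times> B" using base[OF P(2)] by (auto simp: r_def)
  have rp: "x < x' \<longleftrightarrow> y < y'" if xy: "(x, y) \<in> r" "(x', y') \<in> r" for x y x' y'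
  proof -
    obtain m where "(x, y) \<in> P m" using xy(1) unfolding r_def by blast
    moreover obtain n where "(x', y') \<in> P n" using xy(2) unfolding r_def by blast
    ultimately have "(x, y) \<in> P (max m n)" "(x', y') \<in> P (max m n)"
      using Pm[of m "max m n"] Pm[of n "max m n"] by auto
    then show ?thesis using pisoD base[OF P(2)] by metis
  qed
  have dom: "\<exists>y. (x, y) \<in> r" if x: "x \<in> A" for x
  proof -
    obtain n where "from_nat_into A n = x" using from_nat_into_surj[OF cA x] by blast
    then show ?thesis using P(4)[of n] x by (auto simp: r_def)
  qed
  have ran: "\<exists>x. (x, y) \<in> r" if y: "y \<in> B" for y
  proof -
    obtain n where "from_nat_into B n = y" using from_nat_into_surj[OF cB y] by blast
    then show ?thesis using P(5)[of n] y by (auto simp: r_def)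
  qed
  obtain f where f: "\<And>x. x \<in> A \<Longrightarrow> (x, f x) \<in> r" using dom by metis
  have f_eq: "y = f x" if "(x, y) \<in> r" for x y
    using rp[OF that f] rp[OF f that] that rAB by (metis less_irrefl linorder_cases mem_Sigma_iff subsetD)
  have "strict_mono_on A f" using rp[OF f f] by (auto simp: strict_mono_on_def)
  moreover have "f ` A = B"
  proof
    show "f ` A \<subseteq> B" using f rAB by blast
    show "B \<subseteq> f ` A" using ran f_eq rAB by blast
  qed
  moreover have "p0 \<subseteq> gr f A"
    using P(1) f_eq rAB by (force simp: gr_def r_def)
  ultimately show ?thesis by (auto simp: oiso_def)
qed

section \<open>Homogeneity at level n\<close>

locale base_level =
  fixes \<alpha> :: ordinal
  assumes countable_base: "countable {..<\<alpha>}"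
begin

definition En :: "nat \<Rightarrow> real set \<Rightarrow> real set \<Rightarrow> (real \<times> real) set \<Rightarrow> bool" where
  "En n = bf ((osuc ^^ n) \<alpha>)"

lemma En_mono: "m \<le> n \<Longrightarrow> En n A B p \<Longrightarrow> En m A B p"
  unfolding En_def by (rule bf_mono[OF osuc_pow_mono])

lemmas En_base = bf_base[of "(osuc ^^ n) \<alpha>" for n, folded En_def]
lemmas En_subset = bf_subset[of "(osuc ^^ n) \<alpha>" for n, folded En_def]
lemmas En_empty = bf_empty[of "(osuc ^^ n) \<alpha>" for n, folded En_def]
lemmas En_converse = bf_converse[of "(osuc ^^ n) \<alpha>" for n, folded En_def]
lemmas En_trans = bf_trans[of "(osuc ^^ n) \<alpha>" for n, folded En_def]
lemmas En_trans0 = bf_trans0[of "(osuc ^^ n) \<alpha>" for n, folded En_def]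
lemmas En_sym0 = bf_sym0[of "(osuc ^^ n) \<alpha>" for n, folded En_def]
lemmas En_oiso = bf_oiso[of _ _ _ _ "(osuc ^^ n) \<alpha>" for n, folded En_def]
lemmas En_isom = bf_isom[of _ _ "(osuc ^^ n) \<alpha>" for n, folded En_def]
lemmas En_Id_on = bf_Id_on[of _ _ "(osuc ^^ n) \<alpha>" for n, folded En_def]
lemmas En_refl0 = bf_refl0[of "(osuc ^^ n) \<alpha>" for n, folded En_def]
lemmas En_sum2 = bf_sum2[of "(osuc ^^ n) \<alpha>" for n, folded En_def]
lemmas En_below = bf_below[of "(osuc ^^ n) \<alpha>" for n, folded En_def]
lemmas En_above = bf_above[of "(osuc ^^ n) \<alpha>" for n, folded En_def]
lemmas En_below0 = bf_below0[of "(osuc ^^ n) \<alpha>" for n, folded En_def]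
lemmas En_between0 = bf_between0[of "(osuc ^^ n) \<alpha>" for n, folded En_def]
lemmas En_uminus = bf_uminus[of "(osuc ^^ n) \<alpha>" for n, folded En_def]
lemmas En_uminus0 = bf_uminus0[of "(osuc ^^ n) \<alpha>" for n, folded En_def]

lemma En_forth:
  assumes "En (Suc n) A B p" "finite C" "C \<subseteq> A"
  obtains p' where "p \<subseteq> p'" "C \<subseteq> Domain p'" "En n A B p'"
  using bf_forth[of "(osuc ^^ Suc n) \<alpha>" A B p "(osuc ^^ n) \<alpha>"] assms less_osuc
  unfolding En_def by (metis funpow.simps(2) comp_apply)

lemma En_back:
  assumes "En (Suc n) A B p" "finite C" "C \<subseteq> B"
  obtains p' where "p \<subseteq> p'" "C \<subseteq> Range p'" "En n A B p'"
  using bf_back[of "(osuc ^^ Suc n) \<alpha>" A B p "(osuc ^^ n) \<alpha>"] assms less_osuc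
  unfolding En_def by (metis funpow.simps(2) comp_apply)

lemma En_forth1:
  assumes "En (Suc n) A B p" "x \<in> A"
  obtains p' y where "p \<subseteq> p'" "(x, y) \<in> p'" "En n A B p'"
proof -
  obtain p' where "p \<subseteq> p'" "{x} \<subseteq> Domain p'" "En n A B p'"
    by (rule En_forth[OF assms(1), of "{x}"]) (use assms(2) in auto)
  then show thesis using that by blast
qed

lemma En_back1:
  assumes "En (Suc n) A B p" "y \<in> B"
  obtains p' x where "p \<subseteq> p'" "(x, y) \<in> p'" "En n A B p'"
proof -
  obtain p' where "p \<subseteq> p'" "{y} \<subseteq> Range p'" "En n A B p'"
    by (rule En_back[OF assms(1), of "{y}"]) (use assms(2) in auto)
  then show thesis using that by blast
qed

lemma En_SucI:
  assumes "finite p" "p \<subseteq> A \<times> B" "piso p"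
    and "\<And>C. finite C \<Longrightarrow> C \<subseteq> A \<Longrightarrow> \<exists>p'. p \<subseteq> p' \<and> C \<subseteq> Domain p' \<and> En n A B p'"
    and "\<And>D. finite D \<Longrightarrow> D \<subseteq> B \<Longrightarrow> \<exists>p'. p \<subseteq> p' \<and> D \<subseteq> Range p' \<and> En n A B p'"
  shows "En (Suc n) A B p"
  unfolding En_def
proof (rule bfI[OF assms(1-3)])
  fix \<gamma> assume "\<gamma> < (osuc ^^ Suc n) \<alpha>"
  then have g: "\<gamma> \<le> (osuc ^^ n) \<alpha>" by (simp add: less_osuc_iff)
  show "\<exists>p'. p \<subseteq> p' \<and> C \<subseteq> Domain p' \<and> bf \<gamma> A B p'" if "finite C" "C \<subseteq> A" for C
    using assms(4)[OF that] bf_mono[OF g] unfolding En_def by blast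
  show "\<exists>p'. p \<subseteq> p' \<and> D \<subseteq> Range p' \<and> bf \<gamma> A B p'" if "finite D" "D \<subseteq> B" for D
    using assms(5)[OF that] bf_mono[OF g] unfolding En_def by blast
qed

lemma En_join:
  assumes x: "x \<in> A" "y \<in> B"
    and 1: "En n (A \<inter> {..<x}) (B \<inter> {..<y}) p1" and 2: "En n (A \<inter> {x<..}) (B \<inter> {y<..}) p2"
  shows "En n A B (p1 \<union> insert (x, y) p2)"
proof -
  have "En n {x} {y} {(x, y)}"
    by (rule En_oiso[of "\<lambda>_. y"]) (auto simp: oiso_def gr_def strict_mono_on_def)
  then have "En n ({x} \<union> A \<inter> {x<..}) ({y} \<union> B \<inter> {y<..}) ({(x, y)} \<union> p2)"
    by (rule En_sum2[OF _ 2]) auto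
  then have "En n (A \<inter> {..<x} \<union> ({x} \<union> A \<inter> {x<..})) (B \<inter> {..<y} \<union> ({y} \<union> B \<inter> {y<..})) (p1 \<union> ({(x, y)} \<union> p2))"
    by (rule En_sum2[OF 1]) auto
  moreover have "A \<inter> {..<x} \<union> ({x} \<union> A \<inter> {x<..}) = A" using x by auto
  moreover have "B \<inter> {..<y} \<union> ({y} \<union> B \<inter> {y<..}) = B" using x by auto
  ultimately show ?thesis by simp
qed

lemma En_split_subset:
  assumes "En n A B q" "(x, y) \<in> q"
  shows "q \<subseteq> (q \<inter> {..<x} \<times> {..<y}) \<union> insert (x, y) (q \<inter> {x<..} \<times> {y<..})"
  using pisoD[OF En_base(3)[OF assms(1)]] pisoD_eq[OF En_base(3)[OF assms(1)]] assms(2)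
  by (auto; metis linorder_less_linear)

text \<open>
  The least \<open>n\<close> with \<open>hom n A\<close> plays the role of the Scott rank of \<open>A\<close> above the base level.
\<close>

definition hom :: "nat \<Rightarrow> real set \<Rightarrow> bool" where
  "hom n A \<longleftrightarrow> (\<exists>P. finite P \<and> P \<subseteq> A \<and> (\<forall>q. Id_on P \<subseteq> q \<longrightarrow> En n A A q \<longrightarrow> En (Suc n) A A q))"

definition low :: "real set \<Rightarrow> bool" where
  "low A \<longleftrightarrow> (\<exists>n. hom n A)"

lemma homI: "(\<And>q. En n A A q \<Longrightarrow> En (Suc n) A A q) \<Longrightarrow> hom n A"
  unfolding hom_def by (intro exI[of _ "{}"]) auto

text \<open>Answers of level n + 1 would be wanted where the game yields only level n; the
  hypothesis lifts them, with the same parameters.\<close>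

lemma hom_Suc:
  assumes "hom n A" shows "hom (Suc n) A"
proof -
  obtain P where P: "finite P" "P \<subseteq> A" "\<And>q. Id_on P \<subseteq> q \<Longrightarrow> En n A A q \<Longrightarrow> En (Suc n) A A q"
    using assms unfolding hom_def by blast
  have "En (Suc (Suc n)) A A q" if q: "Id_on P \<subseteq> q" "En (Suc n) A A q" for q
  proof (rule En_SucI[OF En_base[OF q(2)]])
    show "\<exists>p'. q \<subseteq> p' \<and> C \<subseteq> Domain p' \<and> En (Suc n) A A p'" if "finite C" "C \<subseteq> A" for C
      using En_forth[OF q(2) that] P(3) q(1) by (metis subset_trans)
    show "\<exists>p'. q \<subseteq> p' \<and> D \<subseteq> Range p' \<and> En (Suc n) A A p'" if "finite D" "D \<subseteq> A" for D
      using En_back[OF q(2) that] P(3) q(1) by (metis subset_trans)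
  qed
  then show ?thesis unfolding hom_def using P by blast
qed

lemma hom_mono: "m \<le> n \<Longrightarrow> hom m A \<Longrightarrow> hom n A"
  by (induction n rule: dec_induct) (auto intro: hom_Suc)

lemma hom_empty: "hom n {}"
  by (rule homI) (use En_base(2) En_refl0 in fastforce)

text \<open>The three extra levels are spent as follows: one move brings the parameters of
  \<open>A\<close> into the position, one covers the range of a competing position, and the last
  leaves level n + 1 for the transfer.\<close>

lemma En_oiso_ex:
  assumes A: "countable A" "countable B" and hom: "hom n A" and q: "En (n + 3) A B q"
  shows "\<exists>f. oiso f A B \<and> q \<subseteq> gr f A"
proof -
  obtain P where P: "finite P" "P \<subseteq> A" "\<And>q. Id_on P \<subseteq> q \<Longrightarrow> En n A A q \<Longrightarrow> En (Suc n) A A q"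
    using hom unfolding hom_def by blast
  have "En (Suc (Suc (Suc n))) A B q" using q by (simp add: eval_nat_numeral)
  then obtain q0 where q0: "q \<subseteq> q0" "P \<subseteq> Domain q0" "En (Suc (Suc n)) A B q0"
    by (rule En_forth[OF _ P(1,2)])
  \<comment> \<open>A position \<open>p\<close> of level n is compared with a position
    \<open>p1\<close> of level n + 1 covering its range. Their quotient is a position of
    \<open>A\<close> with itself that fixes the parameters; homogeneity raises it, and composing
    with \<open>p1\<close> raises \<open>p\<close>.\<close>
  have up: "En (Suc n) A B p" if p: "q0 \<subseteq> p" "En n A B p" for p
  proof -
    have "finite (Range p)" "Range p \<subseteq> B" using En_base(1,2)[OF p(2)] by (auto simp: finite_Range)
    then obtain p1 where p1: "q0 \<subseteq> p1" "Range p \<subseteq> Range p1" "En (Suc n) A B p1"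
      by (rule En_back[OF q0(3)])
    have "En n A A (p O p1\<inverse>)"
      by (rule En_trans[OF p(2) En_converse[OF En_mono[OF _ p1(3)]]]) simp
    moreover have "Id_on P \<subseteq> p O p1\<inverse>" using q0(2) p(1) p1(1) by fast
    ultimately have "En (Suc n) A A (p O p1\<inverse>)" using P(3) by blast
    from En_trans[OF this p1(3)] have "En (Suc n) A B (p O p1\<inverse> O p1)" by (simp add: O_assoc)
    moreover have "p \<subseteq> p O p1\<inverse> O p1" using p1(2) by fast
    ultimately show ?thesis by (rule En_subset)
  qed
  define F where "F = {p. q0 \<subseteq> p \<and> En (Suc n) A B p}"
  have "\<exists>f. oiso f A B \<and> q0 \<subseteq> gr f A"
  proof (rule bf_back_forth_oiso[OF A, of q0 F])
    show "q0 \<in> F" using En_mono[OF _ q0(3), of "Suc n"] by (simp add: F_def)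
    show "p \<subseteq> A \<times> B \<and> piso p" if "p \<in> F" for p using that En_base(2,3)[of "Suc n" A B p] by (simp add: F_def)
    show "\<exists>q\<in>F. p \<subseteq> q \<and> x \<in> Domain q" if "p \<in> F" "x \<in> A" for p x
    proof -
      have p: "q0 \<subseteq> p" "En (Suc n) A B p" using that by (auto simp: F_def)
      obtain p' y where "p \<subseteq> p'" "(x, y) \<in> p'" "En n A B p'" by (rule En_forth1[OF p(2) \<open>x \<in> A\<close>])
      then show ?thesis using up[of p'] p(1) by (auto simp: F_def intro!: bexI[of _ p'])
    qed
    show "\<exists>q\<in>F. p \<subseteq> q \<and> y \<in> Range q" if "p \<in> F" "y \<in> B" for p y
    proof -
      have p: "q0 \<subseteq> p" "En (Suc n) A B p" using that by (auto simp: F_def)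
      obtain p' x where "p \<subseteq> p'" "(x, y) \<in> p'" "En n A B p'" by (rule En_back1[OF p(2) \<open>y \<in> B\<close>])
      then show ?thesis using up[of p'] p(1) by (auto simp: F_def intro!: bexI[of _ p'])
    qed
  qed
  then show ?thesis using q0(1) by blast
qed

lemma hom_oiso:
  assumes f: "oiso f A B" and hom: "hom n A" shows "hom n B"
proof -
  obtain P where P: "finite P" "P \<subseteq> A" "\<And>q. Id_on P \<subseteq> q \<Longrightarrow> En n A A q \<Longrightarrow> En (Suc n) A A q"
    using hom unfolding hom_def by blast
  have "En (Suc n) B B q" if q: "Id_on (f ` P) \<subseteq> q" "En n B B q" for q
  proof -
    \<comment> \<open>A finite part of \<open>f\<close> that contains the parameters and reaches all
      points of \<open>q\<close>, enough to conjugate \<open>q\<close> into a position on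
      \<open>A\<close>.\<close>
    define Z where "Z = P \<union> inv_into A f ` (Domain q \<union> Range q)"
    have B: "B = f ` A" using f by (simp add: oiso_def)
    have qB: "Domain q \<union> Range q \<subseteq> B" using En_base(2)[OF q(2)] by auto
    have "inv_into A f ` (Domain q \<union> Range q) \<subseteq> A"
      using qB unfolding B by (metis image_subsetI inv_into_into subsetD)
    then have Z: "finite Z" "Z \<subseteq> A"
      using P(1,2) En_base(1)[OF q(2)] by (auto simp: Z_def finite_Domain finite_Range)
    have F: "En k A B (gr f Z)" for k
      by (rule En_oiso[OF f]) (use Z in \<open>auto simp: gr_def\<close>)
    have "f ` Z \<supseteq> Domain q \<union> Range q"
    proof
      fix y assume "y \<in> Domain q \<union> Range q"
      then have "y = f (inv_into A f y)" "inv_into A f y \<in> Z"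
        using qB unfolding B Z_def by (auto simp: f_inv_into_f)
      then show "y \<in> f ` Z" by (rule image_eqI)
    qed
    then have cov: "Domain q \<union> Range q \<subseteq> Range (gr f Z)" by (simp add: gr_def Range_snd image_image)
    have "En n A A (gr f Z O q O (gr f Z)\<inverse>)"
      using En_trans[OF F En_trans[OF q(2) En_converse[OF F]]] .
    moreover have "Id_on P \<subseteq> gr f Z O q O (gr f Z)\<inverse>"
    proof
      fix z assume "z \<in> Id_on P"
      then obtain a where a: "a \<in> P" "z = (a, a)" by auto
      then have "(a, f a) \<in> gr f Z" "(f a, f a) \<in> q" using q(1) by (auto simp: gr_def Z_def)
      then show "z \<in> gr f Z O q O (gr f Z)\<inverse>" using a(2) by blast
    qed
    ultimately have "En (Suc n) A A (gr f Z O q O (gr f Z)\<inverse>)" by (intro P(3))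
    then have "En (Suc n) B B ((gr f Z)\<inverse> O (gr f Z O q O (gr f Z)\<inverse>) O gr f Z)"
      using En_trans[OF En_converse[OF F] En_trans[OF _ F]] by blast
    moreover have "q \<subseteq> (gr f Z)\<inverse> O (gr f Z O q O (gr f Z)\<inverse>) O gr f Z"
    proof clarify
      fix x y assume xy: "(x, y) \<in> q"
      then obtain u v where "(u, x) \<in> gr f Z" "(v, y) \<in> gr f Z" using cov by blast
      then show "(x, y) \<in> (gr f Z)\<inverse> O (gr f Z O q O (gr f Z)\<inverse>) O gr f Z" using xy by blast
    qed
    ultimately show ?thesis by (rule En_subset)
  qed
  moreover have "finite (f ` P)" "f ` P \<subseteq> B" using P f by (auto simp: oiso_def)
  ultimately show ?thesis unfolding hom_def by blast
qed

lemma hom_isom: "isom A B \<Longrightarrow> hom n A \<Longrightarrow> hom n B"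
  unfolding isom_def using hom_oiso by blast

lemma hom_isom_iff: "isom A B \<Longrightarrow> hom n A \<longleftrightarrow> hom n B"
  using hom_isom isom_sym by blast

lemma low_isom_iff: "isom A B \<Longrightarrow> low A \<longleftrightarrow> low B"
  unfolding low_def using hom_isom_iff by blast

lemma isom_of_hom_En:
  "countable A \<Longrightarrow> countable B \<Longrightarrow> hom n A \<Longrightarrow> En (n + 3) A B q \<Longrightarrow> isom A B"
  using En_oiso_ex unfolding isom_def by blast

text \<open>Homogeneity of either side makes the two orders isomorphic, whence the three levels
  again.\<close>

lemma hom_En_iff:
  assumes "countable A" "countable B" "En (n + 3) A B q"
  shows "hom n A \<longleftrightarrow> hom n B"
  using isom_of_hom_En[OF assms(1,2) _ assms(3)] isom_of_hom_En[OF assms(2,1) _ En_converse[OF assms(3)]]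
    hom_isom isom_sym by blast

lemma hom_uminus: "hom n A \<Longrightarrow> hom n (uminus ` A)"
proof -
  assume "hom n A"
  then obtain P where P: "finite P" "P \<subseteq> A" "\<And>q. Id_on P \<subseteq> q \<Longrightarrow> En n A A q \<Longrightarrow> En (Suc n) A A q"
    unfolding hom_def by blast
  let ?h = "\<lambda>(x :: real, y :: real). (- x, - y)"
  have hh: "?h ` ?h ` q = q" for q
  proof -
    have "?h \<circ> ?h = id" by (rule ext) (simp add: case_prod_unfold)
    then show ?thesis by (simp add: image_comp)
  qed
  have AA: "uminus ` uminus ` A = A" for A :: "real set" by (simp add: image_comp)
  have "En (Suc n) (uminus ` A) (uminus ` A) q" if q: "Id_on (uminus ` P) \<subseteq> q" "En n (uminus ` A) (uminus ` A) q" for q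
  proof -
    have "En n A A (?h ` q)" using En_uminus[OF q(2)] by (simp add: AA)
    moreover have "Id_on P \<subseteq> ?h ` q"
    proof
      fix z assume "z \<in> Id_on P"
      then obtain a where "a \<in> P" "z = (a, a)" by auto
      then have "(- a, - a) \<in> q" "z = ?h (- a, - a)" using q(1) by auto
      then show "z \<in> ?h ` q" by blast
    qed
    ultimately have "En (Suc n) A A (?h ` q)" by (intro P(3))
    from En_uminus[OF this] show ?thesis by (simp only: hh)
  qed
  moreover have "finite (uminus ` P)" "uminus ` P \<subseteq> uminus ` A" using P by auto
  ultimately show ?thesis unfolding hom_def by blast
qed

lemma uminus_image2: "uminus ` uminus ` A = A" for A :: "real set"
  by (simp add: image_comp)

lemma hom_uminus_iff: "hom n (uminus ` A) \<longleftrightarrow> hom n A"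
  using hom_uminus[of n A] hom_uminus[of n "uminus ` A"] by (auto simp: uminus_image2)

lemma low_uminus_iff: "low (uminus ` A) \<longleftrightarrow> low A"
  by (simp add: low_def hom_uminus_iff)

lemma uminus_Int_image:
  fixes A :: "real set" shows
  "uminus ` A \<inter> {..<x} = uminus ` (A \<inter> {- x<..})"
  "uminus ` A \<inter> {x<..} = uminus ` (A \<inter> {..<- x})"
  "uminus ` A \<inter> {x<..<y} = uminus ` (A \<inter> {- y<..<- x})"
  by (force simp: image_iff)+

text \<open>A position below \<open>x\<close> is completed by the identity at \<open>x\<close> and
  at the parameters above it; it is raised as a position on \<open>A\<close> and restricted
  again.\<close>

lemma hom_below: 
  assumes "hom n A" "x \<in> A" shows "hom n (A \<inter> {..<x})"
proof -
  obtain P where P: "finite P" "P \<subseteq> A" "\<And>q. Id_on P \<subseteq> q \<Longrightarrow> En n A A q \<Longrightarrow> En (Suc n) A A q"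
    using assms unfolding hom_def by blast
  let ?A = "A \<inter> {..<x}" and ?R = "Id_on (insert x (P \<inter> {x<..}))"
  have "En (Suc n) ?A ?A q" if q: "Id_on (P \<inter> {..<x}) \<subseteq> q" "En n ?A ?A q" for q
  proof -
    have R: "En n (A \<inter> {x<..}) (A \<inter> {x<..}) (Id_on (P \<inter> {x<..}))" by (rule En_Id_on) (use P in auto)
    let ?q = "q \<union> insert (x, x) (Id_on (P \<inter> {x<..}))"
    have "En n A A ?q" by (rule En_join[OF assms(2,2) q(2) R])
    moreover have "Id_on P \<subseteq> ?q"
    proof
      fix z assume "z \<in> Id_on P"
      then obtain a where "a \<in> P" "z = (a, a)" by auto
      then show "z \<in> ?q" using q(1) by (cases a x rule: linorder_cases) auto
    qed
    ultimately have "En (Suc n) A A ?q" by (intro P(3))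
    from En_below[OF this, of x x] have "En (Suc n) ?A ?A (?q \<inter> {..<x} \<times> {..<x})" by simp
    then show ?thesis by (rule En_subset) (use En_base(2)[OF q(2)] in auto)
  qed
  moreover have "finite (P \<inter> {..<x})" "P \<inter> {..<x} \<subseteq> ?A" using P by auto
  ultimately show ?thesis unfolding hom_def by blast
qed

lemma hom_above: 
  assumes "hom n A" "x \<in> A" shows "hom n (A \<inter> {x<..})"
  using hom_below[of n "uminus ` A" "- x"] assms by (simp add: hom_uminus_iff uminus_Int_image)

lemma hom_between:
  assumes "hom n A" "x \<in> A" "y \<in> A" shows "hom n (A \<inter> {x<..<y})"
proof (cases "x < y")
  case True
  have "hom n (A \<inter> {..<y} \<inter> {x<..})" by (rule hom_above[OF hom_below]) (use assms True in auto)
  moreover have "A \<inter> {..<y} \<inter> {x<..} = A \<inter> {x<..<y}" by auto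
  ultimately show ?thesis by simp
qed (simp add: hom_empty)

text \<open>With \<open>x\<close> as an additional parameter every position splits into its parts
  below and above \<open>x\<close>, which are raised separately. Joining at a point therefore costs
  no level.\<close>

lemma hom_join:
  assumes "x \<in> A" "hom n (A \<inter> {..<x})" "hom n (A \<inter> {x<..})" shows "hom n A"
proof -
  let ?A1 = "A \<inter> {..<x}" and ?A2 = "A \<inter> {x<..}"
  obtain P1 where P1: "finite P1" "P1 \<subseteq> ?A1" "\<And>q. Id_on P1 \<subseteq> q \<Longrightarrow> En n ?A1 ?A1 q \<Longrightarrow> En (Suc n) ?A1 ?A1 q"
    using assms(2) unfolding hom_def by blast
  obtain P2 where P2: "finite P2" "P2 \<subseteq> ?A2" "\<And>q. Id_on P2 \<subseteq> q \<Longrightarrow> En n ?A2 ?A2 q \<Longrightarrow> En (Suc n) ?A2 ?A2 q"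
    using assms(3) unfolding hom_def by blast
  have "En (Suc n) A A q" if q: "Id_on (P1 \<union> insert x P2) \<subseteq> q" "En n A A q" for q
  proof -
    have x: "(x, x) \<in> q" using q(1) by auto
    have "En (Suc n) ?A1 ?A1 (q \<inter> {..<x} \<times> {..<x})"
      by (rule P1(3)[OF _ En_below[OF q(2) x]]) (use q(1) P1(2) in auto)
    moreover have "En (Suc n) ?A2 ?A2 (q \<inter> {x<..} \<times> {x<..})"
      by (rule P2(3)[OF _ En_above[OF q(2) x]]) (use q(1) P2(2) in auto)
    ultimately show ?thesis
      using En_subset[OF En_join[OF assms(1,1)] En_split_subset[OF q(2) x]] by blast
  qed
  moreover have "finite (P1 \<union> insert x P2)" "P1 \<union> insert x P2 \<subseteq> A" using P1 P2 assms by auto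
  ultimately show ?thesis unfolding hom_def by blast
qed

section \<open>Homogeneity of joins, limits and cuts\<close>

lemma hom_join_below:
  assumes "hom n (A \<inter> {..<x})" "hom n (A \<inter> {x<..<y})" "x \<in> A" "x < y"
  shows "hom n (A \<inter> {..<y})"
proof -
  have "A \<inter> {..<y} \<inter> {..<x} = A \<inter> {..<x}" "A \<inter> {..<y} \<inter> {x<..} = A \<inter> {x<..<y}" using assms by auto
  then show ?thesis using hom_join[of x "A \<inter> {..<y}" n] assms by simp
qed

lemma hom_insert_top: "hom n A \<Longrightarrow> (\<And>a. a \<in> A \<Longrightarrow> a < x) \<Longrightarrow> hom n (insert x A)"
proof -
  assume A: "hom n A" "\<And>a. a \<in> A \<Longrightarrow> a < x"
  have "insert x A \<inter> {..<x} = A" "insert x A \<inter> {x<..} = {}" using A(2) by force+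
  then show ?thesis using hom_join[of x "insert x A" n] A(1) hom_empty by simp
qed

lemma isom_insert_top:
  assumes "isom A B" "\<And>a. a \<in> A \<Longrightarrow> a < x" "\<And>b. b \<in> B \<Longrightarrow> b < y"
  shows "isom (insert x A) (insert y B)"
proof -
  obtain f where f: "oiso f A B" using assms(1) by (auto simp: isom_def)
  have "oiso (\<lambda>_. y) {x} {y}" by (simp add: oiso_def strict_mono_on_def)
  from oiso_glue2[OF f this] assms have "isom (A \<union> {x}) (B \<union> {y})" by (auto simp: isom_def)
  then show ?thesis by simp
qed

text \<open>
  The upper tails above \<open>u\<close> and \<open>u'\<close> have the same bounded initial segments, so they are isomorphic.
\<close>

lemma En_initial_part:
  assumes K: "countable K" and L: "L \<subseteq> K" "\<And>x y. x \<in> L \<Longrightarrow> y \<in> K \<Longrightarrow> y < x \<Longrightarrow> y \<in> L"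
    and nomax: "\<And>x. x \<in> L \<Longrightarrow> \<exists>y\<in>L. x < y"
    and hom: "\<And>x. x \<in> L \<Longrightarrow> hom h (K \<inter> {..<x})"
    and q: "En (h + 4) K K q"
    and resp: "\<And>p x y. En (h + 3) K K p \<Longrightarrow> (x, y) \<in> p \<Longrightarrow> x \<in> L \<longleftrightarrow> y \<in> L"
  shows "En n L L (q \<inter> L \<times> L)"
proof (cases "q \<inter> L \<times> L = {}")
  case True
  then show ?thesis using En_refl0 by simp
next
  case False
  let ?D = "Domain (q \<inter> L \<times> L)"
  have fin: "finite ?D" using En_base(1)[OF q] by (simp add: finite_Domain)
  have q3: "En (h + 3) K K q" by (rule En_mono[OF _ q]) simp
  \<comment> \<open>Below the largest point of the position in \<open>L\<close> homogeneity provides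
    an isomorphism; above it the tails are compared. Everything is matched by actual isomorphisms,
    which is why the conclusion holds at every level n.\<close>
  define u where "u = Max ?D"
  have "u \<in> ?D" unfolding u_def by (rule Max_in[OF fin]) (use False in auto)
  then obtain u' where u: "(u, u') \<in> q" "u \<in> L" "u' \<in> L" by auto
  have uK: "u \<in> K" "u' \<in> K" using u L(1) by auto
  have max: "x \<le> u" if "(x, y) \<in> q" "x \<in> L" for x y
  proof -
    have "x \<in> ?D" using that resp[OF q3 that(1)] by auto
    then show ?thesis unfolding u_def by (rule Max_ge[OF fin])
  qed
  have Lb: "L \<inter> {..<x} = K \<inter> {..<x}" if "x \<in> L" for x using L that by auto
  have cL: "countable (K \<inter> S)" for S using K by (rule countable_Int1)
  obtain f where f: "oiso f (K \<inter> {..<u}) (K \<inter> {..<u'})" "q \<inter> {..<u} \<times> {..<u'} \<subseteq> gr f (K \<inter> {..<u})"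
    using En_oiso_ex[OF cL cL hom[OF u(2)] En_below[OF q3 u(1)]] by blast
  \<comment> \<open>One of the h + 4 levels finds the partner \<open>z\<close> of \<open>w\<close>;
    the remaining h + 3 turn the equivalence of the bounded intervals into an isomorphism.\<close>
  have tail: "\<exists>z\<in>L. b < z \<and> isom (L \<inter> {a<..w}) (L \<inter> {b<..z})"
    if p: "En (h + 4) K K p" "(a, b) \<in> p" and aL: "a \<in> L" "b \<in> L" and w: "w \<in> L" "a < w" for p a b w
  proof -
    have "h + 4 = Suc (h + 3)" by simp
    then have pS: "En (Suc (h + 3)) K K p" using p(1) by (simp only:)
    have wK: "w \<in> K" using w(1) L(1) by blast
    obtain p' z where p': "p \<subseteq> p'" "(w, z) \<in> p'" "En (h + 3) K K p'"
      by (rule En_forth1[OF pS wK])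
    have z: "z \<in> L" using resp[OF p'(3,2)] w(1) by simp
    have ab: "(a, b) \<in> p'" using p' p(2) by auto
    have bz: "b < z" using pisoD[OF En_base(3)[OF p'(3)] ab p'(2)] w(2) by simp
    have "hom h (K \<inter> {..<w} \<inter> {a<..})" by (rule hom_above[OF hom[OF w(1)]]) (use aL w L in auto)
    moreover have "K \<inter> {..<w} \<inter> {a<..} = K \<inter> {a<..<w}" by auto
    ultimately have "isom (K \<inter> {a<..<w}) (K \<inter> {b<..<z})"
      using isom_of_hom_En[OF cL cL _ En_between0[OF p'(3) ab p'(2)]] by simp
    then have "isom (insert w (K \<inter> {a<..<w})) (insert z (K \<inter> {b<..<z}))"
      by (rule isom_insert_top) auto
    moreover have "insert w (K \<inter> {a<..<w}) = L \<inter> {a<..w}" using Lb[OF w(1)] w L(1) by auto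
    moreover have "insert z (K \<inter> {b<..<z}) = L \<inter> {b<..z}" using Lb[OF z] z bz L(1) by auto
    ultimately show ?thesis using z bz by auto
  qed
  have "isom (L \<inter> {u<..}) (L \<inter> {u'<..})"
  proof (rule isom_tails[OF u(2,3) nomax])
    show "\<exists>z\<in>L. u' < z \<and> isom (L \<inter> {u<..w}) (L \<inter> {u'<..z})" if "w \<in> L" "u < w" for w
      by (rule tail[OF q u that])
    show "\<exists>z\<in>L. u < z \<and> isom (L \<inter> {u'<..w}) (L \<inter> {u<..z})" if "w \<in> L" "u' < w" for w
      by (rule tail[OF En_converse[OF q] _ u(3,2) that]) (use u in simp)
  qed
  then have 2: "En n (L \<inter> {u<..}) (L \<inter> {u'<..}) {}" by (rule En_isom)
  have "En n (L \<inter> {..<u}) (L \<inter> {..<u'}) (q \<inter> {..<u} \<times> {..<u'})"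
    unfolding Lb[OF u(2)] Lb[OF u(3)] by (rule En_oiso[OF f(1) _ f(2)]) (use En_base(1)[OF q] in simp)
  from En_join[OF u(2,3) this 2] show ?thesis
  proof (rule En_subset)
    have "x < u \<longleftrightarrow> y < u'" "x = u \<longleftrightarrow> y = u'" if "(x, y) \<in> q" for x y
      using pisoD[OF En_base(3)[OF q] that u(1)] pisoD_eq[OF En_base(3)[OF q] that u(1)] by auto
    then show "q \<inter> L \<times> L \<subseteq> q \<inter> {..<u} \<times> {..<u'} \<union> insert (u, u') {}"
      using max by fastforce
  qed
qed

text \<open>Without a greatest element this is \<open>En_initial_part\<close> for
  \<open>L = A\<close>, which costs four levels; a greatest element is adjoined to a homogeneous
  part at no cost.\<close>

lemma hom_limit:
  assumes "countable A" "\<And>x. x \<in> A \<Longrightarrow> hom n (A \<inter> {..<x})"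
  shows "hom (n + 4) A"
proof (cases "\<exists>x\<in>A. \<forall>y\<in>A. y \<le> x")
  case True
  then obtain x where x: "x \<in> A" "\<And>y. y \<in> A \<Longrightarrow> y \<le> x" by blast
  then have "A = insert x (A \<inter> {..<x})" by force
  moreover have "hom n (insert x (A \<inter> {..<x}))" by (rule hom_insert_top) (use assms x in auto)
  ultimately show ?thesis using hom_mono[of n "n + 4"] by simp
next
  case False
  show ?thesis
  proof (rule homI)
    fix q assume q: "En (n + 4) A A q"
    have "En (Suc (n + 4)) A A (q \<inter> A \<times> A)"
      by (rule En_initial_part[OF assms(1) _ _ _ assms(2) q]) (use False En_base(2) in \<open>force simp: not_le\<close>)+
    then show "En (Suc (n + 4)) A A q" by (rule En_subset) (use En_base(2)[OF q] in auto)
  qed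
qed

lemma hom_limit_above:
  assumes "countable A" "\<And>x. x \<in> A \<Longrightarrow> hom n (A \<inter> {x<..})"
  shows "hom (n + 4) A"
proof -
  have "hom (n + 4) (uminus ` A)"
    by (rule hom_limit) (use assms in \<open>auto simp: uminus_Int_image hom_uminus_iff\<close>)
  then show ?thesis by (simp add: hom_uminus_iff)
qed

text \<open>The order splits into the points \<open>L\<close> with a simple initial segment and the
  rest \<open>R\<close>, whose final segments are simple. If a point sits at the cut, the halves are
  joined there; at a gap the equivalence itself must recognise the halves.\<close>

lemma hom_cut:
  assumes K: "countable K"
    and R: "\<And>z. z \<in> K \<Longrightarrow> \<not> hom i (K \<inter> {..<z}) \<Longrightarrow> hom j (K \<inter> {z<..})"
  shows "hom (max i j + 4) K"
proof -
  let ?h = "max i j"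
  define L where "L = {z\<in>K. hom i (K \<inter> {..<z})}"
  define R where "R = K - L"
  have dc: "y \<in> L" if "x \<in> L" "y \<in> K" "y < x" for x y
  proof -
    have "hom i (K \<inter> {..<x} \<inter> {..<y})" by (rule hom_below) (use that in \<open>auto simp: L_def\<close>)
    moreover have "K \<inter> {..<x} \<inter> {..<y} = K \<inter> {..<y}" using that by auto
    ultimately show ?thesis using that by (simp add: L_def)
  qed
  have uc: "y \<in> R" if "x \<in> R" "y \<in> K" "x < y" for x y using dc that by (auto simp: R_def)
  have LR: "x < y" if "x \<in> L" "y \<in> R" for x y
    using dc[OF that(1), of y] that by (cases x y rule: linorder_cases) (auto simp: R_def)
  have KLR: "K = L \<union> R" by (auto simp: L_def R_def)
  have hL: "hom ?h (K \<inter> {..<x})" if "x \<in> L" for x using that hom_mono[of i ?h] by (simp add: L_def)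
  have hR: "hom ?h (K \<inter> {x<..})" if "x \<in> R" for x
    using that assms(2)[of x] hom_mono[of j ?h] by (simp add: L_def R_def)
  have cK: "countable (K \<inter> S)" for S using K by (rule countable_Int1)
  have cL: "countable L" and cR: "countable R" using K by (auto simp: L_def R_def)
  have homL: "hom (?h + 4) L"
  proof (rule hom_limit[OF cL])
    fix x assume x: "x \<in> L"
    then have "L \<inter> {..<x} = K \<inter> {..<x}" using dc[OF x] by (auto simp: L_def)
    then show "hom ?h (L \<inter> {..<x})" using hL[OF x] by simp
  qed
  have homR: "hom (?h + 4) R"
  proof (rule hom_limit_above[OF cR])
    fix x assume x: "x \<in> R"
    then have "R \<inter> {x<..} = K \<inter> {x<..}" using uc[OF x] by (auto simp: R_def)
    then show "hom ?h (R \<inter> {x<..})" using hR[OF x] by simp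
  qed
  show ?thesis
  proof (cases "\<exists>l\<in>L. \<forall>y\<in>L. y \<le> l")
    case True
    then obtain l where l: "l \<in> L" "\<And>y. y \<in> L \<Longrightarrow> y \<le> l" by blast
    have "K \<inter> {l<..} = R" using l LR uc by (force simp: KLR)
    then show ?thesis
      using hom_join[of l K "?h + 4"] hom_mono[OF _ hL[OF l(1)], of "?h + 4"] homR l(1) by (simp add: L_def)
  next
    case noL: False
    show ?thesis
    proof (cases "\<exists>r\<in>R. \<forall>y\<in>R. r \<le> y")
      case True
      then obtain r where r: "r \<in> R" "\<And>y. y \<in> R \<Longrightarrow> r \<le> y" by blast
      have "K \<inter> {..<r} = L" using r LR by (force simp: KLR)
      then show ?thesis
        using hom_join[of r K "?h + 4"] hom_mono[OF _ hR[OF r(1)], of "?h + 4"] homL r(1) by (simp add: R_def)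
    next
      case noR: False
      show ?thesis
      proof (rule homI)
        fix q assume q: "En (?h + 4) K K q"
        \<comment> \<open>Membership in \<open>L\<close> is a property of the initial segment, and
          homogeneity of level i is invariant under equivalence of level i + 3; so positions of
          level \<open>?h + 3\<close> respect the gap.\<close>
        have resp: "x \<in> L \<longleftrightarrow> y \<in> L" if p: "En (?h + 3) K K p" "(x, y) \<in> p" for p x y
        proof -
          have "En (i + 3) (K \<inter> {..<x}) (K \<inter> {..<y}) {}"
            by (rule En_mono[OF _ En_below0[OF p]]) simp
          from hom_En_iff[OF cK cK this] show ?thesis using En_base(2)[OF p(1)] p(2) by (auto simp: L_def)
        qed
        have EL: "En (Suc (?h + 4)) L L (q \<inter> L \<times> L)"
          by (rule En_initial_part[OF K _ dc _ hL q resp]) (use noL in \<open>force simp: L_def not_le\<close>)+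
        let ?m = "\<lambda>(x :: real, y :: real). (- x, - y)"
        \<comment> \<open>In the reversed order \<open>R\<close> is an initial part, so the same
          lemma applies.\<close>
        have "En (Suc (?h + 4)) (uminus ` R) (uminus ` R) (?m ` q \<inter> uminus ` R \<times> uminus ` R)"
        proof (rule En_initial_part[of "uminus ` K"])
          show "countable (uminus ` K)" using K by simp
          show "uminus ` R \<subseteq> uminus ` K" by (auto simp: R_def)
          show "y \<in> uminus ` R" if "x \<in> uminus ` R" "y \<in> uminus ` K" "y < x" for x y using that uc by auto
          show "\<exists>y\<in>uminus ` R. x < y" if "x \<in> uminus ` R" for x using that noR by (force simp: not_le)
          show "hom ?h (uminus ` K \<inter> {..<x})" if "x \<in> uminus ` R" for x
            using that hR by (auto simp: uminus_Int_image hom_uminus_iff)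
          show "En (?h + 4) (uminus ` K) (uminus ` K) (?m ` q)" by (rule En_uminus[OF q])
          show "x \<in> uminus ` R \<longleftrightarrow> y \<in> uminus ` R" if p: "En (?h + 3) (uminus ` K) (uminus ` K) p" "(x, y) \<in> p" for p x y
          proof -
            have "En (?h + 3) K K (?m ` p)" using En_uminus[OF p(1)] by (simp add: uminus_image2)
            moreover have "(- x, - y) \<in> ?m ` p" using p(2) by force
            ultimately have "- x \<in> L \<longleftrightarrow> - y \<in> L" by (rule resp)
            moreover have "- x \<in> K" "- y \<in> K" using En_base(2)[OF p(1)] p(2) by auto
            ultimately show ?thesis by (force simp: R_def image_iff)
          qed
        qed
        from En_uminus[OF this] have ER: "En (Suc (?h + 4)) R R (?m ` (?m ` q \<inter> uminus ` R \<times> uminus ` R))"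
          by (simp only: uminus_image2)
        have big: "En (Suc (?h + 4)) (L \<union> R) (L \<union> R) (q \<inter> L \<times> L \<union> ?m ` (?m ` q \<inter> uminus ` R \<times> uminus ` R))"
          by (rule En_sum2[OF EL ER LR LR])
        have sub: "q \<subseteq> q \<inter> L \<times> L \<union> ?m ` (?m ` q \<inter> uminus ` R \<times> uminus ` R)"
        proof
          fix z assume z: "z \<in> q"
          obtain x y where zxy: "z = (x, y)" by (cases z)
          have "(x, y) \<in> q \<inter> L \<times> L" if "(x, y) \<notin> ?m ` (?m ` q \<inter> uminus ` R \<times> uminus ` R)"
          proof -
          have xy: "(x, y) \<in> q" "(x, y) \<notin> ?m ` (?m ` q \<inter> uminus ` R \<times> uminus ` R)" using z zxy that by auto
          have "x \<in> L \<longleftrightarrow> y \<in> L" by (rule resp[OF En_mono[OF _ q] xy(1)]) simp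
          moreover have "x \<in> K" "y \<in> K" using En_base(2)[OF q] xy(1) by auto
          moreover have "\<not> (x \<in> R \<and> y \<in> R)"
          proof
            assume "x \<in> R \<and> y \<in> R"
            then have "(- x, - y) \<in> ?m ` q \<inter> uminus ` R \<times> uminus ` R" using xy(1) by force
            then have "?m (- x, - y) \<in> ?m ` (?m ` q \<inter> uminus ` R \<times> uminus ` R)" by (rule imageI)
            then show False using xy(2) by simp
          qed
          ultimately have "x \<in> L" "y \<in> L" unfolding R_def by blast+
          then show ?thesis using xy(1) by blast
          qed
          then show "z \<in> q \<inter> L \<times> L \<union> ?m ` (?m ` q \<inter> uminus ` R \<times> uminus ` R)" unfolding zxy Un_iff by argo
        qed
        from En_subset[OF big sub] show "En (Suc (?h + 4)) K K q" by (simp only: KLR[symmetric])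
      qed
    qed
  qed
qed

end

section \<open>Embeddings into the reals\<close>

text \<open>An element is sent to the sum of \<open>(1/2)^n\<close> over the indices n that
  enumerate a predecessor of it. If \<open>less a b\<close>, an index of \<open>a\<close> counts for
  \<open>b\<close> but not for \<open>a\<close>, which makes the inequality strict.\<close>

lemma ex_real_embedding:
  fixes X :: "'a set" and less :: "'a \<Rightarrow> 'a \<Rightarrow> bool"
  assumes X: "countable X"
    and irrefl: "\<And>a. a \<in> X \<Longrightarrow> \<not> less a a"
    and trans: "\<And>a b c. a \<in> X \<Longrightarrow> b \<in> X \<Longrightarrow> c \<in> X \<Longrightarrow> less a b \<Longrightarrow> less b c \<Longrightarrow> less a c"
    and total: "\<And>a b. a \<in> X \<Longrightarrow> b \<in> X \<Longrightarrow> a \<noteq> b \<Longrightarrow> less a b \<or> less b a"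
  shows "\<exists>\<phi> :: 'a \<Rightarrow> real. \<forall>a\<in>X. \<forall>b\<in>X. \<phi> a < \<phi> b \<longleftrightarrow> less a b"
proof -
  define t where "t a n = (if from_nat_into X n \<in> X \<and> less (from_nat_into X n) a then (1/2) ^ n else 0 :: real)" for a n
  define \<phi> where "\<phi> a = (\<Sum>n. t a n)" for a
  have sg: "summable (\<lambda>n. (1/2 :: real) ^ n)" by (rule summable_geometric) simp
  have s: "summable (t a)" for a
    by (rule summable_comparison_test'[OF sg, of 0]) (auto simp: t_def)
  have lt: "\<phi> a < \<phi> b" if ab: "a \<in> X" "b \<in> X" "less a b" for a b
  proof -
    obtain k where k: "from_nat_into X k = a" using from_nat_into_surj[OF X ab(1)] by blast
    have le: "t a n \<le> t b n" for n using trans[of "from_nat_into X n" a b] ab by (auto simp: t_def)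
    have "0 < (\<Sum>n. t b n - t a n)"
    proof (rule suminf_pos2)
      show "summable (\<lambda>n. t b n - t a n)" by (rule summable_diff[OF s s])
      show "0 \<le> t b n - t a n" for n using le[of n] by simp
      show "0 < t b k - t a k" using k ab irrefl[OF ab(1)] by (simp add: t_def)
    qed
    then show ?thesis using suminf_diff[OF s s, of b a] by (simp add: \<phi>_def)
  qed
  have "\<phi> a < \<phi> b \<longleftrightarrow> less a b" if ab: "a \<in> X" "b \<in> X" for a b
  proof
    assume l: "\<phi> a < \<phi> b"
    then have "a \<noteq> b" by auto
    moreover have "\<not> less b a" using lt[OF ab(2,1)] l by auto
    ultimately show "less a b" using total[OF ab] by blast
  qed (rule lt[OF ab])
  then show ?thesis by blast
qed

section \<open>Extending and pinning finite partial isomorphisms\<close>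

lemma Id_on_mono: "A \<subseteq> B \<Longrightarrow> Id_on A \<subseteq> Id_on B" by auto

text \<open>Points are added in increasing order; beyond the last point treated, the function is
  continued as the line through the next prescribed value.\<close>

lemma extend_strict_mono:
  fixes f :: "real \<Rightarrow> real"
  assumes "finite Y" "strict_mono_on Y f"
  shows "\<exists>h. strict_mono h \<and> (\<forall>y\<in>Y. h y = f y)"
  using assms
proof (induction Y rule: finite_linorder_max_induct)
  case empty
  show ?case by (intro exI[of _ id]) (auto simp: strict_mono_def)
next
  case (insert b A)
  have "strict_mono_on A f" using insert.prems by (rule strict_mono_on_subset) auto
  then obtain h where h: "strict_mono h" "\<forall>y\<in>A. h y = f y" using insert.IH by blast
  show ?case
  proof (cases "A = {}")
    case True
    then show ?thesis by (intro exI[of _ "\<lambda>y. f b + (y - b)"]) (auto simp: strict_mono_def)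
  next
    case False
    define a where "a = Max A"
    have a: "a \<in> A" "\<And>y. y \<in> A \<Longrightarrow> y \<le> a" using False insert.hyps(1) by (auto simp: a_def)
    have ab: "a < b" "f a < f b" using insert.hyps(2) a(1) insert.prems by (auto simp: strict_mono_on_def)
    define c where "c = (f b - f a) / (b - a)"
    have c: "c > 0" "c * (b - a) = f b - f a" using ab by (auto simp: c_def)
    define k where "k y = (if y \<le> a then h y else f a + c * (y - a))" for y
    have "strict_mono k"
    proof (rule strict_monoI)
      fix r s :: real assume rs: "r < s"
      consider "s \<le> a" | "r \<le> a" "a < s" | "a < r" using rs by linarith
      then show "k r < k s"
      proof cases
        case 1 then show ?thesis using rs h(1) by (simp add: k_def strict_mono_def)
      next
        case 2
        have "h r \<le> h a" using 2(1) h(1) by (simp add: strict_mono_less_eq)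
        also have "\<dots> = f a" using h(2) a(1) by simp
        also have "\<dots> < f a + c * (s - a)" using c(1) 2 by simp
        finally show ?thesis using 2 by (simp add: k_def)
      next
        case 3
        then show ?thesis using rs c(1) by (simp add: k_def)
      qed
    qed
    moreover have "k y = f y" if "y \<in> insert b A" for y
      using that a h(2) ab c(2) by (auto simp: k_def)
    ultimately show ?thesis by blast
  qed
qed

text \<open>Replacing \<open>B\<close> by a copy turns the position into an identity. Chains of
  orders can then be arranged so that their chosen finite parts increase as sets, and limits become
  plain unions.\<close>

lemma bf_pin:
  assumes "bf \<beta> A B p"
  shows "\<exists>h. strict_mono h \<and> (\<forall>(x, y)\<in>p. h y = x) \<and> bf \<beta> A (h ` B) (Id_on (Domain p))"
proof -
  note fin = bf_base(1)[OF assms] and sub = bf_base(2)[OF assms] and p = bf_base(3)[OF assms]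
  define f where "f y = (SOME x. (x, y) \<in> p)" for y
  have fp: "(f y, y) \<in> p" if "y \<in> Range p" for y
    using that someI_ex[of "\<lambda>x. (x, y) \<in> p"] unfolding f_def by blast
  have fx: "f y = x" if "(x, y) \<in> p" for x y using pisoD_eq[OF p fp that] that by blast
  have "strict_mono_on (Range p) f"
    by (rule strict_mono_onI) (use pisoD[OF p fp fp] in blast)
  then obtain h where h: "strict_mono h" "\<forall>y\<in>Range p. h y = f y"
    using extend_strict_mono[of "Range p" f] fin by (auto simp: finite_Range)
  have hx: "h y = x" if "(x, y) \<in> p" for x y using h(2) fx[OF that] that by blast
  have "oiso h B (h ` B)" using h(1) by (intro oiso_image) (simp add: strict_mono_on_def strict_mono_def)
  then have "bf \<beta> B (h ` B) (gr h (Range p))"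
    by (rule bf_oiso) (use sub fin in \<open>auto simp: gr_def finite_Range\<close>)
  from bf_trans[OF assms this] have "bf \<beta> A (h ` B) (p O gr h (Range p))" .
  then have "bf \<beta> A (h ` B) (Id_on (Domain p))"
    by (rule bf_subset) (use hx in \<open>force simp: gr_def\<close>)
  then show ?thesis using h(1) hx by blast
qed

section \<open>Generic limits\<close>

text \<open>Dependent choice in which a step may consult the whole history: finite histories are
  extended one entry at a time, and by \<open>loc\<close> a requirement is unaffected by later
  entries.\<close>

lemma history_choice:
  assumes loc: "\<And>k F F' s. (\<And>i. i \<le> k \<Longrightarrow> F i = F' i) \<Longrightarrow> R k F s \<Longrightarrow> R k F' s"
    and ext: "\<And>k F. F 0 = s0 \<Longrightarrow> (\<And>i. i < k \<Longrightarrow> R i F (F (Suc i))) \<Longrightarrow> \<exists>s. R k F s"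
  shows "\<exists>F. F 0 = s0 \<and> (\<forall>k. R k F (F (Suc k)))"
proof -
  have "\<exists>H. \<forall>n. (H n 0 = s0 \<and> (\<forall>i<n. R i (H n) (H n (Suc i)))) \<and> (\<forall>i\<le>n. H (Suc n) i = H n i)"
  proof (rule dependent_nat_choice)
    show "\<exists>F. F 0 = s0 \<and> (\<forall>i<0. R i F (F (Suc i)))" by (intro exI[of _ "\<lambda>_. s0"]) simp
    fix F n assume F: "F 0 = s0 \<and> (\<forall>i<n. R i F (F (Suc i)))"
    then obtain s where s: "R n F s" using ext[of F n] by blast
    let ?F = "F(Suc n := s)"
    have "R i ?F (?F (Suc i))" if "i < Suc n" for i
    proof (cases "i = n")
      case True
      then show ?thesis using loc[of n F ?F s] s by simp
    next
      case False
      then show ?thesis using loc[of i F ?F "F (Suc i)"] F that by simp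
    qed
    then show "\<exists>F'. (F' 0 = s0 \<and> (\<forall>i<Suc n. R i F' (F' (Suc i)))) \<and> (\<forall>i\<le>n. F' i = F i)"
      using F by (intro exI[of _ ?F]) auto
  qed
  then obtain H where H: "\<And>n. H n 0 = s0" "\<And>n i. i < n \<Longrightarrow> R i (H n) (H n (Suc i))"
    "\<And>n i. i \<le> n \<Longrightarrow> H (Suc n) i = H n i" by blast
  have stable: "H (n + d) i = H n i" if "i \<le> n" for n d i
    using that by (induction d) (auto simp: H(3))
  define F where "F n = H n n" for n
  have F: "H n i = F i" if "i \<le> n" for n i using stable[of i i "n - i"] that by (simp add: F_def)
  have "R k F (F (Suc k))" for k
  proof (rule loc[of k "H (Suc k)" F])
    show "R k (H (Suc k)) (F (Suc k))" using H(2)[of k "Suc k"] F[of "Suc k" "Suc k"] by simp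
  qed (use F in simp)
  then show ?thesis using H(1)[of 0] by (intro exI[of _ F]) (simp add: F_def)
qed

text \<open>Only the finite parts \<open>C k\<close> survive into the limit, not the orders
  \<open>A k\<close>. Going back is possible because later stages are equivalent over
  \<open>C k\<close>; going forth is possible because by \<open>task\<close> some later finite part
  contains an answer to each move.\<close>

lemma bf_limit:
  assumes C: "\<And>k. C k \<subseteq> A k" "\<And>k. finite (C k)" "\<And>k. C k \<subseteq> C (Suc k)"
    and m: "\<And>k. m k \<le> m (Suc k)"
    and step: "\<And>k. bf (m k) (A k) (A (Suc k)) (Id_on (C k))"
    and task: "\<And>k D \<gamma>. \<gamma> < m k \<Longrightarrow> finite D \<Longrightarrow> D \<subseteq> A k \<Longrightarrow>
      \<exists>l\<ge>k. \<exists>q. Id_on (C k) \<subseteq> q \<and> bf \<gamma> (A k) (A l) q \<and> D \<subseteq> Domain q \<and> Range q \<subseteq> C l"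
  shows "bf (m k) (A k) (\<Union>l. C l) (Id_on (C k))"
proof -
  let ?G = "\<Union>l. C l"
  have Cm: "C k \<subseteq> C l" if "k \<le> l" for k l using lift_Suc_mono_le[of C, OF C(3) that] .
  have mm: "m k \<le> m l" if "k \<le> l" for k l using lift_Suc_mono_le[of m, OF m that] .
  have steps: "bf (m k) (A k) (A l) (Id_on (C k))" if "k \<le> l" for k l
    using that
  proof (induction l rule: dec_induct)
    case base show ?case by (rule bf_Id_on[OF C(2,1)])
  next
    case (step l)
    have "bf (m k) (A k) (A (Suc l)) (Id_on (C k) O Id_on (C l))"
      by (rule bf_trans[OF step.IH bf_mono[OF mm assms(5)]]) (use step in simp)
    then show ?case by (rule bf_subset) (use Cm[of k l] step in auto)
  qed
  have "bf \<beta> (A k) ?G (Id_on (C k))" if "\<beta> \<le> m k" for \<beta> k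
    using that
  proof (induction \<beta> arbitrary: k rule: less_induct)
    case (less \<beta>)
    show ?case
    proof (rule bfI)
      show "finite (Id_on (C k))" using C(2) by (simp add: Id_on_def)
      show "Id_on (C k) \<subseteq> A k \<times> ?G" using C(1) by auto
      show "piso (Id_on (C k))" by (auto simp: piso_def)
      fix \<gamma> assume g: "\<gamma> < \<beta>"
      have lift: "bf \<gamma> (A k) ?G (q O Id_on (C l))" if "k \<le> l" "bf \<gamma> (A k) (A l) q" for l q
        by (rule bf_trans[OF that(2) less.IH[OF g]]) (use g less.prems mm[OF that(1)] in simp)
      show "\<exists>p'. Id_on (C k) \<subseteq> p' \<and> D \<subseteq> Domain p' \<and> bf \<gamma> (A k) ?G p'" if D: "finite D" "D \<subseteq> A k" for D
      proof -
        have gm: "\<gamma> < m k" using g less.prems by simp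
        obtain l q where q: "k \<le> l" "Id_on (C k) \<subseteq> q" "bf \<gamma> (A k) (A l) q" "D \<subseteq> Domain q" "Range q \<subseteq> C l"
          using task[OF gm D] by blast
        have "q O Id_on (C l) = q" using q(5) by auto
        then show ?thesis using lift[OF q(1,3)] q by auto
      qed
      show "\<exists>p'. Id_on (C k) \<subseteq> p' \<and> D \<subseteq> Range p' \<and> bf \<gamma> (A k) ?G p'" if D: "finite D" "D \<subseteq> ?G" for D
      proof -
        have "\<exists>l. D \<subseteq> C l" using D
        proof (induction D)
          case (insert x D)
          then obtain l i where "D \<subseteq> C l" "x \<in> C i" by auto
          then show ?case using Cm[of l "max l i"] Cm[of i "max l i"] by (intro exI[of _ "max l i"]) auto
        qed simp
        then obtain l0 where "D \<subseteq> C l0" by blast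
        then obtain l where l: "k \<le> l" "D \<subseteq> C l" using Cm[of l0 "max l0 k"] by (meson max.cobounded1 max.cobounded2 subset_trans)
        have "bf (m k) (A k) (A l) (Id_on (C k))" by (rule steps[OF l(1)])
        moreover have "\<gamma> < m k" using g less.prems by simp
        ultimately obtain q where q: "Id_on (C k) \<subseteq> q" "C l \<subseteq> Range q" "bf \<gamma> (A k) (A l) q"
          by (rule bf_back[OF _ _ C(2,1)])
        have "Id_on (C k) \<subseteq> q O Id_on (C l)" using q(1) Cm[OF l(1)] by auto
        moreover have "D \<subseteq> Range (q O Id_on (C l))" using q(2) l(2) by blast
        ultimately have "Id_on (C k) \<subseteq> q O Id_on (C l)" "D \<subseteq> Range (q O Id_on (C l))" by auto
        then show ?thesis using lift[OF l(1) q(3)] by blast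
      qed
    qed
  qed
  then show ?thesis by simp
qed

text \<open>Bookkeeping for \<open>bf_limit\<close> together with a requirement \<open>U\<close> at
  each stage. \<open>Uup\<close> lets a stage enlarge its finite part by the answer to a pending
  task; the third component carries data, such as the embedding of the current stage.\<close>

lemma generic_limit:
  fixes m :: "nat \<Rightarrow> ordinal" and U :: "nat \<Rightarrow> (nat \<Rightarrow> real set \<times> real set \<times> 'x) \<Rightarrow> real set \<Rightarrow> real set \<Rightarrow> 'x \<Rightarrow> bool"
  assumes m: "\<And>k. m k \<le> m (Suc k)" "\<And>k. countable {..<m k}"
    and init: "countable A0" "finite C0" "C0 \<subseteq> A0"
    and Uloc: "\<And>k F F' A C x. (\<And>i. i \<le> k \<Longrightarrow> F i = F' i) \<Longrightarrow> U k F A C x \<Longrightarrow> U k F' A C x"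
    and Uup: "\<And>k F A C x C'. countable A \<Longrightarrow> U k F A C x \<Longrightarrow> C \<subseteq> C' \<Longrightarrow> finite C' \<Longrightarrow> C' \<subseteq> A \<Longrightarrow> U k F A C' x"
    and ext: "\<And>k F A C x. F 0 = (A0, C0, x0) \<Longrightarrow> F k = (A, C, x) \<Longrightarrow> countable A \<Longrightarrow> finite C \<Longrightarrow> C \<subseteq> A \<Longrightarrow>
      (\<And>i. i < k \<Longrightarrow> U i F (fst (F (Suc i))) (fst (snd (F (Suc i)))) (snd (snd (F (Suc i))))) \<Longrightarrow>
      (\<And>i. i < k \<Longrightarrow> bf (m i) (fst (F i)) A (Id_on (fst (snd (F i))))) \<Longrightarrow>
      \<exists>A' C' x'. countable A' \<and> finite C' \<and> C' \<subseteq> A' \<and> C \<subseteq> C' \<and> bf (m k) A A' (Id_on C) \<and> U k F A' C' x'"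
  shows "\<exists>A C x. A 0 = A0 \<and> C 0 = C0 \<and> x 0 = x0 \<and>
    (\<forall>k. countable (A k) \<and> finite (C k) \<and> C k \<subseteq> A k \<and> C k \<subseteq> C (Suc k) \<and> bf (m k) (A k) (A (Suc k)) (Id_on (C k)) \<and>
      U k (\<lambda>i. (A i, C i, x i)) (A (Suc k)) (C (Suc k)) (x (Suc k)) \<and>
      bf (m k) (A k) (\<Union>l. C l) (Id_on (C k)))"
proof -
  define FA where "FA F i = fst (F i)" for F :: "nat \<Rightarrow> real set \<times> real set \<times> 'x" and i
  define FC where "FC F i = fst (snd (F i))" for F :: "nat \<Rightarrow> real set \<times> real set \<times> 'x" and i
  define tasks where "tasks A \<beta> = {D. finite D \<and> D \<subseteq> A} \<times> {..<\<beta>}" for A :: "real set" and \<beta> :: ordinal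
  \<comment> \<open>Stage k serves task number t of stage j, where k codes the pair (j, t); since j
    \<le> k, that stage is already available.\<close>
  define TR where "TR k F A' C' \<longleftrightarrow> (let j = fst (prod_decode k); s = from_nat_into (tasks (FA F j) (m j)) (snd (prod_decode k)) in
     s \<in> tasks (FA F j) (m j) \<longrightarrow> (\<exists>q. Id_on (FC F j) \<subseteq> q \<and> bf (snd s) (FA F j) A' q \<and> fst s \<subseteq> Domain q \<and> Range q \<subseteq> C'))" for k F A' C'
  have jle: "fst (prod_decode k) \<le> k" for k
    using le_prod_encode_1[of "fst (prod_decode k)" "snd (prod_decode k)"] by simp
  define R where "R k F s \<longleftrightarrow> (case s of (A', C', x') \<Rightarrow> countable A' \<and> finite C' \<and> C' \<subseteq> A' \<and> FC F k \<subseteq> C' \<and>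
     bf (m k) (FA F k) A' (Id_on (FC F k)) \<and> U k F A' C' x' \<and> TR k F A' C')" for k F s
  have "\<exists>F. F 0 = (A0, C0, x0) \<and> (\<forall>k. R k F (F (Suc k)))"
  proof (rule history_choice)
    fix k F F' s assume eq: "\<And>i. i \<le> k \<Longrightarrow> F i = F' i" and R: "R k F s"
    have "F k = F' k" "F (fst (prod_decode k)) = F' (fst (prod_decode k))" using eq jle by auto
    then show "R k F' s"
      using R Uloc[of k F F', OF eq] unfolding R_def TR_def FA_def FC_def by (auto split: prod.splits)
  next
    fix k F assume F0: "F 0 = (A0, C0, x0)" and F: "\<And>i. i < k \<Longrightarrow> R i F (F (Suc i))"
    obtain A C x where Fk: "F k = (A, C, x)" by (cases "F k")
    have ok: "countable (FA F i) \<and> finite (FC F i) \<and> FC F i \<subseteq> FA F i" if "i \<le> k" for i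
    proof (cases i)
      case 0 then show ?thesis using F0 init by (simp add: FA_def FC_def)
    next
      case (Suc j) then show ?thesis using F[of j] that by (auto simp: R_def FA_def FC_def split: prod.splits)
    qed
    have one: "FC F i \<subseteq> FC F (Suc i) \<and> bf (m i) (FA F i) (FA F (Suc i)) (Id_on (FC F i))" if "i < k" for i
      using F[OF that] by (auto simp: R_def FA_def FC_def split: prod.splits)
    have reach: "FC F i \<subseteq> FC F j \<and> bf (m i) (FA F i) (FA F j) (Id_on (FC F i))" if "i \<le> j" "j \<le> k" for i j
      using that
    proof (induction j rule: dec_induct)
      case base then show ?case using bf_Id_on ok by auto
    next
      case (step j)
      have mm: "m i \<le> m j" using lift_Suc_mono_le[of m, OF m(1)] step by blast
      have IH: "FC F i \<subseteq> FC F j" "bf (m i) (FA F i) (FA F j) (Id_on (FC F i))" using step by auto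
      have o: "FC F j \<subseteq> FC F (Suc j)" "bf (m j) (FA F j) (FA F (Suc j)) (Id_on (FC F j))" using one[of j] step by auto
      have "bf (m i) (FA F i) (FA F (Suc j)) (Id_on (FC F i) O Id_on (FC F j))"
        by (rule bf_trans[OF IH(2) bf_mono[OF mm o(2)]])
      moreover have "Id_on (FC F i) \<subseteq> Id_on (FC F i) O Id_on (FC F j)" using IH(1) by auto
      ultimately show ?case using bf_subset IH(1) o(1) by blast
    qed
    have AC: "FA F k = A" "FC F k = C" by (simp_all add: FA_def FC_def Fk)
    have "\<exists>A' C' x'. countable A' \<and> finite C' \<and> C' \<subseteq> A' \<and> C \<subseteq> C' \<and> bf (m k) A A' (Id_on C) \<and> U k F A' C' x'"
    proof (rule ext[OF F0 Fk])
      show "countable A" "finite C" "C \<subseteq> A" using ok[of k] AC by auto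
      show "U i F (fst (F (Suc i))) (fst (snd (F (Suc i)))) (snd (snd (F (Suc i))))" if "i < k" for i
        using F[OF that] by (auto simp: R_def split: prod.splits)
      show "bf (m i) (fst (F i)) A (Id_on (fst (snd (F i))))" if "i < k" for i
        using reach[of i k] that AC by (simp add: FA_def FC_def)
    qed
    then obtain A' C' x' where n: "countable A'" "finite C'" "C' \<subseteq> A'" "C \<subseteq> C'" "bf (m k) A A' (Id_on C)" "U k F A' C' x'"
      by blast
    define j where "j = fst (prod_decode k)"
    define s where "s = from_nat_into (tasks (FA F j) (m j)) (snd (prod_decode k))"
    have jk: "j \<le> k" using jle by (simp add: j_def)
    have "\<exists>C''. C' \<subseteq> C'' \<and> finite C'' \<and> C'' \<subseteq> A' \<and> TR k F A' C''"
    proof (cases "s \<in> tasks (FA F j) (m j)")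
      case True
      then have s: "finite (fst s)" "fst s \<subseteq> FA F j" "snd s < m j" by (auto simp: tasks_def)
      have mm: "m j \<le> m k" using lift_Suc_mono_le[of m, OF m(1) jk] .
      have "bf (m j) (FA F j) A' (Id_on (FC F j) O Id_on C)"
        using bf_trans[OF conjunct2[OF reach[OF jk order_refl]] bf_mono[OF mm n(5)[folded AC]]] AC by simp
      moreover have "Id_on (FC F j) \<subseteq> Id_on (FC F j) O Id_on C" using reach[OF jk order_refl] AC by auto
      ultimately have "bf (m j) (FA F j) A' (Id_on (FC F j))" by (rule bf_subset)
      then obtain q where q: "Id_on (FC F j) \<subseteq> q" "fst s \<subseteq> Domain q" "bf (snd s) (FA F j) A' q"
        by (rule bf_forth[OF _ s(3,1,2)])
      have "finite (Range q)" "Range q \<subseteq> A'" using bf_base(1,2)[OF q(3)] by (auto simp: finite_Range)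
      then show ?thesis
        using n q by (intro exI[of _ "C' \<union> Range q"]) (auto simp: TR_def Let_def j_def[symmetric] s_def[symmetric])
    next
      case False
      then show ?thesis
        using n by (intro exI[of _ C']) (auto simp: TR_def Let_def j_def[symmetric] s_def[symmetric])
    qed
    then obtain C'' where C'': "C' \<subseteq> C''" "finite C''" "C'' \<subseteq> A'" "TR k F A' C''" by blast
    have "R k F (A', C'', x')"
      unfolding R_def prod.case AC using n C'' Uup[OF n(1) n(6) C''(1,2,3)] by auto
    then show "\<exists>s. R k F s" ..
  qed
  then obtain F where F0: "F 0 = (A0, C0, x0)" and F: "\<And>k. R k F (F (Suc k))" by blast
  define x where "x i = snd (snd (F i))" for i
  have Fe: "F = (\<lambda>i. (FA F i, FC F i, x i))" by (simp add: FA_def FC_def x_def)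
  have ok: "countable (FA F i) \<and> finite (FC F i) \<and> FC F i \<subseteq> FA F i" for i
  proof (cases i)
    case 0 then show ?thesis using F0 init by (simp add: FA_def FC_def)
  next
    case (Suc j) then show ?thesis using F[of j] by (auto simp: R_def FA_def FC_def split: prod.splits)
  qed
  have one: "FC F k \<subseteq> FC F (Suc k) \<and> bf (m k) (FA F k) (FA F (Suc k)) (Id_on (FC F k)) \<and>
     U k F (FA F (Suc k)) (FC F (Suc k)) (x (Suc k)) \<and> TR k F (FA F (Suc k)) (FC F (Suc k))" for k
    using F[of k] unfolding R_def x_def by (cases "F (Suc k)") (simp add: FA_def FC_def)
  have lim: "bf (m k) (FA F k) (\<Union>l. FC F l) (Id_on (FC F k))" for k
  proof (rule bf_limit)
    fix k D \<gamma> assume D: "\<gamma> < m k" "finite D" "D \<subseteq> FA F k"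
    have "countable {D. finite D \<and> D \<subseteq> FA F k}"
      by (rule countable_Collect_finite_subset) (use ok in blast)
    then have cnt: "countable (tasks (FA F k) (m k))" unfolding tasks_def using m(2) by (intro countable_SIGMA) auto
    have mem: "(D, \<gamma>) \<in> tasks (FA F k) (m k)" using D by (simp add: tasks_def)
    from from_nat_into_surj[OF cnt mem] obtain t where t: "from_nat_into (tasks (FA F k) (m k)) t = (D, \<gamma>)" ..
    let ?l = "prod_encode (k, t)"
    have "TR ?l F (FA F (Suc ?l)) (FC F (Suc ?l))" using one by blast
    then obtain q where "Id_on (FC F k) \<subseteq> q" "bf \<gamma> (FA F k) (FA F (Suc ?l)) q" "D \<subseteq> Domain q" "Range q \<subseteq> FC F (Suc ?l)"
      using t D by (auto simp: TR_def Let_def tasks_def)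
    moreover have "k \<le> Suc ?l" using le_prod_encode_1[of k t] by simp
    ultimately show "\<exists>l\<ge>k. \<exists>q. Id_on (FC F k) \<subseteq> q \<and> bf \<gamma> (FA F k) (FA F l) q \<and> D \<subseteq> Domain q \<and> Range q \<subseteq> FC F l"
      by blast
  qed (use ok one m in auto)
  have "FA F 0 = A0" "FC F 0 = C0" "x 0 = x0" using F0 by (simp_all add: FA_def FC_def x_def)
  moreover have "U k (\<lambda>i. (FA F i, FC F i, x i)) (FA F (Suc k)) (FC F (Suc k)) (x (Suc k))" for k
    using one[of k] unfolding Fe[symmetric] by blast
  ultimately show ?thesis
    using ok one lim by (intro exI[of _ "FA F"] exI[of _ "FC F"] exI[of _ x] conjI allI) simp_all
qed

section \<open>Limits of chains of equivalent orders\<close>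

context base_level begin

lemma countable_level: "countable {..<(osuc ^^ n) \<alpha>}"
  by (rule countable_osuc_pow[OF countable_base])

text \<open>Each link \<open>\<rho> k\<close> has one level more than is retained: this level brings
  the finite part collected so far into the position. Pinning turns the links into identities
  between copies of the orders, so that the linked points persist in the limit.\<close>

lemma chain_limit:
  assumes H: "\<And>k. countable (H k)"
    and step: "\<And>k. En (Suc (n + k)) (H k) (H (Suc k)) (\<rho> k)"
  shows "\<exists>G f. countable G \<and> (\<forall>k. strict_mono (f k) \<and> En (n + k) (f k ` H k) G (Id_on (f k ` Domain (\<rho> k))) \<and>
     (\<forall>(x, z)\<in>\<rho> k. f k x = f (Suc k) z))"
proof -
  define U where "U k F A C h \<longleftrightarrow> strict_mono h \<and> A = h ` H (Suc k) \<and> h ` Domain (\<rho> (Suc k)) \<subseteq> C \<and>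
     (\<forall>(x, z)\<in>\<rho> k. snd (snd (F k)) x = h z)"
    for k and F :: "nat \<Rightarrow> real set \<times> real set \<times> (real \<Rightarrow> real)" and A C :: "real set" and h :: "real \<Rightarrow> real"
  have dom: "finite (Domain (\<rho> k))" "Domain (\<rho> k) \<subseteq> H k" for k
    using En_base(1,2)[OF step[of k]] by (auto simp: finite_Domain)
  have ex: "\<exists>A C x. A 0 = H 0 \<and> C 0 = Domain (\<rho> 0) \<and> x 0 = (\<lambda>x. x) \<and>
    (\<forall>k. countable (A k) \<and> finite (C k) \<and> C k \<subseteq> A k \<and> C k \<subseteq> C (Suc k) \<and>
      bf ((osuc ^^ (n + k)) \<alpha>) (A k) (A (Suc k)) (Id_on (C k)) \<and>
      U k (\<lambda>i. (A i, C i, x i)) (A (Suc k)) (C (Suc k)) (x (Suc k)) \<and>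
      bf ((osuc ^^ (n + k)) \<alpha>) (A k) (\<Union>l. C l) (Id_on (C k)))"
  proof (rule generic_limit)
    show "(osuc ^^ (n + k)) \<alpha> \<le> (osuc ^^ (n + Suc k)) \<alpha>" for k by (rule osuc_pow_mono) simp
    show "countable {..<(osuc ^^ (n + k)) \<alpha>}" for k by (rule countable_level)
    show "countable (H 0)" "finite (Domain (\<rho> 0))" "Domain (\<rho> 0) \<subseteq> H 0" using H dom by auto
    show "U k F' A C x" if "\<And>i. i \<le> k \<Longrightarrow> F i = F' i" "U k F A C x" for k F F' A C x
      using that by (simp add: U_def)
    show "U k F A C' x" if "countable A" "U k F A C x" "C \<subseteq> C'" for k F A C x C'
      using that by (auto simp: U_def)
    fix k F A C h assume F0: "F 0 = (H 0, Domain (\<rho> 0), \<lambda>x. x)" and Fk: "F k = (A, C, h)"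
      and A: "countable A" "finite C" "C \<subseteq> A"
      and hist: "\<And>i. i < k \<Longrightarrow> U i F (fst (F (Suc i))) (fst (snd (F (Suc i)))) (snd (snd (F (Suc i))))"
    have h: "strict_mono h" "A = h ` H k"
    proof -
      have "strict_mono h \<and> A = h ` H k"
      proof (cases k)
        case 0 then show ?thesis using F0 Fk by (auto simp: strict_mono_def)
      next
        case (Suc j) then show ?thesis using hist[of j] Fk by (auto simp: U_def)
      qed
      then show "strict_mono h" "A = h ` H k" by auto
    qed
    have "oiso h (H k) A" using h by (auto simp: oiso_def strict_mono_on_def strict_mono_def)
    then have "En (Suc (n + k)) (H k) A (gr h (Domain (\<rho> k)))"
      by (rule En_oiso) (use dom[of k] in \<open>auto simp: gr_def\<close>)
    from En_trans[OF En_converse[OF this] step]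
    have "En (Suc (n + k)) A (H (Suc k)) ((gr h (Domain (\<rho> k)))\<inverse> O \<rho> k)" .
    then obtain p where p: "(gr h (Domain (\<rho> k)))\<inverse> O \<rho> k \<subseteq> p" "C \<subseteq> Domain p" "En (n + k) A (H (Suc k)) p"
      by (rule En_forth[OF _ A(2,3)])
    obtain h' where h': "strict_mono h'" "\<forall>(x, y)\<in>p. h' y = x" "En (n + k) A (h' ` H (Suc k)) (Id_on (Domain p))"
      using bf_pin[OF p(3)[unfolded En_def]] unfolding En_def by blast
    \<comment> \<open>The domain of the next link is put into the finite part in advance, so that
      its points reach the limit.\<close>
    let ?C = "Domain p \<union> h' ` Domain (\<rho> (Suc k))"
    have "Domain p \<subseteq> h' ` H (Suc k)" using h'(2) En_base(2)[OF p(3)] by force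
    then have C: "finite ?C" "?C \<subseteq> h' ` H (Suc k)" using dom[of "Suc k"] En_base(1)[OF p(3)] by (auto simp: finite_Domain)
    have "h x = h' z" if "(x, z) \<in> \<rho> k" for x z
    proof -
      have "(h x, z) \<in> (gr h (Domain (\<rho> k)))\<inverse> O \<rho> k" using that by (auto simp: gr_def)
      then show ?thesis using p(1) h'(2) by auto
    qed
    then have "U k F (h' ` H (Suc k)) ?C h'" using h' Fk by (auto simp: U_def)
    moreover have "bf ((osuc ^^ (n + k)) \<alpha>) A (h' ` H (Suc k)) (Id_on C)"
      by (rule En_subset[OF h'(3), unfolded En_def]) (use p(2) in auto)
    ultimately show "\<exists>A' C' x'. countable A' \<and> finite C' \<and> C' \<subseteq> A' \<and> C \<subseteq> C' \<and>
        bf ((osuc ^^ (n + k)) \<alpha>) A A' (Id_on C) \<and> U k F A' C' x'"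
      using C H p(2) by (intro exI[of _ "h' ` H (Suc k)"] exI[of _ ?C] exI[of _ h']) auto
  qed
  from ex[folded En_def] obtain A C x where ACx: "A 0 = H 0 \<and> C 0 = Domain (\<rho> 0) \<and> x 0 = (\<lambda>x. x) \<and>
    (\<forall>k. countable (A k) \<and> finite (C k) \<and> C k \<subseteq> A k \<and> C k \<subseteq> C (Suc k) \<and>
      En (n + k) (A k) (A (Suc k)) (Id_on (C k)) \<and>
      U k (\<lambda>i. (A i, C i, x i)) (A (Suc k)) (C (Suc k)) (x (Suc k)) \<and>
      En (n + k) (A k) (\<Union>l. C l) (Id_on (C k)))" by (elim exE)
  then have AC: "A 0 = H 0" "C 0 = Domain (\<rho> 0)" "x 0 = (\<lambda>x. x)" by simp_all
  have all: "countable (A k) \<and> finite (C k) \<and> C k \<subseteq> A k \<and>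
      U k (\<lambda>i. (A i, C i, x i)) (A (Suc k)) (C (Suc k)) (x (Suc k)) \<and>
      En (n + k) (A k) (\<Union>l. C l) (Id_on (C k))" for k using ACx by simp
  have x: "strict_mono (x k) \<and> A k = x k ` H k \<and> x k ` Domain (\<rho> k) \<subseteq> C k" for k
  proof (cases k)
    case 0 then show ?thesis using AC by (auto simp: strict_mono_def)
  next
    case (Suc j) then show ?thesis using all[of j] by (auto simp: U_def)
  qed
  have "strict_mono (x k) \<and> En (n + k) (x k ` H k) (\<Union>l. C l) (Id_on (x k ` Domain (\<rho> k))) \<and>
     (\<forall>(y, z)\<in>\<rho> k. x k y = x (Suc k) z)" for k
  proof (intro conjI)
    have "En (n + k) (A k) (\<Union>l. C l) (Id_on (x k ` Domain (\<rho> k)))"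
    proof (rule En_subset[OF _ Id_on_mono])
      show "En (n + k) (A k) (\<Union>l. C l) (Id_on (C k))" using all[of k] by blast
      show "x k ` Domain (\<rho> k) \<subseteq> C k" using x[of k] by (rule conjunct2[OF conjunct2])
    qed
    then show "En (n + k) (x k ` H k) (\<Union>l. C l) (Id_on (x k ` Domain (\<rho> k)))" using x[of k] by simp
    show "strict_mono (x k)" using x by blast
    show "\<forall>(y, z)\<in>\<rho> k. x k y = x (Suc k) z" using all[of k] by (simp add: U_def)
  qed
  moreover have "countable (\<Union>l. C l)" using all by (auto intro: countable_finite)
  ultimately show ?thesis by blast
qed

end

context base_level begin

section \<open>Monotone sequences of complicated intervals\<close>

text \<open>The function \<open>r\<close> prescribes which levels the intervals must exceed: a
  constant asks for infinitely many intervals above a fixed level, the identity for unbounded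
  levels.\<close>

definition inc :: "(nat \<Rightarrow> nat) \<Rightarrow> real set \<Rightarrow> bool" where
  "inc r I \<longleftrightarrow> (\<exists>a. \<forall>k. a k \<in> I \<and> a k < a (Suc k) \<and> \<not> hom (r k) (I \<inter> {a k<..<a (Suc k)}))"

definition dec :: "(nat \<Rightarrow> nat) \<Rightarrow> real set \<Rightarrow> bool" where
  "dec r I \<longleftrightarrow> (\<exists>a. \<forall>k. a k \<in> I \<and> a (Suc k) < a k \<and> \<not> hom (r k) (I \<inter> {a (Suc k)<..<a k}))"

lemma inc_uminus: "dec r I \<Longrightarrow> inc r (uminus ` I)"
proof -
  assume "dec r I"
  then obtain a where "\<And>k. a k \<in> I \<and> a (Suc k) < a k \<and> \<not> hom (r k) (I \<inter> {a (Suc k)<..<a k})"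
    unfolding dec_def by blast
  then show ?thesis unfolding inc_def
    by (intro exI[of _ "\<lambda>k. - a k"]) (auto simp: uminus_Int_image hom_uminus_iff)
qed

lemma dec_uminus: "inc r I \<Longrightarrow> dec r (uminus ` I)"
proof -
  assume "inc r I"
  then obtain a where "\<And>k. a k \<in> I \<and> a k < a (Suc k) \<and> \<not> hom (r k) (I \<inter> {a k<..<a (Suc k)})"
    unfolding inc_def by blast
  then show ?thesis unfolding dec_def
    by (intro exI[of _ "\<lambda>k. - a k"]) (auto simp: uminus_Int_image hom_uminus_iff)
qed

lemma inc_uminus_iff: "inc r (uminus ` I) \<longleftrightarrow> dec r I"
  using inc_uminus dec_uminus uminus_image2 by metis

lemma dec_uminus_iff: "dec r (uminus ` I) \<longleftrightarrow> inc r I"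
  using inc_uminus dec_uminus uminus_image2 by metis

lemma incI:
  assumes "z0 \<in> R" "R \<subseteq> I" "\<And>z k. z \<in> R \<Longrightarrow> \<exists>w\<in>R. z < w \<and> \<not> hom (r k) (I \<inter> {z<..<w})"
  shows "inc r I"
proof -
  have "\<exists>a. \<forall>k. a k \<in> R \<and> a k < a (Suc k) \<and> \<not> hom (r k) (I \<inter> {a k<..<a (Suc k)})"
    by (rule dependent_nat_choice) (use assms in blast)+
  then show ?thesis using assms(2) unfolding inc_def by blast
qed

lemma decI:
  assumes "z0 \<in> R" "R \<subseteq> I" "\<And>z k. z \<in> R \<Longrightarrow> \<exists>w\<in>R. w < z \<and> \<not> hom (r k) (I \<inter> {w<..<z})"
  shows "dec r I"
proof -
  have "\<exists>a. \<forall>k. a k \<in> R \<and> a (Suc k) < a k \<and> \<not> hom (r k) (I \<inter> {a (Suc k)<..<a k})"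
    by (rule dependent_nat_choice) (use assms in blast)+
  then show ?thesis using assms(2) unfolding dec_def by blast
qed

lemma inc_mono: "inc r' I \<Longrightarrow> (\<And>k. r k \<le> r' k) \<Longrightarrow> inc r I"
  unfolding inc_def using hom_mono by meson

lemma dec_mono: "dec r' I \<Longrightarrow> (\<And>k. r k \<le> r' k) \<Longrightarrow> dec r I"
  unfolding dec_def using hom_mono by meson

lemma dec_convex:
  assumes "dec r J" "J \<subseteq> I" "\<And>x y z. x \<in> J \<Longrightarrow> y \<in> J \<Longrightarrow> z \<in> I \<Longrightarrow> x < z \<Longrightarrow> z < y \<Longrightarrow> z \<in> J"
  shows "dec r I"
proof -
  obtain a where a: "\<And>k. a k \<in> J \<and> a (Suc k) < a k \<and> \<not> hom (r k) (J \<inter> {a (Suc k)<..<a k})"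
    using assms(1) unfolding dec_def by blast
  have "J \<inter> {a (Suc k)<..<a k} = I \<inter> {a (Suc k)<..<a k}" for k
    using a[of k] a[of "Suc k"] assms(2) assms(3)[of "a (Suc k)" "a k"] by auto
  then show ?thesis using a assms(2) unfolding dec_def by (intro exI[of _ a]) auto
qed

lemma inc_isom: "isom I J \<Longrightarrow> inc r I \<Longrightarrow> inc r J"
proof -
  assume "isom I J" "inc r I"
  then obtain f a where f: "oiso f I J" and a: "\<And>k. a k \<in> I \<and> a k < a (Suc k) \<and> \<not> hom (r k) (I \<inter> {a k<..<a (Suc k)})"
    unfolding inc_def isom_def by blast
  have "\<not> hom (r k) (J \<inter> {f (a k)<..<f (a (Suc k))})" for k
    using hom_isom_iff[OF oiso_isom[OF oiso_between[OF f, of "a k" "a (Suc k)"]]] a by auto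
  then show ?thesis using a f unfolding inc_def oiso_def
    by (intro exI[of _ "\<lambda>k. f (a k)"]) (auto simp: strict_mono_on_def)
qed

lemma dec_isom: "isom I J \<Longrightarrow> dec r I \<Longrightarrow> dec r J"
  using inc_isom[OF isom_uminus] inc_uminus_iff by blast

text \<open>Without a decreasing sequence, every nonempty set of points has an element that is
  separated from the lower members by simple intervals only. Choosing such elements repeatedly among
  the ends of complicated intervals builds an increasing sequence, unless the order is
  homogeneous.\<close>

lemma hom_of_no_sequence:
  assumes I: "countable I" and ni: "\<not> inc (\<lambda>_. j) I" and nd: "\<not> dec (\<lambda>_. j) I"
  shows "hom (j + 4) I"
proof (rule ccontr)
  assume nh: "\<not> hom (j + 4) I"
  have cI: "countable (I \<inter> S)" for S using I by (rule countable_Int1)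
  have least: "\<exists>x\<in>R. \<forall>y\<in>R. y < x \<longrightarrow> hom j (I \<inter> {y<..<x})" if "R \<subseteq> I" "z0 \<in> R" for R z0
    using decI[OF that(2,1), of "\<lambda>_. j"] nd by blast
  define G where "G = {x\<in>I. hom (j + 4) (I \<inter> {..<x})}"
  have "I \<noteq> {}" using nh hom_empty by blast
  then obtain x1 where x1: "x1 \<in> I" "\<And>y. y \<in> I \<Longrightarrow> y < x1 \<Longrightarrow> hom j (I \<inter> {y<..<x1})"
    using least[OF order_refl] by blast
  have "hom (j + 4) (I \<inter> {..<x1})"
  proof (rule hom_limit_above[OF cI])
    fix x assume x: "x \<in> I \<inter> {..<x1}"
    have "I \<inter> {..<x1} \<inter> {x<..} = I \<inter> {x<..<x1}" by auto
    then show "hom j (I \<inter> {..<x1} \<inter> {x<..})" using x1(2) x by simp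
  qed
  then have "x1 \<in> G" using x1(1) by (simp add: G_def)
  have "inc (\<lambda>_. j) I"
  proof (rule incI[OF \<open>x1 \<in> G\<close>])
    show "G \<subseteq> I" by (auto simp: G_def)
    fix x and k :: nat assume xG: "x \<in> G"
    then have x: "x \<in> I" "hom (j + 4) (I \<inter> {..<x})" by (auto simp: G_def)
    define R where "R = {z\<in>I. x < z \<and> \<not> hom j (I \<inter> {x<..<z})}"
    have "R \<noteq> {}"
    proof
      assume R: "R = {}"
      have "hom (j + 4) (I \<inter> {x<..})"
      proof (rule hom_limit[OF cI])
        fix z assume z: "z \<in> I \<inter> {x<..}"
        have "I \<inter> {x<..} \<inter> {..<z} = I \<inter> {x<..<z}" by auto
        then show "hom j (I \<inter> {x<..} \<inter> {..<z})" using R z by (auto simp: R_def)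
      qed
      then show False using hom_join[OF x] nh by blast
    qed
    then obtain z where z: "z \<in> R" "\<And>w. w \<in> R \<Longrightarrow> w < z \<Longrightarrow> hom j (I \<inter> {w<..<z})"
      using least[of R] by (auto simp: R_def)
    have zI: "z \<in> I" "x < z" "\<not> hom j (I \<inter> {x<..<z})" using z(1) by (auto simp: R_def)
    \<comment> \<open>A point \<open>w\<close> of the interval that is not simple from
      \<open>x\<close> belongs to \<open>R\<close>, hence is simple up to \<open>z\<close> by the
      choice of \<open>z\<close>: the interval is cut into two simple parts.\<close>
    have "hom (max j j + 4) (I \<inter> {x<..<z})"
    proof (rule hom_cut[OF cI])
      fix w assume w: "w \<in> I \<inter> {x<..<z}" "\<not> hom j (I \<inter> {x<..<z} \<inter> {..<w})"
      have "I \<inter> {x<..<z} \<inter> {..<w} = I \<inter> {x<..<w}" "I \<inter> {x<..<z} \<inter> {w<..} = I \<inter> {w<..<z}" using w by auto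
      then show "hom j (I \<inter> {x<..<z} \<inter> {w<..})" using z(2)[of w] w by (auto simp: R_def)
    qed
    then have "z \<in> G" using hom_join_below[OF x(2) _ x(1) zI(2)] zI(1) by (simp add: G_def)
    then show "\<exists>w\<in>G. x < w \<and> \<not> hom j (I \<inter> {x<..<w})" using zI by blast
  qed
  then show False using ni by blast
qed

definition unb :: "real set \<Rightarrow> bool" where
  "unb J \<longleftrightarrow> (\<forall>k. \<exists>x\<in>J. low (J \<inter> {..<x}) \<and> \<not> hom k (J \<inter> {..<x}))"

text \<open>If the low initial segments have a common bound k, \<open>hom_limit\<close> produces a
  point with a non-low initial segment. By \<open>hom_cut\<close> there is below each such point
  another one with a complicated interval in between, whatever level \<open>r\<close>
  demands.\<close>

lemma not_low_cases:
  assumes J: "countable J" "\<not> low J" and nu: "\<not> unb J"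
  shows "dec r J"
proof -
  have cJ: "countable (J \<inter> S)" for S using J(1) by (rule countable_Int1)
  obtain k where k: "\<And>x. x \<in> J \<Longrightarrow> low (J \<inter> {..<x}) \<Longrightarrow> hom k (J \<inter> {..<x})"
    using nu unfolding unb_def by blast
  define R where "R = {x\<in>J. \<not> low (J \<inter> {..<x})}"
  have "R \<noteq> {}"
  proof
    assume "R = {}"
    then have "hom (k + 4) J" using k by (intro hom_limit[OF J(1)]) (auto simp: R_def)
    then show False using J(2) by (auto simp: low_def)
  qed
  then obtain z0 where "z0 \<in> R" by blast
  then show ?thesis
  proof (rule decI)
    show "R \<subseteq> J" by (auto simp: R_def)
    fix z i assume zR: "z \<in> R"
    show "\<exists>w\<in>R. w < z \<and> \<not> hom (r i) (J \<inter> {w<..<z})"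
    proof (rule ccontr)
      assume n: "\<not> ?thesis"
      have "hom (max k (r i) + 4) (J \<inter> {..<z})"
      proof (rule hom_cut[OF cJ])
        fix w assume w: "w \<in> J \<inter> {..<z}" "\<not> hom k (J \<inter> {..<z} \<inter> {..<w})"
        have e: "J \<inter> {..<z} \<inter> {..<w} = J \<inter> {..<w}" "J \<inter> {..<z} \<inter> {w<..} = J \<inter> {w<..<z}" using w by auto
        have "w \<in> R" using w k[of w] by (auto simp: R_def e)
        then show "hom (r i) (J \<inter> {..<z} \<inter> {w<..})" using n w by (auto simp: e)
      qed
      then show False using zR by (auto simp: R_def low_def)
    qed
  qed
qed

text \<open>A level beyond that of the part below \<open>x\<close> can only come from above
  \<open>x\<close>, since joining at \<open>x\<close> does not raise levels.\<close>

lemma unb_above: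
  assumes u: "unb J" and x: "x \<in> J" "low (J \<inter> {..<x})"
  shows "\<exists>y\<in>J. x < y \<and> low (J \<inter> {..<y}) \<and> \<not> hom k (J \<inter> {x<..<y}) \<and> \<not> hom k (J \<inter> {..<y})"
proof -
  obtain m where m: "hom m (J \<inter> {..<x})" using x(2) by (auto simp: low_def)
  obtain y where y: "y \<in> J" "low (J \<inter> {..<y})" "\<not> hom (max m k) (J \<inter> {..<y})"
    using u unfolding unb_def by blast
  have xy: "x < y"
  proof (rule ccontr)
    assume "\<not> x < y"
    have "hom m (J \<inter> {..<y})"
    proof (cases "y = x")
      case False
      have "hom m (J \<inter> {..<x} \<inter> {..<y})" by (rule hom_below[OF m]) (use y \<open>\<not> x < y\<close> False in auto)
      moreover have "J \<inter> {..<x} \<inter> {..<y} = J \<inter> {..<y}" using \<open>\<not> x < y\<close> by auto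
      ultimately show ?thesis by simp
    qed (use m in simp)
    then show False using y(3) hom_mono[of m "max m k"] by simp
  qed
  have "\<not> hom k (J \<inter> {x<..<y})"
  proof
    assume "hom k (J \<inter> {x<..<y})"
    then have "hom (max m k) (J \<inter> {..<y})"
      using hom_join_below[OF hom_mono[OF _ m] hom_mono x(1) xy, of "max m k" k] by simp
    then show False using y(3) by simp
  qed
  moreover have "\<not> hom k (J \<inter> {..<y})" using y(3) hom_mono[of k "max m k"] by auto
  ultimately show ?thesis using y xy by blast
qed

lemma unb_ex: assumes "unb J" shows "\<exists>x\<in>J. low (J \<inter> {..<x})"
  using assms unfolding unb_def by blast

lemma unb_inc:
  assumes "unb J" shows "inc r J"
proof -
  obtain x where "x \<in> {x\<in>J. low (J \<inter> {..<x})}" using unb_ex[OF assms] by blast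
  then show ?thesis
  proof (rule incI)
    fix z k assume "z \<in> {x\<in>J. low (J \<inter> {..<x})}"
    then have "\<exists>y\<in>J. z < y \<and> low (J \<inter> {..<y}) \<and> \<not> hom (r k) (J \<inter> {z<..<y}) \<and> \<not> hom (r k) (J \<inter> {..<y})"
      by (intro unb_above[OF assms]) auto
    then show "\<exists>w\<in>{x\<in>J. low (J \<inter> {..<x})}. z < w \<and> \<not> hom (r k) (J \<inter> {z<..<w})" by blast
  qed blast
qed

section \<open>Few equivalence classes and generic models\<close>

definition cls :: "real set \<Rightarrow> real set set" where
  "cls M = {N. countable N \<and> En 0 M N {}}"

text \<open>All that is retained of having few models: one countable list meets every class for the
  intersection of all levels. The diagonal arguments run through this list.\<close>

definition thin :: "real set \<Rightarrow> bool" where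
  "thin M \<longleftrightarrow> countable M \<and>
     (\<exists>R :: nat \<Rightarrow> real set. (\<forall>j. countable (R j)) \<and> (\<forall>N\<in>cls M. \<exists>j. \<forall>n. En n N (R j) {}))"

lemma cls_En: "N \<in> cls M \<Longrightarrow> countable N' \<Longrightarrow> En n N N' {} \<Longrightarrow> N' \<in> cls M"
  unfolding cls_def using En_trans0 En_mono[of 0 n] by blast

lemma cls_uminus: "N \<in> cls (uminus ` M) \<Longrightarrow> uminus ` N \<in> cls M"
  unfolding cls_def using En_uminus0[of 0 "uminus ` M" N] by (simp add: uminus_image2)

lemma thin_uminus: "thin M \<Longrightarrow> thin (uminus ` M)"
proof -
  assume thin: "thin M"
  from thin obtain R :: "nat \<Rightarrow> real set" where R: "\<forall>j. countable (R j)" "\<forall>N\<in>cls M. \<exists>j. \<forall>n. En n N (R j) {}"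
    unfolding thin_def by auto
  have "\<forall>N\<in>cls (uminus ` M). \<exists>j. \<forall>n. En n N (uminus ` R j) {}"
  proof
    fix N assume "N \<in> cls (uminus ` M)"
    from bspec[OF R(2) cls_uminus[OF this]] obtain j where j: "\<forall>n. En n (uminus ` N) (R j) {}" ..
    have "En n N (uminus ` R j) {}" for n using En_uminus0[OF spec[OF j, of n]] by (simp only: uminus_image2)
    then show "\<exists>j. \<forall>n. En n N (uminus ` R j) {}" by blast
  qed
  moreover have "countable (uminus ` M)" "\<forall>j. countable (uminus ` R j)" using thin R(1) by (auto simp: thin_def)
  ultimately show ?thesis unfolding thin_def by (intro conjI exI[of _ "\<lambda>j. uminus ` R j"])
qed

text \<open>
  A condition is a structure \<open>A\<close> with a finite \<open>C \<subseteq> A\<close>, regarded up to level \<open>m\<close>; \<open>ext m A C \<tau> A' C'\<close> says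
  that \<open>(A', C')\<close> extends \<open>(A, C)\<close> along the partial map \<open>\<tau>\<close>. A condition decides \<open>X \<subseteq> C\<close> if it settles
  which finite configurations over \<open>X\<close> are realised in every generic structure below it.
\<close>

definition ext :: "nat \<Rightarrow> real set \<Rightarrow> real set \<Rightarrow> (real \<times> real) set \<Rightarrow> real set \<Rightarrow> real set \<Rightarrow> bool" where
  "ext m A C \<tau> A' C' \<longleftrightarrow> countable A' \<and> finite C' \<and> C' \<subseteq> A' \<and> Domain \<tau> = C \<and> Range \<tau> \<subseteq> C' \<and> En m A A' \<tau>"

text \<open>The pair (\<open>B\<close>, \<open>Y\<close>) names a type: a finite set
  \<open>Y\<close> with its position in \<open>B\<close> up to level m. The relation
  \<open>\<sigma>\<close> fixes the places of those points of \<open>Y\<close> that are already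
  assigned.\<close>

definition real_over :: "nat \<Rightarrow> real set \<Rightarrow> real set \<Rightarrow> (real \<times> real) set \<Rightarrow> real set \<Rightarrow> real set \<Rightarrow> bool" where
  "real_over m B Y \<sigma> A C \<longleftrightarrow> (\<exists>q. \<sigma> \<subseteq> q \<and> Domain q = Y \<and> Range q \<subseteq> C \<and> En m B A q)"

definition decides :: "nat \<Rightarrow> real set \<Rightarrow> real set \<Rightarrow> real set \<Rightarrow> bool" where
  "decides m A C X \<longleftrightarrow> (\<forall>B Y \<sigma>. Range \<sigma> \<subseteq> X \<longrightarrow>
     (\<forall>\<tau> A' C'. ext m A C \<tau> A' C' \<longrightarrow> (\<exists>\<tau>' A'' C''. ext m A' C' \<tau>' A'' C'' \<and> real_over m B Y (\<sigma> O \<tau> O \<tau>') A'' C'')) \<or>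
     (\<forall>\<tau> A' C'. ext m A C \<tau> A' C' \<longrightarrow> \<not> real_over m B Y (\<sigma> O \<tau>) A' C'))"

lemma ext_trans: "ext m A C \<tau> A' C' \<Longrightarrow> ext m A' C' \<tau>' A'' C'' \<Longrightarrow> ext m A C (\<tau> O \<tau>') A'' C''"
proof -
  assume e: "ext m A C \<tau> A' C'" "ext m A' C' \<tau>' A'' C''"
  then have "Range \<tau> \<subseteq> Domain \<tau>'" "Domain \<tau> = C" by (auto simp: ext_def)
  then have "Domain (\<tau> O \<tau>') = C" by fast
  moreover have "En m A A'' (\<tau> O \<tau>')" using e En_trans by (auto simp: ext_def)
  ultimately show ?thesis using e unfolding ext_def by auto
qed

text \<open>Configurations over the image of \<open>X\<close> are pulled back along the injective
  \<open>\<tau>0\<close> to configurations over \<open>X\<close>; extensions of the later condition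
  compose with \<open>\<tau>0\<close> to extensions of the earlier one.\<close>

lemma decides_ext: 
  assumes d: "decides m A C X" and e: "ext m A C \<tau>0 A2 C2" and X: "X \<subseteq> C"
  shows "decides m A2 C2 (\<tau>0 `` X)"
  unfolding decides_def
proof (intro allI impI)
  fix B Y and \<sigma> :: "(real \<times> real) set" assume s: "Range \<sigma> \<subseteq> \<tau>0 `` X"
  let ?s = "\<sigma> O \<tau>0\<inverse>"
  have p: "piso \<tau>0" using e En_base(3) by (auto simp: ext_def)
  have fn: "\<tau>0\<inverse> O \<tau>0 \<subseteq> Id" using pisoD_eq[OF p] by blast
  have inj: "x = x'" if "(x, y) \<in> \<tau>0" "(x', y) \<in> \<tau>0" for x x' y using pisoD_eq[OF p that] by simp
  have ss: "?s O \<tau>0 = \<sigma>"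
  proof
    show "?s O \<tau>0 \<subseteq> \<sigma>" using fn by blast
    show "\<sigma> \<subseteq> ?s O \<tau>0"
    proof
      fix z assume "z \<in> \<sigma>"
      moreover obtain b y where z: "z = (b, y)" by (cases z)
      ultimately have "(b, y) \<in> \<sigma>" "y \<in> \<tau>0 `` X" using s by auto
      then obtain x where "(b, y) \<in> \<sigma>" "(x, y) \<in> \<tau>0" by blast
      then show "z \<in> ?s O \<tau>0" unfolding z by blast
    qed
  qed
  have rs: "Range ?s \<subseteq> X" using s inj by blast
  have c: "?s O (\<tau>0 O \<tau>) = \<sigma> O \<tau>" for \<tau> :: "(real \<times> real) set" by (simp only: O_assoc[symmetric] ss)
  have c': "?s O (\<tau>0 O \<tau>) O \<tau>' = \<sigma> O \<tau> O \<tau>'" for \<tau> \<tau>' :: "(real \<times> real) set"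
    by (simp only: O_assoc[symmetric] ss)
  from d rs consider
    "\<forall>\<tau> A' C'. ext m A C \<tau> A' C' \<longrightarrow> (\<exists>\<tau>' A'' C''. ext m A' C' \<tau>' A'' C'' \<and> real_over m B Y (?s O \<tau> O \<tau>') A'' C'')"
    | "\<forall>\<tau> A' C'. ext m A C \<tau> A' C' \<longrightarrow> \<not> real_over m B Y (?s O \<tau>) A' C'"
    unfolding decides_def by blast
  then show "(\<forall>\<tau> A' C'. ext m A2 C2 \<tau> A' C' \<longrightarrow> (\<exists>\<tau>' A'' C''. ext m A' C' \<tau>' A'' C'' \<and> real_over m B Y (\<sigma> O \<tau> O \<tau>') A'' C'')) \<or>
     (\<forall>\<tau> A' C'. ext m A2 C2 \<tau> A' C' \<longrightarrow> \<not> real_over m B Y (\<sigma> O \<tau>) A' C')"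
  proof cases
    case 1
    have "\<exists>\<tau>' A'' C''. ext m A' C' \<tau>' A'' C'' \<and> real_over m B Y (\<sigma> O \<tau> O \<tau>') A'' C''" if "ext m A2 C2 \<tau> A' C'" for \<tau> A' C'
      using spec[OF spec[OF spec[OF 1, of "\<tau>0 O \<tau>"], of A'], of C'] ext_trans[OF e that] by (simp only: c')
    then show ?thesis by blast
  next
    case 2
    have "\<not> real_over m B Y (\<sigma> O \<tau>) A' C'" if "ext m A2 C2 \<tau> A' C'" for \<tau> A' C'
      using spec[OF spec[OF spec[OF 2, of "\<tau>0 O \<tau>"], of A'], of C'] ext_trans[OF e that] by (simp only: c) blast
    then show ?thesis by blast
  qed
qed

lemma ext_Id: "countable A' \<Longrightarrow> finite C' \<Longrightarrow> C' \<subseteq> A' \<Longrightarrow> C \<subseteq> C' \<Longrightarrow> En m A A' (Id_on C) \<Longrightarrow> ext m A C (Id_on C) A' C'"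
  unfolding ext_def by auto

lemma real_over_mono:
  assumes "real_over m B Y \<sigma> A C" "\<sigma>' \<subseteq> \<sigma>" "C \<subseteq> C'"
  shows "real_over m B Y \<sigma>' A C'"
proof -
  obtain q where "\<sigma> \<subseteq> q" "Domain q = Y" "Range q \<subseteq> C" "En m B A q"
    using assms(1) unfolding real_over_def by blast
  then show ?thesis unfolding real_over_def using assms(2,3) by (intro exI[of _ q]) auto
qed

lemma decides_more:
  assumes "decides m A C X" "X \<subseteq> C" "C \<subseteq> C'" "countable A" "finite C'" "C' \<subseteq> A"
  shows "decides m A C' X"
proof -
  have "ext m A C (Id_on C) A C'"
    using assms by (intro ext_Id En_Id_on) (auto intro: finite_subset)
  from decides_ext[OF assms(1) this assms(2)] show ?thesis
  proof -
    have "Id_on C `` X = X" using assms(2) by auto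
    then show ?thesis using decides_ext[OF assms(1) \<open>ext m A C (Id_on C) A C'\<close> assms(2)] by simp
  qed
qed

text \<open>An extension of the larger condition restricts to one of the smaller condition, so a
  configuration excluded once stays excluded.\<close>

lemma never_more:
  assumes n: "\<And>\<tau> A' C'. ext m A C \<tau> A' C' \<Longrightarrow> \<not> real_over m B Y (\<sigma> O \<tau>) A' C'"
    and C: "C \<subseteq> D" "Range \<sigma> \<subseteq> C" and e: "ext m A D \<tau> A' C'"
  shows "\<not> real_over m B Y (\<sigma> O \<tau>) A' C'"
proof -
  have "ext m A C (Id_on C O \<tau>) A' C'"
  proof -
    have "C \<subseteq> Domain \<tau>" using e C(1) by (simp add: ext_def)
    then have "Domain (Id_on C O \<tau>) = C" by fast
    moreover have "En m A A' (Id_on C O \<tau>)" by (rule En_subset[of m A A' \<tau>]) (use e in \<open>auto simp: ext_def\<close>)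
    ultimately show ?thesis using e unfolding ext_def by auto
  qed
  from n[OF this] have "\<not> real_over m B Y (\<sigma> O Id_on C O \<tau>) A' C'" .
  moreover have "\<sigma> O Id_on C O \<tau> = \<sigma> O \<tau>" using C(2) by fast
  ultimately show ?thesis by simp
qed

text \<open>\<open>generic_limit\<close> proceeds by identities, while extensions of conditions come
  with arbitrary maps; an isomorphic copy reconciles the two. Extensions of the copy are led back to
  extensions of the original, so that exclusions survive the renaming.\<close>

lemma ext_pin:
  assumes "ext m A C \<tau> A' C'"
  shows "\<exists>h. strict_mono h \<and> (\<forall>(x, y)\<in>\<tau>. h y = x) \<and> ext m A C (Id_on C) (h ` A') (h ` C') \<and>
    (\<forall>\<tau>' A'' C''. ext m (h ` A') (h ` C') \<tau>' A'' C'' \<longrightarrow> ext m A' C' (gr h C' O \<tau>') A'' C'')"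
proof -
  from assms have e: "countable A'" "finite C'" "C' \<subseteq> A'" "Domain \<tau> = C" "Range \<tau> \<subseteq> C'" "En m A A' \<tau>"
    by (auto simp: ext_def)
  obtain h where h: "strict_mono h" "\<forall>(x, y)\<in>\<tau>. h y = x" "En m A (h ` A') (Id_on C)"
    using bf_pin[OF e(6)[unfolded En_def]] e(4) unfolding En_def by blast
  have "C \<subseteq> h ` C'"
  proof
    fix x assume "x \<in> C"
    then obtain y where "(x, y) \<in> \<tau>" using e(4) by blast
    then show "x \<in> h ` C'" using h(2) e(5) by auto
  qed
  then have 1: "ext m A C (Id_on C) (h ` A') (h ` C')"
    using e h(3) by (intro ext_Id) auto
  have "oiso h A' (h ` A')" using h(1) by (intro oiso_image) (simp add: strict_mono_on_def strict_mono_def)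
  then have E: "En m A' (h ` A') (gr h C')" by (rule En_oiso) (use e in \<open>auto simp: gr_def\<close>)
  have "ext m A' C' (gr h C') (h ` A') (h ` C')" unfolding ext_def
    using e E by (auto simp: gr_def)
  from ext_trans[OF this] have "\<forall>\<tau>' A'' C''. ext m (h ` A') (h ` C') \<tau>' A'' C'' \<longrightarrow> ext m A' C' (gr h C' O \<tau>') A'' C''"
    by blast
  then show ?thesis using h(1,2) 1 by blast
qed

lemma ext_realise:
  assumes e: "ext m A C \<tau> A2 C2" and r: "real_over m B Y (\<sigma> O \<tau>) A2 C2" and s: "Range \<sigma> \<subseteq> C"
  shows "\<exists>A' C'. ext m A C (Id_on C) A' C' \<and> real_over m B Y \<sigma> A' C'"
proof -
  obtain h where h0: "strict_mono h" and h: "\<forall>(x, y)\<in>\<tau>. h y = x" "ext m A C (Id_on C) (h ` A2) (h ` C2)"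
    using ext_pin[OF e] by blast
  obtain q where q: "\<sigma> O \<tau> \<subseteq> q" "Domain q = Y" "Range q \<subseteq> C2" "En m B A2 q"
    using r unfolding real_over_def by blast
  have C2: "finite C2" "C2 \<subseteq> A2" using e by (auto simp: ext_def)
  have "oiso h A2 (h ` A2)" using h0 by (intro oiso_image) (simp add: strict_mono_on_def strict_mono_def)
  then have "En m A2 (h ` A2) (gr h C2)" by (rule En_oiso) (use C2 in \<open>auto simp: gr_def\<close>)
  from En_trans[OF q(4) this] have "En m B (h ` A2) (q O gr h C2)" .
  moreover have "Domain (q O gr h C2) = Y" using q(2,3) by (force simp: in_gr)
  moreover have "Range (q O gr h C2) \<subseteq> h ` C2" by (auto simp: in_gr)
  moreover have "\<sigma> \<subseteq> q O gr h C2"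
  proof
    fix z assume zs: "z \<in> \<sigma>"
    obtain b x where z: "z = (b, x)" by (cases z)
    have "x \<in> Domain \<tau>" using zs z s e unfolding ext_def by blast
    then obtain y where y: "(x, y) \<in> \<tau>" by blast
    then have "(b, y) \<in> q" "(y, x) \<in> gr h C2" using q(1) zs z h(1) e by (auto simp: in_gr ext_def)
    then show "z \<in> q O gr h C2" using z by blast
  qed
  ultimately have "real_over m B Y \<sigma> (h ` A2) (h ` C2)" unfolding real_over_def by blast
  then show ?thesis using h(2) by blast
qed

text \<open>
  If no extension of \<open>(A, C)\<close> decides \<open>X\<close>, a generic structure can be made to differ over \<open>X\<close> from each
  of countably many given structures.
\<close>

lemma decides_dense:
  assumes thin: "thin M" and A: "A \<in> cls M" and C: "finite C" "C \<subseteq> A" and X: "X \<subseteq> C"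
  shows "\<exists>A' C'. ext m A C (Id_on C) A' C' \<and> decides m A' C' X"
proof (rule ccontr)
  assume contr: "\<not> ?thesis"
  from thin obtain R :: "nat \<Rightarrow> real set" where R: "\<forall>j. countable (R j)" "\<forall>N\<in>cls M. \<exists>j. \<forall>n. En n N (R j) {}"
    unfolding thin_def by auto
  have finX: "finite X" using X C(1) by (rule finite_subset)
  \<comment> \<open>All ways in which the generic structure could correspond to a representative
    over \<open>X\<close>: an index j and a finite relation between \<open>X\<close> and
    \<open>R j\<close>.\<close>
  define fam where "fam = Sigma UNIV (\<lambda>j. {\<sigma>. finite \<sigma> \<and> \<sigma> \<subseteq> X \<times> R j})"
  have cfam: "countable fam" unfolding fam_def
    using R(1) finX by (intro countable_SIGMA countable_Collect_finite_subset countable_SIGMA) (auto intro: countable_finite)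
  \<comment> \<open>Stage k ruins the k-th possible correspondence: some configuration is realised
    here but not in \<open>R j\<close>, or it is realised in \<open>R j\<close> and excluded here
    for ever.\<close>
  define AV where "AV k A' C' \<longleftrightarrow> (let j = fst (from_nat_into fam k); \<sigma> = snd (from_nat_into fam k) in
    \<exists>B Y \<sigma>'. Range \<sigma>' \<subseteq> X \<and>
      (real_over m B Y \<sigma>' A' C' \<and> \<not> real_over m B Y (\<sigma>' O \<sigma>) (R j) (R j) \<or>
       real_over m B Y (\<sigma>' O \<sigma>) (R j) (R j) \<and>
         (\<forall>\<tau> A'' C''. ext m A' C' \<tau> A'' C'' \<longrightarrow> \<not> real_over m B Y (\<sigma>' O \<tau>) A'' C'')))"
    for k A' C'
  define U where "U k F A' C' u \<longleftrightarrow> X \<subseteq> C' \<and> AV k A' C'"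
    for k and F :: "nat \<Rightarrow> real set \<times> real set \<times> unit" and A' C' and u :: unit
  have cA: "countable A" using A by (simp add: cls_def)
  have ex: "\<exists>A' C' x. A' 0 = A \<and> C' 0 = C \<and> x 0 = () \<and>
    (\<forall>k. countable (A' k) \<and> finite (C' k) \<and> C' k \<subseteq> A' k \<and> C' k \<subseteq> C' (Suc k) \<and>
      bf ((osuc ^^ m) \<alpha>) (A' k) (A' (Suc k)) (Id_on (C' k)) \<and>
      U k (\<lambda>i. (A' i, C' i, x i)) (A' (Suc k)) (C' (Suc k)) (x (Suc k)) \<and>
      bf ((osuc ^^ m) \<alpha>) (A' k) (\<Union>l. C' l) (Id_on (C' k)))"
  proof (rule generic_limit)
    show "countable {..<(osuc ^^ m) \<alpha>}" by (rule countable_level)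
    show "countable A" "finite C" "C \<subseteq> A" by fact+
    show "U k F' A C x" if "U k F A C x" for k F F' A C x using that by (simp add: U_def)
    show "U k F A' D' x" if u: "U k F A' C' x" "C' \<subseteq> D'" "finite D'" "D' \<subseteq> A'" for k F A' C' x D'
    proof -
      have XC: "X \<subseteq> C'" using u(1) by (simp add: U_def)
      from u(1) obtain B Y \<sigma>' where B: "Range \<sigma>' \<subseteq> X"
        "real_over m B Y \<sigma>' A' C' \<and> \<not> real_over m B Y (\<sigma>' O snd (from_nat_into fam k)) (R (fst (from_nat_into fam k))) (R (fst (from_nat_into fam k))) \<or>
         real_over m B Y (\<sigma>' O snd (from_nat_into fam k)) (R (fst (from_nat_into fam k))) (R (fst (from_nat_into fam k))) \<and>
         (\<forall>\<tau> A'' C''. ext m A' C' \<tau> A'' C'' \<longrightarrow> \<not> real_over m B Y (\<sigma>' O \<tau>) A'' C'')"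
        unfolding U_def AV_def Let_def by blast
      have "real_over m B Y \<sigma>' A' D'" if "real_over m B Y \<sigma>' A' C'" using real_over_mono[OF that _ u(2)] by simp
      moreover have "\<forall>\<tau> A'' C''. ext m A' D' \<tau> A'' C'' \<longrightarrow> \<not> real_over m B Y (\<sigma>' O \<tau>) A'' C''"
        if "\<forall>\<tau> A'' C''. ext m A' C' \<tau> A'' C'' \<longrightarrow> \<not> real_over m B Y (\<sigma>' O \<tau>) A'' C''"
        using never_more[of m A' C' B Y \<sigma>' D'] that u(2) B(1) XC by blast
      ultimately have "AV k A' D'" unfolding AV_def Let_def using B by blast
      then show ?thesis using XC u(2) by (auto simp: U_def)
    qed
    fix k F A1 C1 x assume F0: "F 0 = (A, C, ())" and Fk: "F k = (A1, C1, x)"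
      and A1: "countable A1" "finite C1" "C1 \<subseteq> A1"
      and h1: "\<And>i. i < k \<Longrightarrow> U i F (fst (F (Suc i))) (fst (snd (F (Suc i)))) (snd (snd (F (Suc i))))"
      and h2: "\<And>i. i < k \<Longrightarrow> bf ((osuc ^^ m) \<alpha>) (fst (F i)) A1 (Id_on (fst (snd (F i))))"
    have E1: "En m A A1 (Id_on C)"
    proof (cases k)
      case 0 then show ?thesis using F0 Fk En_Id_on C by auto
    next
      case (Suc i) then show ?thesis using h2[of 0] F0 by (simp add: En_def)
    qed
    have X1: "X \<subseteq> C1"
    proof (cases k)
      case 0 then show ?thesis using F0 Fk X by auto
    next
      case (Suc i) then show ?thesis using h1[of i] Fk by (simp add: U_def)
    qed
    have nd: "\<not> decides m A1 C1 X"
    proof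
      assume d: "decides m A1 C1 X"
      have sub: "C \<subseteq> A1" using En_base(2)[OF E1] by auto
      have "decides m A1 (C1 \<union> C) X"
        by (rule decides_more[OF d X1]) (use A1 C sub in auto)
      moreover have "ext m A C (Id_on C) A1 (C1 \<union> C)"
        by (rule ext_Id) (use A1 C E1 sub in auto)
      ultimately show False using contr by blast
    qed
    \<comment> \<open>Undecidedness supplies one extension that realises a configuration and another
      that excludes it for ever; the one disagreeing with \<open>R j\<close> is taken.\<close>
    then obtain B Y \<sigma>' \<tau>1 A2 C2 \<tau>2 A3 C3 where s: "Range \<sigma>' \<subseteq> X"
      and e1: "ext m A1 C1 \<tau>1 A2 C2" "real_over m B Y (\<sigma>' O \<tau>1) A2 C2"
      and e2: "ext m A1 C1 \<tau>2 A3 C3"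
        "\<And>\<tau>' A'' C''. ext m A3 C3 \<tau>' A'' C'' \<Longrightarrow> \<not> real_over m B Y (\<sigma>' O \<tau>2 O \<tau>') A'' C''"
      unfolding decides_def by blast
    define j where "j = fst (from_nat_into fam k)"
    define \<sigma> where "\<sigma> = snd (from_nat_into fam k)"
    have "\<exists>A' C'. ext m A1 C1 (Id_on C1) A' C' \<and> AV k A' C'"
    proof (cases "real_over m B Y (\<sigma>' O \<sigma>) (R j) (R j)")
      case True
      obtain h where h: "\<forall>(x, y)\<in>\<tau>2. h y = x" "ext m A1 C1 (Id_on C1) (h ` A3) (h ` C3)"
        "\<And>\<tau>' A'' C''. ext m (h ` A3) (h ` C3) \<tau>' A'' C'' \<Longrightarrow> ext m A3 C3 (gr h C3 O \<tau>') A'' C''"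
        using ext_pin[OF e2(1)] by blast
      have "\<not> real_over m B Y (\<sigma>' O \<tau>') A'' C''" if t: "ext m (h ` A3) (h ` C3) \<tau>' A'' C''" for \<tau>' A'' C''
      proof -
        have "\<sigma>' O \<tau>2 O gr h C3 O \<tau>' = \<sigma>' O \<tau>'"
        proof
          show "\<sigma>' O \<tau>2 O gr h C3 O \<tau>' \<subseteq> \<sigma>' O \<tau>'" using h(1) by (force simp: in_gr)
          show "\<sigma>' O \<tau>' \<subseteq> \<sigma>' O \<tau>2 O gr h C3 O \<tau>'"
          proof
            fix z assume "z \<in> \<sigma>' O \<tau>'"
            then obtain b x c where z: "z = (b, c)" "(b, x) \<in> \<sigma>'" "(x, c) \<in> \<tau>'" by auto
            have "x \<in> Domain \<tau>2" using z(2) s X1 e2(1) unfolding ext_def by blast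
            then obtain y where y: "(x, y) \<in> \<tau>2" by blast
            then have "(y, x) \<in> gr h C3" using h(1) e2(1) by (auto simp: in_gr ext_def)
            then show "z \<in> \<sigma>' O \<tau>2 O gr h C3 O \<tau>'" using z y by blast
          qed
        qed
        then show ?thesis using e2(2)[OF h(3)[OF t]] by simp
      qed
      then have "AV k (h ` A3) (h ` C3)" unfolding AV_def Let_def j_def[symmetric] \<sigma>_def[symmetric]
        using True s by blast
      then show ?thesis using h(2) by blast
    next
      case False
      obtain A' C' where A': "ext m A1 C1 (Id_on C1) A' C'" "real_over m B Y \<sigma>' A' C'"
        using ext_realise[OF e1] s X1 by auto
      then have "AV k A' C'" unfolding AV_def Let_def j_def[symmetric] \<sigma>_def[symmetric]
        using False s by blast
      then show ?thesis using A'(1) by blast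
    qed
    then obtain A' C' where "ext m A1 C1 (Id_on C1) A' C'" "AV k A' C'" by blast
    then show "\<exists>A' C' x'. countable A' \<and> finite C' \<and> C' \<subseteq> A' \<and> C1 \<subseteq> C' \<and>
        bf ((osuc ^^ m) \<alpha>) A1 A' (Id_on C1) \<and> U k F A' C' x'"
      using X1 by (intro exI[of _ A'] exI[of _ C'] exI[of _ "()"]) (auto simp: ext_def U_def En_def)
  qed simp
  from ex[folded En_def] obtain A' C' x where AC: "A' 0 = A \<and> C' 0 = C \<and> x 0 = () \<and>
    (\<forall>k. countable (A' k) \<and> finite (C' k) \<and> C' k \<subseteq> A' k \<and> C' k \<subseteq> C' (Suc k) \<and>
      En m (A' k) (A' (Suc k)) (Id_on (C' k)) \<and>
      U k (\<lambda>i. (A' i, C' i, x i)) (A' (Suc k)) (C' (Suc k)) (x (Suc k)) \<and>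
      En m (A' k) (\<Union>l. C' l) (Id_on (C' k)))" by (elim exE)
  define G where "G = (\<Union>l. C' l)"
  have S: "countable (A' k)" "finite (C' k)" "C' k \<subseteq> A' k" "C' k \<subseteq> C' (Suc k)" "AV k (A' (Suc k)) (C' (Suc k))"
      "X \<subseteq> C' (Suc k)" "En m (A' k) G (Id_on (C' k))" for k
    using AC unfolding U_def G_def by simp_all
  have Cm: "C' k \<subseteq> C' l" if "k \<le> l" for k l using lift_Suc_mono_le[of C', OF S(4) that] .
  have cG: "countable G" unfolding G_def using S(2) by (auto intro: countable_finite)
  have "G \<in> cls M"
    by (rule cls_En[OF A cG]) (use En_empty[OF S(7)[of 0]] AC in simp)
  with R(2) obtain j where j: "\<forall>n. En n G (R j) {}" by blast
  \<comment> \<open>Two levels above m are used: one to locate \<open>X\<close> in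
    \<open>R j\<close>, one to transfer the configuration in question.\<close>
  have E2: "En (Suc (Suc m)) G (R j) {}" using j by blast
  have XG: "X \<subseteq> G" using S(6) by (auto simp: G_def)
  obtain q0 where q0: "X \<subseteq> Domain q0" "En (Suc m) G (R j) q0"
    by (rule En_forth[OF E2 finX XG])
  define \<sigma> where "\<sigma> = Id_on X O q0"
  have sq: "\<sigma> \<subseteq> q0" by (auto simp: \<sigma>_def)
  have "(j, \<sigma>) \<in> fam"
    using En_base(1,2)[OF q0(2)] sq by (auto simp: fam_def \<sigma>_def intro: finite_subset)
  from from_nat_into_surj[OF cfam this] obtain k where k: "from_nat_into fam k = (j, \<sigma>)" ..
  have Xdom: "\<exists>z. (x, z) \<in> \<sigma>" if "x \<in> X" for x using that q0(1) unfolding \<sigma>_def by blast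
  from S(5)[of k] obtain B Y \<sigma>' where s: "Range \<sigma>' \<subseteq> X" and
    alt: "real_over m B Y \<sigma>' (A' (Suc k)) (C' (Suc k)) \<and> \<not> real_over m B Y (\<sigma>' O \<sigma>) (R j) (R j) \<or>
       real_over m B Y (\<sigma>' O \<sigma>) (R j) (R j) \<and>
         (\<forall>\<tau> A'' C''. ext m (A' (Suc k)) (C' (Suc k)) \<tau> A'' C'' \<longrightarrow> \<not> real_over m B Y (\<sigma>' O \<tau>) A'' C'')"
    unfolding AV_def k Let_def fst_conv snd_conv by blast
  from alt show False
  proof
    assume a: "real_over m B Y \<sigma>' (A' (Suc k)) (C' (Suc k)) \<and> \<not> real_over m B Y (\<sigma>' O \<sigma>) (R j) (R j)"
    then obtain q where q: "\<sigma>' \<subseteq> q" "Domain q = Y" "Range q \<subseteq> C' (Suc k)" "En m B (A' (Suc k)) q"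
      unfolding real_over_def by blast
    have "q O Id_on (C' (Suc k)) = q" using q(3) by auto
    then have qG: "En m B G q" using En_trans[OF q(4) S(7)] by simp
    then have "finite (Range q)" "Range q \<subseteq> G" using En_base(1,2)[OF qG] by (auto simp: finite_Range)
    then obtain q1 where q1: "q0 \<subseteq> q1" "Range q \<subseteq> Domain q1" "En m G (R j) q1" by (rule En_forth[OF q0(2)])
    have "En m B (R j) (q O q1)" by (rule En_trans[OF qG q1(3)])
    moreover have "Domain (q O q1) = Y" using q(2) q1(2) by blast
    moreover have "Range (q O q1) \<subseteq> R j" using En_base(2)[OF q1(3)] by blast
    moreover have "\<sigma>' O \<sigma> \<subseteq> q O q1" using q(1) sq q1(1) by blast
    ultimately show False using a unfolding real_over_def by blast
  next
    assume a: "real_over m B Y (\<sigma>' O \<sigma>) (R j) (R j) \<and>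
         (\<forall>\<tau> A'' C''. ext m (A' (Suc k)) (C' (Suc k)) \<tau> A'' C'' \<longrightarrow> \<not> real_over m B Y (\<sigma>' O \<tau>) A'' C'')"
    then obtain q where q: "\<sigma>' O \<sigma> \<subseteq> q" "Domain q = Y" "Range q \<subseteq> R j" "En m B (R j) q"
      unfolding real_over_def by blast
    have "finite (Range q)" using En_base(1)[OF q(4)] by (simp add: finite_Range)
    then obtain q1 where q1: "q0 \<subseteq> q1" "Range q \<subseteq> Range q1" "En m G (R j) q1" by (rule En_back[OF q0(2) _ q(3)])
    define q2 where "q2 = q O q1\<inverse>"
    have E2: "En m B G q2" unfolding q2_def by (rule En_trans[OF q(4) En_converse[OF q1(3)]])
    have d2: "Domain q2 = Y" unfolding q2_def using q(2) q1(2) by fast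
    have s2: "\<sigma>' \<subseteq> q2"
    proof
      fix z assume zs: "z \<in> \<sigma>'"
      obtain b x where z: "z = (b, x)" by (cases z)
      then obtain y where "(x, y) \<in> \<sigma>" using Xdom s zs by blast
      then have "(b, y) \<in> q" "(x, y) \<in> q1" using zs z q(1) sq q1(1) by blast+
      then show "z \<in> q2" using z by (auto simp: q2_def)
    qed
    have "finite (Range q2)" "Range q2 \<subseteq> G" using En_base(1,2)[OF E2] by (auto simp: finite_Range)
    moreover have "\<exists>l. D \<subseteq> C' l" if "finite D" "D \<subseteq> G" for D using that
    proof (induction D)
      case (insert x D)
      then obtain l i where "D \<subseteq> C' l" "x \<in> C' i" by (auto simp: G_def)
      then show ?case using Cm[of l "max l i"] Cm[of i "max l i"] by (intro exI[of _ "max l i"]) auto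
    qed simp
    ultimately have "\<exists>l. Range q2 \<subseteq> C' l" by blast
    then obtain l0 where "Range q2 \<subseteq> C' l0" by blast
    define l where "l = max l0 (Suc k)"
    have l: "Range q2 \<subseteq> C' l" "C' (Suc k) \<subseteq> C' l"
      using \<open>Range q2 \<subseteq> C' l0\<close> Cm[of l0 l] Cm[of "Suc k" l] by (auto simp: l_def)
    have "En m B (A' l) (q2 O (Id_on (C' l))\<inverse>)" by (rule En_trans[OF E2 En_converse[OF S(7)]])
    moreover have "q2 O (Id_on (C' l))\<inverse> = q2" using l(1) by auto
    ultimately have "real_over m B Y \<sigma>' (A' l) (C' l)" unfolding real_over_def using d2 s2 l(1) by auto
    moreover have "En m (A' (Suc k)) (A' l) (Id_on (C' (Suc k)) O (Id_on (C' l))\<inverse>)"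
      by (rule En_trans[OF S(7) En_converse[OF S(7)]])
    moreover have "Id_on (C' (Suc k)) O (Id_on (C' l))\<inverse> = Id_on (C' (Suc k))" using l(2) by auto
    ultimately have "ext m (A' (Suc k)) (C' (Suc k)) (Id_on (C' (Suc k))) (A' l) (C' l)"
      "real_over m B Y \<sigma>' (A' l) (C' l)" using ext_Id[OF S(1,2,3) l(2)] by simp_all
    moreover have "\<sigma>' O Id_on (C' (Suc k)) = \<sigma>'" using s S(6)[of k] by auto
    ultimately show False using a by metis
  qed
qed

end

section \<open>Existence of generic models\<close>

context base_level begin

lemma Domain_Id_on_comp: "Domain (Id_on A O q) = A \<inter> Domain q"
  by fast

text \<open>The density of deciding conditions serves the first kind of requirement. For the second,
  either some extension realises the configuration and is taken, or the configuration is excluded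
  already.\<close>

lemma generic_sequence:
  assumes thin: "thin M" and N: "N \<in> cls M"
  shows "\<exists>A C. A 0 = N \<and> (\<forall>k. countable (A k) \<and> finite (C k) \<and> C k \<subseteq> A k \<and> C k \<subseteq> C (Suc k) \<and>
      En m (A k) (\<Union>l. C l) (Id_on (C k))) \<and>
    (\<forall>j X. X \<subseteq> C j \<longrightarrow> (\<exists>k\<ge>j. decides m (A k) (C k) X)) \<and>
    (\<forall>j X \<pi>. X \<subseteq> C j \<longrightarrow> \<pi> \<subseteq> C j \<times> C j \<longrightarrow> (\<exists>k\<ge>j. real_over m (A j) X \<pi> (A k) (C k) \<or>
      (\<forall>\<tau> A' C'. ext m (A k) (C k) \<tau> A' C' \<longrightarrow> \<not> real_over m (A j) X (\<pi> O \<tau>) A' C')))"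
proof -
  define dec_task where "dec_task k F A' C' \<longleftrightarrow> (let j = fst (prod_decode k) in
     decides m A' C' (from_nat_into (Pow (fst (snd (F j)))) (snd (prod_decode k))))"
    for k and F :: "nat \<Rightarrow> real set \<times> real set \<times> unit" and A' C'
  define real_task where "real_task k F A' C' \<longleftrightarrow> (let j = fst (prod_decode k); C = fst (snd (F j));
      s = from_nat_into (Pow C \<times> Pow (C \<times> C)) (snd (prod_decode k)) in
     real_over m (fst (F j)) (fst s) (snd s) A' C' \<or>
     (\<forall>\<tau> A'' C''. ext m A' C' \<tau> A'' C'' \<longrightarrow> \<not> real_over m (fst (F j)) (fst s) (snd s O \<tau>) A'' C''))"
    for k and F :: "nat \<Rightarrow> real set \<times> real set \<times> unit" and A' C'
  define U where "U k F A' C' u \<longleftrightarrow> (\<forall>i\<le>k. fst (snd (F i)) \<subseteq> C') \<and> dec_task k F A' C' \<and> real_task k F A' C'"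
    for k F A' C' and u :: unit
  have jle: "fst (prod_decode k) \<le> k" for k
    using le_prod_encode_1[of "fst (prod_decode k)" "snd (prod_decode k)"] by simp
  have Xin: "from_nat_into (Pow S) t \<subseteq> S" for S :: "real set" and t
    using from_nat_into[of "Pow S" t] by auto
  have sin: "snd (from_nat_into (Pow S \<times> Pow (S \<times> S)) t) \<subseteq> S \<times> S" for S :: "real set" and t
    using from_nat_into[of "Pow S \<times> Pow (S \<times> S)" t] by (auto simp: mem_Times_iff)
  have cN: "countable N" using N by (simp add: cls_def)
  have ex: "\<exists>A C x. A 0 = N \<and> C 0 = {} \<and> x 0 = () \<and>
    (\<forall>k. countable (A k) \<and> finite (C k) \<and> C k \<subseteq> A k \<and> C k \<subseteq> C (Suc k) \<and>
      bf ((osuc ^^ m) \<alpha>) (A k) (A (Suc k)) (Id_on (C k)) \<and>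
      U k (\<lambda>i. (A i, C i, x i)) (A (Suc k)) (C (Suc k)) (x (Suc k)) \<and>
      bf ((osuc ^^ m) \<alpha>) (A k) (\<Union>l. C l) (Id_on (C k)))"
  proof (rule generic_limit)
    show "countable {..<(osuc ^^ m) \<alpha>}" by (rule countable_level)
    show "countable N" by (rule cN)
    show "U k F' A C x" if eq: "\<And>i. i \<le> k \<Longrightarrow> F i = F' i" and u: "U k F A C x" for k F F' A C x
      using u eq jle[of k] unfolding U_def dec_task_def real_task_def Let_def by simp
    show "U k F A D x" if cA: "countable A" and u: "U k F A C x" "C \<subseteq> D" "finite D" "D \<subseteq> A" for k F A C x D
    proof -
      let ?j = "fst (prod_decode k)"
      let ?s = "from_nat_into (Pow (fst (snd (F ?j))) \<times> Pow (fst (snd (F ?j)) \<times> fst (snd (F ?j)))) (snd (prod_decode k))"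
      have sub: "fst (snd (F ?j)) \<subseteq> C" using u(1) jle unfolding U_def by blast
      have "decides m A C (from_nat_into (Pow (fst (snd (F ?j)))) (snd (prod_decode k)))"
        using u(1) by (simp add: U_def dec_task_def Let_def)
      then have "dec_task k F A D" unfolding dec_task_def Let_def
        by (rule decides_more) (use u(2-) cA sub Xin in blast)+
      moreover have "real_task k F A D"
      proof -
        have "real_over m (fst (F ?j)) (fst ?s) (snd ?s) A C \<or>
          (\<forall>\<tau> A'' C''. ext m A C \<tau> A'' C'' \<longrightarrow> \<not> real_over m (fst (F ?j)) (fst ?s) (snd ?s O \<tau>) A'' C'')"
          using u(1) unfolding U_def real_task_def Let_def by blast
        then show ?thesis
        proof
          assume "real_over m (fst (F ?j)) (fst ?s) (snd ?s) A C"
          from real_over_mono[OF this order_refl u(2)] show ?thesis unfolding real_task_def Let_def by blast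
        next
          assume n: "\<forall>\<tau> A'' C''. ext m A C \<tau> A'' C'' \<longrightarrow> \<not> real_over m (fst (F ?j)) (fst ?s) (snd ?s O \<tau>) A'' C''"
          have "Range (snd ?s) \<subseteq> C" using sin[of "fst (snd (F ?j))" "snd (prod_decode k)"] sub by blast
          with never_more[of m A C "fst (F ?j)" "fst ?s" "snd ?s" D] n u(2)
          show ?thesis unfolding real_task_def Let_def by blast
        qed
      qed
      ultimately show ?thesis using u(1,2) unfolding U_def by blast
    qed
    fix k F A C x assume F0: "F 0 = (N, {}, ())" and Fk: "F k = (A, C, x)"
      and A: "countable A" "finite C" "C \<subseteq> A"
      and h1: "\<And>i. i < k \<Longrightarrow> U i F (fst (F (Suc i))) (fst (snd (F (Suc i)))) (snd (snd (F (Suc i))))"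
      and h2: "\<And>i. i < k \<Longrightarrow> bf ((osuc ^^ m) \<alpha>) (fst (F i)) A (Id_on (fst (snd (F i))))"
    have Ci: "fst (snd (F i)) \<subseteq> C" if ik: "i \<le> k" for i
    proof (cases "i = k")
      case True then show ?thesis using Fk by simp
    next
      case False
      then obtain l where l: "k = Suc l" "i \<le> l" using ik by (cases k) auto
      then show ?thesis using h1[of l] Fk unfolding U_def by auto
    qed
    have "En m N A {}"
    proof (cases k)
      case 0 then show ?thesis using F0 Fk En_refl0 by simp
    next
      case (Suc i) then show ?thesis using h2[of 0] F0 by (simp add: En_def)
    qed
    then have Acls: "A \<in> cls M" by (rule cls_En[OF N A(1)])
    let ?j = "fst (prod_decode k)"
    define X where "X = from_nat_into (Pow (fst (snd (F ?j)))) (snd (prod_decode k))"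
    define s where "s = from_nat_into (Pow (fst (snd (F ?j))) \<times> Pow (fst (snd (F ?j)) \<times> fst (snd (F ?j)))) (snd (prod_decode k))"
    have XC: "X \<subseteq> C" unfolding X_def by (rule subset_trans[OF Xin Ci[OF jle]])
    have sC: "Range (snd s) \<subseteq> C"
      using sin[of "fst (snd (F ?j))" "snd (prod_decode k)"] Ci[OF jle] unfolding s_def by blast
    obtain A1 C1 where 1: "ext m A C (Id_on C) A1 C1" "decides m A1 C1 X"
      using decides_dense[OF thin Acls A(2,3) XC] by blast
    have C1: "C \<subseteq> C1" using 1(1) by (auto simp: ext_def)
    have "\<exists>A2 C2. ext m A1 C1 (Id_on C1) A2 C2 \<and> (real_over m (fst (F ?j)) (fst s) (snd s) A2 C2 \<or>
      (\<forall>\<tau> A'' C''. ext m A2 C2 \<tau> A'' C'' \<longrightarrow> \<not> real_over m (fst (F ?j)) (fst s) (snd s O \<tau>) A'' C''))"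
    proof (cases "\<exists>\<tau> A'' C''. ext m A1 C1 \<tau> A'' C'' \<and> real_over m (fst (F ?j)) (fst s) (snd s O \<tau>) A'' C''")
      case True
      then show ?thesis using ext_realise sC C1 by (meson subset_trans)
    next
      case False
      have "ext m A1 C1 (Id_on C1) A1 C1"
        by (rule ext_Id) (use 1(1) in \<open>auto simp: ext_def intro: En_Id_on\<close>)
      then show ?thesis using False by blast
    qed
    then obtain A2 C2 where 2: "ext m A1 C1 (Id_on C1) A2 C2" "real_over m (fst (F ?j)) (fst s) (snd s) A2 C2 \<or>
      (\<forall>\<tau> A'' C''. ext m A2 C2 \<tau> A'' C'' \<longrightarrow> \<not> real_over m (fst (F ?j)) (fst s) (snd s O \<tau>) A'' C'')"
      by blast
    have "Id_on C1 `` X = X" using XC C1 by auto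
    then have d2: "decides m A2 C2 X" using decides_ext[OF 1(2) 2(1)] XC C1 by simp
    have "Id_on C O Id_on C1 = Id_on C" using C1 by auto
    then have e: "ext m A C (Id_on C) A2 C2" using ext_trans[OF 1(1) 2(1)] by simp
    then have C2: "C \<subseteq> C2" by (auto simp: ext_def)
    have "U k F A2 C2 ()" unfolding U_def dec_task_def real_task_def Let_def
      using d2 2(2) Ci C2 unfolding X_def s_def by blast
    then show "\<exists>A' C' x'. countable A' \<and> finite C' \<and> C' \<subseteq> A' \<and> C \<subseteq> C' \<and> bf ((osuc ^^ m) \<alpha>) A A' (Id_on C) \<and> U k F A' C' x'"
      using e C2 unfolding ext_def En_def by blast
  qed simp_all
  from ex obtain A C x where AC: "A 0 = N \<and> C 0 = {} \<and> x 0 = () \<and>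
    (\<forall>k. countable (A k) \<and> finite (C k) \<and> C k \<subseteq> A k \<and> C k \<subseteq> C (Suc k) \<and>
      bf ((osuc ^^ m) \<alpha>) (A k) (A (Suc k)) (Id_on (C k)) \<and>
      U k (\<lambda>i. (A i, C i, x i)) (A (Suc k)) (C (Suc k)) (x (Suc k)) \<and>
      bf ((osuc ^^ m) \<alpha>) (A k) (\<Union>l. C l) (Id_on (C k)))" by (elim exE)
  then have S: "countable (A k)" "finite (C k)" "C k \<subseteq> A k" "C k \<subseteq> C (Suc k)"
    "dec_task k (\<lambda>i. (A i, C i, x i)) (A (Suc k)) (C (Suc k))"
    "real_task k (\<lambda>i. (A i, C i, x i)) (A (Suc k)) (C (Suc k))" "En m (A k) (\<Union>l. C l) (Id_on (C k))" for k
    unfolding U_def En_def by simp_all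
  have "\<exists>k\<ge>j. decides m (A k) (C k) X" if X: "X \<subseteq> C j" for j X
  proof -
    have "countable (Pow (C j))" using S(2) by (simp add: countable_finite)
    from from_nat_into_surj[OF this, of X] X obtain t where "from_nat_into (Pow (C j)) t = X" by auto
    then have "decides m (A (Suc (prod_encode (j, t)))) (C (Suc (prod_encode (j, t)))) X"
      using S(5)[of "prod_encode (j, t)"] by (simp add: dec_task_def)
    moreover have "j \<le> Suc (prod_encode (j, t))" using le_prod_encode_1[of j t] by simp
    ultimately show ?thesis by blast
  qed
  moreover have "\<exists>k\<ge>j. real_over m (A j) X \<pi> (A k) (C k) \<or>
      (\<forall>\<tau> A' C'. ext m (A k) (C k) \<tau> A' C' \<longrightarrow> \<not> real_over m (A j) X (\<pi> O \<tau>) A' C')"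
    if X: "X \<subseteq> C j" "\<pi> \<subseteq> C j \<times> C j" for j X \<pi>
  proof -
    have "countable (Pow (C j) \<times> Pow (C j \<times> C j))" using S(2) by (simp add: countable_finite)
    from from_nat_into_surj[OF this, of "(X, \<pi>)"] X
    obtain t where "from_nat_into (Pow (C j) \<times> Pow (C j \<times> C j)) t = (X, \<pi>)" by auto
    then have "real_over m (A j) X \<pi> (A (Suc (prod_encode (j, t)))) (C (Suc (prod_encode (j, t)))) \<or>
      (\<forall>\<tau> A' C'. ext m (A (Suc (prod_encode (j, t)))) (C (Suc (prod_encode (j, t)))) \<tau> A' C' \<longrightarrow> \<not> real_over m (A j) X (\<pi> O \<tau>) A' C')"
      using S(6)[of "prod_encode (j, t)"] by (simp add: real_task_def)
    moreover have "j \<le> Suc (prod_encode (j, t))" using le_prod_encode_1[of j t] by simp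
    ultimately show ?thesis by blast
  qed
  ultimately show ?thesis using AC[THEN conjunct1] S(1-4,7) by (intro exI[of _ A] exI[of _ C] conjI allI impI) simp_all
qed

text \<open>Over a decided set the condition determines what the generic structure realises, so
  correspondences between decided sets extend back and forth to automorphisms. One level above m is
  spent on reaching a deciding superset, hence \<open>Suc m\<close>.\<close>

lemma generic_model:
  assumes thin: "thin M" and N: "N \<in> cls M"
  shows "\<exists>G. countable G \<and> En m N G {} \<and> hom (Suc m) G"
proof -
  from generic_sequence[OF assms, of m] obtain A C where A0: "A 0 = N" and
    S0: "\<forall>k. countable (A k) \<and> finite (C k) \<and> C k \<subseteq> A k \<and> C k \<subseteq> C (Suc k) \<and> En m (A k) (\<Union>l. C l) (Id_on (C k))"
    and dec0: "\<forall>j X. X \<subseteq> C j \<longrightarrow> (\<exists>k\<ge>j. decides m (A k) (C k) X)"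
    and re0: "\<forall>j X \<pi>. X \<subseteq> C j \<longrightarrow> \<pi> \<subseteq> C j \<times> C j \<longrightarrow> (\<exists>k\<ge>j. real_over m (A j) X \<pi> (A k) (C k) \<or>
      (\<forall>\<tau> A' C'. ext m (A k) (C k) \<tau> A' C' \<longrightarrow> \<not> real_over m (A j) X (\<pi> O \<tau>) A' C'))"
    by (elim exE conjE)
  define G where "G = (\<Union>l. C l)"
  have S: "countable (A k)" "finite (C k)" "C k \<subseteq> A k" "C k \<subseteq> C (Suc k)" "En m (A k) G (Id_on (C k))" for k
    using S0 unfolding G_def by blast+
  have Cm: "C k \<subseteq> C l" if "k \<le> l" for k l using lift_Suc_mono_le[of C, OF S(4) that] .
  have CG: "C k \<subseteq> G" for k by (auto simp: G_def)
  have cG: "countable G" unfolding G_def using S(2) by (auto intro: countable_finite)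
  have fin: "\<exists>l. D \<subseteq> C l" if "finite D" "D \<subseteq> G" for D using that
  proof (induction D)
    case (insert x D)
    then obtain l i where "D \<subseteq> C l" "x \<in> C i" by (auto simp: G_def)
    then show ?case using Cm[of l "max l i"] Cm[of i "max l i"] by (intro exI[of _ "max l i"]) auto
  qed simp
  have extG: "ext m (A k) (C k) (Id_on (C k)) G (C k)" for k
    by (rule ext_Id[OF cG S(2) CG order_refl S(5)])
  have dec: "\<exists>D. finite D \<and> Z \<subseteq> D \<and> D \<subseteq> G \<and> decides m G D X" if X: "finite Z" "Z \<subseteq> G" "X \<subseteq> Z" for X Z
  proof -
    obtain j where j: "Z \<subseteq> C j" using fin X by blast
    then obtain k where k: "j \<le> k" "decides m (A k) (C k) X" using dec0 X(3) by (meson subset_trans)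
    have Z: "Z \<subseteq> C k" using j Cm[OF k(1)] by blast
    have XC: "X \<subseteq> C k" using Z X(3) by blast
    have "Id_on (C k) `` X = X" using XC by auto
    then have "decides m G (C k) X" using decides_ext[OF k(2) extG XC] by simp
    then show ?thesis using S(2) CG Z by blast
  qed
  have re: "(\<exists>q. \<pi> \<subseteq> q \<and> Domain q = X \<and> En m G G q) \<or>
      (\<exists>D. finite D \<and> D \<subseteq> G \<and> Y \<subseteq> D \<and> (\<forall>\<tau> A' C'. ext m G D \<tau> A' C' \<longrightarrow> \<not> real_over m G X (\<pi> O \<tau>) A' C'))"
    if X: "finite X" "X \<subseteq> G" "finite Y" "Y \<subseteq> G" "\<pi> \<subseteq> X \<times> Y" for X Y \<pi>
  proof -
    obtain j where j: "X \<union> Y \<subseteq> C j" using fin[of "X \<union> Y"] X by auto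
    then have Xj: "X \<subseteq> C j" "\<pi> \<subseteq> C j \<times> C j" using X(5) by auto
    from mp[OF mp[OF spec[OF spec[OF spec[OF re0, of j], of X], of \<pi>] Xj(1)] Xj(2)]
    obtain k where k: "k \<ge> j" "real_over m (A j) X \<pi> (A k) (C k) \<or>
      (\<forall>\<tau> A' C'. ext m (A k) (C k) \<tau> A' C' \<longrightarrow> \<not> real_over m (A j) X (\<pi> O \<tau>) A' C')" by (elim exE conjE)
    from k(2) show ?thesis
    proof
      assume "real_over m (A j) X \<pi> (A k) (C k)"
      then obtain q where q: "\<pi> \<subseteq> q" "Domain q = X" "Range q \<subseteq> C k" "En m (A j) (A k) q"
        unfolding real_over_def by blast
      have "En m G G ((Id_on (C j))\<inverse> O q O Id_on (C k))"
        by (rule En_trans[OF En_converse[OF S(5)] En_trans[OF q(4) S(5)]])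
      moreover have "(Id_on (C j))\<inverse> O q O Id_on (C k) = q" using q(2,3) j by fast
      ultimately show ?thesis using q by auto
    next
      assume n: "\<forall>\<tau> A' C'. ext m (A k) (C k) \<tau> A' C' \<longrightarrow> \<not> real_over m (A j) X (\<pi> O \<tau>) A' C'"
      have "\<not> real_over m G X (\<pi> O \<tau>) A' C'" if e: "ext m G (C k) \<tau> A' C'" for \<tau> A' C'
      proof
        assume "real_over m G X (\<pi> O \<tau>) A' C'"
        then obtain q where q: "\<pi> O \<tau> \<subseteq> q" "Domain q = X" "Range q \<subseteq> C'" "En m G A' q"
          unfolding real_over_def by blast
        have "En m (A j) A' (Id_on (C j) O q)" by (rule En_trans[OF S(5) q(4)])
        moreover have "Id_on (C j) O q = q" using q(2) j by fast
        ultimately have r: "real_over m (A j) X (\<pi> O \<tau>) A' C'" using q unfolding real_over_def by auto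
        have dt: "Domain \<tau> = C k" using e by (simp add: ext_def)
        have "ext m (A k) (C k) (Id_on (C k) O \<tau>) A' C'" by (rule ext_trans[OF extG e])
        moreover have "Id_on (C k) O \<tau> = \<tau>" using dt by fast
        ultimately have "ext m (A k) (C k) \<tau> A' C'" by simp
        then show False using n r by blast
      qed
      moreover have "Y \<subseteq> C k" using j Cm[OF k(1)] by blast
      ultimately show ?thesis using S(2) CG by (intro disjI2 exI[of _ "C k"] conjI allI impI) auto
    qed
  qed
  \<comment> \<open>The back-and-forth family: positions with an extension whose domain decides the
    domain of the position.\<close>
  define Z where "Z \<pi> \<longleftrightarrow> (\<exists>\<pi>'. \<pi> \<subseteq> \<pi>' \<and> En m G G \<pi>' \<and> decides m G (Domain \<pi>') (Domain \<pi>))" for \<pi>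
  have forth: "\<exists>\<pi>2. Z \<pi>2 \<and> \<pi> \<subseteq> \<pi>2 \<and> z \<in> Domain \<pi>2" if "Z \<pi>" and z: "z \<in> G" for \<pi> z
  proof -
    obtain \<pi>' where p: "\<pi> \<subseteq> \<pi>'" "En m G G \<pi>'" "decides m G (Domain \<pi>') (Domain \<pi>)"
      using \<open>Z \<pi>\<close> unfolding Z_def by blast
    have b: "finite (Domain \<pi>')" "finite (Range \<pi>')" "Domain \<pi>' \<subseteq> G" "Range \<pi>' \<subseteq> G"
      using En_base(1,2)[OF p(2)] by (auto simp: finite_Domain finite_Range)
    have "\<exists>D. finite D \<and> insert z (Domain \<pi>') \<subseteq> D \<and> D \<subseteq> G \<and> decides m G D (insert z (Domain \<pi>))"
      by (rule dec) (use b z p(1) in auto)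
    then obtain D where D: "finite D" "insert z (Domain \<pi>') \<subseteq> D" "D \<subseteq> G" "decides m G D (insert z (Domain \<pi>))"
      by blast
    have "\<pi> \<subseteq> D \<times> Range \<pi>'" using p(1) D(2) by auto
    from re[OF D(1,3) b(2,4) this] show ?thesis
    proof
      assume "\<exists>q. \<pi> \<subseteq> q \<and> Domain q = D \<and> En m G G q"
      then obtain q where q: "\<pi> \<subseteq> q" "Domain q = D" "En m G G q" by blast
      define P where "P = Id_on (insert z (Domain \<pi>)) O q"
      have "Domain \<pi> \<subseteq> D" using p(1) D(2) by blast
      then have dP: "Domain P = insert z (Domain \<pi>)"
        using q(2) D(2) by (simp add: P_def Domain_Id_on_comp Int_absorb2)
      have pP: "\<pi> \<subseteq> P" unfolding P_def using q(1) by fast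
      have Pq: "P \<subseteq> q" unfolding P_def by fast
      have "Z P" unfolding Z_def dP using Pq q(2,3) D(4) by (intro exI[of _ q]) simp
      then show ?thesis using pP dP by blast
    next
      assume "\<exists>E. finite E \<and> E \<subseteq> G \<and> Range \<pi>' \<subseteq> E \<and>
        (\<forall>\<tau> A' C'. ext m G E \<tau> A' C' \<longrightarrow> \<not> real_over m G D (\<pi> O \<tau>) A' C')"
      then obtain E where E: "finite E" "E \<subseteq> G" "Range \<pi>' \<subseteq> E"
        "\<And>\<tau> A' C'. ext m G E \<tau> A' C' \<Longrightarrow> \<not> real_over m G D (\<pi> O \<tau>) A' C'" by blast
      \<comment> \<open>The identity realises \<open>D\<close> over the domain of
        \<open>\<pi>\<close>, so the decision must be the positive one. Applied along
        \<open>\<pi>'\<close> it says that some extension beyond \<open>E\<close> realises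
        \<open>D\<close> over \<open>\<pi>\<close>, against the choice of \<open>E\<close>.\<close>
      let ?I = "Id_on (Domain \<pi>)"
      have Ip: "?I O \<pi>' = \<pi>"
      proof
        show "\<pi> \<subseteq> ?I O \<pi>'" using p(1) by fast
        show "?I O \<pi>' \<subseteq> \<pi>"
        proof
          fix w assume "w \<in> ?I O \<pi>'"
          then obtain x y y' where w: "w = (x, y)" "(x, y) \<in> \<pi>'" "(x, y') \<in> \<pi>" by auto
          then have "y = y'" using pisoD_eq[OF En_base(3)[OF p(2)], of x y x y'] p(1) by auto
          then show "w \<in> \<pi>" using w by simp
        qed
      qed
      have e1: "ext m G (Domain \<pi>') \<pi>' G E" unfolding ext_def using cG E p(2) by simp
      have e2: "ext m G (Domain \<pi>') (Id_on (Domain \<pi>')) G D"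
        by (rule ext_Id) (use cG D b En_Id_on in auto)
      have "real_over m G D ?I G D" unfolding real_over_def
        using En_Id_on[OF D(1,3)] p(1) D(2) by (intro exI[of _ "Id_on D"]) auto
      moreover have "?I O Id_on (Domain \<pi>') = ?I" using p(1) by auto
      ultimately have r: "real_over m G D (?I O Id_on (Domain \<pi>')) G D" by simp
      have Ir: "Range ?I \<subseteq> Domain \<pi>" by auto
      have "(\<forall>\<tau> A' C'. ext m G (Domain \<pi>') \<tau> A' C' \<longrightarrow> (\<exists>\<tau>' A'' C''. ext m A' C' \<tau>' A'' C'' \<and> real_over m G D (?I O \<tau> O \<tau>') A'' C'')) \<or>
        (\<forall>\<tau> A' C'. ext m G (Domain \<pi>') \<tau> A' C' \<longrightarrow> \<not> real_over m G D (?I O \<tau>) A' C')"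
        using p(3) Ir unfolding decides_def by blast
      then have "\<exists>\<tau>' A'' C''. ext m G E \<tau>' A'' C'' \<and> real_over m G D (?I O \<pi>' O \<tau>') A'' C''"
        using e1 e2 r by meson
      then obtain \<tau>' A'' C'' where "ext m G E \<tau>' A'' C''" "real_over m G D (?I O \<pi>' O \<tau>') A'' C''"
        by (elim exE conjE)
      then have False using E(4) Ip by (metis O_assoc)
      then show ?thesis ..
    qed
  qed
  have Zconv: "Z (\<pi>\<inverse>)" if "Z \<pi>" for \<pi>
  proof -
    obtain \<pi>' where p: "\<pi> \<subseteq> \<pi>'" "En m G G \<pi>'" "decides m G (Domain \<pi>') (Domain \<pi>)"
      using \<open>Z \<pi>\<close> unfolding Z_def by blast
    have b: "finite (Range \<pi>')" "Range \<pi>' \<subseteq> G" using En_base(1,2)[OF p(2)] by (auto simp: finite_Range)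
    have e: "ext m G (Domain \<pi>') \<pi>' G (Range \<pi>')" unfolding ext_def using cG b p(2) by simp
    have "\<pi>' `` Domain \<pi> = Range \<pi>"
    proof
      show "\<pi>' `` Domain \<pi> \<subseteq> Range \<pi>"
      proof
        fix y assume "y \<in> \<pi>' `` Domain \<pi>"
        then obtain x y' where w: "(x, y) \<in> \<pi>'" "(x, y') \<in> \<pi>" by auto
        then have "y = y'" using pisoD_eq[OF En_base(3)[OF p(2)], of x y x y'] p(1) by auto
        then show "y \<in> Range \<pi>" using w by blast
      qed
    qed (use p(1) in blast)
    then have "decides m G (Range \<pi>') (Range \<pi>)" using decides_ext[OF p(3) e] p(1) by auto
    then show ?thesis unfolding Z_def using p(1) En_converse[OF p(2)] by (intro exI[of _ "\<pi>'\<inverse>"]) auto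
  qed
  have Zbase: "\<pi> \<subseteq> G \<times> G \<and> piso \<pi>" if "Z \<pi>" for \<pi>
    using that En_base(2,3) piso_subset unfolding Z_def by (meson subset_trans)
  have "En (Suc (Suc m)) G G q" if q: "En (Suc m) G G q" for q
  proof -
    have b: "finite (Domain q)" "Domain q \<subseteq> G" using En_base(1,2)[OF q] by (auto simp: finite_Domain)
    obtain D where D: "finite D" "Domain q \<subseteq> D" "D \<subseteq> G" "decides m G D (Domain q)" using dec[OF b order_refl] by blast
    obtain q' where q': "q \<subseteq> q'" "D \<subseteq> Domain q'" "En m G G q'" by (rule En_forth[OF q D(1,3)])
    let ?p = "Id_on D O q'"
    have "Domain ?p = D" using q'(2) by (simp add: Domain_Id_on_comp Int_absorb2)
    moreover have "q \<subseteq> ?p" using q'(1) D(2) by fast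
    moreover have "En m G G ?p" by (rule En_subset[OF q'(3)]) fast
    ultimately have Zq: "Z q" unfolding Z_def using D(4) by (intro exI[of _ ?p]) auto
    have "\<exists>f. oiso f G G \<and> q \<subseteq> gr f G"
    proof (rule bf_back_forth_oiso[OF cG cG, of q "{\<pi>. Z \<pi>}"])
      show "\<exists>q\<in>{\<pi>. Z \<pi>}. p \<subseteq> q \<and> y \<in> Range q" if p: "p \<in> {\<pi>. Z \<pi>}" "y \<in> G" for p y
      proof -
        obtain \<pi>2 where "Z \<pi>2" "p\<inverse> \<subseteq> \<pi>2" "y \<in> Domain \<pi>2" using forth[OF Zconv] p by blast
        then show ?thesis using Zconv by (intro bexI[of _ "\<pi>2\<inverse>"]) auto
      qed
    qed (use Zq Zbase forth in auto)
    then obtain f where f: "oiso f G G" "q \<subseteq> gr f G" by blast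
    show ?thesis by (rule En_oiso[OF f(1) _ f(2)]) (use En_base(1)[OF q] in simp)
  qed
  then have "hom (Suc m) G" by (rule homI)
  moreover have "En m N G {}" using En_empty[OF S(5)[of 0]] A0 by simp
  ultimately show ?thesis using cG by blast
qed

end

section \<open>Sums of blocks\<close>

text \<open>\<open>arctan\<close> takes values strictly between -2 and 2, so the image lies strictly
  inside the unit interval and the integers stay free for separating points.\<close>

definition squash :: "real \<Rightarrow> real" where
  "squash x = (arctan x + 2) / 4"

lemma squash_bounds: "0 < squash x" "squash x < 1"
  using arctan_bounded[of x] pi_less_4 by (auto simp: squash_def)

lemma squash_less_iff: "squash x < squash y \<longleftrightarrow> x < y"
  by (simp add: squash_def arctan_less_iff)

definition block :: "int \<Rightarrow> real set \<Rightarrow> real set" where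
  "block i G = (\<lambda>x. squash x + of_int i) ` G"

lemma block_oiso: "oiso (\<lambda>x. squash x + of_int i) G (block i G)"
  unfolding block_def by (rule oiso_image) (simp add: strict_mono_on_def squash_less_iff)

lemma block_isom: "isom G (block i G)"
  using block_oiso by (rule oiso_isom)

lemma block_bounds: "x \<in> block i G \<Longrightarrow> of_int i < x \<and> x < of_int i + 1"
  using squash_bounds unfolding block_def by auto

text \<open>The sum of the orders \<open>G i\<close> over \<open>i \<in> \<int>\<close>, with an additional point in front of \<open>G i\<close> if \<open>i \<in> D\<close>.\<close>

definition zsum :: "int set \<Rightarrow> (int \<Rightarrow> real set) \<Rightarrow> real set" where
  "zsum D G = of_int ` D \<union> (\<Union>i. block i (G i))"

lemma zsum_cases:
  assumes "x \<in> zsum D G"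
  obtains i where "i \<in> D" "x = of_int i" | i where "x \<in> block i (G i)"
  using assms unfolding zsum_def by auto

lemma block_floor: "x \<in> block i G \<Longrightarrow> \<lfloor>x\<rfloor> = i"
  using block_bounds[of x i G] by (simp add: floor_unique)

lemma zsum_between: "zsum D G \<inter> {of_int i<..<of_int i + 1} = block i (G i)"
proof
  show "block i (G i) \<subseteq> zsum D G \<inter> {of_int i<..<of_int i + 1}" using block_bounds by (fastforce simp: zsum_def)
  show "zsum D G \<inter> {of_int i<..<of_int i + 1} \<subseteq> block i (G i)"
  proof
    fix x assume x: "x \<in> zsum D G \<inter> {of_int i<..<of_int i + 1}"
    then have fl: "\<lfloor>x\<rfloor> = i" by (simp add: floor_unique)
    from x have "x \<in> zsum D G" by blast
    then show "x \<in> block i (G i)"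
    proof (cases rule: zsum_cases)
      case (1 j) then show ?thesis using x fl by auto
    next
      case (2 j) then show ?thesis using block_floor[OF 2] fl by simp
    qed
  qed
qed

lemma zsum_point: "i \<in> D \<Longrightarrow> of_int i \<in> zsum D G"
  by (simp add: zsum_def)

lemma countable_zsum: "(\<And>i. countable (G i)) \<Longrightarrow> countable (zsum D G)"
  unfolding zsum_def block_def by simp

context base_level begin

text \<open>The labelling cuts \<open>K\<close> into pieces. The least point \<open>c i\<close> of a
  piece is matched with the integer point, the remainder of the piece with the block.\<close>

lemma En_zsum:
  assumes f: "mono_on K f"
    and c: "\<And>i. i \<in> D \<Longrightarrow> c i \<in> K \<and> f (c i) = i \<and> (\<forall>x\<in>K. f x = i \<longrightarrow> c i \<le> x)"
    and G: "\<And>i. En m {x\<in>K. f x = i \<and> (i \<in> D \<longrightarrow> x \<noteq> c i)} (G i) {}"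
  shows "En m K (zsum D G) {}"
  unfolding En_def
proof (rule bf_sum[OF f])
  show "mono_on (zsum D G) floor" by (intro mono_onI floor_mono)
  fix i
  have b: "En m {x\<in>K. f x = i \<and> (i \<in> D \<longrightarrow> x \<noteq> c i)} (block i (G i)) {}"
    by (rule En_trans0[OF G En_isom[OF block_isom]])
  have z: "{y\<in>zsum D G. \<lfloor>y\<rfloor> = i} = (if i \<in> D then {of_int i} else {}) \<union> block i (G i)"
  proof (intro equalityI subsetI)
    fix y assume y: "y \<in> {y\<in>zsum D G. \<lfloor>y\<rfloor> = i}"
    then have "y \<in> zsum D G" by blast
    then show "y \<in> (if i \<in> D then {of_int i} else {}) \<union> block i (G i)"
      by (cases rule: zsum_cases) (use y block_floor in auto)
  qed (use block_floor in \<open>auto simp: zsum_def split: if_splits\<close>)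
  have "En m {x\<in>K. f x = i} {y\<in>zsum D G. \<lfloor>y\<rfloor> = i} {}"
  proof (cases "i \<in> D")
    case True
    have "isom {c i} {of_int i}" using oiso_image[of "{c i}" "\<lambda>_. of_int i"] by (auto intro!: oiso_isom simp: strict_mono_on_def)
    then have "En m ({c i} \<union> {x\<in>K. f x = i \<and> (i \<in> D \<longrightarrow> x \<noteq> c i)}) ({of_int i} \<union> block i (G i)) ({} \<union> {})"
      by (rule En_sum2[OF En_isom b]) (use c[OF True] True block_bounds in \<open>auto simp: less_le\<close>)
    moreover have "{c i} \<union> {x\<in>K. f x = i \<and> (i \<in> D \<longrightarrow> x \<noteq> c i)} = {x\<in>K. f x = i}" using c[OF True] True by auto
    ultimately show ?thesis using True by (simp add: z)
  next
    case False then show ?thesis using b by (simp add: z)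
  qed
  then show "bf ((osuc ^^ m) \<alpha>) {x \<in> K. f x = i} {y \<in> zsum D G. \<lfloor>y\<rfloor> = i} {(x, y) \<in> {}. f x = i}"
    unfolding En_def by simp
qed auto

lemma En_zsum_down:
  fixes b :: "nat \<Rightarrow> real"
  assumes b: "\<And>t. b t \<in> K" "\<And>t. b (Suc t) < b t" "\<And>z. z \<in> K \<Longrightarrow> \<exists>t. b t \<le> z"
    and G: "En m (K \<inter> {b 0<..}) (G 0) {}" "\<And>t. En m (K \<inter> {b (Suc t)<..<b t}) (G (Suc t)) {}"
  shows "En m K (zsum {..0} (\<lambda>i. if i \<le> 0 then G (nat (- i)) else {})) {}"
proof (rule En_zsum)
  \<comment> \<open>Index 0 holds everything from \<open>b 0\<close> upwards, and index -t, for t >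
    0, the part from \<open>b t\<close> up to but excluding \<open>b (t - 1)\<close>.\<close>
  define l where "l z = (LEAST t. b t \<le> z)" for z
  have l1: "b (l z) \<le> z" if "z \<in> K" for z unfolding l_def using b(3)[OF that] by (rule LeastI_ex)
  have l2: "l z \<le> t" if "b t \<le> z" for z t unfolding l_def using that by (rule Least_le)
  have anti: "b s \<le> b t \<longleftrightarrow> t \<le> s" for s t
    using strict_mono_less_eq[of "\<lambda>t. - b t" t s] b(2) by (simp add: strict_mono_Suc_iff)
  have lb: "l (b t) = t" for t
    using l1[OF b(1)[of t]] l2[of t "b t"] anti by (simp add: le_antisym)
  show "mono_on K (\<lambda>z. - int (l z))"
  proof (rule mono_onI)
    fix r s assume "r \<in> K" "s \<in> K" "r \<le> s"
    then show "- int (l r) \<le> - int (l s)" using l2[of "l r" s] l1[of r] by simp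
  qed
  show "b (nat (- i)) \<in> K \<and> - int (l (b (nat (- i)))) = i \<and> (\<forall>x\<in>K. - int (l x) = i \<longrightarrow> b (nat (- i)) \<le> x)"
    if "i \<in> {..0}" for i
    using b(1) lb that l1 by auto
  fix i :: int
  show "En m {x \<in> K. - int (l x) = i \<and> (i \<in> {..0} \<longrightarrow> x \<noteq> b (nat (- i)))} (if i \<le> 0 then G (nat (- i)) else {}) {}"
  proof (cases "i \<le> 0")
    case False
    then have "{x \<in> K. - int (l x) = i \<and> (i \<in> {..0} \<longrightarrow> x \<noteq> b (nat (- i)))} = {}" by auto
    then show ?thesis using False En_refl0 by simp
  next
    case True
    define t where "t = nat (- i)"
    have i: "i = - int t" using True by (simp add: t_def)
    have "{x \<in> K. - int (l x) = i \<and> (i \<in> {..0} \<longrightarrow> x \<noteq> b (nat (- i)))} = {x\<in>K. l x = t \<and> x \<noteq> b t}"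
      by (auto simp: i)
    also have "\<dots> = (case t of 0 \<Rightarrow> K \<inter> {b 0<..} | Suc s \<Rightarrow> K \<inter> {b (Suc s)<..<b s})"
    proof (cases t)
      case 0
      have "l x = 0 \<longleftrightarrow> b 0 \<le> x" if "x \<in> K" for x using l1[OF that] l2[of 0 x] by auto
      then show ?thesis by (auto simp: 0)
    next
      case (Suc s)
      have "l x = Suc s \<longleftrightarrow> b (Suc s) \<le> x \<and> x < b s" if x: "x \<in> K" for x
      proof
        assume lx: "l x = Suc s"
        then show "b (Suc s) \<le> x \<and> x < b s" using l1[OF x] l2[of s x] by (auto simp: not_le[symmetric])
      next
        assume a: "b (Suc s) \<le> x \<and> x < b s"
        have "\<not> l x \<le> s" using l1[OF x] anti[of s "l x"] a by auto
        then show "l x = Suc s" using l2[of "Suc s" x] a by simp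
      qed
      then show ?thesis by (auto simp: Suc)
    qed
    finally have e: "{x \<in> K. - int (l x) = i \<and> (i \<in> {..0} \<longrightarrow> x \<noteq> b (nat (- i)))} =
      (case t of 0 \<Rightarrow> K \<inter> {b 0<..} | Suc s \<Rightarrow> K \<inter> {b (Suc s)<..<b s})" .
    have "nat (- i) = t" by (simp add: t_def)
    then show ?thesis unfolding e using G True by (cases t) simp_all
  qed
qed

text \<open>Index -1 is reserved for the part below \<open>a 0\<close>; it is outside
  \<open>{0..}\<close>, so no point is put in front of it. This is also the origin of the shift by
  one in the labelling.\<close>

lemma En_zsum_up:
  fixes a :: "nat \<Rightarrow> real"
  assumes a: "\<And>t. a t \<in> K" "\<And>t. a t < a (Suc t)" "\<And>z. z \<in> K \<Longrightarrow> \<exists>t. z < a t"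
    and G: "En m (K \<inter> {..<a 0}) G0 {}" "\<And>t. En m (K \<inter> {a t<..<a (Suc t)}) (G t) {}"
  shows "En m K (zsum {0..} (\<lambda>i. if 0 \<le> i then G (nat i) else if i = -1 then G0 else {})) {}"
proof (rule En_zsum)
  define l where "l z = (LEAST t. z < a t)" for z
  have l1: "z < a (l z)" if "z \<in> K" for z unfolding l_def using a(3)[OF that] by (rule LeastI_ex)
  have l2: "l z \<le> t" if "z < a t" for z t unfolding l_def using that by (rule Least_le)
  have am: "a s \<le> a t \<longleftrightarrow> s \<le> t" for s t
    using strict_mono_less_eq[of a s t] a(2) by (simp add: strict_mono_Suc_iff)
  have l3: "l x = Suc t \<longleftrightarrow> a t \<le> x \<and> x < a (Suc t)" if x: "x \<in> K" for x t
  proof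
    assume lx: "l x = Suc t"
    then show "a t \<le> x \<and> x < a (Suc t)" using l1[OF x] l2[of x t] by (auto simp: not_less[symmetric])
  next
    assume s: "a t \<le> x \<and> x < a (Suc t)"
    then have "\<not> l x \<le> t" using l1[OF x] am[of "l x" t] by auto
    then show "l x = Suc t" using l2[of x "Suc t"] s by simp
  qed
  have lb: "l (a t) = Suc t" for t using l3[OF a(1)] a(2) by simp
  show "mono_on K (\<lambda>z. int (l z) - 1)"
  proof (rule mono_onI)
    fix r s assume "r \<in> K" "s \<in> K" "r \<le> s"
    then show "int (l r) - 1 \<le> int (l s) - 1" using l2[of r "l s"] l1[of s] by simp
  qed
  show "a (nat i) \<in> K \<and> int (l (a (nat i))) - 1 = i \<and> (\<forall>x\<in>K. int (l x) - 1 = i \<longrightarrow> a (nat i) \<le> x)"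
    if "i \<in> {0..}" for i
  proof -
    obtain t where i: "i = int t" using zero_le_imp_eq_int \<open>i \<in> {0..}\<close> by auto
    have "l x = Suc t \<Longrightarrow> x \<in> K \<Longrightarrow> a t \<le> x" for x using l3 by blast
    then show ?thesis using a(1) lb by (auto simp: i)
  qed
  fix i :: int
  let ?S = "{x \<in> K. int (l x) - 1 = i \<and> (i \<in> {0..} \<longrightarrow> x \<noteq> a (nat i))}"
  have "(\<exists>t. i = int t) \<or> i = -1 \<or> i < -1" using zero_le_imp_eq_int[of i] by force
  then consider t where "i = int t" | "i = -1" | "i < -1" by blast
  then show "En m ?S (if 0 \<le> i then G (nat i) else if i = -1 then G0 else {}) {}"
  proof cases
    case (1 t)
    have "?S = {x\<in>K. l x = Suc t \<and> x \<noteq> a t}" by (auto simp: 1)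
    also have "\<dots> = K \<inter> {a t<..<a (Suc t)}" using l3 by auto
    finally show ?thesis using G(2) by (simp add: 1)
  next
    case 2
    have "l x = 0 \<longleftrightarrow> x < a 0" if "x \<in> K" for x using l1[OF that] l2[of x 0] by auto
    then have "?S = K \<inter> {..<a 0}" by (auto simp: 2)
    then show ?thesis using G(1) by (simp add: 2)
  next
    case 3
    then have "?S = {}" by auto
    then show ?thesis using 3 En_refl0 by simp
  qed
qed

lemma hom_join_above:
  assumes "hom n (A \<inter> {x<..<y})" "hom n (A \<inter> {y<..})" "y \<in> A" "x < y"
  shows "hom n (A \<inter> {x<..})"
proof -
  have "A \<inter> {x<..} \<inter> {..<y} = A \<inter> {x<..<y}" "A \<inter> {x<..} \<inter> {y<..} = A \<inter> {y<..}" using assms by auto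
  then show ?thesis using hom_join[of y "A \<inter> {x<..}" n] assms by simp
qed

lemma zsum_down_facts:
  fixes G :: "nat \<Rightarrow> real set"
  defines "Z \<equiv> zsum {..0} (\<lambda>i. if i \<le> 0 then G (nat (- i)) else {})"
  shows "- real t \<in> Z" "isom (G (Suc t)) (Z \<inter> {- real (Suc t)<..<- real t})" "isom (G 0) (Z \<inter> {0<..})"
    "x \<in> Z \<Longrightarrow> \<exists>t. - real t \<le> x" "(\<And>t. hom n (G t)) \<Longrightarrow> hom n (Z \<inter> {- real t<..})"
proof -
  show p: "- real t \<in> Z" for t
    using zsum_point[of "- int t" "{..0}" "\<lambda>i. if i \<le> 0 then G (nat (- i)) else {}"] by (simp add: Z_def)
  have b: "Z \<inter> {- real t<..<1 - real t} = block (- int t) (G t)" for t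
    using zsum_between[of "{..0}" "\<lambda>i. if i \<le> 0 then G (nat (- i)) else {}" "- int t"] by (simp add: Z_def add.commute)
  have lt: "x < 1" if "x \<in> Z" for x
    using that unfolding Z_def
  proof (cases rule: zsum_cases)
    case (1 i) then show ?thesis by (auto simp: of_int_le_0_iff intro: le_less_trans[of _ 0])
  next
    case (2 i) then show ?thesis
    proof (cases "i \<le> 0")
      case True
      then have "(of_int i :: real) \<le> 0" by simp
      then show ?thesis using block_bounds[OF 2] by linarith
    qed (use 2 in \<open>auto simp: block_def\<close>)
  qed
  show i: "isom (G (Suc t)) (Z \<inter> {- real (Suc t)<..<- real t})" for t
    using b[of "Suc t"] block_isom[of "G (Suc t)" "- int (Suc t)"] by simp
  have "Z \<inter> {0<..} = Z \<inter> {- real 0<..<1 - real 0}" using lt by auto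
  then show i0: "isom (G 0) (Z \<inter> {0<..})" using b[of 0] block_isom[of "G 0" 0] by simp
  show "\<exists>t. - real t \<le> x" for x :: real
    using reals_Archimedean2[of "- x"] by (metis less_eq_real_def minus_less_iff)
  assume h: "\<And>t. hom n (G t)"
  show "hom n (Z \<inter> {- real t<..})" for t
  proof (induction t)
    case 0 then show ?case using hom_isom[OF i0 h] by simp
  next
    case (Suc t)
    show ?case by (rule hom_join_above[OF hom_isom[OF i h] Suc.IH p]) simp
  qed
qed

lemma zsum_down_above:
  fixes G :: "nat \<Rightarrow> real set"
  defines "Z \<equiv> zsum {..0} (\<lambda>i. if i \<le> 0 then G (nat (- i)) else {})"
  assumes h: "\<And>t. hom n (G t)" and x: "x \<in> Z"
  shows "hom n (Z \<inter> {x<..})"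
proof -
  obtain t where t: "- real t \<le> x" using zsum_down_facts(4)[of x G] x by (auto simp: Z_def)
  have h: "hom n (Z \<inter> {- real t<..})" unfolding Z_def by (rule zsum_down_facts(5)) (rule h)
  show ?thesis
  proof (cases "- real t = x")
    case False
    then have "Z \<inter> {- real t<..} \<inter> {x<..} = Z \<inter> {x<..}" using t by auto
    then show ?thesis using hom_above[OF h, of x] x t False by simp
  qed (use h in simp)
qed

lemma decreasing_coinitial:
  fixes K :: "real set"
  assumes K: "countable K" "K \<noteq> {}" "\<And>x. x \<in> K \<Longrightarrow> \<exists>y\<in>K. y < x"
  shows "\<exists>b. (\<forall>t. b t \<in> K \<and> b (Suc t) < b t) \<and> (\<forall>z\<in>K. \<exists>t. b t \<le> z)"
proof -
  have "\<exists>b. \<forall>t. b t \<in> K \<and> (b (Suc t) < b t \<and> b (Suc t) \<le> from_nat_into K t)"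
  proof (rule dependent_nat_choice)
    fix x and t :: nat assume x: "x \<in> K"
    have "min x (from_nat_into K t) \<in> K" using x from_nat_into[OF K(2), of t] by (simp add: min_def)
    then obtain y where "y \<in> K" "y < min x (from_nat_into K t)" using K(3) by blast
    then show "\<exists>y. y \<in> K \<and> y < x \<and> y \<le> from_nat_into K t" by (intro exI[of _ y]) auto
  qed (use K(2) in blast)
  then obtain b where b: "\<And>t. b t \<in> K \<and> b (Suc t) < b t \<and> b (Suc t) \<le> from_nat_into K t" by blast
  have "\<exists>t. b t \<le> z" if z: "z \<in> K" for z
  proof -
    obtain t where "from_nat_into K t = z" using from_nat_into_surj[OF K(1) z] ..
    then show ?thesis using b[of t] by (intro exI[of _ "Suc t"]) simp
  qed
  then show ?thesis using b by blast
qed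

section \<open>Replacing intervals\<close>

text \<open>The generic model is taken one level higher, where it is homogeneous at m + 2; the extra
  level places the end points in it.\<close>

lemma generic_between:
  assumes thin: "thin M" and N: "N \<in> cls M" and xy: "x \<in> N" "y \<in> N"
  shows "\<exists>G. countable G \<and> En m (N \<inter> {x<..<y}) G {} \<and> hom (m + 2) G"
proof -
  obtain G where G: "countable G" "En (Suc m) N G {}" "hom (Suc (Suc m)) G" using generic_model[OF thin N] by blast
  have "finite {x, y}" "{x, y} \<subseteq> N" using xy by auto
  then obtain q where q: "{x, y} \<subseteq> Domain q" "En m N G q" by (rule En_forth[OF G(2)])
  then obtain u v where uv: "(x, u) \<in> q" "(y, v) \<in> q" by auto
  have "u \<in> G" "v \<in> G" using En_base(2)[OF q(2)] uv by auto
  then have "hom (m + 2) (G \<inter> {u<..<v})" using hom_between[OF G(3)] by simp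
  then show ?thesis using En_between0[OF q(2) uv] G(1) by blast
qed

lemma generic_below:
  assumes thin: "thin M" and N: "N \<in> cls M" and x: "x \<in> N"
  shows "\<exists>G. countable G \<and> En m (N \<inter> {..<x}) G {} \<and> hom (m + 2) G"
proof -
  obtain G where G: "countable G" "En (Suc m) N G {}" "hom (Suc (Suc m)) G" using generic_model[OF thin N] by blast
  obtain q u where q: "(x, u) \<in> q" "En m N G q" by (rule En_forth1[OF G(2) x])
  have "u \<in> G" using En_base(2)[OF q(2)] q(1) by auto
  then have "hom (m + 2) (G \<inter> {..<u})" using hom_below[OF G(3)] by simp
  then show ?thesis using En_below0[OF q(2,1)] G(1) by blast
qed

text \<open>If \<open>K\<close> has no least element, a decreasing coinitial sequence cuts it into
  intervals with end points in \<open>N\<close>. Each is replaced by a generic one of level m + 2,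
  and the descending sum costs four more levels.\<close>

lemma generic_coinitial:
  assumes thin: "thin M" and N: "N \<in> cls M" and p: "p \<in> N"
    and K: "K \<subseteq> N \<inter> {..<p}" "\<And>x y. x \<in> K \<Longrightarrow> y \<in> N \<Longrightarrow> x < y \<Longrightarrow> y < p \<Longrightarrow> y \<in> K"
  shows "\<exists>G. countable G \<and> En m K G {} \<and> hom (m + 6) G"
proof (cases "K = {} \<or> (\<exists>x\<in>K. \<forall>y\<in>K. x \<le> y)")
  case True
  then show ?thesis
  proof
    assume "K = {}" then show ?thesis using hom_empty En_refl0 by (intro exI[of _ "{}"]) simp
  next
    assume "\<exists>x\<in>K. \<forall>y\<in>K. x \<le> y"
    then obtain x where x: "x \<in> K" "\<And>y. y \<in> K \<Longrightarrow> x \<le> y" by blast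
    have xN: "x \<in> N" using x K by blast
    obtain G where G: "countable G" "En m (N \<inter> {x<..<p}) G {}" "hom (m + 2) G"
      using generic_between[OF thin N xN p] by blast
    let ?G = "zsum {0} (\<lambda>i. if i = 0 then G else {})"
    have KI: "K = {x} \<union> N \<inter> {x<..<p}"
    proof
      show "K \<subseteq> {x} \<union> N \<inter> {x<..<p}"
      proof
        fix y assume y: "y \<in> K"
        then have "y \<in> N" "y < p" "x \<le> y" using x(2)[OF y] K(1) by blast+
        then show "y \<in> {x} \<union> N \<inter> {x<..<p}" by auto
      qed
      show "{x} \<union> N \<inter> {x<..<p} \<subseteq> K" using x(1) K(2)[OF x(1)] by auto
    qed
    have isoG: "isom G (?G \<inter> {0<..<1})" using zsum_between[of "{0}" "\<lambda>i. if i = 0 then G else {}" 0] block_isom[of G 0] by simp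
    have G01: "?G = {0} \<union> ?G \<inter> {0<..<1}"
      using zsum_between[of "{0}" "\<lambda>i. if i = 0 then G else {}" 0] by (auto simp: zsum_def block_def split: if_splits)
    have "isom {x} {0}" using oiso_image[of "{x}" "\<lambda>_. 0"] by (auto intro!: oiso_isom simp: strict_mono_on_def)
    then have "En m ({x} \<union> N \<inter> {x<..<p}) ({0} \<union> ?G \<inter> {0<..<1}) ({} \<union> {})"
      by (rule En_sum2[OF En_isom En_trans0[OF G(2) En_isom[OF isoG]]]) auto
    then have E: "En m K ?G {}" unfolding KI[symmetric] G01[symmetric] by simp
    have "hom (m + 2) ?G"
    proof (rule hom_join[of 0])
      have "z = 0 \<or> 0 < z \<and> z < 1" if "z \<in> ?G" for z
        using subsetD[OF equalityD1[OF G01] that] by auto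
      then have "?G \<inter> {..<0} = {}" "?G \<inter> {0<..} = ?G \<inter> {0<..<1}" by fastforce+
      then show "hom (m + 2) (?G \<inter> {..<0})" "hom (m + 2) (?G \<inter> {0<..})" using hom_empty hom_isom[OF isoG G(3)] by simp_all
      show "0 \<in> ?G" by (simp add: zsum_def)
    qed
    then have "hom (m + 6) ?G" using hom_mono[of "m + 2" "m + 6"] by simp
    moreover have "countable ?G" by (rule countable_zsum) (simp add: G(1))
    ultimately show ?thesis using E by blast
  qed
next
  case False
  have cN: "countable N" using N by (simp add: cls_def)
  have cK: "countable K" by (rule countable_subset[OF _ cN]) (use K(1) in auto)
  have "\<exists>b. (\<forall>t. b t \<in> K \<and> b (Suc t) < b t) \<and> (\<forall>z\<in>K. \<exists>t. b t \<le> z)"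
    by (rule decreasing_coinitial[OF cK]) (use False in \<open>auto simp: not_le\<close>)
  then obtain b where b: "\<And>t. b t \<in> K" "\<And>t. b (Suc t) < b t" "\<And>z. z \<in> K \<Longrightarrow> \<exists>t. b t \<le> z" by blast
  have bN: "b t \<in> N" "b t < p" for t using b(1)[of t] K(1) by auto
  have "\<exists>G. \<forall>t. countable (G t) \<and> En m (N \<inter> {b t<..<case t of 0 \<Rightarrow> p | Suc s \<Rightarrow> b s}) (G t) {} \<and> hom (m + 2) (G t)"
    by (rule choice, rule allI, rule generic_between[OF thin N bN(1)]) (use p bN in \<open>simp split: nat.split\<close>)
  then obtain G where G: "\<And>t. countable (G t) \<and> En m (N \<inter> {b t<..<case t of 0 \<Rightarrow> p | Suc s \<Rightarrow> b s}) (G t) {} \<and> hom (m + 2) (G t)"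
    by blast
  let ?Z = "zsum {..0} (\<lambda>i. if i \<le> 0 then G (nat (- i)) else {})"
  have "En m K ?Z {}"
  proof (rule En_zsum_down[OF b])
    have "K \<inter> {b 0<..} = N \<inter> {b 0<..<p}" 
      by (intro equalityI subsetI) (use subsetD[OF K(1)] K(2)[OF b(1)[of 0]] in auto)
    then show "En m (K \<inter> {b 0<..}) (G 0) {}" using G[of 0] by simp
    fix t
    have "K \<inter> {b (Suc t)<..<b t} = N \<inter> {b (Suc t)<..<b t}" 
      by (intro equalityI subsetI) (use subsetD[OF K(1)] K(2)[OF b(1)[of "Suc t"]] bN(2)[of t] in auto)
    then show "En m (K \<inter> {b (Suc t)<..<b t}) (G (Suc t)) {}" using G[of "Suc t"] by simp
  qed
  moreover have cZ: "countable ?Z" by (rule countable_zsum) (simp add: G)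
  moreover have "hom (m + 2 + 4) ?Z"
    by (rule hom_limit_above[OF cZ], rule zsum_down_above) (use G in blast)+
  ultimately show ?thesis by (intro exI[of _ ?Z]) (simp add: numeral_eq_Suc)
qed

lemma generic_initial:
  assumes thin: "thin M" and N: "N \<in> cls M" and p: "p \<in> N"
    and K: "K \<subseteq> N \<inter> {p<..}" "\<And>x y. x \<in> K \<Longrightarrow> y \<in> N \<Longrightarrow> y < x \<Longrightarrow> p < y \<Longrightarrow> y \<in> K"
  shows "\<exists>G. countable G \<and> En m K G {} \<and> hom (m + 6) G"
proof -
  have "uminus ` N \<in> cls (uminus ` M)" by (rule cls_uminus) (simp add: uminus_image2 N)
  then have "\<exists>G. countable G \<and> En m (uminus ` K) G {} \<and> hom (m + 6) G"
    by (rule generic_coinitial[OF thin_uminus[OF thin], where p = "- p"]) (use p K in auto)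
  then obtain G where "countable G" "En m (uminus ` K) G {}" "hom (m + 6) G" by blast
  then show ?thesis
    using En_uminus0[of m "uminus ` K" G] by (intro exI[of _ "uminus ` G"]) (simp add: uminus_image2 hom_uminus_iff)
qed

text \<open>\<open>y - exp (- t)\<close> maps the reals increasingly onto the reals below
  \<open>y\<close>, so a copy of \<open>H\<close> takes the place of everything below
  \<open>y\<close>.\<close>

definition below_graft :: "real \<Rightarrow> real set \<Rightarrow> real set \<Rightarrow> real set" where
  "below_graft y H N = (\<lambda>t. y - exp (- t)) ` H \<union> (N \<inter> {y..})"

lemma below_graft_below: "oiso (\<lambda>t. y - exp (- t)) H (below_graft y H N \<inter> {..<y})"
proof -
  have "below_graft y H N \<inter> {..<y} = (\<lambda>t. y - exp (- t)) ` H" by (auto simp: below_graft_def)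
  then show ?thesis by (simp only:) (intro oiso_image strict_mono_onI, simp)
qed

lemma below_graft_above: "below_graft y H N \<inter> {y..} = N \<inter> {y..}"
  by (auto simp: below_graft_def)

lemma En_below_graft:
  assumes "En n (N \<inter> {..<y}) H {}" "finite Y" "Y \<subseteq> N \<inter> {y..}"
  shows "En n N (below_graft y H N) (Id_on Y)"
proof -
  have "En n (N \<inter> {..<y} \<union> N \<inter> {y..}) (below_graft y H N \<inter> {..<y} \<union> N \<inter> {y..}) ({} \<union> Id_on Y)"
    by (rule En_sum2[OF En_trans0[OF assms(1) En_isom[OF oiso_isom[OF below_graft_below]]] En_Id_on[OF assms(2,3)]]) auto
  moreover have "N \<inter> {..<y} \<union> N \<inter> {y..} = N" by auto
  moreover have "below_graft y H N \<inter> {..<y} \<union> N \<inter> {y..} = below_graft y H N" by (auto simp: below_graft_def)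
  ultimately show ?thesis by simp
qed

lemma countable_below_graft: "countable H \<Longrightarrow> countable N \<Longrightarrow> countable (below_graft y H N)"
  by (simp add: below_graft_def)

end

section \<open>Coding sets of natural numbers\<close>

text \<open>The ordered sum: the first summand is moved increasingly into the negative reals, the
  second into the positive ones.\<close>

definition conc :: "real set \<Rightarrow> real set \<Rightarrow> real set" where
  "conc A B = (\<lambda>t. - exp (- t)) ` A \<union> exp ` B"

lemma conc_isom:
  "isom A ((\<lambda>t. - exp (- t)) ` A)" "isom B (exp ` B)" for A B :: "real set"
  by (rule oiso_isom, rule oiso_image, rule strict_mono_onI, simp)+

lemma conc_order: "- exp (- x) < exp y" for x y :: real
  by (rule less_trans[of _ 0]) auto

lemma conc_order': "\<not> exp y < - exp (- x)" for x y :: real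
  using conc_order[of x y] by linarith

lemma conc_below: "x \<in> A \<Longrightarrow> isom (A \<inter> {..<x}) (conc A B \<inter> {..<- exp (- x)})"
proof -
  have "conc A B \<inter> {..<- exp (- x)} = (\<lambda>t. - exp (- t)) ` (A \<inter> {..<x})"
    by (auto simp: conc_def conc_order')
  then show ?thesis using conc_isom(1) by simp
qed

lemma conc_above: "x \<in> B \<Longrightarrow> isom (B \<inter> {x<..}) (conc A B \<inter> {exp x<..})"
proof -
  have "conc A B \<inter> {exp x<..} = exp ` (B \<inter> {x<..})"
    by (auto simp: conc_def conc_order')
  then show ?thesis using conc_isom(2) by simp
qed

lemma conc_between: "x \<in> B \<Longrightarrow> y \<in> B \<Longrightarrow> isom (B \<inter> {x<..<y}) (conc A B \<inter> {exp x<..<exp y})"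
proof -
  have "conc A B \<inter> {exp x<..<exp y} = exp ` (B \<inter> {x<..<y})"
    by (auto simp: conc_def conc_order')
  then show ?thesis using conc_isom(2) by simp
qed

lemma countable_conc: "countable A \<Longrightarrow> countable B \<Longrightarrow> countable (conc A B)"
  by (simp add: conc_def)

lemma zsum_up_facts:
  fixes G :: "nat \<Rightarrow> real set" and G0 :: "real set"
  defines "Z \<equiv> zsum {0..} (\<lambda>i. if 0 \<le> i then G (nat i) else if i = -1 then G0 else {})"
  shows "real t \<in> Z" "isom (G t) (Z \<inter> {real t<..<real (Suc t)})" "isom G0 (Z \<inter> {..<0})"
    "x \<in> Z \<Longrightarrow> x < 0 \<or> (\<exists>t. x = real t \<or> x \<in> Z \<inter> {real t<..<real (Suc t)})"
proof -
  let ?F = "\<lambda>i. if 0 \<le> i then G (nat i) else if i = -1 then G0 else {}"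
  show "real t \<in> Z"
    using zsum_point[of "int t" "{0..}" ?F] by (simp add: Z_def)
  show "isom (G t) (Z \<inter> {real t<..<real (Suc t)})"
    using zsum_between[of "{0..}" ?F "int t"] block_isom[of "G t" "int t"] by (simp add: Z_def add.commute)
  have lo: "-1 < x" if "x \<in> Z" for x
    using that unfolding Z_def
  proof (cases rule: zsum_cases)
    case (1 i) then show ?thesis by (auto simp: intro: less_le_trans[of _ 0])
  next
    case (2 i) then show ?thesis
    proof (cases "-1 \<le> i")
      case True
      then have "(-1 :: real) \<le> of_int i" by simp
      then show ?thesis using block_bounds[OF 2] by linarith
    qed (use 2 in \<open>auto simp: block_def\<close>)
  qed
  have "Z \<inter> {..<0} = Z \<inter> {of_int (-1)<..<of_int (-1) + 1}" using lo by auto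
  then show "isom G0 (Z \<inter> {..<0})"
    using zsum_between[of "{0..}" ?F "-1"] block_isom[of G0 "-1"] by (simp add: Z_def)
  show "x < 0 \<or> (\<exists>t. x = real t \<or> x \<in> Z \<inter> {real t<..<real (Suc t)})" if x: "x \<in> Z"
  proof (cases "x < 0")
    case False
    define t where "t = nat \<lfloor>x\<rfloor>"
    have "real t = of_int \<lfloor>x\<rfloor>" using False by (simp add: t_def)
    then have "real t \<le> x" "x < real t + 1" by linarith+
    then show ?thesis using x by (cases "x = real t") (auto intro!: exI[of _ t])
  qed simp
qed

section \<open>Intervals of prescribed level and the sets they code\<close>

context base_level begin

lemma En_conc:
  assumes "En m A1 B1 {}" "En m A2 B2 {}" "\<And>x y. x \<in> A1 \<Longrightarrow> y \<in> A2 \<Longrightarrow> x < y"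
  shows "En m (A1 \<union> A2) (conc B1 B2) {}"
proof -
  have "En m (A1 \<union> A2) ((\<lambda>t. - exp (- t)) ` B1 \<union> exp ` B2) ({} \<union> {})"
    by (rule En_sum2[OF En_trans0[OF assms(1) En_isom[OF conc_isom(1)]] En_trans0[OF assms(2) En_isom[OF conc_isom(2)]] assms(3)])
      (use conc_order in auto)
  then show ?thesis by (simp add: conc_def)
qed

text \<open>The interval is split at the lower end of the given decreasing sequence. Below, it
  becomes an order of level 6; above, a descending sum of blocks of level i + 5, all but the top one
  certainly not homogeneous at i. An initial segment either stays in the lower part or contains
  whole complicated blocks, so no level in between occurs.\<close>

lemma dec_piece:
  assumes thin: "thin M" and N: "N \<in> cls M" and ac: "a \<in> N" "c \<in> N" and d: "dec (\<lambda>_. i) (N \<inter> {a<..<c})"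
  shows "\<exists>P. countable P \<and> En 0 (N \<inter> {a<..<c}) P {} \<and> hom (i + 10) P \<and> \<not> hom i P \<and>
    (\<forall>x\<in>P. hom 16 (P \<inter> {..<x}) \<or> \<not> hom i (P \<inter> {..<x}))"
proof -
  obtain b where b0: "\<And>t. b t \<in> N \<inter> {a<..<c} \<and> b (Suc t) < b t \<and> \<not> hom i (N \<inter> {a<..<c} \<inter> {b (Suc t)<..<b t})"
    using d unfolding dec_def by blast
  have b: "b t \<in> N" "a < b t" "b t < c" "b (Suc t) < b t" for t using b0[of t] by auto
  have nh: "\<not> hom i (N \<inter> {b (Suc t)<..<b t})" for t
  proof -
    have "N \<inter> {a<..<c} \<inter> {b (Suc t)<..<b t} = N \<inter> {b (Suc t)<..<b t}" using b(2)[of "Suc t"] b(3)[of t] by auto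
    then show ?thesis using b0[of t] by simp
  qed
  define K where "K = {z\<in>N. a < z \<and> (\<forall>t. z < b t)}"
  define J where "J = {z\<in>N. z < c \<and> (\<exists>t. b t \<le> z)}"
  have cN: "countable N" using N by (simp add: cls_def)
  have "\<exists>G. countable G \<and> En 0 K G {} \<and> hom (0 + 6) G"
    by (rule generic_initial[OF thin N ac(1)]) (auto simp: K_def intro: less_trans)
  then obtain K0 where K0: "countable K0" "En 0 K K0 {}" "hom 6 K0" by auto
  \<comment> \<open>Equivalence at level i + 3 carries over the failure of homogeneity at level i;
    the generic interval then has level i + 5.\<close>
  have "\<exists>G. \<forall>t. countable (G t) \<and> En (i + 3) (N \<inter> {b t<..<case t of 0 \<Rightarrow> c | Suc s \<Rightarrow> b s}) (G t) {} \<and> hom (i + 3 + 2) (G t)"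
    by (rule choice, rule allI, rule generic_between[OF thin N b(1)]) (use ac b in \<open>simp split: nat.split\<close>)
  then obtain G where G: "\<And>t. countable (G t) \<and> En (i + 3) (N \<inter> {b t<..<case t of 0 \<Rightarrow> c | Suc s \<Rightarrow> b s}) (G t) {} \<and> hom (i + 3 + 2) (G t)"
    by blast
  have hG: "hom (i + 5) (G t)" for t using G[of t] by (simp add: add.commute)
  have nG: "\<not> hom i (G (Suc t))" for t
    using hom_En_iff[of "N \<inter> {b (Suc t)<..<b t}" "G (Suc t)" i "{}"] nh[of t] G[of "Suc t"] cN by simp
  let ?Z = "zsum {..0} (\<lambda>i. if i \<le> 0 then G (nat (- i)) else {})"
  have EZ: "En 0 J ?Z {}"
  proof (rule En_zsum_down)
    show "b t \<in> J" for t using b by (auto simp: J_def)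
    show "b (Suc t) < b t" for t by (rule b)
    show "\<exists>t. b t \<le> z" if "z \<in> J" for z using that by (simp add: J_def)
    have "J \<inter> {b 0<..} = N \<inter> {b 0<..<c}" by (auto simp: J_def intro: exI[of _ 0])
    then show "En 0 (J \<inter> {b 0<..}) (G 0) {}" using En_mono[of 0 "i + 3"] G[of 0] by simp
    fix t
    have "J \<inter> {b (Suc t)<..<b t} = N \<inter> {b (Suc t)<..<b t}" using b(3)[of t] by (auto simp: J_def intro: exI[of _ "Suc t"])
    then show "En 0 (J \<inter> {b (Suc t)<..<b t}) (G (Suc t)) {}" using En_mono[of 0 "i + 3"] G[of "Suc t"] by simp
  qed
  define P where "P = conc K0 ?Z"
  have cZ: "countable ?Z" by (rule countable_zsum) (simp add: G)
  have cP: "countable P" unfolding P_def by (rule countable_conc[OF K0(1) cZ])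
  have NKJ: "N \<inter> {a<..<c} = K \<union> J"
  proof (intro equalityI subsetI)
    fix z assume "z \<in> N \<inter> {a<..<c}"
    then show "z \<in> K \<union> J" by (auto simp: K_def J_def not_le)
  next
    fix z assume "z \<in> K \<union> J"
    then consider "z \<in> N" "a < z" "z < b 0" | t where "z \<in> N" "z < c" "b t \<le> z" by (auto simp: K_def J_def)
    then show "z \<in> N \<inter> {a<..<c}" using b(3)[of 0] b(2) by cases (auto intro: less_trans less_le_trans)
  qed
  have EP: "En 0 (N \<inter> {a<..<c}) P {}" unfolding NKJ P_def
    by (rule En_conc[OF K0(2) EZ]) (auto simp: K_def J_def intro: less_le_trans)
  have copy: "\<not> hom i (P \<inter> {exp (- real (Suc t))<..<exp (- real t)})" for t
  proof -
    have "isom (?Z \<inter> {- real (Suc t)<..<- real t}) (P \<inter> {exp (- real (Suc t))<..<exp (- real t)})"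
      unfolding P_def by (rule conc_between[OF zsum_down_facts(1) zsum_down_facts(1)])
    then show ?thesis using nG[of t] hom_isom_iff zsum_down_facts(2) by blast
  qed
  have pt: "exp (- real t) \<in> P" for t unfolding P_def conc_def using zsum_down_facts(1) by blast
  have nP: "\<not> hom i (P \<inter> {..<exp z})" if "z \<in> ?Z" for z
  proof
    assume h: "hom i (P \<inter> {..<exp z})"
    obtain t where t: "- real t \<le> z" using zsum_down_facts(4)[OF \<open>z \<in> ?Z\<close>] by blast
    have lt: "exp (- real (Suc (Suc t))) < exp z" "exp (- real (Suc t)) < exp z" using t by auto
    have "hom i (P \<inter> {..<exp z} \<inter> {exp (- real (Suc (Suc t)))<..<exp (- real (Suc t))})"
      by (rule hom_between[OF h]) (simp_all only: Int_iff lessThan_iff pt lt simp_thms)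
    moreover have "P \<inter> {..<z'} \<inter> {u<..<v} = P \<inter> {u<..<v}" if "v < z'" for u v z' using that by auto
    note this[OF lt(2)]
    ultimately show False using copy[of "Suc t"] by (simp only:)
  qed
  have lP: "hom 6 (P \<inter> {..<- exp (- z)})" if "z \<in> K0" for z
    unfolding P_def using hom_isom[OF conc_below[OF that] hom_below[OF K0(3) that]] .
  have Pc: "(\<exists>w\<in>K0. z = - exp (- w)) \<or> (\<exists>w\<in>?Z. z = exp w)" if "z \<in> P" for z
    using that unfolding P_def conc_def by blast
  have alt: "hom 6 (P \<inter> {..<z}) \<or> \<not> hom i (P \<inter> {..<z})" if "z \<in> P" for z
    using Pc[OF that] lP nP by blast
  \<comment> \<open>The bound \<open>max 6 (i + 5) + 4\<close> is at most \<open>i + 10\<close>,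
    with equality for i = 0.\<close>
  have "hom (max 6 (i + 5) + 4) P"
  proof (rule hom_cut[OF cP])
    fix z assume z: "z \<in> P" "\<not> hom 6 (P \<inter> {..<z})"
    then obtain w where w: "w \<in> ?Z" "z = exp w" using Pc lP by blast
    show "hom (i + 5) (P \<inter> {z<..})" unfolding w(2) P_def
      by (rule hom_isom[OF conc_above[OF w(1)] zsum_down_above[OF hG w(1)]])
  qed
  then have "hom (i + 10) P" using hom_mono[of "max 6 (i + 5) + 4" "i + 10"] by simp
  moreover have "\<not> hom i P"
    using hom_below[of i P "exp (- real 0)"] pt nP[OF zsum_down_facts(1)[of 0]] by blast
  moreover have "hom 16 (P \<inter> {..<x}) \<or> \<not> hom i (P \<inter> {..<x})" if "x \<in> P" for x
    using alt[OF that] hom_mono[of 6 16] by auto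
  ultimately show ?thesis using cP EP by blast
qed

text \<open>The windows from level 40 k to level 40 k + 16 are disjoint and wide enough for the
  additive losses of the construction. The value k = 0 is left out because initial segments of level
  at most 16 are not controlled.\<close>

definition code :: "real set \<Rightarrow> nat set" where
  "code N = {k. 1 \<le> k \<and> (\<exists>x\<in>N. \<not> hom (40 * k) (N \<inter> {..<x}) \<and> hom (40 * k + 16) (N \<inter> {..<x}))}"

text \<open>One move matches the end points of the initial segments, and 19 = 16 + 3 levels transfer
  both bounds of the window.\<close>

lemma code_En:
  assumes c: "countable N" "countable N'" and E: "\<And>n. En n N N' {}"
  shows "code N \<subseteq> code N'"
proof
  fix k assume "k \<in> code N"
  then obtain x where x: "1 \<le> k" "x \<in> N" "\<not> hom (40 * k) (N \<inter> {..<x})" "hom (40 * k + 16) (N \<inter> {..<x})"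
    by (auto simp: code_def)
  obtain q y where q: "(x, y) \<in> q" "En (40 * k + 19) N N' q" by (rule En_forth1[OF E x(2)])
  have e: "En (40 * k + 19) (N \<inter> {..<x}) (N' \<inter> {..<y}) {}" by (rule En_below0[OF q(2,1)])
  have cc: "countable (N \<inter> {..<x})" "countable (N' \<inter> {..<y})" using c by auto
  have "hom (40 * k) (N \<inter> {..<x}) \<longleftrightarrow> hom (40 * k) (N' \<inter> {..<y})"
    by (rule hom_En_iff[OF cc En_mono[OF _ e]]) simp
  moreover have "hom (40 * k + 16) (N \<inter> {..<x}) \<longleftrightarrow> hom (40 * k + 16) (N' \<inter> {..<y})"
    by (rule hom_En_iff[OF cc En_mono[OF _ e]]) simp
  moreover have "y \<in> N'" using En_base(2)[OF q(2)] q(1) by auto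
  ultimately show "k \<in> code N'" using x by (auto simp: code_def)
qed

definition ladder :: "real set \<Rightarrow> bool" where
  "ladder N \<longleftrightarrow> (\<exists>x. \<forall>k. x k \<in> N \<and> x k < x (Suc k) \<and> dec (\<lambda>_. k) (N \<inter> {x k<..<x (Suc k)}))"

text \<open>Rungs with the indices \<open>40 * \<kappa> l\<close> are reshaped by
  \<open>dec_piece\<close>, so that the levels of initial segments jump from one window belonging to
  \<open>\<kappa>\<close> to the next and skip all others.\<close>

lemma ladder_code:
  fixes \<kappa> :: "nat \<Rightarrow> nat"
  assumes thin: "thin M" and N: "N \<in> cls M" and lad: "ladder N" and \<kappa>: "strict_mono \<kappa>" "1 \<le> \<kappa> 0"
  shows "\<exists>N'\<in>cls M. code N' = range \<kappa>"
proof -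
  obtain x where x: "\<And>k. x k \<in> N" "\<And>k. x k < x (Suc k)" "\<And>k. dec (\<lambda>_. k) (N \<inter> {x k<..<x (Suc k)})"
    using lad unfolding ladder_def by blast
  have xm: "strict_mono x" using x(2) by (simp add: strict_mono_Suc_iff)
  have km: "\<kappa> l < \<kappa> (Suc l)" for l using \<kappa>(1) by (simp add: strict_mono_Suc_iff)
  define a where "a l = x (40 * \<kappa> l)" for l
  have aN: "a l \<in> N" for l using x(1) by (simp add: a_def)
  have am: "a l < a (Suc l)" for l unfolding a_def using strict_monoD[OF xm] km[of l] by simp
  have "dec (\<lambda>_. 40 * \<kappa> l) (N \<inter> {a l<..<a (Suc l)})" for l
  proof (rule dec_convex[OF x(3)[of "40 * \<kappa> l"]])
    have "x (Suc (40 * \<kappa> l)) \<le> a (Suc l)" unfolding a_def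
      using strict_mono_less_eq[OF xm] km[of l] by simp
    then show "N \<inter> {x (40 * \<kappa> l)<..<x (Suc (40 * \<kappa> l))} \<subseteq> N \<inter> {a l<..<a (Suc l)}" by (auto simp: a_def)
  qed auto
  then have "\<forall>l. \<exists>P. countable P \<and> En 0 (N \<inter> {a l<..<a (Suc l)}) P {} \<and> hom (40 * \<kappa> l + 10) P \<and>
    \<not> hom (40 * \<kappa> l) P \<and> (\<forall>x\<in>P. hom 16 (P \<inter> {..<x}) \<or> \<not> hom (40 * \<kappa> l) (P \<inter> {..<x}))"
    by (intro allI dec_piece[OF thin N aN aN])
  from choice[OF this] obtain P where P0: "\<forall>l. countable (P l) \<and> En 0 (N \<inter> {a l<..<a (Suc l)}) (P l) {} \<and> hom (40 * \<kappa> l + 10) (P l) \<and>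
    \<not> hom (40 * \<kappa> l) (P l) \<and> (\<forall>x\<in>P l. hom 16 (P l \<inter> {..<x}) \<or> \<not> hom (40 * \<kappa> l) (P l \<inter> {..<x}))" ..
  have P: "\<And>l. countable (P l)" "\<And>l. En 0 (N \<inter> {a l<..<a (Suc l)}) (P l) {}"
    "\<And>l. hom (40 * \<kappa> l + 10) (P l)" "\<And>l. \<not> hom (40 * \<kappa> l) (P l)"
    "\<And>l x. x \<in> P l \<Longrightarrow> hom 16 (P l \<inter> {..<x}) \<or> \<not> hom (40 * \<kappa> l) (P l \<inter> {..<x})"
    using P0 by simp_all
  obtain G0 where G0: "countable G0" "En 0 (N \<inter> {..<a 0}) G0 {}" "hom 2 G0"
    using generic_below[OF thin N aN, of 0 0] by (auto simp: numeral_2_eq_2)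
  let ?F = "\<lambda>i. if 0 \<le> i then P (nat i) else if i = -1 then G0 else {}"
  define Z where "Z = zsum {0..} ?F"
  note Zf = zsum_up_facts[where G = P and ?G0.0 = G0, folded Z_def]
  define L where "L = {z\<in>N. \<exists>l. z < a l}"
  define R where "R = {z\<in>N. \<forall>l. a l \<le> z}"
  have "En 0 L Z {}" unfolding Z_def
  proof (rule En_zsum_up)
    show "a l \<in> L" for l using aN am by (auto simp: L_def)
    show "a l < a (Suc l)" for l by (rule am)
    show "\<exists>l. z < a l" if "z \<in> L" for z using that by (simp add: L_def)
    have "L \<inter> {..<a 0} = N \<inter> {..<a 0}" by (auto simp: L_def)
    then show "En 0 (L \<inter> {..<a 0}) G0 {}" using G0 by simp
    fix l
    have "L \<inter> {a l<..<a (Suc l)} = N \<inter> {a l<..<a (Suc l)}" by (auto simp: L_def)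
    then show "En 0 (L \<inter> {a l<..<a (Suc l)}) (P l) {}" using P(2) by simp
  qed
  then have "En 0 (L \<union> R) (conc Z R) {}"
    by (rule En_conc[OF _ En_refl0]) (auto simp: L_def R_def intro: less_le_trans)
  moreover have "L \<union> R = N" by (auto simp: L_def R_def not_le)
  ultimately have E: "En 0 N (conc Z R) {}" by simp
  define N' where "N' = conc Z R"
  have cN: "countable N" using N by (simp add: cls_def)
  have cZ: "countable Z" unfolding Z_def by (rule countable_zsum) (simp add: P(1) G0(1))
  have "countable N'" unfolding N'_def by (rule countable_conc[OF cZ]) (use cN in \<open>auto simp: R_def intro: countable_subset[of _ N]\<close>)
  then have N'cls: "N' \<in> cls M" using cls_En[OF N _ E] by (simp add: N'_def)
  \<comment> \<open>Levels do not add up along the sum: joining at the integer points takes maxima,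
    and \<open>40 * \<kappa> l + 10\<close> increases with l.\<close>
  have H1: "hom (40 * \<kappa> l + 10) (Z \<inter> {..<real (Suc l)})" for l
  proof (induction l)
    case 0
    have "hom (40 * \<kappa> 0 + 10) (Z \<inter> {..<real 0})"
      using hom_mono[OF _ hom_isom[OF Zf(3) G0(3)]] by simp
    then show ?case by (rule hom_join_below[OF _ hom_isom[OF Zf(2) P(3)] Zf(1)]) simp
  next
    case (Suc l)
    have "hom (40 * \<kappa> (Suc l) + 10) (Z \<inter> {..<real (Suc l)})"
      by (rule hom_mono[OF _ Suc.IH]) (use km[of l] in simp)
    then show ?case by (rule hom_join_below[OF _ hom_isom[OF Zf(2) P(3)] Zf(1)]) simp
  qed
  have ab: "\<not> hom n (Z \<inter> {..<x})" if "\<not> hom n (Z \<inter> {real l<..<x})" "real l < x" for n l x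
  proof
    assume "hom n (Z \<inter> {..<x})"
    then have "hom n (Z \<inter> {..<x} \<inter> {real l<..})" by (rule hom_above) (use Zf(1) that in auto)
    moreover have "Z \<inter> {..<x} \<inter> {real l<..} = Z \<inter> {real l<..<x}" by auto
    ultimately show False using that by simp
  qed
  have H2: "\<not> hom (40 * \<kappa> l) (Z \<inter> {..<real (Suc l)})" for l
    by (rule ab[of _ l]) (use P(4)[of l] hom_isom_iff[OF Zf(2)[of l]] in auto)
  have bel: "hom n (Z \<inter> {..<y})" if "hom n (Z \<inter> {..<x})" "y \<in> Z" "y < x" for n x y
  proof -
    have "hom n (Z \<inter> {..<x} \<inter> {..<y})" by (rule hom_below[OF that(1)]) (use that in auto)
    moreover have "Z \<inter> {..<x} \<inter> {..<y} = Z \<inter> {..<y}" using that by auto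
    ultimately show ?thesis by simp
  qed
  \<comment> \<open>An initial segment ending in piece l either keeps the window of the previous
    piece, since only a part of level 16 is added, or has jumped to the window of
    \<open>\<kappa> l\<close>. Before the first jump the level is at most 16.\<close>
  have T: "hom 16 (Z \<inter> {..<z}) \<or> (\<exists>l. \<not> hom (40 * \<kappa> l) (Z \<inter> {..<z}) \<and> hom (40 * \<kappa> l + 16) (Z \<inter> {..<z}))" if z: "z \<in> Z" for z
  proof -
    have h0: "hom 16 (Z \<inter> {..<0})" using hom_mono[OF _ hom_isom[OF Zf(3) G0(3)]] by simp
    consider "z < 0" | l where "z = real l" | l where "z \<in> Z \<inter> {real l<..<real (Suc l)}" using Zf(4)[OF z] by blast
    then show ?thesis
    proof cases
      case 1 then show ?thesis using bel[OF h0 z] by simp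
    next
      case (2 l)
      show ?thesis
      proof (cases l)
        case 0 then show ?thesis using h0 2 by simp
      next
        case (Suc j)
        then show ?thesis using H2[of j] hom_mono[OF _ H1[of j], of "40 * \<kappa> j + 16"] 2 by auto
      qed
    next
      case (3 l)
      obtain f where f: "oiso f (P l) (Z \<inter> {real l<..<real (Suc l)})" using Zf(2) unfolding isom_def by blast
      then have "z \<in> f ` P l" using 3 by (simp only: oiso_def)
      then obtain z' where z': "z' \<in> P l" "z = f z'" by blast
      have lz: "real l < z" "z < real (Suc l)" using 3 by auto
      have eq: "Z \<inter> {real l<..<real (Suc l)} \<inter> {..<z} = Z \<inter> {real l<..<z}" using lz by auto
      have i: "hom n (P l \<inter> {..<z'}) \<longleftrightarrow> hom n (Z \<inter> {real l<..<z})" for n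
        using hom_isom_iff[OF oiso_isom[OF oiso_below[OF f z'(1)]]] unfolding z'(2)[symmetric] eq .
      from P(5)[OF z'(1)] show ?thesis
      proof
        assume "\<not> hom (40 * \<kappa> l) (P l \<inter> {..<z'})"
        then have "\<not> hom (40 * \<kappa> l) (Z \<inter> {..<z})" using ab[of _ l z] lz i by blast
        moreover have "hom (40 * \<kappa> l + 16) (Z \<inter> {..<z})"
          by (rule hom_mono[OF _ bel[OF H1[of l] z lz(2)]]) simp
        ultimately show ?thesis by blast
      next
        assume "hom 16 (P l \<inter> {..<z'})"
        then have h: "hom 16 (Z \<inter> {real l<..<z})" using i by simp
        show ?thesis
        proof (cases l)
          case 0
          then have "hom 16 (Z \<inter> {..<z})" using hom_join_below[of 16 Z 0 z] h h0 Zf(1)[of 0] lz by simp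
          then show ?thesis ..
        next
          case (Suc j)
          have "hom (40 * \<kappa> j + 16) (Z \<inter> {..<z})"
            by (rule hom_join_below[OF hom_mono[OF _ H1[of j]] hom_mono[OF _ h, unfolded Suc] Zf(1)]) (use lz Suc in auto)
          moreover have "\<not> hom (40 * \<kappa> j) (Z \<inter> {..<z})"
            using bel[OF _ Zf(1)[of "Suc j"]] H2[of j] lz Suc by blast
          ultimately show ?thesis by blast
        qed
      qed
    qed
  qed
  have iso: "hom n (N' \<inter> {..<- exp (- z)}) \<longleftrightarrow> hom n (Z \<inter> {..<z})" if "z \<in> Z" for n z
    unfolding N'_def using hom_isom_iff[OF conc_below[OF that]] by simp
  have ZN: "- exp (- z) \<in> N'" if "z \<in> Z" for z using that by (auto simp: N'_def conc_def)
  have "code N' = range \<kappa>"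
  proof
    show "range \<kappa> \<subseteq> code N'"
    proof
      fix k assume "k \<in> range \<kappa>"
      then obtain l where k: "k = \<kappa> l" by blast
      have "1 \<le> k" using \<kappa>(2) strict_mono_less_eq[OF \<kappa>(1), of 0 l] k by simp
      moreover have "hom (40 * k + 16) (Z \<inter> {..<real (Suc l)})" using hom_mono[OF _ H1[of l], of "40 * k + 16"] k by simp
      ultimately show "k \<in> code N'" unfolding code_def
        using iso[OF Zf(1)[of "Suc l"]] ZN[OF Zf(1)[of "Suc l"]] H2[of l] k by blast
    qed
    show "code N' \<subseteq> range \<kappa>"
    proof
      fix k assume "k \<in> code N'"
      then obtain y where y: "1 \<le> k" "y \<in> N'" "\<not> hom (40 * k) (N' \<inter> {..<y})" "hom (40 * k + 16) (N' \<inter> {..<y})"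
        by (auto simp: code_def)
      from y(2) consider z where "z \<in> Z" "y = - exp (- z)" | z where "z \<in> R" "y = exp z"
        unfolding N'_def conc_def by blast
      then show "k \<in> range \<kappa>"
      proof cases
        case (1 z)
        have zz: "\<not> hom (40 * k) (Z \<inter> {..<z})" "hom (40 * k + 16) (Z \<inter> {..<z})" using y 1 iso[OF 1(1)] by auto
        from T[OF 1(1)] show ?thesis
        proof
          assume "hom 16 (Z \<inter> {..<z})"
          then show ?thesis using zz(1) hom_mono[of 16 "40 * k"] y(1) by simp
        next
          assume "\<exists>l. \<not> hom (40 * \<kappa> l) (Z \<inter> {..<z}) \<and> hom (40 * \<kappa> l + 16) (Z \<inter> {..<z})"
          then obtain l where l: "\<not> hom (40 * \<kappa> l) (Z \<inter> {..<z})" "hom (40 * \<kappa> l + 16) (Z \<inter> {..<z})" by blast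
          have "\<not> \<kappa> l < k" using hom_mono[OF _ l(2), of "40 * k"] zz(1) by auto
          moreover have "\<not> k < \<kappa> l" using hom_mono[OF _ zz(2), of "40 * \<kappa> l"] l(1) by auto
          ultimately show ?thesis by (metis linorder_neqE_nat rangeI)
        qed
      next
        case (2 z)
        \<comment> \<open>A point above the whole sum has all pieces below it; already the pieces up
          to number k + 1 exceed the window of k.\<close>
        let ?l = "Suc k" and ?u = "- exp (- real (Suc (Suc k)))"
        have lt: "?u < y" using conc_order[of "real (Suc (Suc k))" z] 2 by simp
        have "hom (40 * k + 16) (N' \<inter> {..<y} \<inter> {..<?u})"
          by (rule hom_below[OF y(4)]) (use lt ZN[OF Zf(1)[of "Suc (Suc k)"]] in auto)
        moreover have "N' \<inter> {..<y} \<inter> {..<?u} = N' \<inter> {..<?u}" using lt by auto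
        ultimately have "hom (40 * k + 16) (Z \<inter> {..<real (Suc (Suc k))})" using iso[OF Zf(1)[of "Suc (Suc k)"]] by simp
        moreover have "k + 1 \<le> \<kappa> (Suc k)" using strict_mono_imp_increasing[OF \<kappa>(1), of "Suc k"] by simp
        ultimately show ?thesis using hom_mono[of "40 * k + 16" "40 * \<kappa> (Suc k)"] H2[of "Suc k"] by simp
      qed
    qed
  qed
  then show ?thesis using N'cls by blast
qed

lemma no_ladder:
  assumes thin: "thin M" and N: "N \<in> cls M"
  shows "\<not> ladder N"
proof
  assume lad: "ladder N"
  from thin obtain R :: "nat \<Rightarrow> real set" where R: "\<forall>j. countable (R j)" "\<forall>N\<in>cls M. \<exists>j. \<forall>n. En n N (R j) {}"
    unfolding thin_def by auto
  \<comment> \<open>The value \<open>\<kappa> l\<close> is 2 l + 1 or 2 l + 2, chosen so that 2 l +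
    1 is in the coded set exactly when it is not in the code of the l-th representative. Both
    choices keep \<open>\<kappa>\<close> strictly increasing.\<close>
  define \<kappa> where "\<kappa> l = 2 * l + 1 + (if 2 * l + 1 \<in> code (R l) then 1 else 0 :: nat)" for l
  have "strict_mono \<kappa>" unfolding strict_mono_Suc_iff by (simp add: \<kappa>_def)
  then obtain N' where N': "N' \<in> cls M" "code N' = range \<kappa>"
    using ladder_code[OF thin N lad, of \<kappa>] by (auto simp: \<kappa>_def)
  obtain j where j: "\<forall>n. En n N' (R j) {}" using bspec[OF R(2) N'(1)] ..
  have cN': "countable N'" using N'(1) by (simp add: cls_def)
  have "code N' \<subseteq> code (R j)" by (rule code_En) (use cN' R(1) j in auto)
  moreover have "code (R j) \<subseteq> code N'" by (rule code_En) (use cN' R(1) j En_sym0 in auto)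
  ultimately have eq: "code (R j) = range \<kappa>" using N'(2) by blast
  show False
  proof (cases "2 * j + 1 \<in> code (R j)")
    case True
    then obtain l where l: "\<kappa> l = 2 * j + 1" using eq by (metis rangeE)
    show False
    proof (cases "l = j")
      case True then show False using l \<open>2 * j + 1 \<in> code (R j)\<close> by (simp add: \<kappa>_def)
    next
      case False then show False using l by (auto simp: \<kappa>_def split: if_splits)
    qed
  next
    case False
    then have "\<kappa> j = 2 * j + 1" by (simp add: \<kappa>_def)
    then show False using False eq by (metis rangeI)
  qed
qed

lemma no_ladder_down:
  assumes thin: "thin M" and N: "N \<in> cls M"
    and x: "\<And>k. x k \<in> N" "\<And>k. x (Suc k) < x k" "\<And>k. inc (\<lambda>_. k) (N \<inter> {x (Suc k)<..<x k})"
  shows False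
proof -
  have "uminus ` N \<in> cls (uminus ` M)" by (rule cls_uminus) (simp add: uminus_image2 N)
  moreover have "ladder (uminus ` N)" unfolding ladder_def
    using x by (intro exI[of _ "\<lambda>k. - x k"]) (auto simp: uminus_Int_image dec_uminus_iff)
  ultimately show False using no_ladder[OF thin_uminus[OF thin]] by blast
qed

end

context base_level begin

section \<open>Unbounded orders\<close>

lemma low_join_below:
  assumes "low (A \<inter> {..<x})" "low (A \<inter> {x<..<y})" "x \<in> A" "x < y"
  shows "low (A \<inter> {..<y})"
proof -
  obtain i j where "hom i (A \<inter> {..<x})" "hom j (A \<inter> {x<..<y})" using assms by (auto simp: low_def)
  then have "hom (max i j) (A \<inter> {..<y})"
    using hom_join_below[OF hom_mono hom_mono assms(3,4), of i "max i j" j] by simp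
  then show ?thesis by (auto simp: low_def)
qed

lemma hom_between_below:
  assumes "hom n (A \<inter> {..<y})" "x \<in> A" shows "hom n (A \<inter> {x<..<y})"
proof (cases "x < y")
  case True
  then have "hom n (A \<inter> {..<y} \<inter> {x<..})" by (intro hom_above[OF assms(1)]) (use assms in auto)
  moreover have "A \<inter> {..<y} \<inter> {x<..} = A \<inter> {x<..<y}" by auto
  ultimately show ?thesis by simp
next
  case False
  then have "A \<inter> {x<..<y} = {}" by auto
  then show ?thesis using hom_empty by simp
qed

lemma hom_below_le:
  assumes "hom n (A \<inter> {..<y})" "x \<in> A" "x \<le> y" shows "hom n (A \<inter> {..<x})"
proof (cases "x = y")
  case False
  then have "hom n (A \<inter> {..<y} \<inter> {..<x})" by (intro hom_below[OF assms(1)]) (use assms in auto)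
  moreover have "A \<inter> {..<y} \<inter> {..<x} = A \<inter> {..<x}" using assms by auto
  ultimately show ?thesis by simp
qed (use assms in simp)

lemma unbI:
  assumes x: "x \<in> H" "low (H \<inter> {..<x})"
    and z: "\<And>k. \<exists>z\<in>H. x < z \<and> low (H \<inter> {x<..<z}) \<and> \<not> hom k (H \<inter> {x<..<z})"
  shows "unb H"
  unfolding unb_def
proof
  fix k
  obtain z where z: "z \<in> H" "x < z" "low (H \<inter> {x<..<z})" "\<not> hom k (H \<inter> {x<..<z})" using z by blast
  have "low (H \<inter> {..<z})" by (rule low_join_below[OF x(2) z(3) x(1) z(2)])
  moreover have "\<not> hom k (H \<inter> {..<z})" using hom_between_below x(1) z(4) by blast
  ultimately show "\<exists>z\<in>H. low (H \<inter> {..<z}) \<and> \<not> hom k (H \<inter> {..<z})" using z(1) by blast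
qed

text \<open>A decreasing sequence in a tail has a largest member, so it already lies below some
  \<open>a k\<close>. If every tail had such sequences, a subsequence of \<open>a\<close> would be a
  ladder.\<close>

lemma no_dec_tail:
  assumes thin: "thin M" and N: "N \<in> cls M" and a: "\<And>k. a k \<in> N" "\<And>k. a k < a (Suc k)"
  shows "\<exists>i. \<not> dec (\<lambda>_. i) {z\<in>N. a i < z \<and> (\<exists>k. z < a k)}"
proof (rule ccontr)
  assume "\<not> ?thesis"
  then have d: "dec (\<lambda>_. i) {z\<in>N. a i < z \<and> (\<exists>k. z < a k)}" for i by blast
  have am: "strict_mono a" using a(2) by (simp add: strict_mono_Suc_iff)
  have nx: "\<exists>k. i < k \<and> dec (\<lambda>_. i) (N \<inter> {a i<..<a k})" for i
  proof -
    let ?J = "{z\<in>N. a i < z \<and> (\<exists>k. z < a k)}"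
    obtain b where b: "\<And>t. b t \<in> ?J \<and> b (Suc t) < b t \<and> \<not> hom i (?J \<inter> {b (Suc t)<..<b t})"
      using d[of i] unfolding dec_def by blast
    obtain k where k: "b 0 < a k" using b[of 0] by blast
    have b0: "b t \<le> b 0" for t
      by (induction t) (use b in \<open>auto intro: order_trans[OF less_imp_le]\<close>)
    have "?J \<inter> {b (Suc t)<..<b t} = N \<inter> {a i<..<a k} \<inter> {b (Suc t)<..<b t}" for t
    proof -
      have l: "a i < b (Suc t)" "b t < a k" using b[of "Suc t"] b0[of t] k by auto
      show ?thesis
      proof (intro equalityI subsetI)
        fix z assume "z \<in> ?J \<inter> {b (Suc t)<..<b t}"
        then show "z \<in> N \<inter> {a i<..<a k} \<inter> {b (Suc t)<..<b t}" using l by auto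
      next
        fix z assume "z \<in> N \<inter> {a i<..<a k} \<inter> {b (Suc t)<..<b t}"
        then show "z \<in> ?J \<inter> {b (Suc t)<..<b t}" by auto
      qed
    qed
    moreover have "b t \<in> N \<inter> {a i<..<a k}" for t using b[of t] b0[of t] k by auto
    ultimately have "dec (\<lambda>_. i) (N \<inter> {a i<..<a k})" unfolding dec_def using b by (intro exI[of _ b]) auto
    moreover have "a i < a k" using b[of 0] k by auto
    then have "i < k" using strict_mono_less[OF am] by simp
    ultimately show ?thesis by blast
  qed
  have "\<exists>n. \<forall>i. True \<and> (n i < n (Suc i) \<and> dec (\<lambda>_. n i) (N \<inter> {a (n i)<..<a (n (Suc i))}))"
    by (rule dependent_nat_choice) (use nx in auto)
  then obtain n where n: "\<And>i. n i < n (Suc i)" "\<And>i. dec (\<lambda>_. n i) (N \<inter> {a (n i)<..<a (n (Suc i))})" by blast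
  have nm: "strict_mono n" using n(1) by (simp add: strict_mono_Suc_iff)
  have "dec (\<lambda>_. i) (N \<inter> {a (n i)<..<a (n (Suc i))})" for i
    by (rule dec_mono[OF n(2)]) (rule strict_mono_imp_increasing[OF nm])
  then have "ladder N" unfolding ladder_def
    using a(1) strict_monoD[OF am n(1)] by (intro exI[of _ "\<lambda>i. a (n i)"]) auto
  then show False using no_ladder[OF thin N] by blast
qed

text \<open>\<open>chain_limit\<close> relates stage k to the limit at level k only. To gain level
  \<open>l k\<close>, the chain is first followed for \<open>l k\<close> further stages, along which
  equivalence of level \<open>l k\<close> holds.\<close>

lemma chain_limit0:
  assumes H: "\<And>k. countable (H k)" and l: "1 \<le> l 0" "\<And>k. l k < l (Suc k)"
    and step: "\<And>k. En (l k) (H k) (H (Suc k)) {}"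
  shows "\<exists>G. countable G \<and> (\<forall>k. En (l k) (H k) G {})"
proof -
  have lm: "strict_mono l" using l(2) by (simp add: strict_mono_Suc_iff)
  have lk: "Suc (0 + k) \<le> l k" for k
  proof (induction k)
    case (Suc k) then show ?case using l(2)[of k] by simp
  qed (use l in simp)
  from chain_limit[where n = 0 and H = H and \<rho> = "\<lambda>_. {}", OF H En_mono[OF lk step]]
  obtain G f where G: "countable G" "\<And>k. strict_mono (f k)" "\<And>k. En k (f k ` H k) G {}" by auto
  have iso: "En n (H k) (f k ` H k) {}" for n k
    by (rule En_isom, rule oiso_isom, rule oiso_image) (use G(2)[of k] in \<open>simp add: strict_mono_on_def strict_mono_def\<close>)
  have far: "En (l k) (H k) (H (k + d)) {}" for k d
  proof (induction d)
    case (Suc d)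
    have "l k \<le> l (k + d)" using strict_mono_less_eq[OF lm] by simp
    then show ?case using En_trans0[OF Suc.IH En_mono[OF _ step[of "k + d"]]] by simp
  qed (simp add: En_refl0)
  have "En (l k) (H k) G {}" for k
    by (rule En_trans0[OF far[of k "l k"] En_trans0[OF iso En_mono[OF _ G(3)]]]) simp
  then show ?thesis using G(1) by blast
qed

definition fam :: "nat \<Rightarrow> real set \<Rightarrow> real set set" where
  "fam m H0 = {H. countable H \<and> En m H0 H {} \<and> unb H}"

section \<open>Orders grafted below a fixed point\<close>

context
  fixes M N :: "real set" and y :: real
  assumes thin: "thin M" and cN: "countable N"
begin

text \<open>The orders \<open>H\<close> considered here form the part below \<open>y\<close> of an
  ambient member of the class; results on the class are applied to the ambient order and read off
  for \<open>H\<close>.\<close>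

abbreviation gf :: "real set \<Rightarrow> real set" where
  "gf H \<equiv> below_graft y H N"

lemma gf_cong: "En l H H' {} \<Longrightarrow> En l (gf H) (gf H') {}"
proof -
  assume E: "En l H H' {}"
  have i: "isom H (gf H \<inter> {..<y})" for H using oiso_isom[OF below_graft_below] .
  have "En l (gf H \<inter> {..<y} \<union> N \<inter> {y..}) (gf H' \<inter> {..<y} \<union> N \<inter> {y..}) ({} \<union> {})"
    by (rule En_sum2[OF En_trans0[OF En_isom[OF isom_sym[OF i]] En_trans0[OF E En_isom[OF i]]] En_refl0]) auto
  moreover have "gf H \<inter> {..<y} \<union> N \<inter> {y..} = gf H" for H by (auto simp: below_graft_def)
  ultimately show ?thesis by simp
qed

lemma gf_cls: "gf H \<in> cls M \<Longrightarrow> countable H' \<Longrightarrow> En l H H' {} \<Longrightarrow> gf H' \<in> cls M"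
  by (rule cls_En[OF _ countable_below_graft[OF _ cN] gf_cong])

lemma gf_point: "x \<in> H \<Longrightarrow> y - exp (- x) \<in> gf H"
  by (simp add: below_graft_def)

lemma gf_below: "x \<in> H \<Longrightarrow> isom (H \<inter> {..<x}) (gf H \<inter> {..<y - exp (- x)})"
proof -
  assume x: "x \<in> H"
  have "gf H \<inter> {..<y} \<inter> {..<y - exp (- x)} = gf H \<inter> {..<y - exp (- x)}" by (auto intro: less_trans)
  then show ?thesis using oiso_isom[OF oiso_below[OF below_graft_below x, of y N]] by simp
qed

lemma gf_generic_below:
  assumes "gf H \<in> cls M" "x \<in> H"
  shows "\<exists>G. countable G \<and> En m (H \<inter> {..<x}) G {} \<and> hom (m + 2) G"
  using generic_below[OF thin assms(1) gf_point[OF assms(2)], of m] En_trans0[OF En_isom[OF gf_below[OF assms(2)]]] by blast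

lemma gf_no_dec_tail:
  assumes H: "gf H \<in> cls M" and a: "\<And>k. a k \<in> H" "\<And>k. a k < a (Suc k)"
  shows "\<exists>i. \<not> dec (\<lambda>_. i) {z\<in>H. a i < z \<and> (\<exists>k. z < a k)}"
proof -
  let ?h = "\<lambda>t. y - exp (- t) :: real"
  obtain i where i: "\<not> dec (\<lambda>_. i) {z\<in>gf H. ?h (a i) < z \<and> (\<exists>k. z < ?h (a k))}"
    using no_dec_tail[OF thin H, of "\<lambda>k. ?h (a k)"] gf_point a by auto
  have eq: "{z\<in>gf H. ?h (a i) < z \<and> (\<exists>k. z < ?h (a k))} = ?h ` {z\<in>H. a i < z \<and> (\<exists>k. z < a k)}"
  proof (intro equalityI subsetI)
    fix z assume z: "z \<in> {z\<in>gf H. ?h (a i) < z \<and> (\<exists>k. z < ?h (a k))}"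
    then obtain k where "z < ?h (a k)" by blast
    then have "z < y" by (rule less_trans) simp
    then obtain w where w: "w \<in> H" "z = ?h w" using z by (auto simp: below_graft_def)
    then show "z \<in> ?h ` {z\<in>H. a i < z \<and> (\<exists>k. z < a k)}" using z by auto
  qed (auto simp: below_graft_def)
  have "isom {z\<in>H. a i < z \<and> (\<exists>k. z < a k)} (?h ` {z\<in>H. a i < z \<and> (\<exists>k. z < a k)})"
    by (rule oiso_isom, rule oiso_image, rule strict_mono_onI) simp
  from dec_isom[OF this, of "\<lambda>_. i"] i show ?thesis unfolding eq by blast
qed

text \<open>A tail of the increasing sequence without decreasing sequences is not low, because the
  sequence has unbounded levels, hence it is unbounded by \<open>not_low_cases\<close>. What
  precedes the tail is made low by a generic replacement, so that unboundedness passes to the whole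
  order.\<close>

lemma fam_nonempty:
  assumes H: "countable H0" "gf H0 \<in> cls M" "inc (\<lambda>k. k) H0"
  shows "\<exists>H. H \<in> fam m H0"
proof -
  obtain a where a: "\<And>k. a k \<in> H0" "\<And>k. a k < a (Suc k)" "\<And>k. \<not> hom k (H0 \<inter> {a k<..<a (Suc k)})"
    using H(3) unfolding inc_def by blast
  have am: "strict_mono a" using a(2) by (simp add: strict_mono_Suc_iff)
  obtain i where i: "\<not> dec (\<lambda>_. i) {z\<in>H0. a i < z \<and> (\<exists>k. z < a k)}" using gf_no_dec_tail[OF H(2), of a, OF a(1,2)] by blast
  define x where "x = a i"
  define J where "J = {z\<in>H0. x < z \<and> (\<exists>k. z < a k)}"
  have cJ: "countable J" by (rule countable_subset[OF _ H(1)]) (auto simp: J_def)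
  have aJ: "a k \<in> J" if "i < k" for k using that strict_monoD[OF am] a(1,2) unfolding J_def x_def by blast
  have nl: "\<not> low J"
  proof
    assume "low J"
    then obtain n where n: "hom n J" by (auto simp: low_def)
    define k where "k = Suc (max n i)"
    have ik: "i < k" "n \<le> k" by (auto simp: k_def)
    have "hom n (J \<inter> {a k<..<a (Suc k)})" by (rule hom_between[OF n aJ aJ]) (use ik in auto)
    moreover have "J \<inter> {a k<..<a (Suc k)} = H0 \<inter> {a k<..<a (Suc k)}"
      using aJ[OF ik(1)] by (auto simp: J_def)
    ultimately show False using a(3)[of k] hom_mono[OF ik(2)] by simp
  qed
  then have uJ: "unb J" using not_low_cases[OF cJ nl, of "\<lambda>_. i"] i unfolding J_def x_def by blast
  have xH: "x \<in> H0" using a(1) by (simp add: x_def)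
  obtain G where G: "countable G" "En m (H0 \<inter> {..<x}) G {}" "hom (m + 2) G"
    using gf_generic_below[OF H(2) xH] by blast
  let ?H = "below_graft x G H0"
  have ab: "z \<in> ?H \<longleftrightarrow> z \<in> H0" if "x \<le> z" for z using below_graft_above[of x G H0] that by auto
  have "unb ?H"
  proof (rule unbI)
    show "x \<in> ?H" using ab[of x] xH by simp
    have "hom (m + 2) (?H \<inter> {..<x})" by (rule hom_isom[OF oiso_isom[OF below_graft_below] G(3)])
    then show "low (?H \<inter> {..<x})" by (auto simp: low_def)
    fix k
    obtain z where z: "z \<in> J" "low (J \<inter> {..<z})" "\<not> hom k (J \<inter> {..<z})" using uJ unfolding unb_def by blast
    then have zz: "z \<in> H0" "x < z" by (auto simp: J_def)
    have "J \<inter> {..<z} = ?H \<inter> {x<..<z}" using z(1) ab by (auto simp: J_def) (meson less_trans)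
    then show "\<exists>z\<in>?H. x < z \<and> low (?H \<inter> {x<..<z}) \<and> \<not> hom k (?H \<inter> {x<..<z})" using z zz ab[of z] by auto
  qed
  moreover have "En m H0 ?H {}" using En_below_graft[OF G(2), of "{}"] by simp
  ultimately show ?thesis using countable_below_graft[OF G(1) H(1)] by (auto simp: fam_def)
qed

text \<open>
  Otherwise a diagonal sequence of members of the family, each close to the next, has a limit that is
  equivalent to none of the countably many representatives.
\<close>

lemma isolated_member:
  assumes H: "H1 \<in> fam m H0" and cls: "gf H0 \<in> cls M"
  shows "\<exists>H\<in>fam m H0. \<exists>n. m < n \<and> (\<forall>H'\<in>fam m H0. En n H H' {} \<longrightarrow> (\<forall>k. En k (gf H) (gf H') {}))"
proof (rule ccontr)
  assume contr: "\<not> ?thesis"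
  from thin obtain R :: "nat \<Rightarrow> real set" where R: "\<forall>j. countable (R j)" "\<forall>N\<in>cls M. \<exists>j. \<forall>n. En n N (R j) {}"
    unfolding thin_def by auto
  \<comment> \<open>If \<open>H\<close> differs from the j-th representative it is kept; otherwise a
    close member that differs exists because \<open>H\<close> is not isolated. The level
    \<open>l'\<close> is high enough for the difference to persist in the limit.\<close>
  have nx: "\<exists>H' l'. H' \<in> fam m H0 \<and> l < l' \<and> En l H H' {} \<and> \<not> En l' (gf H') (R j) {}"
    if h: "H \<in> fam m H0" "m < l" for H l j
  proof -
    have "\<exists>H'. H' \<in> fam m H0 \<and> En l H H' {} \<and> \<not> (\<forall>k. En k (gf H') (R j) {})"
    proof (cases "\<forall>k. En k (gf H) (R j) {}")
      case True
      obtain H' k where "H' \<in> fam m H0" "En l H H' {}" "\<not> En k (gf H) (gf H') {}" using contr h by blast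
      moreover have "\<not> En k (gf H') (R j) {}" using calculation(3) True En_trans0 En_sym0 by blast
      ultimately show ?thesis by blast
    next
      case False then show ?thesis using h En_refl0 by blast
    qed
    then obtain H' k where H': "H' \<in> fam m H0" "En l H H' {}" "\<not> En k (gf H') (R j) {}" by blast
    have "\<not> En (max (Suc l) k) (gf H') (R j) {}" using H'(3) En_mono[of k "max (Suc l) k"] by auto
    then show ?thesis using H' by (intro exI[of _ H'] exI[of _ "max (Suc l) k"]) auto
  qed
  have "\<exists>s. \<forall>j. (fst (s j) \<in> fam m H0 \<and> m < snd (s j)) \<and>
    (snd (s j) < snd (s (Suc j)) \<and> En (snd (s j)) (fst (s j)) (fst (s (Suc j))) {} \<and> \<not> En (snd (s (Suc j))) (gf (fst (s (Suc j)))) (R j) {})"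
  proof (rule dependent_nat_choice)
    show "\<exists>s. fst s \<in> fam m H0 \<and> m < snd s" using H by (intro exI[of _ "(H1, Suc m)"]) simp
    fix s :: "real set \<times> nat" and j
    assume s: "fst s \<in> fam m H0 \<and> m < snd s"
    then obtain H' l' where "H' \<in> fam m H0" "snd s < l'" "En (snd s) (fst s) H' {}" "\<not> En l' (gf H') (R j) {}"
      using nx by blast
    then show "\<exists>t. (fst t \<in> fam m H0 \<and> m < snd t) \<and>
      (snd s < snd t \<and> En (snd s) (fst s) (fst t) {} \<and> \<not> En (snd t) (gf (fst t)) (R j) {})"
      using s by (intro exI[of _ "(H', l')"]) simp
  qed
  then obtain s where s: "\<And>j. fst (s j) \<in> fam m H0" "\<And>j. m < snd (s j)" "\<And>j. snd (s j) < snd (s (Suc j))"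
    "\<And>j. En (snd (s j)) (fst (s j)) (fst (s (Suc j))) {}" "\<And>j. \<not> En (snd (s (Suc j))) (gf (fst (s (Suc j)))) (R j) {}" by blast
  have "\<exists>G. countable G \<and> (\<forall>k. En (snd (s k)) (fst (s k)) G {})"
    by (rule chain_limit0) (use s(1) s(2)[of 0] s(3,4) in \<open>auto simp: fam_def\<close>)
  then obtain G where G: "countable G" "\<And>k. En (snd (s k)) (fst (s k)) G {}" by blast
  have "En m H0 G {}" using s(1)[of 0] En_trans0[OF _ En_mono[OF less_imp_le[OF s(2)] G(2)]] by (auto simp: fam_def)
  then have "gf G \<in> cls M" by (rule gf_cls[OF cls G(1)])
  with R(2) obtain j where j: "\<forall>n. En n (gf G) (R j) {}" by blast
  have "En (snd (s (Suc j))) (gf (fst (s (Suc j)))) (R j) {}"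
    by (rule En_trans0[OF gf_cong[OF G(2)]]) (use j in blast)
  then show False using s(5) by blast
qed

text \<open>Grafting \<open>D\<close> below \<open>x\<close> gives a close member of the family,
  which after grafting into \<open>N\<close> is equivalent to \<open>H\<close> at all levels. One
  move and the levels d + 3 then exhibit \<open>D\<close> as an initial segment of the ambient order
  of \<open>H\<close>.\<close>

lemma isolated_realises:
  assumes H: "H \<in> fam m H0" and n: "m < n"
    and iso: "\<And>H'. H' \<in> fam m H0 \<Longrightarrow> En n H H' {} \<Longrightarrow> \<forall>k. En k (gf H) (gf H') {}"
    and x: "x \<in> H" "low (H \<inter> {..<x})" and D: "countable D" "low D" "En n (H \<inter> {..<x}) D {}"
  shows "\<exists>x'\<in>H. low (H \<inter> {..<x'}) \<and> isom D (H \<inter> {..<x'})"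
proof -
  let ?H = "below_graft x D H"
  have cH: "countable H" and uH: "unb H" and mH: "En m H0 H {}" using H by (auto simp: fam_def)
  have E: "En n H ?H {}" using En_below_graft[OF D(3), of "{}"] by simp
  have iD: "isom D (?H \<inter> {..<x})" by (rule oiso_isom[OF below_graft_below])
  have ab: "z \<in> ?H \<longleftrightarrow> z \<in> H" if "x \<le> z" for z using below_graft_above[of x D H] that by auto
  have xH: "x \<in> ?H" using ab[of x] x(1) by simp
  have "unb ?H"
  proof (rule unbI[OF xH])
    show "low (?H \<inter> {..<x})" using low_isom_iff[OF iD] D(2) by simp
    fix k
    obtain z where z: "z \<in> H" "x < z" "low (H \<inter> {..<z})" "\<not> hom k (H \<inter> {x<..<z})" using unb_above[OF uH x] by blast
    have "?H \<inter> {x<..<z} = H \<inter> {x<..<z}" using ab by auto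
    moreover have "low (H \<inter> {x<..<z})" using z(3) hom_between_below x(1) unfolding low_def by blast
    ultimately show "\<exists>z\<in>?H. x < z \<and> low (?H \<inter> {x<..<z}) \<and> \<not> hom k (?H \<inter> {x<..<z})" using z ab[of z] by auto
  qed
  moreover have "En m H0 ?H {}" by (rule En_trans0[OF mH En_mono[OF less_imp_le[OF n] E]])
  ultimately have "?H \<in> fam m H0" using countable_below_graft[OF D(1) cH] by (simp add: fam_def)
  from iso[OF this E] have all: "En k (gf H) (gf ?H) {}" for k by blast
  let ?u = "y - exp (- x)"
  obtain d where d: "hom d D" using D(2) by (auto simp: low_def)
  have "En (Suc (d + 3)) (gf H) (gf ?H) {}" by (rule all)
  then obtain q w where q: "(w, ?u) \<in> q" "En (d + 3) (gf H) (gf ?H) q" by (rule En_back1[OF _ gf_point[OF xH]])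
  have w: "w \<in> gf H" using En_base(2)[OF q(2)] q(1) by auto
  have iu: "isom D (gf ?H \<inter> {..<?u})" by (rule isom_trans[OF iD gf_below[OF xH]])
  have cD: "countable (gf ?H \<inter> {..<?u})" by (rule isom_countable[OF iu D(1)])
  have cw: "countable (gf H \<inter> {..<w})" using countable_below_graft[OF cH cN] by (rule countable_Int1)
  have "En (d + 3) (gf ?H \<inter> {..<?u}) (gf H \<inter> {..<w}) {}" by (rule En_sym0[OF En_below0[OF q(2,1)]])
  from isom_of_hom_En[OF cD cw hom_isom[OF iu d] this] have iw: "isom D (gf H \<inter> {..<w})" by (rule isom_trans[OF iu])
  \<comment> \<open>From \<open>y\<close> on, initial segments of the ambient order contain all
    initial segments of \<open>H\<close>, whose levels exceed d by unboundedness.\<close>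
  have "w < y"
  proof (rule ccontr)
    assume "\<not> w < y"
    obtain z where z: "z \<in> H" "\<not> hom d (H \<inter> {..<z})" using uH unfolding unb_def by blast
    have "y - exp (- z) < y" by simp
    then have "y - exp (- z) \<le> w" using \<open>\<not> w < y\<close> by linarith
    then have "hom d (gf H \<inter> {..<y - exp (- z)})"
      by (rule hom_below_le[OF hom_isom[OF iw d] gf_point[OF z(1)]])
    then show False using z(2) hom_isom_iff[OF gf_below[OF z(1)]] by simp
  qed
  then obtain x' where x': "x' \<in> H" "w = y - exp (- x')" using w by (auto simp: below_graft_def)
  have "isom D (H \<inter> {..<x'})" by (rule isom_trans[OF iw]) (use isom_sym[OF gf_below[OF x'(1)]] x'(2) in simp)
  then show ?thesis using x'(1) low_isom_iff D(2) by blast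
qed

text \<open>A simple copy of a complicated initial segment is realised at some \<open>x'\<close>,
  and the failure of \<open>hom (n' + 2)\<close> below \<open>x\<close> forces
  \<open>x' < x\<close>. Inside the part below \<open>x\<close> the copy is exchanged for the
  complicated original, and the result is realised again.\<close>

lemma isolated_raise:
  assumes H: "H \<in> fam m H0" and n: "m < n" and cls: "gf H0 \<in> cls M"
    and iso: "\<And>H'. H' \<in> fam m H0 \<Longrightarrow> En n H H' {} \<Longrightarrow> \<forall>k. En k (gf H) (gf H') {}"
    and x: "x \<in> H" "low (H \<inter> {..<x})" and n': "n \<le> n'" and r: "\<not> hom (n' + 2) (H \<inter> {..<x})"
  shows "\<exists>x'\<in>H. low (H \<inter> {..<x'}) \<and> \<not> hom k (H \<inter> {..<x'}) \<and> En n' (H \<inter> {..<x}) (H \<inter> {..<x'}) {}"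
proof -
  have cH: "countable H" and uH: "unb H" and mH: "En m H0 H {}" using H by (auto simp: fam_def)
  have Hcls: "gf H \<in> cls M" by (rule gf_cls[OF cls cH mH])
  obtain z where z: "z \<in> H" "x < z" "low (H \<inter> {..<z})" "\<not> hom k (H \<inter> {..<z})" using unb_above[OF uH x] by blast
  obtain D where D: "countable D" "En n' (H \<inter> {..<z}) D {}" "hom (n' + 2) D" using gf_generic_below[OF Hcls z(1)] by blast
  have lD: "low D" using D(3) by (auto simp: low_def)
  obtain x' where x': "x' \<in> H" "low (H \<inter> {..<x'})" "isom D (H \<inter> {..<x'})"
    using isolated_realises[OF H n iso z(1,3) D(1) lD En_mono[OF n' D(2)]] by blast
  have xx: "x' < x"
    using hom_below_le[OF hom_isom[OF x'(3) D(3)] x(1)] r by (meson not_le)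
  let ?B = "below_graft x' (H \<inter> {..<z}) (H \<inter> {..<x})"
  have e: "H \<inter> {..<x} \<inter> {..<x'} = H \<inter> {..<x'}" using xx by auto
  have "En n' (H \<inter> {..<x} \<inter> {..<x'}) (H \<inter> {..<z}) {}" unfolding e
    by (rule En_trans0[OF En_isom[OF isom_sym[OF x'(3)]] En_sym0[OF D(2)]])
  from En_below_graft[OF this, of "{}"] have EB: "En n' (H \<inter> {..<x}) ?B {}" by simp
  have cB: "countable ?B" by (rule countable_below_graft) (use cH in auto)
  have ib: "isom (H \<inter> {..<z}) (?B \<inter> {..<x'})" by (rule oiso_isom[OF below_graft_below])
  have xB: "x' \<in> ?B" using below_graft_above[of x' "H \<inter> {..<z}" "H \<inter> {..<x}"] x'(1) xx by auto
  have nB: "\<not> hom k ?B" using hom_below[of k ?B, OF _ xB] hom_isom_iff[OF ib] z(4) by blast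
  have "low ?B"
  proof -
    obtain i where i: "hom i (H \<inter> {..<z})" using z(3) by (auto simp: low_def)
    obtain j where j: "hom j (H \<inter> {..<x})" using x(2) by (auto simp: low_def)
    have "?B \<inter> {x'<..} = H \<inter> {..<x} \<inter> {x'<..}" by (auto simp: below_graft_def)
    then have "hom (max i j) (?B \<inter> {x'<..})" using hom_mono[OF _ hom_above[OF j, of x']] x'(1) xx by simp
    moreover have "hom (max i j) (?B \<inter> {..<x'})" using hom_mono[OF _ hom_isom[OF ib i], of "max i j"] by simp
    ultimately have "hom (max i j) ?B" using hom_join[OF xB] by blast
    then show ?thesis by (auto simp: low_def)
  qed
  from isolated_realises[OF H n iso x cB this En_mono[OF n' EB]]
  obtain x'' where x'': "x'' \<in> H" "low (H \<inter> {..<x''})" "isom ?B (H \<inter> {..<x''})" by blast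
  have "En n' (H \<inter> {..<x}) (H \<inter> {..<x''}) {}" by (rule En_trans0[OF EB En_isom[OF x''(3)]])
  moreover have "\<not> hom k (H \<inter> {..<x''})" using nB hom_isom_iff[OF x''(3)] by simp
  ultimately show ?thesis using x'' by blast
qed

lemma graft_between:
  assumes "x \<in> B" "w \<in> B"
  shows "isom (B \<inter> {x<..<w}) (below_graft u B K \<inter> {u - exp (- x)<..<u - exp (- w)})"
proof -
  have "below_graft u B K \<inter> {..<u} \<inter> {u - exp (- x)<..<u - exp (- w)} = below_graft u B K \<inter> {u - exp (- x)<..<u - exp (- w)}"
    by (auto intro: less_trans)
  then show ?thesis using oiso_isom[OF oiso_between[OF below_graft_below assms, of u K]] by simp
qed

text \<open>Initial segments with growing equivalence and growing level converge to an order
  \<open>B\<close> that is not low. If \<open>B\<close> had no increasing sequence of unbounded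
  levels, its reversal would be unbounded and \<open>B\<close> would contain a descending
  ladder.\<close>

lemma limit_initial:
  assumes H: "H \<in> fam m H0" and n: "m < n" and cls: "gf H0 \<in> cls M"
    and iso: "\<And>H'. H' \<in> fam m H0 \<Longrightarrow> En n H H' {} \<Longrightarrow> \<forall>k. En k (gf H) (gf H') {}"
  shows "\<exists>B x. countable B \<and> x \<in> H \<and> low (H \<inter> {..<x}) \<and> En n (H \<inter> {..<x}) B {} \<and> inc (\<lambda>k. k) B"
proof -
  have cH: "countable H" and uH: "unb H" and mH: "En m H0 H {}" using H by (auto simp: fam_def)
  have Hcls: "gf H \<in> cls M" by (rule gf_cls[OF cls cH mH])
  have "\<exists>xs. \<forall>i. (xs i \<in> H \<and> low (H \<inter> {..<xs i}) \<and> \<not> hom (n + i + 2) (H \<inter> {..<xs i})) \<and>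
    En (n + i) (H \<inter> {..<xs i}) (H \<inter> {..<xs (Suc i)}) {}"
  proof (rule dependent_nat_choice)
    show "\<exists>x. x \<in> H \<and> low (H \<inter> {..<x}) \<and> \<not> hom (n + 0 + 2) (H \<inter> {..<x})" using uH unfolding unb_def by blast
    fix x i assume x: "x \<in> H \<and> low (H \<inter> {..<x}) \<and> \<not> hom (n + i + 2) (H \<inter> {..<x})"
    then show "\<exists>x'. (x' \<in> H \<and> low (H \<inter> {..<x'}) \<and> \<not> hom (n + Suc i + 2) (H \<inter> {..<x'})) \<and> En (n + i) (H \<inter> {..<x}) (H \<inter> {..<x'}) {}"
      using isolated_raise[OF H n cls iso, of x "n + i" "n + Suc i + 2"] by auto
  qed
  then obtain xs where xs: "\<And>i. xs i \<in> H" "\<And>i. low (H \<inter> {..<xs i})" "\<And>i. \<not> hom (n + i + 2) (H \<inter> {..<xs i})"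
    "\<And>i. En (n + i) (H \<inter> {..<xs i}) (H \<inter> {..<xs (Suc i)}) {}" by blast
  have "\<exists>B. countable B \<and> (\<forall>i. En (n + i) (H \<inter> {..<xs i}) B {})"
    by (rule chain_limit0) (use n cH xs(4) in auto)
  then obtain B where B: "countable B" "\<And>i. En (n + i) (H \<inter> {..<xs i}) B {}" by blast
  have cHS: "countable (H \<inter> S)" and cBS: "countable (B \<inter> S)" for S using cH B(1) by auto
  have nlB: "\<not> low B"
  proof
    assume "low B"
    then obtain d where d: "hom d B" by (auto simp: low_def)
    have "hom d (H \<inter> {..<xs (d + 3)})"
      using hom_En_iff[OF cHS B(1) En_mono[OF _ B(2)[of "d + 3"]], of d] d by simp
    then show False using xs(3)[of "d + 3"] hom_mono[of d "n + (d + 3) + 2"] by simp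
  qed
  have "inc (\<lambda>k. k) B"
  proof (rule ccontr)
    assume ninc: "\<not> inc (\<lambda>k. k) B"
    have unbB: "unb (uminus ` B)"
    proof (rule ccontr)
      assume "\<not> unb (uminus ` B)"
      then have "dec (\<lambda>k. k) (uminus ` B)" using not_low_cases[of "uminus ` B"] B(1) nlB low_uminus_iff by simp
      then show False using ninc dec_uminus_iff by blast
    qed
    obtain b0 where b0: "b0 \<in> H" "low (H \<inter> {..<b0})" using unb_ex[OF uH] by blast
    have "\<exists>a. \<forall>k. (a k \<in> H \<and> low (H \<inter> {..<a k})) \<and> (a k < a (Suc k) \<and> \<not> hom k (H \<inter> {a k<..<a (Suc k)}))"
      by (rule dependent_nat_choice) (use b0 unb_above[OF uH] in blast)+
    then obtain a where a: "\<And>k. a k \<in> H" "\<And>k. low (H \<inter> {..<a k})" "\<And>k. a k < a (Suc k)" "\<And>k. \<not> hom k (H \<inter> {a k<..<a (Suc k)})"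
      by blast
    obtain i0 where i0: "\<not> dec (\<lambda>_. i0) {z\<in>H. a i0 < z \<and> (\<exists>k. z < a k)}"
      using gf_no_dec_tail[OF Hcls, of a, OF a(1,3)] by blast
    let ?J = "{z\<in>H. a i0 < z \<and> (\<exists>k. z < a k)}"
    have inJ: "z \<in> ?J" if z: "z \<in> H" "hom d (H \<inter> {..<z})" "a i0 < z" for z d
    proof -
      have "\<exists>k. z < a k"
      proof (rule ccontr)
        assume "\<nexists>k. z < a k"
        then have "a (Suc d) \<le> z" by (simp add: not_less)
        then have "hom d (H \<inter> {..<a (Suc d)})" by (rule hom_below_le[OF z(2) a(1)])
        then show False using hom_between_below[OF _ a(1)] a(4) by blast
      qed
      then show ?thesis using z by blast
    qed
    obtain ds where ds: "hom ds (H \<inter> {..<a i0})" using a(2) by (auto simp: low_def)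
    \<comment> \<open>\<open>dd\<close> bounds the level \<open>i0\<close> of the decreasing
      sequences missing from the tail as well as the level \<open>ds\<close> of the part below
      \<open>a i0\<close>; the 4 added to it below pays for
      \<open>hom_of_no_sequence\<close>.\<close>
    define dd where "dd = max i0 ds"
    have "\<exists>w. \<forall>k. (w k \<in> uminus ` B \<and> low (uminus ` B \<inter> {..<w k})) \<and>
      (w k < w (Suc k) \<and> \<not> hom (k + dd + 4) (uminus ` B \<inter> {w k<..<w (Suc k)}))"
    proof (rule dependent_nat_choice)
      show "\<exists>x. x \<in> uminus ` B \<and> low (uminus ` B \<inter> {..<x})" using unb_ex[OF unbB] by blast
    qed (use unb_above[OF unbB] in blast)
    then obtain w where w: "\<And>k. w k \<in> uminus ` B" "\<And>k. low (uminus ` B \<inter> {..<w k})" "\<And>k. w k < w (Suc k)"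
      "\<And>k. \<not> hom (k + dd + 4) (uminus ` B \<inter> {w k<..<w (Suc k)})" by blast
    define z where "z k = - w k" for k
    have z: "z k \<in> B" "low (B \<inter> {z k<..})" "z (Suc k) < z k" "\<not> hom (k + dd + 4) (B \<inter> {z (Suc k)<..<z k})" for k
      using w[of k] w(1)[of "Suc k"] by (auto simp: z_def uminus_Int_image low_uminus_iff hom_uminus_iff)
    \<comment> \<open>A low interval of \<open>B\<close> is isomorphic to an interval of
      \<open>H\<close> below some \<open>xs i\<close>. The complicated interval next below it does
      not fit under \<open>a i0\<close>, so the copy lies in the tail \<open>?J\<close>, which has
      no decreasing sequence.\<close>
    have ndec: "\<not> dec (\<lambda>_. i0) (B \<inter> {z (Suc k)<..<z k})" for k
    proof
      assume dB: "dec (\<lambda>_. i0) (B \<inter> {z (Suc k)<..<z k})"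
      obtain e where e: "hom e (B \<inter> {z (Suc k)<..})" using z(2) by (auto simp: low_def)
      have "hom e (B \<inter> {z (Suc k)<..} \<inter> {..<z k})" by (rule hom_below[OF e]) (use z in auto)
      moreover have "B \<inter> {z (Suc k)<..} \<inter> {..<z k} = B \<inter> {z (Suc k)<..<z k}" by auto
      ultimately have eI: "hom e (B \<inter> {z (Suc k)<..<z k})" by simp
      \<comment> \<open>Large enough for one move, then an isomorphism at level e + 3 and the
        transfer of level \<open>Suc k + dd + 4\<close>, which takes three levels more.\<close>
      define i where "i = e + k + dd + 12"
      have "En (Suc (e + k + dd + 11)) (H \<inter> {..<xs i}) B {}" by (rule En_mono[OF _ B(2)]) (simp add: i_def)
      moreover have "finite {z k, z (Suc k), z (Suc (Suc k))}" "{z k, z (Suc k), z (Suc (Suc k))} \<subseteq> B" using z(1) by auto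
      ultimately obtain q where q: "{z k, z (Suc k), z (Suc (Suc k))} \<subseteq> Range q" "En (e + k + dd + 11) (H \<inter> {..<xs i}) B q"
        by (rule En_back)
      then have "z k \<in> Range q" "z (Suc k) \<in> Range q" "z (Suc (Suc k)) \<in> Range q" by simp_all
      then obtain u0 u1 u2 where u: "(u0, z k) \<in> q" "(u1, z (Suc k)) \<in> q" "(u2, z (Suc (Suc k))) \<in> q"
        by (elim RangeE)
      have uH: "u0 \<in> H" "u0 < xs i" "u1 \<in> H" "u1 < xs i" "u2 \<in> H" "u2 < xs i" using En_base(2)[OF q(2)] u by auto
      have eq: "H \<inter> {..<xs i} \<inter> {v<..<v'} = H \<inter> {v<..<v'}" if "v' < xs i" for v v' using that by auto
      have E1: "En (e + k + dd + 11) (B \<inter> {z (Suc k)<..<z k}) (H \<inter> {u1<..<u0}) {}"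
        using En_sym0[OF En_between0[OF q(2) u(2,1)]] eq uH by simp
      have E2: "En (e + k + dd + 11) (B \<inter> {z (Suc (Suc k))<..<z (Suc k)}) (H \<inter> {u2<..<u1}) {}"
        using En_sym0[OF En_between0[OF q(2) u(3,2)]] eq uH by simp
      have "isom (B \<inter> {z (Suc k)<..<z k}) (H \<inter> {u1<..<u0})"
        by (rule isom_of_hom_En[OF cBS cHS eI En_mono[OF _ E1]]) simp
      then have dH: "dec (\<lambda>_. i0) (H \<inter> {u1<..<u0})" using dec_isom dB by blast
      have "a i0 < u1"
      proof (rule ccontr)
        assume "\<not> a i0 < u1"
        then have "hom ds (H \<inter> {..<u1})" using hom_below_le[OF ds uH(3)] by simp
        then have "hom ds (H \<inter> {u2<..<u1})" using hom_between_below uH(5) by blast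
        then have "hom (Suc k + dd + 4) (H \<inter> {u2<..<u1})" using hom_mono[of ds] by (simp add: dd_def)
        moreover have "En (Suc k + dd + 4 + 3) (B \<inter> {z (Suc (Suc k))<..<z (Suc k)}) (H \<inter> {u2<..<u1}) {}"
          by (rule En_mono[OF _ E2]) simp
        ultimately show False using hom_En_iff[OF cBS cHS] z(4)[of "Suc k"] by blast
      qed
      obtain d where d: "hom d (H \<inter> {..<xs i})" using xs(2) by (auto simp: low_def)
      have "dec (\<lambda>_. i0) ?J"
      proof (rule dec_convex[OF dH])
        show "H \<inter> {u1<..<u0} \<subseteq> ?J"
        proof
          fix t assume t: "t \<in> H \<inter> {u1<..<u0}"
          then have "hom d (H \<inter> {..<t})" using hom_below_le[OF d, of t] uH by simp
          then show "t \<in> ?J" using inJ[of t d] t \<open>a i0 < u1\<close> by simp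
        qed
      qed auto
      then show False using i0 by blast
    qed
    have incz: "inc (\<lambda>_. k) (B \<inter> {z (Suc k)<..<z k})" for k
    proof -
      have "\<not> dec (\<lambda>_. k + dd) (B \<inter> {z (Suc k)<..<z k})" using ndec[of k] dec_mono[of "\<lambda>_. k + dd" _ "\<lambda>_. i0"] by (auto simp: dd_def)
      then have "inc (\<lambda>_. k + dd) (B \<inter> {z (Suc k)<..<z k})" using hom_of_no_sequence[OF cBS] z(4) by blast
      then show ?thesis by (rule inc_mono) simp
    qed
    \<comment> \<open>\<open>B\<close> is grafted below \<open>xs 0\<close>, so that its descending
      ladder lies inside a member of the class.\<close>
    let ?x = "xs 0"
    let ?H = "below_graft ?x B H"
    have EB: "En n H ?H {}" using En_below_graft[of n H ?x B "{}"] B(2)[of 0] by simp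
    have "gf ?H \<in> cls M" by (rule gf_cls[OF Hcls countable_below_graft[OF B(1) cH] EB])
    moreover have zH: "?x - exp (- z k) \<in> ?H" for k using z(1) by (simp add: below_graft_def)
    then have "y - exp (- (?x - exp (- z k))) \<in> gf ?H" for k by (rule gf_point)
    moreover have "y - exp (- (?x - exp (- z (Suc k)))) < y - exp (- (?x - exp (- z k)))" for k using z(3) by simp
    moreover have "inc (\<lambda>_. k) (gf ?H \<inter> {y - exp (- (?x - exp (- z (Suc k))))<..<y - exp (- (?x - exp (- z k)))})" for k
      by (rule inc_isom[OF isom_trans[OF graft_between[OF z(1) z(1)] graft_between[OF zH zH]] incz])
    ultimately show False by (rule no_ladder_down[OF thin])
  qed
  then show ?thesis using B(1) B(2)[of 0] xs(1,2)[of 0] by auto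
qed

text \<open>Below \<open>x\<close> the limit order restores the hypothesis for a further
  application; above \<open>x\<close> the unbounded order contributes increasing sequences of every
  fixed level.\<close>

lemma step:
  assumes H0: "countable H0" "gf H0 \<in> cls M" "inc (\<lambda>k. k) H0"
  shows "\<exists>H x. countable H \<and> En m H0 H {} \<and> x \<in> H \<and> inc (\<lambda>k. k) (H \<inter> {..<x}) \<and> (\<forall>j. inc (\<lambda>_. j) (H \<inter> {x<..}))"
proof -
  obtain H1 where "H1 \<in> fam m H0" using fam_nonempty[OF H0] by blast
  from isolated_member[OF this H0(2)] obtain H n where H: "H \<in> fam m H0" and n: "m < n"
    and iso: "\<forall>H'\<in>fam m H0. En n H H' {} \<longrightarrow> (\<forall>k. En k (gf H) (gf H') {})" by blast
  have cH: "countable H" and uH: "unb H" and mH: "En m H0 H {}" using H by (auto simp: fam_def)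
  obtain B x where B: "countable B" "x \<in> H" "low (H \<inter> {..<x})" "En n (H \<inter> {..<x}) B {}" "inc (\<lambda>k. k) B"
    using limit_initial[OF H n H0(2)] iso by blast
  let ?H = "below_graft x B H"
  have ab: "z \<in> ?H \<longleftrightarrow> z \<in> H" if "x \<le> z" for z using below_graft_above[of x B H] that by auto
  have "En m H0 ?H {}"
    using En_trans0[OF mH En_mono[OF less_imp_le[OF n]]] En_below_graft[OF B(4), of "{}"] by simp
  moreover have "inc (\<lambda>k. k) (?H \<inter> {..<x})" by (rule inc_isom[OF oiso_isom[OF below_graft_below] B(5)])
  moreover have "inc (\<lambda>_. j) (?H \<inter> {x<..})" for j
  proof -
    let ?R = "{z\<in>H. x < z \<and> low (H \<inter> {..<z})}"
    obtain z0 where z0: "z0 \<in> ?R" using unb_above[OF uH B(2,3)] by blast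
    have "inc (\<lambda>_. j) (H \<inter> {x<..})"
    proof (rule incI[OF z0])
      fix z and k :: nat assume z: "z \<in> ?R"
      then obtain w where w: "w \<in> H" "z < w" "low (H \<inter> {..<w})" "\<not> hom j (H \<inter> {z<..<w})" using unb_above[OF uH, of z j] by blast
      have "H \<inter> {x<..} \<inter> {z<..<w} = H \<inter> {z<..<w}" using z by auto
      then show "\<exists>w\<in>?R. z < w \<and> \<not> hom j (H \<inter> {x<..} \<inter> {z<..<w})" using w z by (intro bexI[of _ w]) auto
    qed auto
    moreover have "?H \<inter> {x<..} = H \<inter> {x<..}" using ab by auto
    ultimately show ?thesis by simp
  qed
  moreover have "countable ?H" by (rule countable_below_graft[OF B(1) cH])
  moreover have "x \<in> ?H" using ab[of x] B(2) by simp
  ultimately show ?thesis by blast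
qed

end
end

context base_level begin

section \<open>Few equivalence classes imply homogeneity\<close>

text \<open>Iterating \<open>step\<close> downwards produces infinitely many consecutive intervals,
  each with increasing sequences of every fixed level: a descending ladder.\<close>

lemma thin_no_inc:
  assumes thin: "thin M"
  shows "\<not> inc (\<lambda>k. k) M"
proof
  assume incM: "inc (\<lambda>k. k) M"
  have cM: "countable M" using thin by (simp add: thin_def)
  have Mcls: "M \<in> cls M" using cM En_refl0 by (simp add: cls_def)
  \<comment> \<open>To start, \<open>M\<close> is regarded as the part below 0 of a graft with
    nothing above.\<close>
  have "below_graft 0 M {} \<inter> {..<0} = below_graft 0 M {}" by (auto simp: below_graft_def)
  then have "isom M (below_graft 0 M {})" using oiso_isom[OF below_graft_below[of 0 M "{}"]] by simp
  then have M0: "below_graft 0 M {} \<in> cls M"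
    by (intro cls_En[OF Mcls countable_below_graft[OF cM] En_isom]) simp_all
  obtain N0 y0 where N0: "countable N0" "En 0 M N0 {}" "y0 \<in> N0" "inc (\<lambda>k. k) (N0 \<inter> {..<y0})"
    using step[OF thin _ cM M0 incM, of 0] by auto
  let ?P = "\<lambda>s. fst s \<in> cls M \<and> snd s \<in> fst s \<and> inc (\<lambda>k. k) (fst s \<inter> {..<snd s})"
  let ?Q = "\<lambda>k s t. snd t < snd s \<and> fst t \<inter> {snd s..} = fst s \<inter> {snd s..} \<and>
    (\<forall>j. inc (\<lambda>_. j) (fst t \<inter> {snd t<..<snd s})) \<and>
    (\<forall>Y. finite Y \<longrightarrow> Y \<subseteq> fst s \<inter> {snd s..} \<longrightarrow> En (Suc k) (fst s) (fst t) (Id_on Y))"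
  have "\<exists>s. \<forall>k. ?P (s k) \<and> ?Q k (s k) (s (Suc k))"
  proof (rule dependent_nat_choice)
    show "\<exists>s. ?P s" using N0 cls_En[OF Mcls N0(1,2)] by (intro exI[of _ "(N0, y0)"]) simp
    fix s :: "real set \<times> real" and k :: nat
    assume "?P s"
    then obtain N y where s: "s = (N, y)" "N \<in> cls M" "y \<in> N" "inc (\<lambda>k. k) (N \<inter> {..<y})" by (cases s) auto
    have cN: "countable N" using s(2) by (simp add: cls_def)
    have "En 0 N (below_graft y (N \<inter> {..<y}) N) {}"
      using En_below_graft[OF En_refl0, of "{}" N y 0] by simp
    then have "below_graft y (N \<inter> {..<y}) N \<in> cls M"
      by (rule cls_En[OF s(2) countable_below_graft[OF countable_Int1[OF cN] cN]])
    from step[OF thin cN countable_Int1[OF cN] this s(4), of "Suc k"] obtain H x where H: "countable H"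
      "En (Suc k) (N \<inter> {..<y}) H {}" "x \<in> H" "inc (\<lambda>k. k) (H \<inter> {..<x})" "\<forall>j. inc (\<lambda>_. j) (H \<inter> {x<..})" by blast
    let ?N = "below_graft y H N" and ?y = "y - exp (- x)"
    have E: "En (Suc k) N ?N (Id_on Y)" if "finite Y" "Y \<subseteq> N \<inter> {y..}" for Y by (rule En_below_graft[OF H(2) that])
    have "?N \<in> cls M" using cls_En[OF s(2) countable_below_graft[OF H(1) cN]] E[of "{}"] by simp
    moreover have "?y \<in> ?N" using H(3) by (simp add: below_graft_def)
    moreover have "inc (\<lambda>k. k) (?N \<inter> {..<?y})"
      by (rule inc_isom[OF gf_below[OF thin cN H(3)] H(4)])
    moreover have "inc (\<lambda>_. j) (?N \<inter> {?y<..<y})" for j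
    proof -
      have "?N \<inter> {..<y} \<inter> {?y<..} = ?N \<inter> {?y<..<y}" by auto
      then show ?thesis using inc_isom[OF oiso_isom[OF oiso_above[OF below_graft_below H(3), of y N]]] H(5) by simp
    qed
    ultimately show "\<exists>t. ?P t \<and> ?Q k s t"
      using E below_graft_above[of y H N] by (intro exI[of _ "(?N, ?y)"]) (simp add: s(1))
  qed
  then obtain s where PQ: "\<forall>k. ?P (s k) \<and> ?Q k (s k) (s (Suc k))" ..
  have P: "?P (s k)" and Q: "?Q k (s k) (s (Suc k))" for k
    using spec[OF PQ, of k] by (rule conjunct1, rule conjunct2)
  define N where "N k = fst (s k)" for k
  define y where "y k = snd (s k)" for k
  have N: "N k \<in> cls M" "y k \<in> N k" for k using P[of k] by (simp_all add: N_def y_def)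
  have y: "y (Suc k) < y k" "N (Suc k) \<inter> {y k..} = N k \<inter> {y k..}" "\<And>j. inc (\<lambda>_. j) (N (Suc k) \<inter> {y (Suc k)<..<y k})" for k
    using Q[of k] by (simp_all add: N_def y_def)
  have EN: "En (Suc k) (N k) (N (Suc k)) (Id_on Y)" if "finite Y" "Y \<subseteq> N k \<inter> {y k..}" for k Y
    using Q[of k] that by (simp add: N_def y_def)
  have old: "y ` {..k} \<subseteq> N k \<inter> {y k..}" for k
  proof (induction k)
    case 0 then show ?case using N(2)[of 0] by auto
  next
    case (Suc k)
    show ?case
    proof
      fix z assume "z \<in> y ` {..Suc k}"
      then consider "z = y (Suc k)" | "z \<in> y ` {..k}" by (auto simp: atMost_Suc)
      then show "z \<in> N (Suc k) \<inter> {y (Suc k)..}"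
      proof cases
        case 1 then show ?thesis using N(2)[of "Suc k"] by simp
      next
        case 2
        then have "z \<in> N (Suc k) \<inter> {y k..}" using Suc.IH unfolding y(2) by (rule subsetD[rotated])
        then show ?thesis using y(1)[of k] by simp
      qed
    qed
  qed
  have cNk: "countable (N k)" for k using N(1) by (simp add: cls_def)
  have "En (Suc (0 + k)) (N k) (N (Suc k)) (Id_on (y ` {..k}))" for k using EN[OF _ old] by simp
  from chain_limit[where \<rho> = "\<lambda>k. Id_on (y ` {..k})", OF cNk this] obtain G f where cG: "countable G"
    and Gf: "\<forall>k. strict_mono (f k) \<and> En (0 + k) (f k ` N k) G (Id_on (f k ` Domain (Id_on (y ` {..k})))) \<and>
      (\<forall>(x, z)\<in>Id_on (y ` {..k}). f k x = f (Suc k) z)" by (elim exE conjE)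
  have G: "strict_mono (f k)" "En k (f k ` N k) G (Id_on (f k ` y ` {..k}))" for k
    using spec[OF Gf, of k] by (simp_all only: Domain_Id_on add_0)
  have Gx: "f k x = f (Suc k) x" if "x \<in> y ` {..k}" for k x
    using bspec[OF conjunct2[OF conjunct2[OF spec[OF Gf, of k]]] Id_onI[OF that]] by simp
  have oi: "oiso (f k) (N k) (f k ` N k)" for k
    by (rule oiso_image) (use G(1)[of k] in \<open>simp add: strict_mono_on_def strict_mono_def\<close>)
  define g where "g j = f j (y j)" for j
  have gj: "g j = f (Suc j) (y j)" for j using Gx[of "y j" j] by (simp add: g_def)
  have pt: "(g (Suc j), g (Suc j)) \<in> Id_on (f (Suc j) ` y ` {..Suc j})" "(g j, g j) \<in> Id_on (f (Suc j) ` y ` {..Suc j})" for j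
    unfolding gj[of j] by (auto simp: g_def)
  have gG: "g j \<in> G" for j using En_base(2)[OF G(2)[of "Suc j"]] pt(2)[of j] by blast
  have gm: "g (Suc j) < g j" for j unfolding gj[of j] g_def[of "Suc j"] using strict_monoD[OF G(1) y(1)] .
  \<comment> \<open>The intervals of the limit are equivalent to the constructed ones up to a finite
    level only, which does not yield the increasing sequences. They are therefore exchanged for the
    constructed intervals afterwards.\<close>
  have I: "En 0 (G \<inter> {g (Suc j)<..<g j}) (N (Suc j) \<inter> {y (Suc j)<..<y j}) {}" for j
  proof -
    have "En (Suc j) (f (Suc j) ` N (Suc j) \<inter> {g (Suc j)<..<g j}) (G \<inter> {g (Suc j)<..<g j}) {}"
      by (rule En_between0[OF G(2) pt])
    moreover have "isom (N (Suc j) \<inter> {y (Suc j)<..<y j}) (f (Suc j) ` N (Suc j) \<inter> {g (Suc j)<..<g j})"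
      unfolding gj[of j] g_def[of "Suc j"] by (rule oiso_isom[OF oiso_between[OF oi]]) (use old[of "Suc j"] in auto)
    ultimately show ?thesis using En_trans0[OF En_sym0 En_isom[OF isom_sym]] En_mono[of 0 "Suc j"] by blast
  qed
  have "En 0 (N 0) (f 0 ` N 0) {}" by (rule En_isom[OF oiso_isom[OF oi]])
  then have "En 0 (N 0) G {}" using En_trans0 En_empty[OF G(2)[of 0]] by blast
  then have Gcls: "G \<in> cls M" by (rule cls_En[OF N(1) cG])
  define K where "K = {z\<in>G. \<forall>t. z < g t}"
  define J where "J = {z\<in>G. \<exists>t. g t \<le> z}"
  define X where "X t = (case t of 0 \<Rightarrow> G \<inter> {g 0<..} | Suc j \<Rightarrow> N (Suc j) \<inter> {y (Suc j)<..<y j})" for t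
  let ?Z = "zsum {..0} (\<lambda>i. if i \<le> 0 then X (nat (- i)) else {})"
  have "En 0 J ?Z {}"
  proof (rule En_zsum_down)
    show "g t \<in> J" for t using gG by (auto simp: J_def)
    show "g (Suc t) < g t" for t by (rule gm)
    show "\<exists>t. g t \<le> z" if "z \<in> J" for z using that by (simp add: J_def)
    have "J \<inter> {g 0<..} = G \<inter> {g 0<..}" by (auto simp: J_def intro: exI[of _ 0])
    then show "En 0 (J \<inter> {g 0<..}) (X 0) {}" using En_refl0 by (simp add: X_def)
    fix t
    have "J \<inter> {g (Suc t)<..<g t} = G \<inter> {g (Suc t)<..<g t}" by (auto simp: J_def intro: exI[of _ "Suc t"])
    then show "En 0 (J \<inter> {g (Suc t)<..<g t}) (X (Suc t)) {}" using I by (simp add: X_def)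
  qed
  then have "En 0 (K \<union> J) (conc K ?Z) {}"
    by (rule En_conc[OF En_refl0]) (auto simp: K_def J_def intro: less_le_trans)
  moreover have "K \<union> J = G" by (auto simp: K_def J_def not_le)
  ultimately have E: "En 0 G (conc K ?Z) {}" by simp
  have "countable (X t)" for t using cG cNk by (cases t) (auto simp: X_def)
  then have "countable ?Z" by (intro countable_zsum) simp
  moreover have "countable K" by (rule countable_subset[OF _ cG]) (auto simp: K_def)
  ultimately have "conc K ?Z \<in> cls M" by (intro cls_En[OF Gcls countable_conc E])
  moreover have "exp (- real k) \<in> conc K ?Z" for k using zsum_down_facts(1)[of k X] by (simp add: conc_def)
  moreover have "exp (- real (Suc k)) < exp (- real k)" for k by simp
  moreover have "inc (\<lambda>_. k) (conc K ?Z \<inter> {exp (- real (Suc k))<..<exp (- real k)})" for k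
  proof (rule inc_isom[OF isom_trans])
    show "isom (X (Suc k)) (?Z \<inter> {- real (Suc k)<..<- real k})" by (rule zsum_down_facts(2))
    show "isom (?Z \<inter> {- real (Suc k)<..<- real k}) (conc K ?Z \<inter> {exp (- real (Suc k))<..<exp (- real k)})"
      by (rule conc_between[OF zsum_down_facts(1) zsum_down_facts(1)])
    show "inc (\<lambda>_. k) (X (Suc k))" using y(3) by (simp add: X_def)
  qed
  ultimately show False by (rule no_ladder_down[OF thin])
qed

lemma thin_low:
  assumes thin: "thin M" shows "low M"
proof (rule ccontr)
  assume nl: "\<not> low M"
  have cM: "countable M" using thin by (simp add: thin_def)
  show False
  proof (cases "unb M")
    case True
    then show False using thin_no_inc[OF thin] unb_inc by blast
  next
    case False
    then have "dec (\<lambda>k. k) M" by (rule not_low_cases[OF cM nl])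
    then show False using thin_no_inc[OF thin_uminus[OF thin]] inc_uminus_iff by blast
  qed
qed

end

section \<open>Truth of infinitary formulas\<close>

definition emb :: "struct \<Rightarrow> (nat \<Rightarrow> real) \<Rightarrow> bool" where
  "emb M e \<longleftrightarrow> fst M \<noteq> {} \<and>
     (\<forall>x\<in>fst M. \<forall>y\<in>fst M. ((x, y) \<in> snd M \<longleftrightarrow> e x \<le> e y) \<and> (e x = e y \<longrightarrow> x = y))"

lemma ex_emb:
  assumes M: "M \<in> structures" "linear_order_on (fst M) (snd M)"
  shows "\<exists>e. emb M e"
proof -
  let ?less = "\<lambda>x y. (x, y) \<in> snd M \<and> x \<noteq> y"
  have lin: "\<And>x. x \<in> fst M \<Longrightarrow> (x, x) \<in> snd M" "trans (snd M)" "antisym (snd M)" "total_on (fst M) (snd M)"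
    using M(2) by (auto simp: order_on_defs refl_on_def)
  have "\<exists>e :: nat \<Rightarrow> real. \<forall>a\<in>fst M. \<forall>b\<in>fst M. e a < e b \<longleftrightarrow> ?less a b"
  proof (rule ex_real_embedding)
    show "?less a c" if "?less a b" "?less b c" for a b c
      using that transD[OF lin(2)] antisymD[OF lin(3)] by blast
    show "?less a b \<or> ?less b a" if "a \<in> fst M" "b \<in> fst M" "a \<noteq> b" for a b
      using lin(4) that unfolding total_on_def by blast
  qed auto
  then obtain e :: "nat \<Rightarrow> real" where e: "\<forall>a\<in>fst M. \<forall>b\<in>fst M. e a < e b \<longleftrightarrow> ?less a b" ..
  have "((x, y) \<in> snd M \<longleftrightarrow> e x \<le> e y) \<and> (e x = e y \<longrightarrow> x = y)" if xy: "x \<in> fst M" "y \<in> fst M" for x y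
  proof (cases "x = y")
    case True then show ?thesis using lin(1) xy by simp
  next
    case False
    have "?less x y \<or> ?less y x" using lin(4) xy False unfolding total_on_def by blast
    moreover have "e x < e y \<longleftrightarrow> ?less x y" "e y < e x \<longleftrightarrow> ?less y x" using e xy by blast+
    moreover have "\<not> (?less x y \<and> ?less y x)" using antisymD[OF lin(3)] by blast
    ultimately show ?thesis using False by auto
  qed
  moreover have "fst M \<noteq> {}" using M(1) by (auto simp: structures_def)
  ultimately show ?thesis unfolding emb_def by blast
qed

lemma emb_eq: "emb M e \<Longrightarrow> x \<in> fst M \<Longrightarrow> y \<in> fst M \<Longrightarrow> e x = e y \<longleftrightarrow> x = y"
  unfolding emb_def by metis

lemma emb_le: "emb M e \<Longrightarrow> x \<in> fst M \<Longrightarrow> y \<in> fst M \<Longrightarrow> (x, y) \<in> snd M \<longleftrightarrow> e x \<le> e y"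
  unfolding emb_def by metis

text \<open>Stated with assignments rather than tuples, since the list of variables may contain
  repetitions.\<close>

lemma sat_foldr_Ex:
  "sat M \<nu> (foldr Ex xs \<psi>) \<longleftrightarrow>
    (\<exists>\<nu>'. (\<forall>x. x \<notin> set xs \<longrightarrow> \<nu>' x = \<nu> x) \<and> (\<forall>x\<in>set xs. \<nu>' x \<in> fst M) \<and> sat M \<nu>' \<psi>)"
proof (induction xs arbitrary: \<nu>)
  case Nil
  show ?case
  proof
    assume "\<exists>\<nu>'. (\<forall>x. x \<notin> set [] \<longrightarrow> \<nu>' x = \<nu> x) \<and> (\<forall>x\<in>set []. \<nu>' x \<in> fst M) \<and> sat M \<nu>' \<psi>"
    then obtain \<nu>' where "\<And>x. \<nu>' x = \<nu> x" "sat M \<nu>' \<psi>" by auto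
    then show "sat M \<nu> (foldr Ex [] \<psi>)" using sat_cong_fv[of \<psi> \<nu>' \<nu> M] by simp
  qed auto
next
  case (Cons x xs)
  show ?case
  proof
    assume "sat M \<nu> (foldr Ex (x # xs) \<psi>)"
    then obtain a \<nu>' where "a \<in> fst M" "\<forall>z. z \<notin> set xs \<longrightarrow> \<nu>' z = (\<nu>(x := a)) z" "\<forall>z\<in>set xs. \<nu>' z \<in> fst M" "sat M \<nu>' \<psi>"
      using Cons.IH by auto
    then show "\<exists>\<nu>'. (\<forall>z. z \<notin> set (x # xs) \<longrightarrow> \<nu>' z = \<nu> z) \<and> (\<forall>z\<in>set (x # xs). \<nu>' z \<in> fst M) \<and> sat M \<nu>' \<psi>"
      by (intro exI[of _ \<nu>']) (cases "x \<in> set xs"; auto)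
  next
    assume "\<exists>\<nu>'. (\<forall>z. z \<notin> set (x # xs) \<longrightarrow> \<nu>' z = \<nu> z) \<and> (\<forall>z\<in>set (x # xs). \<nu>' z \<in> fst M) \<and> sat M \<nu>' \<psi>"
    then obtain \<nu>' where v: "\<forall>z. z \<notin> set (x # xs) \<longrightarrow> \<nu>' z = \<nu> z" "\<forall>z\<in>set (x # xs). \<nu>' z \<in> fst M" "sat M \<nu>' \<psi>" by blast
    then have "sat M (\<nu>(x := \<nu>' x)) (foldr Ex xs \<psi>)" unfolding Cons.IH by (intro exI[of _ \<nu>']) auto
    then show "sat M \<nu> (foldr Ex (x # xs) \<psi>)" using v(2) by auto
  qed
qed

lemma sat_foldr_All:
  "sat M \<nu> (foldr All xs \<psi>) \<longleftrightarrow>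
    (\<forall>\<nu>'. (\<forall>x. x \<notin> set xs \<longrightarrow> \<nu>' x = \<nu> x) \<longrightarrow> (\<forall>x\<in>set xs. \<nu>' x \<in> fst M) \<longrightarrow> sat M \<nu>' \<psi>)"
proof -
  have "sat M \<nu> (foldr All xs \<psi>) \<longleftrightarrow> \<not> sat M \<nu> (foldr Ex xs (Neg \<psi>))"
    by (induction xs arbitrary: \<nu>) auto
  then show ?thesis unfolding sat_foldr_Ex sat.simps by blast
qed

lemma fv_foldr_Ex: "fv (foldr Ex xs \<psi>) = fv \<psi> - set xs"
  by (induction xs) auto

lemma fv_foldr_All: "fv (foldr All xs \<psi>) = fv \<psi> - set xs"
  by (induction xs) auto

lemma sat_qf:
  assumes "emb M e" "emb N e'" "piso p"
  shows "finitary_qf \<phi> \<Longrightarrow> (\<And>x. x \<in> fv \<phi> \<Longrightarrow> \<nu> x \<in> fst M \<and> \<nu>' x \<in> fst N \<and> (e (\<nu> x), e' (\<nu>' x)) \<in> p) \<Longrightarrow>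
    sat M \<nu> \<phi> \<longleftrightarrow> sat N \<nu>' \<phi>"
proof (induction \<phi>)
  case (Eq x y)
  have v: "\<nu> x \<in> fst M" "\<nu>' x \<in> fst N" "(e (\<nu> x), e' (\<nu>' x)) \<in> p"
    "\<nu> y \<in> fst M" "\<nu>' y \<in> fst N" "(e (\<nu> y), e' (\<nu>' y)) \<in> p" using Eq.prems(2) by simp_all
  show ?case using pisoD_eq[OF assms(3) v(3,6)] emb_eq[OF assms(1) v(1,4)] emb_eq[OF assms(2) v(2,5)] by simp
next
  case (Le x y)
  have v: "\<nu> x \<in> fst M" "\<nu>' x \<in> fst N" "(e (\<nu> x), e' (\<nu>' x)) \<in> p"
    "\<nu> y \<in> fst M" "\<nu>' y \<in> fst N" "(e (\<nu> y), e' (\<nu>' y)) \<in> p" using Le.prems(2) by simp_all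
  show ?case using pisoD_le[OF assms(3) v(3,6)] emb_le[OF assms(1) v(1,4)] emb_le[OF assms(2) v(2,5)] by simp
qed auto

text \<open>The relation contains both directions of the game at every level, so one induction
  covers both kinds of formulas: existential blocks use forth, universal blocks use back.\<close>

lemma sat_bf:
  "Sigma_in \<beta> \<phi> \<or> Pi_in \<beta> \<phi> \<Longrightarrow> emb M e \<Longrightarrow> emb N e' \<Longrightarrow> bf \<beta> (e ` fst M) (e' ` fst N) p \<Longrightarrow>
    (\<And>x. x \<in> fv \<phi> \<Longrightarrow> \<nu> x \<in> fst M \<and> \<nu>' x \<in> fst N \<and> (e (\<nu> x), e' (\<nu>' x)) \<in> p) \<Longrightarrow> sat M \<nu> \<phi> \<Longrightarrow> sat N \<nu>' \<phi>"
proof (induction \<beta> arbitrary: \<phi> p \<nu> \<nu>' rule: less_induct)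
  case (less \<beta>)
  note E = less.prems(2,3) and p = less.prems(4) and v = less.prems(5) and s = less.prems(6)
  consider "finitary_qf \<phi>"
    | \<Phi> where "\<phi> = CDisj \<Phi>" "\<And>i. \<exists>xs \<psi> \<gamma>. \<gamma> < \<beta> \<and> Pi_in \<gamma> \<psi> \<and> \<Phi> i = foldr Ex xs \<psi>"
    | \<Phi> where "\<phi> = CConj \<Phi>" "\<And>i. \<exists>xs \<psi> \<gamma>. \<gamma> < \<beta> \<and> Sigma_in \<gamma> \<psi> \<and> \<Phi> i = foldr All xs \<psi>"
    using less.prems(1) by (auto elim: Sigma_in.cases Pi_in.cases)
  then show ?case
  proof cases
    case 1
    then show ?thesis using sat_qf[OF E bf_base(3)[OF p] 1 v] s by simp
  next
    case (2 \<Phi>)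
    then obtain i where i: "sat M \<nu> (\<Phi> i)" using s by auto
    obtain xs \<psi> \<gamma> where f: "\<gamma> < \<beta>" "Pi_in \<gamma> \<psi>" "\<Phi> i = foldr Ex xs \<psi>" using 2(2) by blast
    obtain \<nu>1 where n: "\<And>x. x \<notin> set xs \<Longrightarrow> \<nu>1 x = \<nu> x" "\<And>x. x \<in> set xs \<Longrightarrow> \<nu>1 x \<in> fst M" "sat M \<nu>1 \<psi>"
      using i unfolding f(3) sat_foldr_Ex by blast
    have "finite (e ` \<nu>1 ` set xs)" "e ` \<nu>1 ` set xs \<subseteq> e ` fst M" using n(2) by auto
    then obtain p' where p': "p \<subseteq> p'" "e ` \<nu>1 ` set xs \<subseteq> Domain p'" "bf \<gamma> (e ` fst M) (e' ` fst N) p'"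
      by (rule bf_forth[OF p f(1)])
    have "\<forall>x. \<exists>b. x \<in> set xs \<longrightarrow> b \<in> fst N \<and> (e (\<nu>1 x), e' b) \<in> p'"
    proof (intro allI)
      fix x show "\<exists>b. x \<in> set xs \<longrightarrow> b \<in> fst N \<and> (e (\<nu>1 x), e' b) \<in> p'"
      proof (cases "x \<in> set xs")
        case True
        then obtain r where r: "(e (\<nu>1 x), r) \<in> p'" using p'(2) by blast
        then show ?thesis using bf_base(2)[OF p'(3)] by blast
      qed simp
    qed
    from choice[OF this] obtain b where b: "\<forall>x. x \<in> set xs \<longrightarrow> b x \<in> fst N \<and> (e (\<nu>1 x), e' (b x)) \<in> p'" ..
    define \<nu>2 where "\<nu>2 x = (if x \<in> set xs then b x else \<nu>' x)" for x
    have "fv (\<Phi> i) \<subseteq> fv \<phi>" using 2(1) by auto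
    then have "fv \<psi> - set xs \<subseteq> fv \<phi>" by (simp add: f(3) fv_foldr_Ex)
    then have "\<nu>1 x \<in> fst M \<and> \<nu>2 x \<in> fst N \<and> (e (\<nu>1 x), e' (\<nu>2 x)) \<in> p'" if "x \<in> fv \<psi>" for x
    proof (cases "x \<in> set xs")
      case True
      then show ?thesis using n(2) b by (simp add: \<nu>2_def)
    next
      case False
      then have "x \<in> fv \<phi>" using that \<open>fv \<psi> - set xs \<subseteq> fv \<phi>\<close> by blast
      from v[OF this] show ?thesis using n(1)[OF False] False p'(1) by (auto simp: \<nu>2_def)
    qed
    then have "sat N \<nu>2 \<psi>" using less.IH[OF f(1) _ E p'(3) _ n(3)] f(2) by blast
    then have "sat N \<nu>' (\<Phi> i)" unfolding f(3) sat_foldr_Ex using b by (intro exI[of _ \<nu>2]) (auto simp: \<nu>2_def)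
    then show ?thesis using 2(1) by auto
  next
    case (3 \<Phi>)
    have "sat N \<nu>' (\<Phi> i)" for i
    proof -
      obtain xs \<psi> \<gamma> where f: "\<gamma> < \<beta>" "Sigma_in \<gamma> \<psi>" "\<Phi> i = foldr All xs \<psi>" using 3(2) by blast
      have i: "sat M \<nu> (foldr All xs \<psi>)" using s 3(1) f(3) by simp (metis)
      show ?thesis unfolding f(3) sat_foldr_All
      proof (intro allI impI)
        fix \<nu>2 assume n: "\<forall>x. x \<notin> set xs \<longrightarrow> \<nu>2 x = \<nu>' x" "\<forall>x\<in>set xs. \<nu>2 x \<in> fst N"
        have "finite (e' ` \<nu>2 ` set xs)" "e' ` \<nu>2 ` set xs \<subseteq> e' ` fst N" using n(2) by auto
        then obtain p' where p': "p \<subseteq> p'" "e' ` \<nu>2 ` set xs \<subseteq> Range p'" "bf \<gamma> (e ` fst M) (e' ` fst N) p'"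
          by (rule bf_back[OF p f(1)])
        have "\<forall>x. \<exists>b. x \<in> set xs \<longrightarrow> b \<in> fst M \<and> (e b, e' (\<nu>2 x)) \<in> p'"
        proof (intro allI)
          fix x show "\<exists>b. x \<in> set xs \<longrightarrow> b \<in> fst M \<and> (e b, e' (\<nu>2 x)) \<in> p'"
          proof (cases "x \<in> set xs")
            case True
            then obtain r where r: "(r, e' (\<nu>2 x)) \<in> p'" using p'(2) by blast
            then show ?thesis using bf_base(2)[OF p'(3)] by blast
          qed simp
        qed
        from choice[OF this] obtain b where b: "\<forall>x. x \<in> set xs \<longrightarrow> b x \<in> fst M \<and> (e (b x), e' (\<nu>2 x)) \<in> p'" ..
        define \<nu>1 where "\<nu>1 x = (if x \<in> set xs then b x else \<nu> x)" for x
        have "sat M \<nu>1 \<psi>" using i b unfolding sat_foldr_All by (auto simp: \<nu>1_def)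
        have "fv (\<Phi> i) \<subseteq> fv \<phi>" using 3(1) by auto
        then have "fv \<psi> - set xs \<subseteq> fv \<phi>" by (simp add: f(3) fv_foldr_All)
        have "\<nu>1 x \<in> fst M \<and> \<nu>2 x \<in> fst N \<and> (e (\<nu>1 x), e' (\<nu>2 x)) \<in> p'" if "x \<in> fv \<psi>" for x
        proof (cases "x \<in> set xs")
          case True
          then show ?thesis using n(2) b by (simp add: \<nu>1_def)
        next
          case False
          then have "x \<in> fv \<phi>" using that \<open>fv \<psi> - set xs \<subseteq> fv \<phi>\<close> by blast
          from v[OF this] show ?thesis using n(1) False p'(1) by (auto simp: \<nu>1_def)
        qed
        then show "sat N \<nu>2 \<psi>" using less.IH[OF f(1) _ E p'(3) _ \<open>sat M \<nu>1 \<psi>\<close>] f(2) by blast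
      qed
    qed
    then show ?thesis using 3(1) by simp
  qed
qed

lemma models_bf:
  assumes \<phi>: "Pi_in \<beta> \<phi>" "sentence \<phi>" and E: "emb M e" "emb N e'" and b: "bf \<beta> (e ` fst M) (e' ` fst N) {}"
    and M: "models M \<phi>"
  shows "models N \<phi>"
  unfolding models_def
proof (intro allI impI)
  fix \<nu>' :: "nat \<Rightarrow> nat" assume "range \<nu>' \<subseteq> fst N"
  obtain a where a: "a \<in> fst M" using E(1) by (auto simp: emb_def)
  have "sat M (\<lambda>_. a) \<phi>" using M[unfolded models_def, THEN spec, of "\<lambda>_. a"] a by auto
  then show "sat N \<nu>' \<phi>" using sat_bf[OF _ E b, of \<phi> "\<lambda>_. a" \<nu>'] \<phi> by (auto simp: sentence_def)
qed

section \<open>Formulas defining back-and-forth types\<close>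

definition tup :: "(nat \<Rightarrow> real) \<Rightarrow> nat list \<Rightarrow> (nat \<Rightarrow> real) \<Rightarrow> nat list \<Rightarrow> (real \<times> real) set" where
  "tup e as e' bs = set (zip (map e as) (map e' bs))"

lemma tup_append: "length as = length bs \<Longrightarrow> tup e (as @ cs) e' (bs @ ds) = tup e as e' bs \<union> tup e cs e' ds"
  by (simp add: tup_def)

lemma in_tup: "length as = length bs \<Longrightarrow> z \<in> tup e as e' bs \<longleftrightarrow> (\<exists>i<length as. z = (e (as ! i), e' (bs ! i)))"
proof -
  assume l: "length as = length bs"
  then have "z \<in> tup e as e' bs \<longleftrightarrow> (\<exists>i. z = (map e as ! i, map e' bs ! i) \<and> i < length as)"
    by (simp add: tup_def set_zip)
  also have "\<dots> \<longleftrightarrow> (\<exists>i<length as. z = (e (as ! i), e' (bs ! i)))" by (intro ex_cong1) (auto simp: l)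
  finally show ?thesis .
qed

lemma tup_converse: "length as = length bs \<Longrightarrow> (tup e as e' bs)\<inverse> = tup e' bs e as"
  by (auto simp: in_tup)

lemma Domain_tup: "length as = length bs \<Longrightarrow> Domain (tup e as e' bs) = e ` set as"
  by (simp add: tup_def Domain_fst set_map[symmetric] del: set_map)

lemma bf_tuple_forth:
  assumes b: "bf \<beta> (e ` fst M) (e' ` fst N) (tup e as e' bs)" "\<gamma> < \<beta>" and l: "length as = length bs" and cs: "set cs \<subseteq> fst M"
  shows "\<exists>ds. set ds \<subseteq> fst N \<and> length ds = length cs \<and> bf \<gamma> (e ` fst M) (e' ` fst N) (tup e (as @ cs) e' (bs @ ds))"
proof -
  have "finite (e ` set cs)" "e ` set cs \<subseteq> e ` fst M" using cs by auto
  then obtain p' where p': "tup e as e' bs \<subseteq> p'" "e ` set cs \<subseteq> Domain p'" "bf \<gamma> (e ` fst M) (e' ` fst N) p'"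
    by (rule bf_forth[OF b])
  have "\<forall>c. \<exists>d. c \<in> set cs \<longrightarrow> d \<in> fst N \<and> (e c, e' d) \<in> p'"
  proof
    fix c show "\<exists>d. c \<in> set cs \<longrightarrow> d \<in> fst N \<and> (e c, e' d) \<in> p'"
    proof (cases "c \<in> set cs")
      case True
      then obtain r where "(e c, r) \<in> p'" using p'(2) by blast
      then show ?thesis using bf_base(2)[OF p'(3)] by blast
    qed simp
  qed
  from choice[OF this] obtain h where h: "\<forall>c. c \<in> set cs \<longrightarrow> h c \<in> fst N \<and> (e c, e' (h c)) \<in> p'" ..
  have "tup e cs e' (map h cs) \<subseteq> p'" using h by (auto simp: in_tup)
  then have "bf \<gamma> (e ` fst M) (e' ` fst N) (tup e (as @ cs) e' (bs @ map h cs))"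
    using bf_subset[OF p'(3)] p'(1) l by (simp add: tup_append)
  then show ?thesis using h by (intro exI[of _ "map h cs"]) auto
qed

lemma bf_tuple_back:
  assumes b: "bf \<beta> (e ` fst M) (e' ` fst N) (tup e as e' bs)" "\<gamma> < \<beta>" and l: "length as = length bs" and ds: "set ds \<subseteq> fst N"
  shows "\<exists>cs. set cs \<subseteq> fst M \<and> length cs = length ds \<and> bf \<gamma> (e ` fst M) (e' ` fst N) (tup e (as @ cs) e' (bs @ ds))"
proof -
  have "bf \<beta> (e' ` fst N) (e ` fst M) (tup e' bs e as)" using bf_converse[OF b(1)] l by (simp add: tup_converse)
  from bf_tuple_forth[OF this b(2) l[symmetric] ds] obtain cs where
    cs: "set cs \<subseteq> fst M" "length cs = length ds" "bf \<gamma> (e' ` fst N) (e ` fst M) (tup e' (bs @ ds) e (as @ cs))" by blast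
  then show ?thesis using bf_converse[OF cs(3)] l by (intro exI[of _ cs]) (simp add: tup_converse)
qed

text \<open>By monotonicity a cofinal set of lower levels suffices: the predecessor alone at a
  successor, all smaller ordinals at a limit. Any member of \<open>\<Gamma>\<close>, tested with
  empty tuples, shows that the given tuples form a position.\<close>

lemma bf_tuples:
  assumes l: "length as = length bs" and ne: "\<Gamma> \<noteq> {}" and \<Gamma>: "\<Gamma> \<subseteq> {..<\<beta>}" "\<forall>\<gamma><\<beta>. \<exists>\<delta>\<in>\<Gamma>. \<gamma> \<le> \<delta>"
  shows "bf \<beta> (e ` fst M) (e' ` fst N) (tup e as e' bs) \<longleftrightarrow> (\<forall>\<gamma>\<in>\<Gamma>.
    (\<forall>cs. set cs \<subseteq> fst M \<longrightarrow> (\<exists>ds. set ds \<subseteq> fst N \<and> length ds = length cs \<and> bf \<gamma> (e ` fst M) (e' ` fst N) (tup e (as @ cs) e' (bs @ ds)))) \<and>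
    (\<forall>ds. set ds \<subseteq> fst N \<longrightarrow> (\<exists>cs. set cs \<subseteq> fst M \<and> length cs = length ds \<and> bf \<gamma> (e ` fst M) (e' ` fst N) (tup e (as @ cs) e' (bs @ ds)))))"
    (is "?L \<longleftrightarrow> ?R")
proof
  assume ?L
  then show ?R using bf_tuple_forth[OF _ _ l] bf_tuple_back[OF _ _ l] \<Gamma>(1) by (meson lessThan_iff subsetD)
next
  assume R: ?R
  obtain \<gamma>0 where g0: "\<gamma>0 \<in> \<Gamma>" using ne by blast
  then obtain ds where "length ds = length ([] :: nat list)" "bf \<gamma>0 (e ` fst M) (e' ` fst N) (tup e (as @ []) e' (bs @ ds))"
    using R by (metis empty_subsetI list.set(1))
  then have b0: "bf \<gamma>0 (e ` fst M) (e' ` fst N) (tup e as e' bs)" by simp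
  show ?L
  proof (rule bfI[OF bf_base[OF b0]])
    fix \<gamma> C assume g: "\<gamma> < \<beta>" and C: "finite C" "C \<subseteq> e ` fst M"
    obtain \<delta> where d: "\<delta> \<in> \<Gamma>" "\<gamma> \<le> \<delta>" using \<Gamma>(2) g by blast
    obtain C' where C': "C' \<subseteq> fst M" "finite C'" "C = e ` C'" using finite_subset_image[OF C] by blast
    then obtain cs where cs: "set cs = C'" using finite_list by blast
    then obtain ds where ds: "length ds = length cs" "bf \<delta> (e ` fst M) (e' ` fst N) (tup e (as @ cs) e' (bs @ ds))"
      using R d(1) C'(1) by blast
    have "C \<subseteq> Domain (tup e (as @ cs) e' (bs @ ds))" using l ds(1) cs C'(3) by (auto simp: Domain_tup)
    moreover have "tup e as e' bs \<subseteq> tup e (as @ cs) e' (bs @ ds)" using l by (simp add: tup_append)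
    ultimately show "\<exists>p'. tup e as e' bs \<subseteq> p' \<and> C \<subseteq> Domain p' \<and> bf \<gamma> (e ` fst M) (e' ` fst N) p'"
      using bf_mono[OF d(2) ds(2)] by blast
  next
    fix \<gamma> C assume g: "\<gamma> < \<beta>" and C: "finite C" "C \<subseteq> e' ` fst N"
    obtain \<delta> where d: "\<delta> \<in> \<Gamma>" "\<gamma> \<le> \<delta>" using \<Gamma>(2) g by blast
    obtain C' where C': "C' \<subseteq> fst N" "finite C'" "C = e' ` C'" using finite_subset_image[OF C] by blast
    then obtain ds where ds: "set ds = C'" using finite_list by blast
    then obtain cs where cs: "length cs = length ds" "bf \<delta> (e ` fst M) (e' ` fst N) (tup e (as @ cs) e' (bs @ ds))"
      using R d(1) C'(1) by blast
    have "Range (tup e (as @ cs) e' (bs @ ds)) = Domain (tup e' (bs @ ds) e (as @ cs))"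
      using l cs(1) by (subst tup_converse[symmetric]) auto
    then have "C \<subseteq> Range (tup e (as @ cs) e' (bs @ ds))" using l cs(1) ds C'(3) by (auto simp: Domain_tup)
    moreover have "tup e as e' bs \<subseteq> tup e (as @ cs) e' (bs @ ds)" using l by (simp add: tup_append)
    ultimately show "\<exists>p'. tup e as e' bs \<subseteq> p' \<and> C \<subseteq> Range p' \<and> bf \<gamma> (e ` fst M) (e' ` fst N) p'"
      using bf_mono[OF d(2) cs(2)] by blast
  qed
qed

lemma sat_Ex_tuple:
  assumes fv: "fv \<tau> \<subseteq> {..<length bs + n}"
  shows "sat N ((!) bs) (foldr Ex [length bs..<length bs + n] \<tau>) \<longleftrightarrow>
    (\<exists>ds. set ds \<subseteq> fst N \<and> length ds = n \<and> sat N ((!) (bs @ ds)) \<tau>)"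
proof
  assume "sat N ((!) bs) (foldr Ex [length bs..<length bs + n] \<tau>)"
  then obtain \<nu> where v: "\<And>x. x \<notin> set [length bs..<length bs + n] \<Longrightarrow> \<nu> x = bs ! x"
    "\<And>x. x \<in> set [length bs..<length bs + n] \<Longrightarrow> \<nu> x \<in> fst N" "sat N \<nu> \<tau>"
    unfolding sat_foldr_Ex by blast
  let ?ds = "map \<nu> [length bs..<length bs + n]"
  have "\<nu> x = (bs @ ?ds) ! x" if "x \<in> fv \<tau>" for x
    using v(1)[of x] subsetD[OF fv that] by (auto simp: nth_append)
  then have "sat N ((!) (bs @ ?ds)) \<tau>" using v(3) sat_cong_fv[of \<tau> \<nu> "(!) (bs @ ?ds)" N] by simp
  then show "\<exists>ds. set ds \<subseteq> fst N \<and> length ds = n \<and> sat N ((!) (bs @ ds)) \<tau>"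
    using v(2) by (intro exI[of _ ?ds]) auto
next
  assume "\<exists>ds. set ds \<subseteq> fst N \<and> length ds = n \<and> sat N ((!) (bs @ ds)) \<tau>"
  then obtain ds where ds: "set ds \<subseteq> fst N" "length ds = n" "sat N ((!) (bs @ ds)) \<tau>" by blast
  let ?v = "\<lambda>x. if x < length bs + n then (bs @ ds) ! x else bs ! x"
  have "(bs @ ds) ! x = ?v x" if "x \<in> fv \<tau>" for x using subsetD[OF fv that] by simp
  then have "sat N ?v \<tau>" using ds(3) sat_cong_fv[of \<tau> "(!) (bs @ ds)" ?v N] by simp
  then show "sat N ((!) bs) (foldr Ex [length bs..<length bs + n] \<tau>)"
    unfolding sat_foldr_Ex using ds(1,2) by (intro exI[of _ ?v]) (auto simp: nth_append intro!: subsetD[OF ds(1) nth_mem])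
qed

lemma sat_All_tuple:
  assumes fv: "fv \<tau> \<subseteq> {..<length bs + n}"
  shows "sat N ((!) bs) (foldr All [length bs..<length bs + n] \<tau>) \<longleftrightarrow>
    (\<forall>ds. set ds \<subseteq> fst N \<longrightarrow> length ds = n \<longrightarrow> sat N ((!) (bs @ ds)) \<tau>)"
proof -
  have "sat N ((!) bs) (foldr All [length bs..<length bs + n] \<tau>) \<longleftrightarrow> \<not> sat N ((!) bs) (foldr Ex [length bs..<length bs + n] (Neg \<tau>))"
    unfolding sat_foldr_Ex sat_foldr_All sat.simps by blast
  then show ?thesis using sat_Ex_tuple[of "Neg \<tau>" bs n N] fv by auto
qed

definition type_of :: "struct \<Rightarrow> (nat \<Rightarrow> real) \<Rightarrow> ordinal \<Rightarrow> nat list \<Rightarrow> fm \<Rightarrow> bool" where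
  "type_of M e \<beta> as \<phi> \<longleftrightarrow> fv \<phi> \<subseteq> {..<length as} \<and>
    (\<forall>N e' bs. emb N e' \<longrightarrow> set bs \<subseteq> fst N \<longrightarrow> length bs = length as \<longrightarrow>
      (sat N ((!) bs) \<phi> \<longleftrightarrow> bf \<beta> (e ` fst M) (e' ` fst N) (tup e as e' bs)))"

lemma type_ofD:
  "type_of M e \<beta> as \<phi> \<Longrightarrow> emb N e' \<Longrightarrow> set bs \<subseteq> fst N \<Longrightarrow> length bs = length as \<Longrightarrow>
    sat N ((!) bs) \<phi> \<longleftrightarrow> bf \<beta> (e ` fst M) (e' ` fst N) (tup e as e' bs)"
  unfolding type_of_def by blast

text \<open>Forth becomes a conjunction over the tuples \<open>cs\<close> of \<open>M\<close>, back
  a universal block followed by a disjunction over such tuples. Both need a formula of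
  \<open>Sigma_in (osuc (\<delta> \<gamma>))\<close>, hence the two levels from
  \<open>\<delta> \<gamma>\<close> to \<open>\<epsilon>\<close>.\<close>

lemma type_step:
  assumes M: "emb M e" and as: "set as \<subseteq> fst M"
    and \<Gamma>: "countable \<Gamma>" "\<Gamma> \<noteq> {}" "\<Gamma> \<subseteq> {..<\<beta>}" "\<And>\<gamma>. \<gamma> < \<beta> \<Longrightarrow> \<exists>\<delta>\<in>\<Gamma>. \<gamma> \<le> \<delta>"
    and T: "\<And>\<gamma> cs. \<gamma> \<in> \<Gamma> \<Longrightarrow> set cs \<subseteq> fst M \<Longrightarrow> \<exists>\<phi>. Pi_in (\<delta> \<gamma>) \<phi> \<and> type_of M e \<gamma> cs \<phi>"
    and lt: "\<And>\<gamma>. \<gamma> \<in> \<Gamma> \<Longrightarrow> osuc (\<delta> \<gamma>) < \<epsilon>"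
  shows "\<exists>\<phi>. Pi_in \<epsilon> \<phi> \<and> type_of M e \<beta> as \<phi>"
proof -
  define T where "T \<gamma> cs = (SOME \<phi>. Pi_in (\<delta> \<gamma>) \<phi> \<and> type_of M e \<gamma> cs \<phi>)" for \<gamma> cs
  have T: "Pi_in (\<delta> \<gamma>) (T \<gamma> cs)" "type_of M e \<gamma> cs (T \<gamma> cs)" if "\<gamma> \<in> \<Gamma>" "set cs \<subseteq> fst M" for \<gamma> cs
    using someI_ex[OF assms(7)[OF that]] by (auto simp: T_def)
  define L where "L n = {cs. length cs = n \<and> set cs \<subseteq> fst M}" for n
  obtain a where a: "a \<in> fst M" using M by (auto simp: emb_def)
  have Lne: "L n \<noteq> {}" for n
  proof -
    have "replicate n a \<in> L n" using a by (auto simp: L_def)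
    then show ?thesis by blast
  qed
  have L: "from_nat_into (L n) i \<in> L n" for n i by (rule from_nat_into[OF Lne])
  have Ls: "\<exists>i. from_nat_into (L n) i = cs" if "cs \<in> L n" for n cs by (rule from_nat_into_surj[OF countableI_type that])
  \<comment> \<open>The constant disjunction and the empty quantifier block bring the formulas into
    the shape prescribed by the inductive definition.\<close>
  define fo where "fo = (\<lambda>(\<gamma>, cs). CDisj (\<lambda>_. foldr Ex [length as..<length as + length cs] (T \<gamma> (as @ cs))))"
  define ba where "ba = (\<lambda>(\<gamma>, n). foldr All [length as..<length as + n] (CDisj (\<lambda>i. foldr Ex [] (T \<gamma> (as @ from_nat_into (L n) i)))))"
  define S where "S = fo ` (\<Gamma> \<times> {cs. set cs \<subseteq> fst M}) \<union> ba ` (\<Gamma> \<times> UNIV)"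
  have cS: "countable S" unfolding S_def using \<Gamma>(1) by (intro countable_Un countable_image countable_SIGMA) auto
  have Sne: "S \<noteq> {}" unfolding S_def using \<Gamma>(2) by auto
  let ?\<phi> = "CConj (from_nat_into S)"
  have conv: "(\<forall>i. P (from_nat_into S i)) \<longleftrightarrow> (\<forall>\<psi>\<in>S. P \<psi>)" for P
    using range_from_nat_into[OF Sne cS] by (metis rangeE rangeI)
  have fvT: "fv (T \<gamma> (as @ cs)) \<subseteq> {..<length as + length cs}" if "\<gamma> \<in> \<Gamma>" "set cs \<subseteq> fst M" for \<gamma> cs
    using T(2)[of \<gamma> "as @ cs"] that as by (auto simp: type_of_def)
  have fvD: "fv (CDisj (\<lambda>i. foldr Ex [] (T \<gamma> (as @ from_nat_into (L n) i)))) \<subseteq> {..<length as + n}" if g: "\<gamma> \<in> \<Gamma>" for \<gamma> n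
  proof -
    have "fv (T \<gamma> (as @ from_nat_into (L n) i)) \<subseteq> {..<length as + n}" for i
      using fvT[OF g, of "from_nat_into (L n) i"] L[of n i] by (simp add: L_def)
    then show ?thesis by auto
  qed
  have "Pi_in \<epsilon> ?\<phi>"
  proof (rule Pi_CConj)
    have "\<forall>\<psi>\<in>S. \<exists>xs \<chi> \<gamma>. \<gamma> < \<epsilon> \<and> Sigma_in \<gamma> \<chi> \<and> \<psi> = foldr All xs \<chi>"
    proof
      fix \<psi> assume "\<psi> \<in> S"
      then consider \<gamma> cs where "\<gamma> \<in> \<Gamma>" "set cs \<subseteq> fst M" "\<psi> = fo (\<gamma>, cs)" | \<gamma> n where "\<gamma> \<in> \<Gamma>" "\<psi> = ba (\<gamma>, n)"
        by (auto simp: S_def)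
      then show "\<exists>xs \<chi> \<gamma>. \<gamma> < \<epsilon> \<and> Sigma_in \<gamma> \<chi> \<and> \<psi> = foldr All xs \<chi>"
      proof cases
        case (1 \<gamma> cs)
        have "Pi_in (\<delta> \<gamma>) (T \<gamma> (as @ cs))" by (rule T(1)) (use 1 as in auto)
        then have "Sigma_in (osuc (\<delta> \<gamma>)) \<psi>" unfolding 1(3) fo_def prod.case
          using less_osuc by (intro Sigma_CDisj) blast
        then show ?thesis using lt[OF 1(1)] by (intro exI[of _ "[]"] exI[of _ \<psi>]) auto
      next
        case (2 \<gamma> n)
        have "set (as @ from_nat_into (L n) i) \<subseteq> fst M" for i using L[of n i] as by (simp add: L_def)
        then have "Sigma_in (osuc (\<delta> \<gamma>)) (CDisj (\<lambda>i. foldr Ex [] (T \<gamma> (as @ from_nat_into (L n) i))))"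
          using T(1)[OF 2(1)] less_osuc by (intro Sigma_CDisj) blast
        then show ?thesis using lt[OF 2(1)] unfolding 2(2) ba_def by auto
      qed
    qed
    then show "\<exists>xs \<chi> \<gamma>. \<gamma> < \<epsilon> \<and> Sigma_in \<gamma> \<chi> \<and> from_nat_into S i = foldr All xs \<chi>" for i
      using from_nat_into[OF Sne] by blast
  qed
  moreover have "type_of M e \<beta> as ?\<phi>"
    unfolding type_of_def
  proof (intro conjI allI impI)
    have "\<forall>\<psi>\<in>S. fv \<psi> \<subseteq> {..<length as}"
    proof
      fix \<psi> assume "\<psi> \<in> S"
      then consider \<gamma> cs where "\<gamma> \<in> \<Gamma>" "set cs \<subseteq> fst M" "\<psi> = fo (\<gamma>, cs)" | \<gamma> n where "\<gamma> \<in> \<Gamma>" "\<psi> = ba (\<gamma>, n)"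
        by (auto simp: S_def)
      then show "fv \<psi> \<subseteq> {..<length as}"
      proof cases
        case (1 \<gamma> cs)
        have "fv \<psi> = fv (T \<gamma> (as @ cs)) - {length as..<length as + length cs}" by (simp add: 1 fo_def fv_foldr_Ex)
        then show ?thesis using fvT[OF 1(1,2)] by force
      next
        case (2 \<gamma> n)
        have "fv \<psi> \<subseteq> {..<length as + n} - {length as..<length as + n}"
          unfolding 2(2) ba_def prod.case fv_foldr_All using fvD[OF 2(1)] by (metis Diff_mono order_refl set_upt)
        then show ?thesis by force
      qed
    qed
    then show "fv ?\<phi> \<subseteq> {..<length as}" using from_nat_into[OF Sne] by auto
    fix N e' bs assume N: "emb N e'" "set bs \<subseteq> fst N" "length bs = length as"
    let ?B = "\<lambda>\<gamma> cs ds. bf \<gamma> (e ` fst M) (e' ` fst N) (tup e (as @ cs) e' (bs @ ds))"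
    have sT: "sat N ((!) (bs @ ds)) (T \<gamma> (as @ cs)) \<longleftrightarrow> ?B \<gamma> cs ds"
      if "\<gamma> \<in> \<Gamma>" "set cs \<subseteq> fst M" "set ds \<subseteq> fst N" "length ds = length cs" for \<gamma> cs ds
      using type_ofD[OF T(2), of \<gamma> "as @ cs" N e' "bs @ ds"] that as N by simp
    have f: "sat N ((!) bs) (fo (\<gamma>, cs)) \<longleftrightarrow> (\<exists>ds. set ds \<subseteq> fst N \<and> length ds = length cs \<and> ?B \<gamma> cs ds)"
      if g: "\<gamma> \<in> \<Gamma>" "set cs \<subseteq> fst M" for \<gamma> cs
      using sat_Ex_tuple[of "T \<gamma> (as @ cs)" bs "length cs" N] fvT[OF g] sT[OF g] N(3) by (auto simp: fo_def)
    have b: "sat N ((!) bs) (ba (\<gamma>, n)) \<longleftrightarrow> (\<forall>ds. set ds \<subseteq> fst N \<longrightarrow> length ds = n \<longrightarrow> (\<exists>cs. set cs \<subseteq> fst M \<and> length cs = length ds \<and> ?B \<gamma> cs ds))"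
      if g: "\<gamma> \<in> \<Gamma>" for \<gamma> n
    proof -
      have "sat N ((!) (bs @ ds)) (CDisj (\<lambda>i. foldr Ex [] (T \<gamma> (as @ from_nat_into (L n) i)))) \<longleftrightarrow>
          (\<exists>cs. set cs \<subseteq> fst M \<and> length cs = length ds \<and> ?B \<gamma> cs ds)" if ds: "set ds \<subseteq> fst N" "length ds = n" for ds
      proof
        assume "sat N ((!) (bs @ ds)) (CDisj (\<lambda>i. foldr Ex [] (T \<gamma> (as @ from_nat_into (L n) i))))"
        then obtain i where "sat N ((!) (bs @ ds)) (T \<gamma> (as @ from_nat_into (L n) i))" by auto
        then show "\<exists>cs. set cs \<subseteq> fst M \<and> length cs = length ds \<and> ?B \<gamma> cs ds"
          using sT[OF g, of "from_nat_into (L n) i" ds] L[of n i] ds by (auto simp: L_def)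
      next
        assume "\<exists>cs. set cs \<subseteq> fst M \<and> length cs = length ds \<and> ?B \<gamma> cs ds"
        then obtain cs where cs: "set cs \<subseteq> fst M" "length cs = length ds" "?B \<gamma> cs ds" by blast
        then obtain i where "from_nat_into (L n) i = cs" using Ls[of cs n] ds by (auto simp: L_def)
        then show "sat N ((!) (bs @ ds)) (CDisj (\<lambda>i. foldr Ex [] (T \<gamma> (as @ from_nat_into (L n) i))))"
          using sT[OF g cs(1) ds(1)] cs(2,3) by auto
      qed
      then show ?thesis
        using sat_All_tuple[of "CDisj (\<lambda>i. foldr Ex [] (T \<gamma> (as @ from_nat_into (L n) i)))" bs n N] fvD[OF g] N(3)
        unfolding ba_def prod.case by (simp del: sat.simps fv.simps)
    qed
    have "sat N ((!) bs) ?\<phi> \<longleftrightarrow> (\<forall>\<psi>\<in>S. sat N ((!) bs) \<psi>)" using conv[of "sat N ((!) bs)"] by simp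
    also have "\<dots> \<longleftrightarrow> (\<forall>\<gamma>\<in>\<Gamma>. (\<forall>cs. set cs \<subseteq> fst M \<longrightarrow> sat N ((!) bs) (fo (\<gamma>, cs))) \<and> (\<forall>n. sat N ((!) bs) (ba (\<gamma>, n))))"
      unfolding S_def by blast
    also have "\<dots> \<longleftrightarrow> bf \<beta> (e ` fst M) (e' ` fst N) (tup e as e' bs)"
    proof -
      have "\<forall>\<gamma><\<beta>. \<exists>\<delta>\<in>\<Gamma>. \<gamma> \<le> \<delta>" using \<Gamma>(4) by blast
      from bf_tuples[OF N(3)[symmetric] \<Gamma>(2,3) this, of e M e' N] show ?thesis
        using f b by (simp only:) (intro ball_cong refl, auto)
    qed
    finally show "sat N ((!) bs) ?\<phi> \<longleftrightarrow> bf \<beta> (e ` fst M) (e' ` fst N) (tup e as e' bs)" .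
  qed
  ultimately show ?thesis by blast
qed

lemma bf_zero_iff: "bf 0 A B p \<longleftrightarrow> finite p \<and> p \<subseteq> A \<times> B \<and> piso p"
proof
  show "finite p \<and> p \<subseteq> A \<times> B \<and> piso p" if "bf 0 A B p" using bf_base[OF that] by blast
  show "bf 0 A B p" if "finite p \<and> p \<subseteq> A \<times> B \<and> piso p"
    by (rule bfI) (use that zero_le_ordinal leD in blast)+
qed

lemma sat_foldr_And: "sat N \<nu> (foldr And \<phi>s (Neg Falsum)) \<longleftrightarrow> (\<forall>\<phi>\<in>set \<phi>s. sat N \<nu> \<phi>)"
  by (induction \<phi>s) auto

lemma fv_foldr_And: "fv (foldr And \<phi>s (Neg Falsum)) = (\<Union>\<phi>\<in>set \<phi>s. fv \<phi>)"
  by (induction \<phi>s) auto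

lemma qf_foldr_And: "finitary_qf (foldr And \<phi>s (Neg Falsum)) \<longleftrightarrow> (\<forall>\<phi>\<in>set \<phi>s. finitary_qf \<phi>)"
  by (induction \<phi>s) auto

lemma type_zero:
  assumes as: "set as \<subseteq> fst M"
  shows "\<exists>\<phi>. Pi_in 0 \<phi> \<and> type_of M e 0 as \<phi>"
proof -
  let ?l = "length as"
  define lit where "lit = (\<lambda>(i, j). if e (as ! i) \<le> e (as ! j) then Le i j else Neg (Le i j))"
  let ?\<phi> = "foldr And (map lit (List.product [0..<?l] [0..<?l])) (Neg Falsum)"
  have "Pi_in 0 ?\<phi>" by (rule Pi_zero) (auto simp: qf_foldr_And lit_def)
  moreover have "type_of M e 0 as ?\<phi>" unfolding type_of_def
  proof (intro conjI allI impI)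
    show "fv ?\<phi> \<subseteq> {..<?l}" by (auto simp: fv_foldr_And lit_def split: if_splits)
    fix N e' bs assume N: "emb N e'" "set bs \<subseteq> fst N" and l: "length bs = length as"
    have bN: "bs ! i \<in> fst N" if "i < ?l" for i using N(2) l that nth_mem[of i bs] by auto
    have "sat N ((!) bs) ?\<phi> \<longleftrightarrow> (\<forall>i<?l. \<forall>j<?l. sat N ((!) bs) (lit (i, j)))"
      by (auto simp: sat_foldr_And)
    also have "\<dots> \<longleftrightarrow> (\<forall>i<?l. \<forall>j<?l. e (as ! i) \<le> e (as ! j) \<longleftrightarrow> e' (bs ! i) \<le> e' (bs ! j))"
      using emb_le[OF N(1) bN bN] by (auto simp: lit_def)
    also have "\<dots> \<longleftrightarrow> piso (tup e as e' bs)"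
    proof
      assume a: "\<forall>i<?l. \<forall>j<?l. e (as ! i) \<le> e (as ! j) \<longleftrightarrow> e' (bs ! i) \<le> e' (bs ! j)"
      show "piso (tup e as e' bs)" unfolding piso_def
      proof (intro ballI, clarify)
        fix x y x' y' assume "(x, y) \<in> tup e as e' bs" "(x', y') \<in> tup e as e' bs"
        then obtain i j where "i < ?l" "j < ?l" "x = e (as ! i)" "y = e' (bs ! i)" "x' = e (as ! j)" "y' = e' (bs ! j)"
          using l by (auto simp: in_tup)
        then show "x < x' \<longleftrightarrow> y < y'" using a by (simp add: not_le[symmetric])
      qed
    next
      assume p: "piso (tup e as e' bs)"
      have "(e (as ! i), e' (bs ! i)) \<in> tup e as e' bs" if "i < ?l" for i using l that by (auto simp: in_tup)
      then show "\<forall>i<?l. \<forall>j<?l. e (as ! i) \<le> e (as ! j) \<longleftrightarrow> e' (bs ! i) \<le> e' (bs ! j)"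
        using pisoD_le[OF p] by blast
    qed
    also have "\<dots> \<longleftrightarrow> bf 0 (e ` fst M) (e' ` fst N) (tup e as e' bs)"
    proof -
      have "tup e as e' bs \<subseteq> e ` fst M \<times> e' ` fst N"
      proof
        fix z assume "z \<in> tup e as e' bs"
        then obtain i where "i < ?l" "z = (e (as ! i), e' (bs ! i))" using l by (auto simp: in_tup)
        then show "z \<in> e ` fst M \<times> e' ` fst N" using bN subsetD[OF as nth_mem[of i as]] by auto
      qed
      then show ?thesis unfolding bf_zero_iff by (simp add: tup_def)
    qed
    finally show "sat N ((!) bs) ?\<phi> \<longleftrightarrow> bf 0 (e ` fst M) (e' ` fst N) (tup e as e' bs)" .
  qed
  ultimately show ?thesis by blast
qed

text \<open>A successor step adds two levels to the formula and one to \<beta>, so k grows by one;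
  at a limit the formulas for smaller levels all stay below \<beta>, and k is 0 again.\<close>

lemma type_formula:
  "countable {..<\<beta>} \<Longrightarrow> \<exists>k. \<forall>M e as. emb M e \<longrightarrow> set as \<subseteq> fst M \<longrightarrow> (\<exists>\<phi>. Pi_in ((osuc ^^ k) \<beta>) \<phi> \<and> type_of M e \<beta> as \<phi>)"
proof (induction \<beta> rule: less_induct)
  case (less \<beta>)
  have cnt: "countable {..<\<gamma>}" if "\<gamma> < \<beta>" for \<gamma>
    by (rule countable_subset[OF _ less.prems]) (use that in auto)
  consider "\<beta> = 0" | \<gamma> where "\<beta> = osuc \<gamma>" | "\<beta> \<noteq> 0" "\<And>\<gamma>. \<beta> \<noteq> osuc \<gamma>" by blast
  then show ?case
  proof cases
    case 1
    then show ?thesis using type_zero by (intro exI[of _ 0]) auto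
  next
    case (2 \<gamma>)
    have g: "\<gamma> < \<beta>" unfolding 2 by (rule less_osuc)
    from less.IH[OF g cnt[OF g]] obtain k where
      k: "\<forall>M e as. emb M e \<longrightarrow> set as \<subseteq> fst M \<longrightarrow> (\<exists>\<phi>. Pi_in ((osuc ^^ k) \<gamma>) \<phi> \<and> type_of M e \<gamma> as \<phi>)" ..
    have e: "(osuc ^^ Suc k) \<beta> = osuc (osuc ((osuc ^^ k) \<gamma>))" by (simp add: 2 funpow_swap1)
    have "\<exists>\<phi>. Pi_in ((osuc ^^ Suc k) \<beta>) \<phi> \<and> type_of M e \<beta> as \<phi>" if "emb M e" "set as \<subseteq> fst M" for M e as
    proof (rule type_step[OF that, of "{\<gamma>}" _ "\<lambda>_. (osuc ^^ k) \<gamma>"])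
      show "\<exists>\<phi>. Pi_in ((osuc ^^ k) \<gamma>) \<phi> \<and> type_of M e \<gamma>' cs \<phi>" if "\<gamma>' \<in> {\<gamma>}" "set cs \<subseteq> fst M" for \<gamma>' cs
        using k that \<open>emb M e\<close> by blast
      show "osuc ((osuc ^^ k) \<gamma>) < (osuc ^^ Suc k) \<beta>" for \<gamma>' unfolding e by (rule less_osuc)
    qed (use g in \<open>auto simp: 2 less_osuc_iff\<close>)
    then show ?thesis by blast
  next
    case 3
    have lim: "(osuc ^^ n) \<gamma> < \<beta>" if "\<gamma> < \<beta>" for n \<gamma>
    proof (induction n)
      case (Suc n)
      then have "osuc ((osuc ^^ n) \<gamma>) \<le> \<beta>" by (simp add: osuc_le_iff)
      then have "osuc ((osuc ^^ n) \<gamma>) < \<beta>" using 3(2) by (metis order_le_neq_trans)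
      then show ?case by simp
    qed (use that in simp)
    have "\<forall>\<gamma>. \<exists>k. \<gamma> < \<beta> \<longrightarrow> (\<forall>M e as. emb M e \<longrightarrow> set as \<subseteq> fst M \<longrightarrow> (\<exists>\<phi>. Pi_in ((osuc ^^ k) \<gamma>) \<phi> \<and> type_of M e \<gamma> as \<phi>))"
    proof
      fix \<gamma> show "\<exists>k. \<gamma> < \<beta> \<longrightarrow> (\<forall>M e as. emb M e \<longrightarrow> set as \<subseteq> fst M \<longrightarrow> (\<exists>\<phi>. Pi_in ((osuc ^^ k) \<gamma>) \<phi> \<and> type_of M e \<gamma> as \<phi>))"
      proof (cases "\<gamma> < \<beta>")
        case True
        from less.IH[OF True cnt[OF True]] show ?thesis by (elim exE) (rule exI, rule impI)
      qed simp
    qed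
    from choice[OF this] obtain k where k: "\<forall>\<gamma>. \<gamma> < \<beta> \<longrightarrow>
      (\<forall>M e as. emb M e \<longrightarrow> set as \<subseteq> fst M \<longrightarrow> (\<exists>\<phi>. Pi_in ((osuc ^^ k \<gamma>) \<gamma>) \<phi> \<and> type_of M e \<gamma> as \<phi>))" ..
    have "0 < \<beta>" using 3(1) zero_le_ordinal[of \<beta>] by (simp add: less_le)
    have "\<exists>\<phi>. Pi_in \<beta> \<phi> \<and> type_of M e \<beta> as \<phi>" if "emb M e" "set as \<subseteq> fst M" for M e as
    proof (rule type_step[OF that less.prems, of _ "\<lambda>\<gamma>. (osuc ^^ k \<gamma>) \<gamma>"])
      show "{..<\<beta>} \<noteq> {}" using \<open>0 < \<beta>\<close> by auto
      show "\<exists>\<phi>. Pi_in ((osuc ^^ k \<gamma>) \<gamma>) \<phi> \<and> type_of M e \<gamma> cs \<phi>" if "\<gamma> \<in> {..<\<beta>}" "set cs \<subseteq> fst M" for \<gamma> cs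
        using k that \<open>emb M e\<close> by blast
      show "osuc ((osuc ^^ k \<gamma>) \<gamma>) < \<beta>" if "\<gamma> \<in> {..<\<beta>}" for \<gamma>
        using lim[of \<gamma> "Suc (k \<gamma>)"] that by simp
    qed auto
    then show ?thesis by (intro exI[of _ 0]) simp
  qed
qed

section \<open>Isomorphisms of structures\<close>

lemma emb_inj: "emb M e \<Longrightarrow> inj_on e (fst M)"
  unfolding inj_on_def using emb_eq by blast

lemma is_iso_of_oiso:
  assumes E: "emb M e" "emb N e'" and f: "oiso f (e ` fst M) (e' ` fst N)"
  shows "\<exists>h. is_iso M N h \<and> (\<forall>x\<in>fst M. h x \<in> fst N \<and> e' (h x) = f (e x))"
proof -
  define h where "h x = inv_into (fst N) e' (f (e x))" for x
  have fe: "f (e x) \<in> e' ` fst N" if "x \<in> fst M" for x using f that by (auto simp: oiso_def)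
  have h: "h x \<in> fst N" "e' (h x) = f (e x)" if "x \<in> fst M" for x
    unfolding h_def using inv_into_into[OF fe[OF that]] f_inv_into_f[OF fe[OF that]] by auto
  have sm: "strict_mono_on (e ` fst M) f" using f by (simp add: oiso_def)
  have "inj_on h (fst M)"
  proof (rule inj_onI)
    fix x y assume "x \<in> fst M" "y \<in> fst M" "h x = h y"
    then show "x = y" using h(2)[of x] h(2)[of y] strict_mono_on_eq_iff[OF sm, of "e x" "e y"] emb_eq[OF E(1)] by auto
  qed
  moreover have "fst N \<subseteq> h ` fst M"
  proof
    fix y assume y: "y \<in> fst N"
    then have "e' y \<in> f ` e ` fst M" using f by (auto simp: oiso_def)
    then obtain x where x: "x \<in> fst M" "e' y = f (e x)" by auto
    then have "y = h x" using emb_eq[OF E(2) y h(1)[OF x(1)]] h(2)[OF x(1)] by simp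
    then show "y \<in> h ` fst M" using x(1) by blast
  qed
  moreover have "(x, y) \<in> snd M \<longleftrightarrow> (h x, h y) \<in> snd N" if "x \<in> fst M" "y \<in> fst M" for x y
    using that h[OF that(1)] h[OF that(2)] emb_le[OF E(1) that] emb_le[OF E(2)] strict_mono_on_le_iff[OF sm, of "e x" "e y"] by auto
  ultimately show ?thesis unfolding is_iso_def bij_betw_def using h by blast
qed

lemma oiso_of_is_iso:
  assumes E: "emb M e" "emb N e'" and h: "is_iso M N h"
  shows "\<exists>f. oiso f (e ` fst M) (e' ` fst N) \<and> (\<forall>x\<in>fst M. f (e x) = e' (h x))"
proof -
  define f where "f r = e' (h (inv_into (fst M) e r))" for r
  have f: "f (e x) = e' (h x)" if "x \<in> fst M" for x
    unfolding f_def inv_into_f_f[OF emb_inj[OF E(1)] that] ..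
  have b: "h ` fst M = fst N" using h by (simp add: is_iso_def bij_betw_def)
  have lt: "e x < e y \<longleftrightarrow> e' (h x) < e' (h y)" if "x \<in> fst M" "y \<in> fst M" for x y
  proof -
    have "h x \<in> fst N" "h y \<in> fst N" using b that by auto
    then have "e y \<le> e x \<longleftrightarrow> e' (h y) \<le> e' (h x)"
      using h that emb_le[OF E(1) that(2,1)] emb_le[OF E(2), of "h y" "h x"] by (auto simp: is_iso_def)
    then show ?thesis by auto
  qed
  have "oiso f (e ` fst M) (e' ` fst N)" unfolding oiso_def
  proof
    show "strict_mono_on (e ` fst M) f" by (rule strict_mono_onI) (use f lt in auto)
    have "f ` e ` fst M = e' ` h ` fst M" using f by (auto simp: image_iff)
    then show "f ` e ` fst M = e' ` fst N" by (simp only: b)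
  qed
  then show ?thesis using f by blast
qed

lemma is_iso_comp: "is_iso M N f \<Longrightarrow> is_iso N K g \<Longrightarrow> is_iso M K (g \<circ> f)"
proof -
  assume f: "is_iso M N f" and g: "is_iso N K g"
  then have "f x \<in> fst N" if "x \<in> fst M" for x using that by (auto simp: is_iso_def bij_betw_def)
  then show ?thesis using f g bij_betw_trans[of f "fst M" "fst N" g "fst K"] by (auto simp: is_iso_def)
qed

lemma models_sentence: "sentence \<phi> \<Longrightarrow> fst M \<noteq> {} \<Longrightarrow> models M \<phi> \<longleftrightarrow> sat M \<nu> \<phi>"
proof -
  assume \<phi>: "sentence \<phi>" and "fst M \<noteq> {}"
  then obtain a where a: "a \<in> fst M" by blast
  have c: "sat M \<nu> \<phi> \<longleftrightarrow> sat M \<nu>' \<phi>" for \<nu> \<nu>' using \<phi> sat_cong_fv[of \<phi> \<nu> \<nu>' M] by (simp add: sentence_def)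
  have "range (\<lambda>_ :: nat. a) \<subseteq> fst M" using a by auto
  then show ?thesis unfolding models_def using c by blast
qed

context base_level begin

lemma Pi_equiv_En:
  assumes E: "emb M e" "emb N e'" and eq: "Pi_equiv \<delta> M N" and \<delta>: "\<And>k. (osuc ^^ k) \<alpha> < \<delta>"
  shows "En n (e ` fst M) (e' ` fst N) {}"
proof -
  let ?b = "(osuc ^^ n) \<alpha>"
  obtain k where k: "\<forall>M e as. emb M e \<longrightarrow> set as \<subseteq> fst M \<longrightarrow> (\<exists>\<phi>. Pi_in ((osuc ^^ k) ?b) \<phi> \<and> type_of M e ?b as \<phi>)"
    using type_formula[OF countable_level] by blast
  have "set [] \<subseteq> fst M" by simp
  then obtain \<phi> where \<phi>: "Pi_in ((osuc ^^ k) ?b) \<phi>" "type_of M e ?b [] \<phi>" using k E(1) by blast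
  \<comment> \<open>\<open>Pi_in\<close> is not monotone in its level on quantifier-free formulas;
    two vacuous infinitary layers lift the formula to level \<open>\<delta>\<close>.\<close>
  let ?\<psi> = "CConj (\<lambda>_. CDisj (\<lambda>_. \<phi>))"
  have "(osuc ^^ k) ?b < osuc ((osuc ^^ k) ?b)" by (rule less_osuc)
  then have S: "Sigma_in (osuc ((osuc ^^ k) ?b)) (CDisj (\<lambda>_. \<phi>))"
    by (intro Sigma_CDisj exI[of _ "[]"] exI[of _ \<phi>] exI[of _ "(osuc ^^ k) ?b"]) (use \<phi> in simp)
  have "osuc ((osuc ^^ k) ?b) < \<delta>" using \<delta>[of "Suc k + n"] by (simp add: funpow_add)
  then have "Pi_in \<delta> ?\<psi>"
    by (intro Pi_CConj exI[of _ "[]"] exI[of _ "CDisj (\<lambda>_. \<phi>)"] exI[of _ "osuc ((osuc ^^ k) ?b)"]) (use S in simp)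
  moreover have s: "sentence ?\<psi>" using \<phi>(2) by (simp add: sentence_def type_of_def)
  ultimately have m: "models M ?\<psi> \<longleftrightarrow> models N ?\<psi>" using eq by (simp add: Pi_equiv_def)
  have t: "sat K ((!) []) \<phi> \<longleftrightarrow> En n (e ` fst M) (d ` fst K) {}" if "emb K d" for K d
    using type_ofD[OF \<phi>(2) that, of "[]"] by (simp add: tup_def En_def)
  have "sat M ((!) []) \<phi>" using t[OF E(1)] En_refl0 by simp
  then have "models M ?\<psi>" using models_sentence[OF s, of M "(!) []"] E(1) by (simp add: emb_def)
  then have "sat N ((!) []) \<phi>" using m models_sentence[OF s, of N "(!) []"] E(2) by (simp add: emb_def)
  then show ?thesis using t[OF E(2)] by simp
qed

text \<open>By \<open>En_oiso_ex\<close> equivalence of two tuples at level n + 3 already extends to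
  an automorphism, so back-and-forth types define the orbits, with the empty tuple as
  parameters.\<close>

lemma low_Scott_rank:
  assumes E: "emb M e" and low: "low (e ` fst M)" and \<delta>: "\<And>k. (osuc ^^ k) \<alpha> < \<delta>"
  shows "Scott_rank M < \<delta>"
proof -
  let ?A = "e ` fst M"
  obtain n where n: "hom n ?A" using low by (auto simp: low_def)
  let ?b = "(osuc ^^ (n + 3)) \<alpha>"
  obtain k where k: "\<forall>M e as. emb M e \<longrightarrow> set as \<subseteq> fst M \<longrightarrow> (\<exists>\<phi>. Pi_in ((osuc ^^ k) ?b) \<phi> \<and> type_of M e ?b as \<phi>)"
    using type_formula[OF countable_level] by blast
  let ?g = "osuc ((osuc ^^ k) ?b)"
  have g: "?g = (osuc ^^ (Suc k + (n + 3))) \<alpha>" by (simp only: funpow_add comp_apply funpow.simps)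
  have "orbits_definable ?g M []"
    unfolding orbits_definable_def
  proof (intro allI impI)
    fix as assume as: "set as \<subseteq> fst M"
    obtain \<phi> where \<phi>: "Pi_in ((osuc ^^ k) ?b) \<phi>" "type_of M e ?b as \<phi>" using k E as by blast
    have "Sigma_in ?g (CDisj (\<lambda>_. \<phi>))"
      by (intro Sigma_CDisj exI[of _ "[]"] exI[of _ \<phi>] exI[of _ "(osuc ^^ k) ?b"]) (use \<phi> less_osuc in simp)
    moreover have "fv (CDisj (\<lambda>_. \<phi>)) \<subseteq> {..<length ([] :: nat list) + length as}" using \<phi>(2) by (simp add: type_of_def)
    moreover have "sat M ((!) ([] @ bs)) (CDisj (\<lambda>_. \<phi>)) \<longleftrightarrow> same_orbit M as bs"
      if bs: "set bs \<subseteq> fst M \<and> length bs = length as" for bs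
    proof -
      have "sat M ((!) ([] @ bs)) (CDisj (\<lambda>_. \<phi>)) \<longleftrightarrow> En (n + 3) ?A ?A (tup e as e bs)"
        using type_ofD[OF \<phi>(2) E, of bs] bs by (simp add: En_def)
      also have "\<dots> \<longleftrightarrow> same_orbit M as bs"
      proof
        assume q: "En (n + 3) ?A ?A (tup e as e bs)"
        have cA: "countable ?A" by simp
        obtain f where f: "oiso f ?A ?A" "tup e as e bs \<subseteq> gr f ?A" using En_oiso_ex[OF cA cA n q] by blast
        obtain h where h: "is_iso M M h" "\<forall>x\<in>fst M. h x \<in> fst M \<and> e (h x) = f (e x)" using is_iso_of_oiso[OF E E f(1)] by blast
        have "map h as = bs"
        proof (rule nth_equalityI)
          fix i assume i: "i < length (map h as)"
          then have a: "as ! i \<in> fst M" "bs ! i \<in> fst M" using as bs nth_mem[of i as] nth_mem[of i bs] by auto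
          have "(e (as ! i), e (bs ! i)) \<in> tup e as e bs" using i bs by (auto simp: in_tup)
          then have "e (bs ! i) = f (e (as ! i))" using f(2) by (auto simp: in_gr)
          then have "e (h (as ! i)) = e (bs ! i)" using h(2) a by simp
          then show "map h as ! i = bs ! i" using i h(2) a emb_eq[OF E, of "h (as ! i)" "bs ! i"] by simp
        qed (use bs in simp)
        then show "same_orbit M as bs" using h(1) unfolding same_orbit_def by blast
      next
        assume "same_orbit M as bs"
        then obtain h where h: "is_iso M M h" "map h as = bs" unfolding same_orbit_def by blast
        obtain f where f: "oiso f ?A ?A" "\<forall>x\<in>fst M. f (e x) = e (h x)" using oiso_of_is_iso[OF E E h(1)] by blast
        have "tup e as e bs \<subseteq> gr f ?A"
        proof
          fix z assume "z \<in> tup e as e bs"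
          then obtain i where i: "i < length as" "z = (e (as ! i), e (bs ! i))" using bs by (auto simp: in_tup)
          then have "as ! i \<in> fst M" "bs ! i = h (as ! i)" using as h(2) nth_mem[of i as] by auto
          then show "z \<in> gr f ?A" using i(2) f(2) by (auto simp: in_gr)
        qed
        then show "En (n + 3) ?A ?A (tup e as e bs)" by (intro En_oiso[OF f(1)]) (auto simp: tup_def)
      qed
      finally show ?thesis .
    qed
    ultimately show "\<exists>\<phi>. Sigma_in ?g \<phi> \<and> fv \<phi> \<subseteq> {..<length ([] :: nat list) + length as} \<and>
      (\<forall>bs. set bs \<subseteq> fst M \<and> length bs = length as \<longrightarrow> (sat M ((!) ([] @ bs)) \<phi> \<longleftrightarrow> same_orbit M as bs))"
      by (intro exI[of _ "CDisj (\<lambda>_. \<phi>)"]) blast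
  qed
  moreover have "countable {..<?g}" unfolding g by (rule countable_level)
  ultimately have "countable {..<?g} \<and> (\<exists>ps. set ps \<subseteq> fst M \<and> orbits_definable ?g M ps)"
    by (intro conjI exI[of _ "[]"]) simp_all
  then have "Scott_rank M \<le> ?g" unfolding Scott_rank_def by (rule Least_le)
  also have "?g < \<delta>" unfolding g by (rule \<delta>)
  finally show ?thesis .
qed

end

text \<open>The chosen representative depends only on the class, because equivalent structures
  induce the same predicate \<open>Pi_equiv \<beta> M\<close>.\<close>

lemma Pi_equiv_representatives:
  "\<exists>S\<subseteq>K. pairwise (\<lambda>M N. \<not> Pi_equiv \<beta> M N) S \<and> (\<forall>M\<in>K. \<exists>N\<in>S. Pi_equiv \<beta> M N)"
proof -
  define c where "c M = (SOME N. N \<in> K \<and> Pi_equiv \<beta> M N)" for M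
  have refl: "Pi_equiv \<beta> M M" for M by (simp add: Pi_equiv_def)
  have c: "c M \<in> K \<and> Pi_equiv \<beta> M (c M)" if "M \<in> K" for M
    unfolding c_def by (rule someI[of _ M]) (use that refl in simp)
  have eq: "c M = c N" if "Pi_equiv \<beta> M N" for M N
  proof -
    have "Pi_equiv \<beta> M = Pi_equiv \<beta> N" by (rule ext) (use that in \<open>auto simp: Pi_equiv_def\<close>)
    then show ?thesis by (simp add: c_def)
  qed
  have "pairwise (\<lambda>M N. \<not> Pi_equiv \<beta> M N) (c ` K)"
    unfolding pairwise_def
  proof (intro ballI impI notI)
    fix M' N' assume MN: "M' \<in> c ` K" "N' \<in> c ` K" "M' \<noteq> N'" "Pi_equiv \<beta> M' N'"
    then obtain M N where "M \<in> K" "N \<in> K" "M' = c M" "N' = c N" by blast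
    then have "c M' = M'" "c N' = N'" using eq c by metis+
    then show False using eq[OF MN(4)] MN(3) by simp
  qed
  then show ?thesis using c by (intro exI[of _ "c ` K"]) blast
qed

theorem theorem1:
  fixes \<alpha> :: ordinal and T :: fm
  assumes "countable {..<\<alpha>}"
    and "Pi_in \<alpha> T"
    and "sentence T"
    and "implies_linear_order T"
  shows "Vaught_ordinal T \<le> \<alpha> + ordinal_omega"
proof -
  let ?d = "\<alpha> + ordinal_omega"
  interpret base_level "osuc \<alpha>" by unfold_locales (rule countable_osuc[OF assms(1)])
  have lev: "(osuc ^^ k) (osuc \<alpha>) < ?d" for k
    using osuc_pow_less_plus_omega[of "Suc k" \<alpha>] by (simp add: funpow_swap1)
  have "(countable (Mod T // iso_rel (Mod T)) \<and> (\<forall>M\<in>Mod T. Scott_rank M < ?d)) \<or>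
     (\<exists>S\<subseteq>Mod T. uncountable S \<and> pairwise (\<lambda>M N. \<not> Pi_equiv ?d M N) S)"
  proof (rule disjCI)
    assume few: "\<not> (\<exists>S\<subseteq>Mod T. uncountable S \<and> pairwise (\<lambda>M N. \<not> Pi_equiv ?d M N) S)"
    obtain S where S: "S \<subseteq> Mod T" "pairwise (\<lambda>M N. \<not> Pi_equiv ?d M N) S" "\<And>M. M \<in> Mod T \<Longrightarrow> \<exists>N\<in>S. Pi_equiv ?d M N"
      using Pi_equiv_representatives[of "Mod T" ?d] by blast
    have cS: "countable S" using few S(1,2) by blast
    have "\<forall>M. \<exists>e. M \<in> Mod T \<longrightarrow> emb M e"
      using ex_emb assms(4) by (auto simp: Mod_def implies_linear_order_def)
    from choice[OF this] obtain e where e: "\<forall>M. M \<in> Mod T \<longrightarrow> emb M (e M)" ..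
    let ?o = "\<lambda>M. e M ` fst M"
    \<comment> \<open>\<open>S\<close> supplies the list of representatives: an order in the class
      becomes a structure on natural numbers by enumeration, is a model of \<open>T\<close> because
      truth is preserved at level \<alpha>, and is then equivalent to a member of
      \<open>S\<close>.\<close>
    have thin: "thin (?o M)" if M: "M \<in> Mod T" for M
    proof -
      have "S \<noteq> {}" using S(3)[OF M] by blast
      have "\<exists>j. \<forall>n. En n A (?o (from_nat_into S j)) {}" if A: "A \<in> cls (?o M)" for A
      proof -
        have cA: "countable A" and EA: "En 0 (?o M) A {}" using A by (auto simp: cls_def)
        let ?N = "(to_nat_on A ` A, {(to_nat_on A x, to_nat_on A y) | x y. x \<in> A \<and> y \<in> A \<and> x \<le> y})"
        have fN: "from_nat_into A ` fst ?N = A" using cA by (force simp: image_iff)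
        \<comment> \<open>A move at level \<open>osuc \<alpha>\<close> carries a point of
          \<open>M\<close> over to \<open>A\<close>; for \<alpha> = 0 the base level \<alpha> itself
          would admit an empty \<open>A\<close>.\<close>
        have "bf (osuc \<alpha>) (?o M) A {}" using EA by (simp add: En_def)
        moreover have "emb M (e M)" using e M by blast
        then obtain a where "a \<in> fst M" by (auto simp: emb_def)
        ultimately have "A \<noteq> {}" using bf_forth[of "osuc \<alpha>" "?o M" A "{}" \<alpha> "{e M a}"] less_osuc bf_base(2)
          by (metis Domain_empty empty_subsetI finite.emptyI finite_insert image_eqI insert_not_empty insert_subset subset_empty Sigma_empty2)
        then have E: "emb ?N (from_nat_into A)"
          using cA inj_on_to_nat_on[OF cA] unfolding emb_def inj_on_def by (auto; metis)
        have "models ?N T"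
        proof (rule models_bf[OF assms(2,3)])
          show "emb M (e M)" using e M by blast
          show "emb ?N (from_nat_into A)" by (rule E)
          show "bf \<alpha> (?o M) (from_nat_into A ` fst ?N) {}" unfolding fN
            using EA bf_mono[OF less_imp_le[OF less_osuc]] by (simp add: En_def)
          show "models M T" using M by (simp add: Mod_def)
        qed
        moreover have "?N \<in> structures" using \<open>A \<noteq> {}\<close> by (auto simp: structures_def)
        ultimately have "?N \<in> Mod T" by (simp add: Mod_def)
        from S(3)[OF this] obtain K where K: "K \<in> S" "Pi_equiv ?d ?N K" ..
        have "En n (from_nat_into A ` fst ?N) (?o K) {}" for n
          by (rule Pi_equiv_En[OF E _ K(2) lev]) (use e S(1) K(1) in blast)
        then have "En n A (?o K) {}" for n unfolding fN .
        moreover obtain j where "from_nat_into S j = K" using from_nat_into_surj[OF cS K(1)] ..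
        ultimately show ?thesis by (intro exI[of _ j]) simp
      qed
      then show ?thesis unfolding thin_def by (intro conjI exI[of _ "\<lambda>j. ?o (from_nat_into S j)"]) auto
    qed
    have low: "low (?o M)" if "M \<in> Mod T" for M by (rule thin_low[OF thin[OF that]])
    \<comment> \<open>A model and its representative are equivalent at every level, and lowness
      makes them isomorphic; so \<open>S\<close> meets every isomorphism class.\<close>
    have "Mod T // iso_rel (Mod T) \<subseteq> (\<lambda>N. iso_rel (Mod T) `` {N}) ` S"
    proof
      fix C assume "C \<in> Mod T // iso_rel (Mod T)"
      then obtain M where M: "M \<in> Mod T" "C = iso_rel (Mod T) `` {M}" by (auto simp: quotient_def)
      obtain N where N: "N \<in> S" "Pi_equiv ?d M N" using S(3)[OF M(1)] by blast
      have NT: "N \<in> Mod T" using N(1) S(1) by blast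
      have E: "emb M (e M)" "emb N (e N)" using e M(1) NT by blast+
      obtain n where n: "hom n (?o M)" using low[OF M(1)] by (auto simp: low_def)
      have "isom (?o M) (?o N)"
        by (rule isom_of_hom_En[OF _ _ n Pi_equiv_En[OF E N(2) lev]]) simp_all
      then obtain f g where "oiso f (?o M) (?o N)" "oiso g (?o N) (?o M)" using isom_sym by (meson isom_def)
      then obtain h k where hk: "is_iso M N h" "is_iso N M k"
        using is_iso_of_oiso[OF E] is_iso_of_oiso[OF E(2,1)] by blast
      have "C = iso_rel (Mod T) `` {N}"
      proof -
        have "(\<exists>f. is_iso M K f) \<longleftrightarrow> (\<exists>f. is_iso N K f)" for K
          using is_iso_comp[OF hk(1)] is_iso_comp[OF hk(2)] by blast
        then show ?thesis unfolding M(2) iso_rel_def using M(1) NT by simp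
      qed
      then show "C \<in> (\<lambda>N. iso_rel (Mod T) `` {N}) ` S" using N(1) by (rule image_eqI)
    qed
    then have "countable (Mod T // iso_rel (Mod T))" by (rule countable_subset[OF _ countable_image[OF cS]])
    moreover have "Scott_rank M < ?d" if "M \<in> Mod T" for M
      by (rule low_Scott_rank[OF _ low[OF that] lev]) (use e that in blast)
    ultimately show "countable (Mod T // iso_rel (Mod T)) \<and> (\<forall>M\<in>Mod T. Scott_rank M < ?d)" by blast
  qed
  then show ?thesis unfolding Vaught_ordinal_def by (rule Least_le)
qed

end
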